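(* Let $\tau\in(0,1)$, $\Lambda>0$ and $\mu\in A_2(\mathbb{R})$. Let $\mathbb{A}_0(y)$ be a symmetric measurable $(n+1)\times(n+1)$ matrix of the form $$\mathbb{A}_0(y)=\mu(y)\begin{bmatrix}\mathbb{B}_0(y)&0\\0&b_0(y)\end{bmatrix},$$ where $\begin{bmatrix}\mathbb{B}_0(y)&0\\0&b_0(y)\end{bmatrix}$ is a measurable, uniformly elliptic $(n+1)\times(n+1)$ matrix, such that $$\Lambda^{-1}\mu(y)|\xi|^2\le\langle\mathbb{A}_0(y)\xi,\xi\rangle\le\Lambda\mu(y)|\xi|^2,\quad\forall\,\xi\in\mathbb{R}^{n+1},\ \text{for a.e. }y\in(0,\tau).$$ Suppose also that there is some constant $C_0>0$ independent of $\tau$ so that $$\int_0^{\tau y}\mu(s)\,ds\le C_0\,\tau\,\mu(y\tau),\quad\text{for a.e. }y\in(0,1).$$ Then for every weak solution $v\in W^{1,2}(Q_\tau,\mu)$ of $$\begin{cases}\operatorname{div}[\mathbb{A}_0(y)\nabla v(X)]=0, & X=(x,y)\in Q_\tau,\\ \lim_{y\to0^+}\langle\mathbb{A}_0(y)\nabla v(x,y),e_{n+1}\rangle=0, & x\in B_\tau,\end{cases}$$ and every $\theta\in(0,1)$, there is $C=C(n,\Lambda,C_0,[\mu]_{A_2},\theta)$ such that $$\|\nabla v\|_{L^\infty(Q_{\theta\tau})}\le C\left[\frac1{\hat\mu(Q_\tau)}\int_{Q_\tau}|\nabla v|^2\mu(y)\,dX\right]^{1/2}.$$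
   Context: $X=(x,y)\in\mathbb{R}^n\times\mathbb{R}$, $\nabla=(\nabla_x,\partial_y)$, $e_{n+1}=(0,\dots,0,1)$; $B_r\subset\mathbb{R}^n$ is the ball of radius $r$ centered at $0$ and $Q_r=B_r\times(0,r)$. $\hat\mu(E)=\int_E\mu(y)\,dX$. $\mu\in A_2(\mathbb{R})$ means $\mu\ge0$ is locally integrable and $[\mu]_{A_2}=\sup_I\left(\frac1{|I|}\int_I\mu\right)\left(\frac1{|I|}\int_I\mu^{-1}\right)<\infty$ over bounded intervals. $W^{1,2}(E,\mu)$: functions which together with their weak gradients are square integrable on $E$ with respect to $\mu(y)\,dx\,dy$. Weak solution: $v\in W^{1,2}(Q_\tau,\mu)$ and $\int_{Q_\tau}\langle\mathbb{A}_0(y)\nabla v,\nabla\psi\rangle dX=0$ for all $\psi$ in the closure in $W^{1,2}(Q_\tau,\mu)$ of $\{\phi\in C^\infty(\overline{Q_\tau}):\phi=0\text{ on }(\partial B_\tau\times(0,\tau))\cup(B_\tau\times\{\tau\})\}$. The constant $C$ depends only on the listed quantities (not on $v$ or $\tau$). *)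

theory Defs
  imports "HOL-Analysis.Analysis" "HOL-Probability.Essential_Supremum"
begin

text \<open>Points are pairs \<open>X = (x, y)\<close> of type \<open>(real^'n) \<times> real\<close>; \<open>n = CARD('n) \<ge> 1\<close>.\<close>

definition Q :: "real \<Rightarrow> ((real^'n) \<times> real) set" where
  "Q r = ball 0 r \<times> {0<..<r}"

section \<open>Muckenhoupt weights on the line\<close>

text \<open>The reciprocal is taken in \<^typ>\<open>ennreal\<close>, so that it is infinite where the weight vanishes.\<close>

definition A2_const :: "(real \<Rightarrow> real) \<Rightarrow> ennreal" where
  "A2_const \<mu> = (SUP (a, b) \<in> {(a, b). a < b}.
     ((\<integral>\<^sup>+ y\<in>{a..b}. ennreal (\<mu> y) \<partial>lebesgue) / ennreal (b - a)) *
     ((\<integral>\<^sup>+ y\<in>{a..b}. inverse (ennreal (\<mu> y)) \<partial>lebesgue) / ennreal (b - a)))"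

text \<open>
  Because \<open>0 * \<infinity> = 0\<close> in \<^typ>\<open>ennreal\<close>, the zero function would have finite constant.
  Positivity almost everywhere rules out this degenerate case, and only this one:
  a weight that vanishes on a set of positive measure but not almost everywhere has infinite constant.
\<close>

definition A2_weight :: "(real \<Rightarrow> real) \<Rightarrow> bool" where
  "A2_weight \<mu> \<longleftrightarrow>
     \<mu> \<in> borel_measurable lebesgue \<and>
     (AE y in lebesgue. 0 < \<mu> y) \<and>
     (\<forall>a b. \<mu> absolutely_integrable_on {a..b}) \<and>
     A2_const \<mu> < \<infinity>"

definition mu_hat :: "(real \<Rightarrow> real) \<Rightarrow> ((real^'n) \<times> real) set \<Rightarrow> real" where
  "mu_hat \<mu> E = (LINT X:E|lebesgue. \<mu> (snd X))"

section \<open>Smooth functions\<close>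

primrec Ck :: "nat \<Rightarrow> ('a::euclidean_space \<Rightarrow> real) \<Rightarrow> bool" where
  "Ck 0 f \<longleftrightarrow> continuous_on UNIV f"
| "Ck (Suc k) f \<longleftrightarrow>
     (\<forall>x. f differentiable (at x)) \<and> (\<forall>e\<in>Basis. Ck k (\<lambda>x. frechet_derivative f (at x) e))"

definition smooth :: "('a::euclidean_space \<Rightarrow> real) \<Rightarrow> bool" where
  "smooth f \<longleftrightarrow> (\<forall>k. Ck k f)"

section \<open>Weighted Sobolev spaces\<close>

definition locally_integrable_on ::
  "('a::euclidean_space \<Rightarrow> 'b::euclidean_space) \<Rightarrow> 'a set \<Rightarrow> bool" where
  "locally_integrable_on f E \<longleftrightarrow> (\<forall>K. compact K \<and> K \<subseteq> E \<longrightarrow> f absolutely_integrable_on K)"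

definition has_weak_gradient ::
  "'a::euclidean_space set \<Rightarrow> ('a \<Rightarrow> real) \<Rightarrow> ('a \<Rightarrow> 'a) \<Rightarrow> bool" where
  "has_weak_gradient E v g \<longleftrightarrow>
     locally_integrable_on v E \<and> locally_integrable_on g E \<and>
     (\<forall>\<phi>. smooth \<phi> \<and> compact (closure {X. \<phi> X \<noteq> 0}) \<and> closure {X. \<phi> X \<noteq> 0} \<subseteq> E \<longrightarrow>
       (\<forall>e\<in>Basis. (LINT X:E|lebesgue. v X * frechet_derivative \<phi> (at X) e)
                  = - (LINT X:E|lebesgue. (g X \<bullet> e) * \<phi> X)))"

text \<open>A weak gradient on an open set is unique up to a null set; \<open>wgrad\<close> picks a representative.\<close>

definition wgrad :: "'a::euclidean_space set \<Rightarrow> ('a \<Rightarrow> real) \<Rightarrow> 'a \<Rightarrow> 'a" where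
  "wgrad E v = (SOME g. has_weak_gradient E v g)"

definition W12 :: "(real \<Rightarrow> real) \<Rightarrow> ((real^'n) \<times> real) set \<Rightarrow> ((real^'n) \<times> real \<Rightarrow> real) set" where
  "W12 \<mu> E = {v. (\<exists>g. has_weak_gradient E v g) \<and>
     (\<lambda>X. (v X)\<^sup>2 * \<mu> (snd X)) absolutely_integrable_on E \<and>
     (\<lambda>X. (norm (wgrad E v X))\<^sup>2 * \<mu> (snd X)) absolutely_integrable_on E}"

definition W12_norm :: "(real \<Rightarrow> real) \<Rightarrow> ((real^'n) \<times> real) set \<Rightarrow> ((real^'n) \<times> real \<Rightarrow> real) \<Rightarrow> real" where
  "W12_norm \<mu> E v =
     sqrt ((LINT X:E|lebesgue. (v X)\<^sup>2 * \<mu> (snd X))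
         + (LINT X:E|lebesgue. (norm (wgrad E v X))\<^sup>2 * \<mu> (snd X)))"

text \<open>
  \<open>C\<^sup>\<infinity>\<close> up to the closed cylinder is understood as being the restriction of a smooth function on
  the whole space. Nothing is imposed on the bottom \<open>y = 0\<close>: this encodes the conormal
  boundary condition in the weak formulation.
\<close>

definition test_functions :: "real \<Rightarrow> ((real^'n) \<times> real \<Rightarrow> real) set" where
  "test_functions \<tau> = {\<phi>. smooth \<phi> \<and>
     (\<forall>X \<in> (sphere 0 \<tau> \<times> {0<..<\<tau>}) \<union> (ball 0 \<tau> \<times> {\<tau>}). \<phi> X = 0)}"

definition test_space :: "(real \<Rightarrow> real) \<Rightarrow> real \<Rightarrow> ((real^'n) \<times> real \<Rightarrow> real) set" where
  "test_space \<mu> \<tau> = {\<psi> \<in> W12 \<mu> (Q \<tau>).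
     \<forall>\<epsilon>>0. \<exists>\<phi>\<in>test_functions \<tau>. W12_norm \<mu> (Q \<tau>) (\<lambda>X. \<psi> X - \<phi> X) < \<epsilon>}"

section \<open>The equation\<close>

text \<open>The block matrix \<open>\<mu>(y) diag(B(y), b(y))\<close>, acting on \<open>(real^'n) \<times> real\<close>.\<close>

definition A0 :: "(real \<Rightarrow> real) \<Rightarrow> (real \<Rightarrow> real^'n^'n) \<Rightarrow> (real \<Rightarrow> real) \<Rightarrow>
    real \<Rightarrow> (real^'n) \<times> real \<Rightarrow> (real^'n) \<times> real" where
  "A0 \<mu> B b y \<xi> = \<mu> y *\<^sub>R (B y *v fst \<xi>, b y * snd \<xi>)"

text \<open>
  For a weight that is positive almost everywhere, the last condition is the uniform ellipticity of
  \<open>diag(B(y), b(y))\<close> with constant \<open>\<Lambda>\<close>.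
\<close>

definition elliptic_coefficients ::
  "real \<Rightarrow> real \<Rightarrow> (real \<Rightarrow> real) \<Rightarrow> (real \<Rightarrow> real^'n^'n) \<Rightarrow> (real \<Rightarrow> real) \<Rightarrow> bool" where
  "elliptic_coefficients \<Lambda> \<tau> \<mu> B b \<longleftrightarrow>
     B \<in> borel_measurable (lebesgue_on {0<..<\<tau>}) \<and>
     b \<in> borel_measurable (lebesgue_on {0<..<\<tau>}) \<and>
     (AE y in lebesgue_on {0<..<\<tau>}. transpose (B y) = B y) \<and>
     (AE y in lebesgue_on {0<..<\<tau>}. \<forall>\<xi>.
        inverse \<Lambda> * \<mu> y * (norm \<xi>)\<^sup>2 \<le> A0 \<mu> B b y \<xi> \<bullet> \<xi> \<and>
        A0 \<mu> B b y \<xi> \<bullet> \<xi> \<le> \<Lambda> * \<mu> y * (norm \<xi>)\<^sup>2)"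

definition weak_solution :: "(real \<Rightarrow> real) \<Rightarrow> (real \<Rightarrow> real^'n^'n) \<Rightarrow> (real \<Rightarrow> real) \<Rightarrow>
    real \<Rightarrow> ((real^'n) \<times> real \<Rightarrow> real) \<Rightarrow> bool" where
  "weak_solution \<mu> B b \<tau> v \<longleftrightarrow> v \<in> W12 \<mu> (Q \<tau>) \<and>
     (\<forall>\<psi>\<in>test_space \<mu> \<tau>.
        (LINT X:Q \<tau>|lebesgue. A0 \<mu> B b (snd X) (wgrad (Q \<tau>) v X) \<bullet> wgrad (Q \<tau>) \<psi> X) = 0)"

end

theory Submission
  imports Defs
begin

text \<open>
  The coefficients depend on \<open>y\<close> only, so the equation commutes with horizontal translations.
  Hence a mollification of \<open>v\<close> in \<open>x\<close> is again a solution, on a cylinder with a slightly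
  smaller base; it is smooth in \<open>x\<close>, and its
  horizontal derivatives of every order are solutions as well. All estimates are made for such
  mollifications, with constants that see the mollifier only through its \<open>L\<^sup>1\<close> norm; the
  mollifier is removed at the end. This linear structure replaces Moser or De Giorgi iteration.

  On vertical lines the solution satisfies ordinary differential equations. Let \<open>u\<close> be the
  mollification of \<open>v\<close> and \<open>p\<close> that of its vertical derivative. Testing with products
  \<open>\<eta>(x) \<zeta>(y)\<close>, where \<open>\<eta>\<close> is the reflected mollifier, shows that for each \<open>x\<close> one has
  \<open>u(x, y) = c + \<integral>\<^sub>0\<^sup>y p\<close> (lemma \<open>conv_absolutely_continuous\<close>) and
  \<open>\<mu> b p = - \<integral>\<^sub>0\<^sup>y \<mu> \<Sum> a\<^sub>i\<^sub>j \<partial>\<^sub>i\<partial>\<^sub>j u\<close> (lemma \<open>conv_flux\<close>). The second identity has no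
  constant of integration because the tests are free at \<open>y = 0\<close>: this is the conormal condition.

  Testing the flux identity with a cutoff times \<open>u\<close> gives the Caccioppoli inequality: the weighted
  energies of \<open>p\<close> and of the first horizontal derivatives of \<open>u\<close> on a smaller cylinder are
  bounded by the energy of \<open>u\<close> on a larger one. Since derivatives of \<open>u\<close> solve the same equation,
  it can be iterated (lemma \<open>iterated_caccioppoli\<close>) and controls the horizontal derivatives of
  order at most \<open>n + 1\<close> together with their vertical derivatives.

  Energies become pointwise bounds in two steps. Vertically, the Cauchy-Schwarz inequality gives
  \<open>(\<integral>\<bar>p\<bar>)\<^sup>2 \<le> (\<integral> p\<^sup>2 \<mu>) (\<integral> 1/\<mu>)\<close>, and the Muckenhoupt condition says that the last factor is
  at most \<open>K \<tau>\<^sup>2\<close> divided by the \<open>\<mu>\<close>-mass of the interval; so the value of \<open>u\<close> at almost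
  every height is bounded by an energy on the line (lemma \<open>conv_line_bound\<close>). Horizontally, a
  Taylor expansion of order \<open>n + 1\<close> averaged over a ball bounds a value by the \<open>L\<^sup>1\<close> norms of
  the derivatives of order at most \<open>n + 1\<close> (lemma \<open>conv_average_bound\<close>). The combination is lemma
  \<open>sup_bound\<close>.

  Applied to the first horizontal derivatives, it bounds the horizontal gradient. Applied to the
  second ones, after one more Caccioppoli step, it bounds them by \<open>C / \<tau>\<close> times the same quantity.
  Then the flux identity and the hypothesis \<open>\<integral>\<^sub>0\<^sup>y \<mu> \<le> C\<^sub>0 \<tau> \<mu>(y)\<close> give
  \<open>\<bar>\<mu> b p\<bar> \<le> C \<mu>\<close>, where \<open>\<mu>\<close> cancels: this bounds the vertical derivative (lemma \<open>gradient_bound\<close>).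
  The right-hand side is normalised by the \<open>\<mu>\<close>-measure of the full cylinder, which is comparable to
  that of the smaller one by the Muckenhoupt condition (lemma \<open>mass_doubling\<close>).

  It remains to choose representatives. A weak solution is only defined up to null sets and with
  respect to Lebesgue measure; lemma \<open>cylinder_solution_of_weak_solution\<close> replaces all data by
  Borel functions for which every horizontal slice is integrable.
\<close>

section \<open>Smooth functions and bump functions\<close>

lemma Ck_SucI:
  assumes "\<And>x. (f has_derivative f' x) (at x)" "\<And>e. e \<in> Basis \<Longrightarrow> Ck k (\<lambda>x. f' x e)"
  shows "Ck (Suc k) f"
proof -
  have "frechet_derivative f (at x) = f' x" for x
    using frechet_derivative_at[OF assms(1)] by simp
  then show ?thesis using assms by (auto simp: differentiable_def)
qed

lemma Ck_Suc_has_derivative: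
  "Ck (Suc k) f \<Longrightarrow> (f has_derivative frechet_derivative f (at x)) (at x)"
  by (simp add: frechet_derivative_works[symmetric])

lemma Ck_SucD: "Ck (Suc k) f \<Longrightarrow> Ck k f"
proof (induction k arbitrary: f)
  case 0
  then show ?case
    by (auto simp: continuous_on_eq_continuous_at intro: differentiable_imp_continuous_within)
next
  case (Suc k)
  then show ?case by (metis Ck.simps(2))
qed

lemma Ck_const: "Ck k (\<lambda>x. c)"
proof (induction k arbitrary: c)
  case (Suc k)
  show ?case by (rule Ck_SucI[of _ "\<lambda>x e. 0"]) (use Suc in auto)
qed auto

lemma Ck_add: "Ck k f \<Longrightarrow> Ck k g \<Longrightarrow> Ck k (\<lambda>x. f x + g x)"
proof (induction k arbitrary: f g)
  case 0
  then show ?case by (auto intro: continuous_on_add)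
next
  case (Suc k)
  show ?case
  proof (rule Ck_SucI)
    show "((\<lambda>x. f x + g x) has_derivative
        (\<lambda>e. frechet_derivative f (at x) e + frechet_derivative g (at x) e)) (at x)" for x
      by (rule has_derivative_add; rule Ck_Suc_has_derivative; fact Suc.prems)
  qed (rule Suc.IH; use Suc.prems in simp)
qed

lemma Ck_mult: "Ck k f \<Longrightarrow> Ck k g \<Longrightarrow> Ck k (\<lambda>x. f x * g x)"
proof (induction k arbitrary: f g)
  case 0
  then show ?case by (auto intro: continuous_on_mult)
next
  case (Suc k)
  note fg = Ck_SucD[OF Suc.prems(1)] Ck_SucD[OF Suc.prems(2)]
  show ?case
  proof (rule Ck_SucI)
    show "((\<lambda>x. f x * g x) has_derivative
        (\<lambda>e. f x * frechet_derivative g (at x) e + frechet_derivative f (at x) e * g x)) (at x)" for x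
      by (rule has_derivative_mult; rule Ck_Suc_has_derivative; fact Suc.prems)
  qed (rule Ck_add; rule Suc.IH; use Suc.prems fg in simp)
qed

lemma Ck_sum: "finite A \<Longrightarrow> (\<And>i. i \<in> A \<Longrightarrow> Ck k (f i)) \<Longrightarrow> Ck k (\<lambda>x. \<Sum>i\<in>A. f i x)"
  by (induction A rule: finite_induct) (auto intro: Ck_const Ck_add)

lemma Ck_prod: "finite A \<Longrightarrow> (\<And>i. i \<in> A \<Longrightarrow> Ck k (f i)) \<Longrightarrow> Ck k (\<lambda>x. \<Prod>i\<in>A. f i x)"
  by (induction A rule: finite_induct) (auto intro: Ck_const Ck_mult)

text \<open>
  By the chain rule, a derivative of \<open>x \<mapsto> f (L x + c)\<close> is a linear combination of derivatives
  of \<open>f\<close>, composed with the same affine map; this closes the induction on the order.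
\<close>

lemma Ck_affine:
  fixes L :: "'b::euclidean_space \<Rightarrow> 'a::euclidean_space"
  assumes L: "bounded_linear L" and "Ck k f"
  shows "Ck k (\<lambda>x. f (L x + c))"
  using assms(2)
proof (induction k arbitrary: f)
  case 0
  have "continuous_on UNIV (\<lambda>x. f (L x + c))"
    using 0 continuous_on_add[OF linear_continuous_on[OF L, of UNIV] continuous_on_const[of UNIV c]]
    by (intro continuous_on_compose2[where g = f and f = "\<lambda>x. L x + c" and t = UNIV and s = UNIV]) auto
  then show ?case by simp
next
  case (Suc k)
  show ?case
  proof (rule Ck_SucI)
    fix x
    have 1: "((\<lambda>x. L x + c) has_derivative L) (at x)"
      using bounded_linear_imp_has_derivative[OF L] by (auto intro!: derivative_eq_intros)
    show "((\<lambda>x. f (L x + c)) has_derivative (\<lambda>e. frechet_derivative f (at (L x + c)) (L e))) (at x)"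
      using has_derivative_compose[OF 1, of f "frechet_derivative f (at (L x + c))"]
        Ck_Suc_has_derivative[OF Suc.prems] by simp
  next
    fix e :: 'b
    have lin: "linear (frechet_derivative f (at z))" for z
      using Ck_Suc_has_derivative[OF Suc.prems] has_derivative_linear by blast
    have "frechet_derivative f (at (L x + c)) (L e) =
        (\<Sum>b\<in>Basis. (L e \<bullet> b) * frechet_derivative f (at (L x + c)) b)" for x
      by (subst euclidean_representation[symmetric, of "L e"])
         (simp add: linear_sum[OF lin] linear_cmul[OF lin])
    then show "Ck k (\<lambda>x. frechet_derivative f (at (L x + c)) (L e))"
      using Suc by (auto intro!: Ck_sum Ck_mult Ck_const)
  qed
qed

lemma smooth_const: "smooth (\<lambda>x. c)" by (simp add: smooth_def Ck_const)
lemma smooth_add: "smooth f \<Longrightarrow> smooth g \<Longrightarrow> smooth (\<lambda>x. f x + g x)" by (simp add: smooth_def Ck_add)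
lemma smooth_mult: "smooth f \<Longrightarrow> smooth g \<Longrightarrow> smooth (\<lambda>x. f x * g x)" by (simp add: smooth_def Ck_mult)
lemma smooth_sum: "finite A \<Longrightarrow> (\<And>i. i \<in> A \<Longrightarrow> smooth (f i)) \<Longrightarrow> smooth (\<lambda>x. \<Sum>i\<in>A. f i x)"
  by (simp add: smooth_def Ck_sum)
lemma smooth_prod: "finite A \<Longrightarrow> (\<And>i. i \<in> A \<Longrightarrow> smooth (f i)) \<Longrightarrow> smooth (\<lambda>x. \<Prod>i\<in>A. f i x)"
  by (simp add: smooth_def Ck_prod)
lemma smooth_affine: "bounded_linear L \<Longrightarrow> smooth f \<Longrightarrow> smooth (\<lambda>x. f (L x + c))"
  by (simp add: smooth_def Ck_affine)
lemma smooth_linear: "bounded_linear L \<Longrightarrow> smooth f \<Longrightarrow> smooth (\<lambda>x. f (L x))"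
  using smooth_affine[of L f 0] by simp
lemma smooth_has_derivative: "smooth f \<Longrightarrow> (f has_derivative frechet_derivative f (at x)) (at x)"
  by (auto simp: smooth_def intro!: Ck_Suc_has_derivative[of 0] simp del: Ck.simps)
lemma smooth_continuous: "smooth f \<Longrightarrow> continuous_on A f"
  by (metis Ck.simps(1) continuous_on_subset smooth_def top_greatest)
lemma smooth_SucI: "(\<And>x. (f has_derivative f' x) (at x)) \<Longrightarrow>
    (\<And>e. e \<in> Basis \<Longrightarrow> smooth (\<lambda>x. f' x e)) \<Longrightarrow> smooth f"
  by (metis Ck_SucI Ck_SucD smooth_def)

text \<open>
  The direction comes first, so that \<open>dirderiv h\<close> is an operator on functions which can be iterated.
\<close>

definition dirderiv :: "'a::euclidean_space \<Rightarrow> ('a \<Rightarrow> real) \<Rightarrow> 'a \<Rightarrow> real" where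
  "dirderiv h f x = frechet_derivative f (at x) h"

lemma dirderiv_eqI: "(f has_derivative f') (at x) \<Longrightarrow> dirderiv h f x = f' h"
  by (metis dirderiv_def frechet_derivative_at)

lemma dirderiv_basis_sum:
  assumes "smooth f"
  shows "dirderiv h f x = (\<Sum>e\<in>Basis. (h \<bullet> e) * dirderiv e f x)"
proof -
  have lin: "linear (frechet_derivative f (at x))"
    using smooth_has_derivative[OF assms] has_derivative_linear by blast
  show ?thesis unfolding dirderiv_def
    by (subst euclidean_representation[symmetric, of h])
       (simp add: linear_sum[OF lin] linear_cmul[OF lin])
qed

lemma smooth_dirderiv:
  assumes "smooth f" shows "smooth (dirderiv h f)"
proof -
  have "smooth (\<lambda>x. frechet_derivative f (at x) e)" if "e \<in> Basis" for e
    using assms that unfolding smooth_def by (metis Ck.simps(2))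
  then have "smooth (\<lambda>x. \<Sum>e\<in>Basis. (h \<bullet> e) * dirderiv e f x)"
    unfolding dirderiv_def by (intro smooth_sum smooth_mult smooth_const) auto
  moreover have "dirderiv h f = (\<lambda>x. \<Sum>e\<in>Basis. (h \<bullet> e) * dirderiv e f x)"
    by (rule ext) (rule dirderiv_basis_sum[OF assms])
  ultimately show ?thesis by simp
qed

lemma dirderiv_line:
  assumes "smooth f"
  shows "((\<lambda>t. f (x + t *\<^sub>R h)) has_real_derivative dirderiv h f (x + t *\<^sub>R h)) (at t)"
proof -
  have 1: "((\<lambda>t. x + t *\<^sub>R h) has_derivative (\<lambda>s. s *\<^sub>R h)) (at t)"
    by (auto intro!: derivative_eq_intros)
  have lin: "linear (frechet_derivative f (at z))" for z
    using smooth_has_derivative[OF assms] has_derivative_linear by blast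
  have "((\<lambda>t. f (x + t *\<^sub>R h)) has_derivative
     (\<lambda>s. frechet_derivative f (at (x + t *\<^sub>R h)) (s *\<^sub>R h))) (at t)"
    using has_derivative_compose[OF 1 smooth_has_derivative[OF assms]] by simp
  then show ?thesis
    by (simp add: has_field_derivative_def linear_cmul[OF lin] dirderiv_def mult_commute_abs)
qed

lemma dirderiv_zero_off_closed:
  assumes "closed S" "\<And>x. f x \<noteq> 0 \<Longrightarrow> x \<in> S" "dirderiv h f x \<noteq> 0"
  shows "x \<in> S"
proof (rule ccontr)
  assume "x \<notin> S"
  then have "((\<lambda>x. 0) has_derivative (\<lambda>h. 0)) (at x)" "open (-S)" "x \<in> -S" 
    using assms by auto
  then have "(f has_derivative (\<lambda>h. 0)) (at x)"
    by (rule has_derivative_transform_within_open) (use assms in auto)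
  then show False using assms(3) dirderiv_eqI by metis
qed

lemma dirderiv_add: "smooth f \<Longrightarrow> smooth g \<Longrightarrow> dirderiv h (\<lambda>x. f x + g x) x = dirderiv h f x + dirderiv h g x"
  by (subst dirderiv_eqI[OF has_derivative_add[OF smooth_has_derivative smooth_has_derivative]])
     (auto simp: dirderiv_def)
lemma dirderiv_mult: "smooth f \<Longrightarrow> smooth g \<Longrightarrow>
    dirderiv h (\<lambda>x. f x * g x) x = f x * dirderiv h g x + dirderiv h f x * g x"
  by (subst dirderiv_eqI[OF has_derivative_mult[OF smooth_has_derivative smooth_has_derivative]])
     (auto simp: dirderiv_def)
lemma dirderiv_const: "dirderiv h (\<lambda>x. c) x = 0"
  by (subst dirderiv_eqI[OF has_derivative_const]) auto
lemma dirderiv_affine: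
  assumes "bounded_linear L" "smooth f"
  shows "dirderiv h (\<lambda>x. f (L x + c)) x = dirderiv (L h) f (L x + c)"
proof -
  have 1: "((\<lambda>x. L x + c) has_derivative L) (at x)"
    using bounded_linear_imp_has_derivative[OF assms(1)] by (auto intro!: derivative_eq_intros)
  show ?thesis unfolding dirderiv_def[of "L h"]
    using has_derivative_compose[OF 1 smooth_has_derivative[OF assms(2)]] by (rule dirderiv_eqI)
qed

text \<open>
  The flat function \<open>exp (- 1/t)\<close>, extended by \<open>0\<close> and multiplied by a polynomial in \<open>1/t\<close>. The
  polynomial factor makes the family closed under differentiation.
\<close>

definition psi :: "real poly \<Rightarrow> real \<Rightarrow> real" where
  "psi p t = (if t > 0 then poly p (inverse t) * exp (- inverse t) else 0)"

lemma poly_exp_tendsto_0: "((\<lambda>s::real. poly p s * exp (- s)) \<longlongrightarrow> 0) at_top"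
proof -
  have "((\<lambda>s::real. \<Sum>i\<le>degree p. coeff p i * (s ^ i / exp s)) \<longlongrightarrow> (\<Sum>i\<le>degree p. coeff p i * 0)) at_top"
    by (intro tendsto_sum tendsto_mult tendsto_const tendsto_power_div_exp_0)
  then show ?thesis
    by (simp add: poly_altdef exp_minus sum_divide_distrib field_simps)
qed

lemma psi_tendsto_0: "(psi p \<longlongrightarrow> 0) (at 0)"
proof -
  have "((\<lambda>t. poly p (inverse t) * exp (- inverse t)) \<longlongrightarrow> 0) (at_right (0::real))"
    using filterlim_compose[OF poly_exp_tendsto_0 filterlim_inverse_at_top_right] .
  moreover have "\<forall>\<^sub>F t in at_right (0::real). poly p (inverse t) * exp (- inverse t) = psi p t"
    by (auto simp: eventually_at_filter psi_def)
  ultimately have 1: "(psi p \<longlongrightarrow> 0) (at_right 0)"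
    using tendsto_cong by fastforce
  have "\<forall>\<^sub>F t in at_left (0::real). psi p t = 0"
    by (auto simp: eventually_at_filter psi_def)
  then have "(psi p \<longlongrightarrow> 0) (at_left 0)"
    by (simp add: tendsto_eventually)
  with 1 show ?thesis by (simp add: filterlim_split_at)
qed

text \<open>
  The derivative stays in the family, also at \<open>0\<close>, where the difference quotient is
  again a member of the family and therefore tends to \<open>0\<close>. Smoothness follows by induction.
\<close>

lemma psi_has_derivative:
  "(psi p has_real_derivative psi ([:0,0,1:] * (p - pderiv p)) t) (at t)"
proof -
  consider "t > 0" | "t < 0" | "t = 0" by linarith
  then show ?thesis
  proof cases
    case 1
    have "((\<lambda>t. poly p (inverse t) * exp (- inverse t)) has_real_derivative
       psi ([:0,0,1:] * (p - pderiv p)) t) (at t)"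
      using 1 by (auto intro!: derivative_eq_intros poly_DERIV simp: psi_def)
        (simp add: algebra_simps power2_eq_square)
    then show ?thesis
      by (rule has_field_derivative_transform_within_open[of _ _ _ "{0<..}"]) (use 1 in \<open>auto simp: psi_def\<close>)
  next
    case 2
    have "((\<lambda>t. 0) has_real_derivative psi ([:0,0,1:] * (p - pderiv p)) t) (at t)"
      using 2 by (auto simp: psi_def)
    then show ?thesis
      by (rule has_field_derivative_transform_within_open[of _ _ _ "{..<0}"]) (use 2 in \<open>auto simp: psi_def\<close>)
  next
    case 3
    have "\<forall>\<^sub>F h in at 0. psi ([:0,1:] * p) h = (psi p (0 + h) - psi p 0) / h"
      by (auto simp: eventually_at_filter psi_def field_simps)
    then have "((\<lambda>h. (psi p (0 + h) - psi p 0) / h) \<longlongrightarrow> 0) (at 0)"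
      using psi_tendsto_0[of "[:0,1:] * p"] tendsto_cong by fastforce
    then show ?thesis using 3 by (simp add: DERIV_def) (simp add: psi_def)
  qed
qed

lemma smooth_psi: "smooth (psi p)"
proof -
  have "Ck k (psi p)" for k
  proof (induction k arbitrary: p)
    case 0
    then show ?case
      using DERIV_continuous_on[of UNIV "psi p"] psi_has_derivative by (auto intro: has_field_derivative_at_within)
  next
    case (Suc k)
    show ?case
      by (rule Ck_SucI[OF psi_has_derivative[unfolded has_field_derivative_def]]) (use Suc in auto)
  qed
  then show ?thesis by (simp add: smooth_def)
qed

text \<open>
  A product of flat functions of the distances to the faces of the box. The factor \<open>Suc k\<close> steepens
  it, so that it tends to the indicator of the open box. It is a product over the coordinates,
  hence a box bump on a product space is a product of box bumps.
\<close>

definition box_bump :: "nat \<Rightarrow> 'a::euclidean_space \<Rightarrow> 'a \<Rightarrow> 'a \<Rightarrow> real" where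
  "box_bump k a b x =
     (\<Prod>e\<in>Basis. psi 1 (Suc k * (x \<bullet> e - a \<bullet> e)) * psi 1 (Suc k * (b \<bullet> e - x \<bullet> e)))"

lemma smooth_box_bump: "smooth (box_bump k a b)"
proof -
  have "smooth (\<lambda>x. psi 1 (Suc k * (x \<bullet> e - a \<bullet> e)))" for e
    using smooth_affine[OF bounded_linear_const_mult[OF bounded_linear_inner_left[of e]] smooth_psi[of 1],
        of "real (Suc k)" "- (Suc k * (a \<bullet> e))"]
    by (simp add: algebra_simps)
  moreover have "smooth (\<lambda>x. psi 1 (Suc k * (b \<bullet> e - x \<bullet> e)))" for e
    using smooth_affine[OF bounded_linear_const_mult[OF bounded_linear_inner_left[of e]] smooth_psi[of 1],
        of "- real (Suc k)" "(Suc k * (b \<bullet> e))"]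
    by (simp add: algebra_simps)
  ultimately show ?thesis unfolding box_bump_def[abs_def]
    by (intro smooth_prod smooth_mult) auto
qed

lemma psi_1_bounds: "0 \<le> psi 1 t" "psi 1 t \<le> 1"
  by (auto simp: psi_def)

lemma box_bump_bounds: "0 \<le> box_bump k a b x" "box_bump k a b x \<le> 1"
  unfolding box_bump_def
  by (auto intro!: prod_nonneg prod_le_1 mult_nonneg_nonneg mult_le_one psi_1_bounds)

lemma psi_1_eq_0: "psi 1 t = 0 \<longleftrightarrow> t \<le> 0"
  by (auto simp: psi_def)

lemma box_bump_nonzero: "box_bump k a b x \<noteq> 0 \<longleftrightarrow> x \<in> box a b"
proof -
  have "real (Suc k) * s \<le> 0 \<longleftrightarrow> s \<le> 0" for s :: real
    by (simp add: mult_le_0_iff)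
  then show ?thesis
    by (auto simp add: box_bump_def psi_1_eq_0 mem_box not_le simp del: of_nat_Suc)
qed

lemma box_bump_tendsto: "(\<lambda>k. box_bump k a b x) \<longlonglongrightarrow> indicator (box a b) x"
proof (cases "x \<in> box a b")
  case True
  have *: "(\<lambda>k. psi 1 (real (Suc k) * s)) \<longlonglongrightarrow> 1" if "s > 0" for s
  proof -
    have "(\<lambda>k. exp (- (inverse (real (Suc k)) * inverse s))) \<longlonglongrightarrow> exp (- (0 * inverse s))"
      by (intro tendsto_intros LIMSEQ_inverse_real_of_nat)
    then show ?thesis using that by (simp add: psi_def del: of_nat_Suc)
  qed
  have "(\<lambda>k. box_bump k a b x) \<longlonglongrightarrow> (\<Prod>e\<in>(Basis::'a set). 1 * 1)"
    unfolding box_bump_def using True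
    by (intro tendsto_prod tendsto_mult *) (auto simp: mem_box)
  then show ?thesis using True by simp
next
  case False
  then have "box_bump k a b x = 0" for k using box_bump_nonzero by metis
  then show ?thesis using False by simp
qed

section \<open>Box averages and vanishing integrals of derivatives\<close>

text \<open>
  Lebesgue differentiation: almost every value is a limit of averages over shrinking cubes. It is
  enough to know the averages over boxes of diameter less than \<open>d0\<close>; this allows a mollification
  radius to be fixed beforehand.
\<close>

lemma AE_le_of_box_averages:
  fixes f :: "'a::euclidean_space \<Rightarrow> real"
  assumes E: "open E" and f: "locally_integrable_on f E"
    and d0: "0 < d0"
    and le: "\<And>a b. cbox a b \<subseteq> E \<Longrightarrow> box a b \<noteq> {} \<Longrightarrow> norm (b - a) < d0 \<Longrightarrow>
      \<bar>LINT x:cbox a b|lebesgue. f x\<bar> \<le> M * measure lborel (cbox a b)"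
  shows "AE x in lebesgue. x \<in> E \<longrightarrow> \<bar>f x\<bar> \<le> M"
proof -
  have local: "AE x in lebesgue. x \<in> cbox a b \<longrightarrow> \<bar>f x\<bar> \<le> M" if ab: "cbox a b \<subseteq> E" for a b
  proof -
    define F where "F x = (if x \<in> cbox a b then f x else 0)" for x
    have fint: "set_integrable lebesgue (cbox a b) f"
      using f ab by (simp add: locally_integrable_on_def)
    have "F integrable_on UNIV"
      unfolding F_def integrable_restrict_UNIV
      using set_lebesgue_integral_eq_integral(1)[OF fint] .
    then have "F integrable_on cbox c d" for c d
      by (rule integrable_on_subcbox) auto
    then obtain N where N: "negligible N"
      "\<And>x e. x \<notin> N \<Longrightarrow> 0 < e \<Longrightarrow> \<exists>d>0. \<forall>h. 0 < h \<and> h < d \<longrightarrow>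
          norm (integral (cbox x (x + h *\<^sub>R One)) F /\<^sub>R h ^ DIM('a) - F x) < e"
      using integrable_ccontinuous_explicit[of F] by blast
    have bound: "\<bar>f x\<bar> \<le> M" if x: "x \<in> box a b" "x \<notin> N" for x
    proof (rule field_le_epsilon)
      fix e :: real assume e: "e > 0"
      obtain d where d: "d > 0" "\<And>h. 0 < h \<Longrightarrow> h < d \<Longrightarrow>
          norm (integral (cbox x (x + h *\<^sub>R One)) F /\<^sub>R h ^ DIM('a) - F x) < e"
        using N(2)[OF x(2) e] by blast
      obtain r' where "r' > 0" "ball x r' \<subseteq> box a b"
        using x open_box open_contains_ball by blast
      then obtain r where r: "r > 0" "ball x r \<subseteq> box a b" "r \<le> d0"
        using d0 subset_ball[of "min r' d0" r' x] by (intro that[of "min r' d0"]) auto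
      define h where "h = min (d / 2) (r / (2 * DIM('a)))"
      have h: "0 < h" "h < d" "h * DIM('a) < r"
      proof -
        show "0 < h" "h < d" using d r by (auto simp: h_def)
        have "h * DIM('a) \<le> (r / (2 * DIM('a))) * DIM('a)"
          by (intro mult_right_mono) (auto simp: h_def)
        also have "\<dots> < r" using r by simp
        finally show "h * DIM('a) < r" .
      qed
      have sub: "cbox x (x + h *\<^sub>R One) \<subseteq> box a b"
      proof
        fix y assume y: "y \<in> cbox x (x + h *\<^sub>R One)"
        have "norm (y - x) \<le> (\<Sum>e\<in>Basis. \<bar>(y - x) \<bullet> e\<bar>)" by (rule norm_le_l1)
        also have "\<dots> \<le> (\<Sum>e\<in>(Basis::'a set). h)"
          using y by (intro sum_mono) (auto simp: mem_box inner_diff_left inner_add_left)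
        also have "\<dots> < r" using h by (simp add: mult.commute)
        finally show "y \<in> box a b" using r by (auto simp: dist_norm norm_minus_commute)
      qed
      have sub': "cbox x (x + h *\<^sub>R One) \<subseteq> cbox a b"
        using sub box_subset_cbox by blast
      have ne: "box x (x + h *\<^sub>R One) \<noteq> {}"
        using h by (auto simp: box_ne_empty inner_add_left)
      have small: "norm (x + h *\<^sub>R One - x) < d0"
      proof -
        have "norm (h *\<^sub>R (One::'a)) \<le> (\<Sum>e\<in>(Basis::'a set). \<bar>h *\<^sub>R One \<bullet> e\<bar>)" by (rule norm_le_l1)
        also have "\<dots> = h * DIM('a)" using h by simp
        finally have "norm (h *\<^sub>R (One::'a)) < d0" using h r by linarith
        then show ?thesis by (simp only: add_diff_cancel_left')
      qed
      have vol: "measure lborel (cbox x (x + h *\<^sub>R One)) = h ^ DIM('a)"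
        using h by (simp add: measure_lborel_cbox_eq inner_add_left)
      have "set_integrable lebesgue (cbox x (x + h *\<^sub>R One)) f"
        by (rule set_integrable_subset[OF fint _ sub']) auto
      note int = set_lebesgue_integral_eq_integral(2)[OF this]
      have "integral (cbox x (x + h *\<^sub>R One)) F = integral (cbox x (x + h *\<^sub>R One)) f"
        by (rule integral_cong) (use sub' in \<open>auto simp: F_def\<close>)
      then have "\<bar>integral (cbox x (x + h *\<^sub>R One)) F\<bar> \<le> M * h ^ DIM('a)"
        using le[of x "x + h *\<^sub>R One"] sub' ab ne small vol int by simp
      then have "\<bar>integral (cbox x (x + h *\<^sub>R One)) F /\<^sub>R h ^ DIM('a)\<bar> \<le> M"
        using h by (simp add: abs_mult field_simps)
      moreover have "F x = f x" using x box_subset_cbox by (auto simp: F_def)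
      ultimately show "\<bar>f x\<bar> \<le> M + e" using d(2)[OF h(1,2)] by (auto simp del: scaleR_conv_of_real)
    qed
    have "negligible (N \<union> (cbox a b - box a b))"
      using N(1) negligible_frontier_interval by (rule negligible_Un)
    then have "AE x in lebesgue. x \<notin> N \<union> (cbox a b - box a b)"
      by (intro AE_not_in) (simp add: negligible_iff_null_sets)
    then show ?thesis by (rule AE_mp) (use bound in auto)
  qed
  obtain \<D> where D: "countable \<D>" "\<D> \<subseteq> Pow E" "\<And>X. X \<in> \<D> \<Longrightarrow> \<exists>a b. X = cbox a b" "\<Union>\<D> = E"
    using open_countable_Union_open_cbox[OF E] by metis
  have "AE x in lebesgue. \<forall>X\<in>\<D>. x \<in> X \<longrightarrow> \<bar>f x\<bar> \<le> M"
  proof (rule AE_ball_countable')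
    fix X assume "X \<in> \<D>"
    then show "AE x in lebesgue. x \<in> X \<longrightarrow> \<bar>f x\<bar> \<le> M" using D local by (metis PowD subsetD)
  qed (rule D)
  then show ?thesis by (rule AE_mp) (use D(4) in auto)
qed

lemma smooth_borel_measurable: "smooth f \<Longrightarrow> f \<in> borel_measurable borel"
  by (rule borel_measurable_continuous_onI[OF smooth_continuous])

text \<open>
  Dominated convergence; the boundary of a box is negligible.
\<close>

lemma box_bump_integral_tendsto:
  fixes f :: "'a::euclidean_space \<Rightarrow> real"
  assumes "set_integrable lebesgue (cbox a b) f"
  shows "(\<lambda>k. LINT x|lebesgue. f x * box_bump k a b x) \<longlonglongrightarrow> (LINT x:cbox a b|lebesgue. f x)"
proof -
  let ?g = "\<lambda>x. indicator (cbox a b) x * f x"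
  have g: "integrable lebesgue ?g" using assms by (simp add: set_integrable_def)
  have bm: "box_bump k a b \<in> borel_measurable lebesgue" for k
    by (intro measurable_completion) (simp add: smooth_borel_measurable smooth_box_bump)
  have supp: "box_bump k a b x * indicator (cbox a b) x = box_bump k a b x" for k x
    using box_bump_nonzero[of k a b x] box_subset_cbox[of a b] by (auto simp: indicator_def)
  have eq: "f x * box_bump k a b x = ?g x * box_bump k a b x" for k x
    using supp[of k x] by (simp add: ac_simps)
  have "negligible (cbox a b - box a b)" by (rule negligible_frontier_interval)
  then have "AE x in lebesgue. x \<notin> cbox a b - box a b"
    by (intro AE_not_in) (simp add: negligible_iff_null_sets)
  then have lim: "AE x in lebesgue. (\<lambda>k. ?g x * box_bump k a b x) \<longlonglongrightarrow> ?g x"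
  proof (rule AE_mp, intro AE_I2 impI)
    fix x assume x: "x \<notin> cbox a b - box a b"
    have "(\<lambda>k. ?g x * box_bump k a b x) \<longlonglongrightarrow> ?g x * indicator (box a b) x"
      by (intro tendsto_intros box_bump_tendsto)
    moreover have "?g x * indicator (box a b) x = ?g x"
      using x box_subset_cbox[of a b] by (auto simp: indicator_def)
    ultimately show "(\<lambda>k. ?g x * box_bump k a b x) \<longlonglongrightarrow> ?g x" by simp
  qed
  have "(\<lambda>k. LINT x|lebesgue. ?g x * box_bump k a b x) \<longlonglongrightarrow> (LINT x|lebesgue. ?g x)"
  proof (rule integral_dominated_convergence[where w = "\<lambda>x. \<bar>?g x\<bar>"])
    show "AE x in lebesgue. norm (?g x * box_bump k a b x) \<le> \<bar>?g x\<bar>" for k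
      using box_bump_bounds[of k a b] by (auto simp: abs_mult intro!: AE_I2 mult_left_le)
  qed (use g bm lim in \<open>auto intro!: borel_measurable_times borel_measurable_integrable[OF g]\<close>)
  then show ?thesis
    by (simp add: eq[symmetric] set_lebesgue_integral_def)
qed

text \<open>
  The fundamental lemma of the calculus of variations, with box bumps as the only tests. Their
  product form is what makes it possible to test in \<open>x\<close> and in \<open>y\<close> separately.
\<close>

lemma AE_zero_of_box_bumps:
  fixes f :: "'a::euclidean_space \<Rightarrow> real"
  assumes E: "open E" and f: "locally_integrable_on f E"
    and z: "\<And>a b k. cbox a b \<subseteq> E \<Longrightarrow> box a b \<noteq> {} \<Longrightarrow> (LINT x|lebesgue. f x * box_bump k a b x) = 0"
  shows "AE x in lebesgue. x \<in> E \<longrightarrow> f x = 0"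
proof -
  have "AE x in lebesgue. x \<in> E \<longrightarrow> \<bar>f x\<bar> \<le> 0"
  proof (rule AE_le_of_box_averages[OF E f, of 1])
    fix a b :: 'a assume ab: "cbox a b \<subseteq> E" "box a b \<noteq> {}"
    have "set_integrable lebesgue (cbox a b) f"
      using f ab by (simp add: locally_integrable_on_def)
    from box_bump_integral_tendsto[OF this] have "(LINT x:cbox a b|lebesgue. f x) = 0"
      using z[OF ab] by (simp add: LIMSEQ_const_iff)
    then show "\<bar>LINT x:cbox a b|lebesgue. f x\<bar> \<le> 0 * measure lborel (cbox a b)" by simp
  qed simp
  then show ?thesis by (rule AE_mp) auto
qed

lemma lborel_integral_translate:
  fixes f :: "'a::euclidean_space \<Rightarrow> real"
  assumes [measurable]: "f \<in> borel_measurable borel"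
  shows "(LINT x|lborel. f (c + x)) = (LINT x|lborel. f x)"
  by (subst (2) lborel_distr_plus[of c, symmetric]) (simp add: integral_distr)

lemma lborel_integrable_translate:
  fixes f :: "'a::euclidean_space \<Rightarrow> real"
  assumes [measurable]: "f \<in> borel_measurable borel"
  shows "integrable lborel (\<lambda>x. f (c + x)) = integrable lborel f"
  by (subst (2) lborel_distr_plus[of c, symmetric]) (simp add: integrable_distr_eq)

lemma lborel_integral_reflect:
  fixes f :: "'a::euclidean_space \<Rightarrow> real"
  assumes [measurable]: "f \<in> borel_measurable borel"
  shows "(LINT x|lborel. f (c - x)) = (LINT x|lborel. f x)"
proof -
  have "(LINT x|lborel. f x) = (LINT x|density (distr lborel borel (\<lambda>x. c + (-1) *\<^sub>R x)) (\<lambda>_. ennreal (\<bar>-1\<bar> ^ DIM('a))). f x)"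
    by (subst lborel_affine[of "-1" c, symmetric]) auto
  also have "\<dots> = (LINT x|lborel. f (c - x))"
    by (simp add: density_1 integral_distr)
  finally show ?thesis by simp
qed

lemma lborel_integrable_reflect:
  fixes f :: "'a::euclidean_space \<Rightarrow> real"
  assumes [measurable]: "f \<in> borel_measurable borel"
  shows "integrable lborel (\<lambda>x. f (c - x)) = integrable lborel f"
proof -
  have "integrable lborel f = integrable (density (distr lborel borel (\<lambda>x. c + (-1) *\<^sub>R x)) (\<lambda>_. ennreal (\<bar>-1\<bar> ^ DIM('a)))) f"
    by (subst lborel_affine[of "-1" c, symmetric]) auto
  also have "\<dots> = integrable lborel (\<lambda>x. f (c - x))"
    by (simp add: density_1 integrable_distr_eq)
  finally show ?thesis by simp
qed

text \<open>
  Difference quotients have integral zero by translation invariance, and the mean value theorem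
  dominates them. Since only a derivative along \<open>e\<close> is involved, the lemma applies to
  mollifications multiplied by cutoffs that are merely continuously differentiable.
\<close>

lemma integral_directional_derivative_eq_0:
  fixes f f' :: "'a::euclidean_space \<Rightarrow> real"
  assumes [measurable]: "f \<in> borel_measurable borel" "f' \<in> borel_measurable borel"
    and der: "\<And>x. ((\<lambda>t. f (x + t *\<^sub>R e)) has_real_derivative f' x) (at 0)"
    and bd: "\<And>x. \<bar>f x\<bar> \<le> C" "\<And>x. \<bar>f' x\<bar> \<le> C" and supp: "\<And>x. norm x > r \<Longrightarrow> f x = 0"
  shows "(LINT x|lborel. f' x) = 0"
proof -
  define q where "q k x = (f (x + inverse (real (Suc k)) *\<^sub>R e) - f x) * real (Suc k)" for k x
  have der': "((\<lambda>t. f (x + t *\<^sub>R e)) has_real_derivative f' (x + t *\<^sub>R e)) (at t)" for x t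
    using der[of "x + t *\<^sub>R e"] DERIV_shift[of "\<lambda>t. f (x + t *\<^sub>R e)" "f' (x + t *\<^sub>R e)" 0 t]
    by (simp add: algebra_simps)
  have ball: "integrable lborel (\<lambda>x. C * indicator (cball (0::'a) s) x)" for s
    by (intro integrable_mult_right integrable_real_indicator)
       (use emeasure_bounded_finite[OF bounded_cball, of "0::'a" s] in \<open>auto simp: less_top\<close>)
  have fi: "integrable lborel f"
  proof (rule Bochner_Integration.integrable_bound[where f = "\<lambda>x. C * indicator (cball 0 r) x"])
    show "integrable lborel (\<lambda>x. C * indicator (cball (0::'a) r) x)" by (rule ball)
    show "AE x in lborel. norm (f x) \<le> norm (C * indicator (cball 0 r) x)"
    proof (intro AE_I2)
      fix x
      show "norm (f x) \<le> norm (C * indicator (cball 0 r) x)"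
      proof (cases "norm x \<le> r")
        case True
        then show ?thesis using bd(1)[of x] by simp
      qed (use supp in simp)
    qed
  qed simp
  have q0: "(LINT x|lborel. q k x) = 0" for k
  proof -
    define c where "c = inverse (real (Suc k)) *\<^sub>R e"
    have "integrable lborel (\<lambda>x. f (c + x))"
      by (simp add: lborel_integrable_translate fi)
    then have "(LINT x|lborel. q k x) = ((LINT x|lborel. f (c + x)) - (LINT x|lborel. f x)) * real (Suc k)"
      unfolding q_def c_def[symmetric] using fi by (simp add: add.commute[of _ c] del: of_nat_Suc)
    then show ?thesis by (simp add: lborel_integral_translate)
  qed
  have "(\<lambda>k. LINT x|lborel. q k x) \<longlonglongrightarrow> (LINT x|lborel. f' x)"
  proof (rule integral_dominated_convergence[where w = "\<lambda>x. C * indicator (cball 0 (r + norm e)) x"])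
    show "AE x in lborel. (\<lambda>k. q k x) \<longlonglongrightarrow> f' x"
    proof (intro AE_I2)
      fix x
      have "((\<lambda>t. (f (x + t *\<^sub>R e) - f x) / t) \<longlongrightarrow> f' x) (at 0)"
        using der[of x] by (simp add: DERIV_def)
      then have "((\<lambda>t. (f (x + t *\<^sub>R e) - f x) / t) \<circ> (\<lambda>k. inverse (real (Suc k)))) \<longlonglongrightarrow> f' x"
        unfolding tendsto_at_iff_sequentially using LIMSEQ_inverse_real_of_nat by auto
      then show "(\<lambda>k. q k x) \<longlonglongrightarrow> f' x"
        by (simp add: q_def o_def divide_inverse del: of_nat_Suc)
    qed
    show "AE x in lborel. norm (q k x) \<le> C * indicator (cball 0 (r + norm e)) x" for k
    proof (intro AE_I2)
      fix x
      let ?t = "inverse (real (Suc k))"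
      have "0 < ?t" by simp
      then obtain z where z: "f (x + ?t *\<^sub>R e) - f (x + 0 *\<^sub>R e) = (?t - 0) * f' (x + z *\<^sub>R e)"
        using MVT2[of 0 ?t "\<lambda>t. f (x + t *\<^sub>R e)" "\<lambda>t. f' (x + t *\<^sub>R e)"] der' by blast
      \<comment> \<open>the difference quotient is a value of \<open>f'\<close>, hence bounded by \<open>C\<close>\<close>
      then have "q k x = f' (x + z *\<^sub>R e)" by (simp add: q_def field_simps)
      then have 1: "\<bar>q k x\<bar> \<le> C" using bd(2)[of "x + z *\<^sub>R e"] by simp
      have "q k x = 0" if "norm x > r + norm e"
      proof -
        have "norm (?t *\<^sub>R e) \<le> norm e" by (simp add: field_simps)
        moreover have "norm x - norm (?t *\<^sub>R e) \<le> norm (x + ?t *\<^sub>R e)"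
          using norm_triangle_ineq2[of x "- (?t *\<^sub>R e)"] by simp
        ultimately have "norm (x + ?t *\<^sub>R e) > r" "norm x > r"
          using that norm_ge_zero[of e] by linarith+
        then show ?thesis using supp by (simp add: q_def)
      qed
      then show "norm (q k x) \<le> C * indicator (cball 0 (r + norm e)) x"
        using 1 by (auto simp: indicator_def)
    qed
    show "integrable lborel (\<lambda>x. C * indicator (cball (0::'a) (r + norm e)) x)" by (rule ball)
  qed (auto simp: q_def)
  then show ?thesis using q0 by (simp add: LIMSEQ_const_iff)
qed

section \<open>Weak derivatives in the vertical variable\<close>

text \<open>
  Supplies smooth test functions with a prescribed compactly supported derivative.
\<close>

lemma smooth_antiderivative:
  fixes g :: "real \<Rightarrow> real"
  assumes g: "smooth g" and supp: "\<And>y. g y \<noteq> 0 \<Longrightarrow> a \<le> y \<and> y \<le> b" and ab: "a \<le> b"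
  obtains G where "smooth G" "\<And>y. dirderiv 1 G y = g y" "\<And>y. y \<le> a \<Longrightarrow> G y = 0"
    "\<And>y. b \<le> y \<Longrightarrow> G y = (LINT s|lborel. g s)"
proof -
  define G where "G y = (LBINT s=ereal a..ereal y. g s)" for y
  have der: "(G has_real_derivative g y) (at y)" for y
  proof -
    have "((\<lambda>u. LBINT s=ereal a..ereal u. g s) has_vector_derivative g y)
        (at y within {min a y - 1..max a y + 1})"
      by (rule interval_integral_FTC2) (auto intro: smooth_continuous g)
    moreover have "at y within {min a y - 1..max a y + 1} = at y"
      by (rule at_within_interior) (auto simp: min_def max_def)
    ultimately show ?thesis
      by (simp add: G_def[abs_def] has_real_derivative_iff_has_vector_derivative)
  qed
  have cont: "continuous_on S G" for S
    by (rule DERIV_continuous_on) (use der in \<open>blast intro: has_field_derivative_at_within\<close>)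
  have Ga: "G a = 0" by (simp add: G_def)
  have sm: "smooth G"
    by (rule smooth_SucI[OF der[unfolded has_field_derivative_def]]) (simp add: g)
  have d: "dirderiv 1 G y = g y" for y
    using dirderiv_eqI[OF der[unfolded has_field_derivative_def], of 1] by simp
  have left: "G y = 0" if "y \<le> a" for y
  proof (cases "y = a")
    case False
    with that have "y < a" by simp
    have "G a = G y"
    proof (rule DERIV_isconst_end[OF \<open>y < a\<close> cont])
      show "(G has_real_derivative 0) (at x)" if "y < x" "x < a" for x
        using der[of x] supp[of x] that by (cases "g x = 0") auto
    qed
    then show ?thesis using Ga by simp
  qed (use Ga in simp)
  have Gb: "G b = (LINT s|lborel. g s)"
  proof -
    have "(\<lambda>s. indicator {a..b} s * g s) = g"
    proof
      show "indicator {a..b} s * g s = g s" for s using supp[of s] by (cases "g s = 0") auto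
    qed
    then show ?thesis
      by (simp add: G_def interval_integral_Icc[OF ab] set_lebesgue_integral_def)
  qed
  have right: "G y = (LINT s|lborel. g s)" if "b \<le> y" for y
  proof (cases "y = b")
    case False
    with that have "b < y" by simp
    have "G y = G b"
    proof (rule DERIV_isconst_end[OF \<open>b < y\<close> cont])
      show "(G has_real_derivative 0) (at x)" if "b < x" "x < y" for x
        using der[of x] supp[of x] that by (cases "g x = 0") auto
    qed
    then show ?thesis using Gb by simp
  qed (use Gb in simp)
  show thesis by (rule that[OF sm d left right])
qed

lemma integrable_imp_locally_integrable_on:
  fixes f :: "'a::euclidean_space \<Rightarrow> real"
  assumes "integrable lborel f" shows "locally_integrable_on f E"
  unfolding locally_integrable_on_def
proof (intro allI impI)
  fix K assume "compact K \<and> K \<subseteq> E"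
  then have "K \<in> sets lebesgue" by (auto intro: lmeasurable_compact fmeasurableD)
  moreover have "integrable lebesgue f"
    using assms integrable_completion[of f lborel] borel_measurable_integrable by blast
  ultimately show "f absolutely_integrable_on K"
    unfolding set_integrable_def by (intro integrable_mult_indicator)
qed

lemma AE_lborel_zero_of_box_bumps:
  fixes f :: "'a::euclidean_space \<Rightarrow> real"
  assumes E: "open E" and f: "integrable lborel f"
    and z: "\<And>a b k. cbox a b \<subseteq> E \<Longrightarrow> box a b \<noteq> {} \<Longrightarrow> (LINT x|lborel. f x * box_bump k a b x) = 0"
  shows "AE x in lborel. x \<in> E \<longrightarrow> f x = 0"
proof -
  have "AE x in lebesgue. x \<in> E \<longrightarrow> f x = 0"
  proof (rule AE_zero_of_box_bumps[OF E integrable_imp_locally_integrable_on[OF f]])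
    fix a b :: 'a and k assume ab: "cbox a b \<subseteq> E" "box a b \<noteq> {}"
    have "(LINT x|lebesgue. f x * box_bump k a b x) = (LINT x|lborel. f x * box_bump k a b x)"
      using borel_measurable_integrable[OF f] smooth_borel_measurable[OF smooth_box_bump[of k a b]]
      by (intro integral_completion) simp
    then show "(LINT x|lebesgue. f x * box_bump k a b x) = 0" using z[OF ab] by simp
  qed
  then show ?thesis by (simp add: AE_completion_iff)
qed

text \<open>
  The tests are unrestricted near \<open>0\<close>. So every bump in the interval is the derivative of
  an admissible test: its antiderivative minus its total integral, which vanishes near \<open>\<tau>\<close>.
\<close>

lemma AE_zero_of_derivative_tests:
  fixes F :: "real \<Rightarrow> real"
  assumes F: "integrable lborel F"
    and t: "\<And>\<zeta> b. smooth \<zeta> \<Longrightarrow> b < \<tau> \<Longrightarrow> (\<And>y. b \<le> y \<Longrightarrow> \<zeta> y = 0) \<Longrightarrow>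
      (LINT y|lborel. F y * dirderiv 1 \<zeta> y) = 0"
  shows "AE y in lborel. y \<in> {0<..<\<tau>} \<longrightarrow> F y = 0"
proof (rule AE_lborel_zero_of_box_bumps[OF _ F])
  fix a b :: real and k assume ab: "cbox a b \<subseteq> {0<..<\<tau>}" "box a b \<noteq> {}"
  then have "a < b" by auto
  then have "b \<in> cbox a b" by simp
  then have "b < \<tau>" using ab by auto
  obtain G where G: "smooth G" "\<And>y. dirderiv 1 G y = box_bump k a b y"
    "\<And>y. b \<le> y \<Longrightarrow> G y = (LINT s|lborel. box_bump k a b s)"
  proof (rule smooth_antiderivative[OF smooth_box_bump[of k a b]])
    show "a \<le> y \<and> y \<le> b" if "box_bump k a b y \<noteq> 0" for y
      using that box_bump_nonzero[of k a b y] by auto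
  qed (use \<open>a < b\<close> in auto)
  define \<zeta> where "\<zeta> y = G y + - (LINT s|lborel. box_bump k a b s)" for y
  have "smooth \<zeta>" unfolding \<zeta>_def[abs_def] by (intro smooth_add G smooth_const)
  moreover have "dirderiv 1 \<zeta> y = box_bump k a b y" for y
    unfolding \<zeta>_def[abs_def] by (subst dirderiv_add[OF G(1) smooth_const]) (simp add: dirderiv_const G)
  ultimately show "(LINT y|lborel. F y * box_bump k a b y) = 0"
    using t[of \<zeta> b] \<open>b < \<tau>\<close> G(3) by (simp add: \<zeta>_def)
qed auto

lemma integrable_indicator_bounded:
  fixes S :: "'a::euclidean_space set"
  shows "bounded S \<Longrightarrow> S \<in> sets borel \<Longrightarrow> integrable lborel (indicator S :: 'a \<Rightarrow> real)"
  using emeasure_bounded_finite[of S] by (intro integrable_real_indicator) auto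

lemma continuous_bound_Icc:
  fixes f :: "real \<Rightarrow> real"
  assumes "continuous_on UNIV f" obtains C where "\<And>y. y \<in> {a..b} \<Longrightarrow> \<bar>f y\<bar> \<le> C"
proof -
  have "bounded (f ` {a..b})"
    by (intro compact_imp_bounded compact_continuous_image continuous_on_subset[OF assms]) auto
  then obtain C where "\<forall>x\<in>f ` {a..b}. norm x \<le> C" unfolding bounded_iff by blast
  then show thesis using that[of C] by auto
qed

lemma box_bump_integrable: "integrable lborel (box_bump k a b)"
proof (rule Bochner_Integration.integrable_bound[where f = "indicator (cbox a b)"])
  show "integrable lborel (indicator (cbox a b) :: _ \<Rightarrow> real)"
    by (intro integrable_indicator_bounded) auto
  show "AE x in lborel. norm (box_bump k a b x) \<le> norm (indicator (cbox a b) x :: real)"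
    using box_bump_bounds[of k a b] box_bump_nonzero[of k a b] box_subset_cbox[of a b]
    by (intro AE_I2) (force simp: indicator_def)
qed (simp add: smooth_borel_measurable smooth_box_bump)

lemma integrable_mult_bounded:
  fixes f g :: "'a \<Rightarrow> real"
  assumes f: "integrable M f" and [measurable]: "g \<in> borel_measurable M" and bd: "\<And>x. f x \<noteq> 0 \<Longrightarrow> \<bar>g x\<bar> \<le> C"
  shows "integrable M (\<lambda>x. f x * g x)"
proof (rule Bochner_Integration.integrable_bound[where f = "\<lambda>x. \<bar>C\<bar> * f x"])
  show "AE x in M. norm (f x * g x) \<le> norm (\<bar>C\<bar> * f x)"
  proof (intro AE_I2)
    fix x
    show "norm (f x * g x) \<le> norm (\<bar>C\<bar> * f x)"
    proof (cases "f x = 0")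
      case False
      then have "\<bar>g x\<bar> \<le> \<bar>C\<bar>" using bd[of x] by linarith
      then show ?thesis using mult_right_mono[of "\<bar>g x\<bar>" "\<bar>C\<bar>" "\<bar>f x\<bar>"]
        by (simp add: abs_mult mult.commute)
    qed simp
  qed
qed (use f in \<open>auto intro!: borel_measurable_times borel_measurable_integrable[OF f]\<close>)

lemma integrable_bump: "integrable lborel F \<Longrightarrow> integrable lborel (\<lambda>x. F x * box_bump k a b x)"
  using box_bump_bounds[of k a b]
  by (intro integrable_mult_bounded[where C = 1]) (auto simp: smooth_borel_measurable smooth_box_bump)

text \<open>
  The lemma of du Bois-Reymond. Here the tests vanish at both ends, so only bumps of mean zero are
  derivatives of tests; these are obtained by subtracting a multiple of one fixed bump.
\<close>

lemma AE_const_of_derivative_tests: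
  fixes F :: "real \<Rightarrow> real"
  assumes F: "integrable lborel F" and \<tau>: "0 < \<tau>"
    and t: "\<And>\<zeta> a b. smooth \<zeta> \<Longrightarrow> 0 < a \<Longrightarrow> b < \<tau> \<Longrightarrow> (\<And>y. \<zeta> y \<noteq> 0 \<Longrightarrow> a \<le> y \<and> y \<le> b) \<Longrightarrow>
      (LINT y|lborel. F y * dirderiv 1 \<zeta> y) = 0"
  shows "\<exists>c. AE y in lborel. y \<in> {0<..<\<tau>} \<longrightarrow> F y = c"
proof -
  define \<xi>0 where "\<xi>0 = (box_bump 0 (\<tau>/3) (2*\<tau>/3) :: real \<Rightarrow> real)"
  have s0: "smooth \<xi>0" unfolding \<xi>0_def by (rule smooth_box_bump)
  define I0 where "I0 = (LINT y|lborel. \<xi>0 y)"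
  have i0: "integrable lborel \<xi>0" unfolding \<xi>0_def by (rule box_bump_integrable)
  have I0: "I0 \<noteq> 0"
  proof
    assume "I0 = 0"
    then have "AE y in lborel. \<xi>0 y = 0"
      using i0 box_bump_bounds unfolding I0_def \<xi>0_def
      by (subst (asm) integral_nonneg_eq_0_iff_AE) (auto intro!: AE_I2)
    then have "AE y in lborel. y \<notin> {\<tau>/3<..<2*\<tau>/3}"
      by (rule AE_mp) (use box_bump_nonzero[of 0 "\<tau>/3" "2*\<tau>/3"] in \<open>auto intro!: AE_I2 simp: \<xi>0_def\<close>)
    then have "emeasure lborel {\<tau>/3<..<2*\<tau>/3} = 0"
      by (subst (asm) AE_iff_measurable[where N = "{\<tau>/3<..<2*\<tau>/3}"]) auto
    then show False using \<tau> by (simp add: ennreal_eq_0_iff)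
  qed
  define c where "c = (LINT y|lborel. F y * \<xi>0 y) / I0"
  have key: "(LINT y|lborel. F y * box_bump k a b y) = c * (LINT y|lborel. box_bump k a b y)"
    if ab: "0 < a" "a < b" "b < \<tau>" for a b :: real and k
  proof -
    let ?\<xi> = "box_bump k a b :: real \<Rightarrow> real"
    define r where "r = (LINT y|lborel. ?\<xi> y) / I0"
    \<comment> \<open>\<open>r\<close> is chosen such that \<open>g\<close> has integral zero\<close>
    define g where "g y = ?\<xi> y + - r * \<xi>0 y" for y
    have g: "smooth g" unfolding g_def[abs_def] by (intro smooth_add smooth_mult smooth_const s0 smooth_box_bump)
    define a' b' where "a' = min a (\<tau>/3)" and "b' = max b (2*\<tau>/3)"
    have supp: "a' \<le> y \<and> y \<le> b'" if "g y \<noteq> 0" for y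
      using that box_bump_nonzero[of k a b y] box_bump_nonzero[of 0 "\<tau>/3" "2*\<tau>/3" y]
      by (auto simp: g_def \<xi>0_def a'_def b'_def)
    have ab': "0 < a'" "a' \<le> b'" "b' < \<tau>" using ab \<tau> by (auto simp: a'_def b'_def)
    obtain G where G: "smooth G" "\<And>y. dirderiv 1 G y = g y" "\<And>y. y \<le> a' \<Longrightarrow> G y = 0"
      "\<And>y. b' \<le> y \<Longrightarrow> G y = (LINT s|lborel. g s)"
      using smooth_antiderivative[OF g supp ab'(2)] by blast
    have "(LINT s|lborel. g s) = 0"
      unfolding g_def using I0 by (simp add: i0 box_bump_integrable r_def I0_def[symmetric])
    then have "a' \<le> y \<and> y \<le> b'" if "G y \<noteq> 0" for y
      using that G(3)[of y] G(4)[of y] by (cases "y \<le> a'"; cases "b' \<le> y") auto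
    then have "(LINT y|lborel. F y * g y) = 0"
      using t[OF G(1) ab'(1,3)] G(2) by simp
    moreover have "(LINT y|lborel. F y * g y) = (LINT y|lborel. F y * ?\<xi> y) - r * (LINT y|lborel. F y * \<xi>0 y)"
    proof -
      have i: "integrable lborel (\<lambda>y. F y * \<xi>0 y)" unfolding \<xi>0_def by (rule integrable_bump[OF F])
      have "F y * g y = F y * ?\<xi> y - r * (F y * \<xi>0 y)" for y by (simp add: g_def algebra_simps)
      then show ?thesis using integrable_bump[OF F, of k a b] i by simp
    qed
    ultimately show ?thesis by (simp add: c_def r_def mult.commute)
  qed
  let ?f = "\<lambda>y. F y - c * indicator {0<..<\<tau>} y"
  have ind: "integrable lborel (indicator {0<..<\<tau>} :: real \<Rightarrow> real)"
    by (intro integrable_indicator_bounded) auto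
  have "AE y in lborel. y \<in> {0<..<\<tau>} \<longrightarrow> ?f y = 0"
  proof (rule AE_lborel_zero_of_box_bumps)
    fix a b :: real and k assume ab: "cbox a b \<subseteq> {0<..<\<tau>}" "box a b \<noteq> {}"
    then have "a < b" by auto
    then have "a \<in> cbox a b" "b \<in> cbox a b" by auto
    then have "a \<in> {0<..<\<tau>}" "b \<in> {0<..<\<tau>}" using ab(1) by blast+
    then have ab': "0 < a" "a < b" "b < \<tau>" using \<open>a < b\<close> by auto
    have "?f y * box_bump k a b y = F y * box_bump k a b y - c * box_bump k a b y" for y
      using box_bump_nonzero[of k a b y] ab' by (auto simp: algebra_simps indicator_def)
    then show "(LINT y|lborel. ?f y * box_bump k a b y) = 0"
      using key[OF ab', of k] integrable_bump[OF F, of k a b] box_bump_integrable[of k a b] by simp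
  qed (use F ind in auto)
  then have "AE y in lborel. y \<in> {0<..<\<tau>} \<longrightarrow> F y = c" by (rule AE_mp) auto
  then show ?thesis by blast
qed

text \<open>
  The antiderivative that vanishes at minus infinity. For functions supported in \<open>(0, \<tau>)\<close> it is the
  integral from \<open>0\<close> to \<open>y\<close>.
\<close>

definition cum :: "(real \<Rightarrow> real) \<Rightarrow> real \<Rightarrow> real" where
  "cum g y = (LINT s|lborel. indicator {..<y} s * g s)"

lemma integrable_indicator_mult: 
  fixes g :: "real \<Rightarrow> real"
  shows "integrable lborel g \<Longrightarrow> S \<in> sets borel \<Longrightarrow> integrable lborel (\<lambda>s. indicator S s * g s)"
  using integrable_mult_indicator[of S lborel g] by simp

lemma cum_bound:
  assumes "integrable lborel g" shows "\<bar>cum g y\<bar> \<le> (LINT s|lborel. \<bar>g s\<bar>)"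
proof -
  have "\<bar>cum g y\<bar> \<le> (LINT s|lborel. \<bar>indicator {..<y} s * g s\<bar>)"
    unfolding cum_def by (rule integral_abs_bound)
  also have "\<dots> \<le> (LINT s|lborel. \<bar>g s\<bar>)"
    by (intro integral_mono integrable_abs integrable_indicator_mult assms) (auto simp: indicator_def)
  finally show ?thesis .
qed

lemma cum_measurable[measurable]:
  assumes [measurable]: "g \<in> borel_measurable borel" shows "cum g \<in> borel_measurable borel"
proof -
  have "(\<lambda>y. LINT s|lborel. (if s < y then 1 else 0) * g s) \<in> borel_measurable borel"
    by (rule lborel.borel_measurable_lebesgue_integral) measurable
  moreover have "(\<lambda>y. LINT s|lborel. (if s < y then 1 else 0) * g s) = cum g"
    unfolding cum_def by (intro ext Bochner_Integration.integral_cong) auto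
  ultimately show ?thesis by simp
qed

lemma integrable_product:
  fixes f :: "'a::euclidean_space \<Rightarrow> real" and g :: "'b::euclidean_space \<Rightarrow> real"
  assumes f: "integrable lborel f" and g: "integrable lborel g"
  shows "integrable (lborel \<Otimes>\<^sub>M lborel) (\<lambda>(y, s). f y * g s)"
proof (rule lborel_pair.Fubini_integrable)
  note [measurable] = borel_measurable_integrable[OF f] borel_measurable_integrable[OF g]
  show "(\<lambda>(y, s). f y * g s) \<in> borel_measurable (lborel \<Otimes>\<^sub>M lborel)" by measurable
  show "integrable lborel (\<lambda>x. LINT y|lborel. norm (case (x, y) of (y, s) \<Rightarrow> f y * g s))"
    using f by (simp add: abs_mult)
qed (use g in simp)

text \<open>
  Integration by parts in integral form: both sides integrate \<open>f y * g s\<close> over the triangle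
  \<open>s < y\<close>.
\<close>

lemma triangle_Fubini:
  assumes f: "integrable lborel f" and g: "integrable lborel g"
  shows "(LINT y|lborel. f y * cum g y) = (LINT s|lborel. g s * (LINT y|lborel. indicator {s<..} y * f y))"
proof -
  note [measurable] = borel_measurable_integrable[OF f] borel_measurable_integrable[OF g]
  let ?k = "\<lambda>y s. (f y * g s) * (if s < y then 1 else 0 :: real)"
  have "integrable (lborel \<Otimes>\<^sub>M lborel) (\<lambda>z. (case z of (y, s) \<Rightarrow> f y * g s) * (if snd z < fst z then 1 else 0))"
    by (rule integrable_mult_bounded[OF integrable_product[OF f g], where C = 1]) auto
  then have int: "integrable (lborel \<Otimes>\<^sub>M lborel) (\<lambda>(y, s). ?k y s)"
    by (simp add: case_prod_beta')
  have "(LINT y|lborel. f y * cum g y) = (LINT y|lborel. (LINT s|lborel. ?k y s))"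
    unfolding cum_def
    by (intro Bochner_Integration.integral_cong refl)
       (subst integral_mult_right_zero[symmetric], intro Bochner_Integration.integral_cong, auto)
  also have "\<dots> = (LINT s|lborel. (LINT y|lborel. ?k y s))"
    by (rule lborel_pair.Fubini_integral[OF int, symmetric])
  also have "\<dots> = (LINT s|lborel. g s * (LINT y|lborel. indicator {s<..} y * f y))"
    by (intro Bochner_Integration.integral_cong refl)
       (subst integral_mult_right_zero[symmetric], intro Bochner_Integration.integral_cong, auto)
  finally show ?thesis .
qed

lemma integrable_cont_on_interval:
  fixes f :: "real \<Rightarrow> real"
  assumes "continuous_on UNIV f"
  shows "integrable lborel (\<lambda>y. indicator {a<..<b} y * f y)"
proof -
  have "set_integrable lborel {a..b} f"
    by (rule borel_integrable_atLeastAtMost') (use assms continuous_on_subset in blast)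
  then have "set_integrable lborel {a<..<b} f" 
    by (rule set_integrable_subset) auto
  then show ?thesis by (simp add: set_integrable_def)
qed

lemma integral_FTC_open:
  fixes F f :: "real \<Rightarrow> real"
  assumes "a \<le> b" "\<And>y. (F has_real_derivative f y) (at y)" "continuous_on UNIV f"
  shows "(LINT y|lborel. indicator {a<..<b} y * f y) = F b - F a"
proof -
  have "(LBINT y=ereal a..ereal b. f y) = F b - F a"
    by (rule interval_integral_FTC_finite)
       (use assms continuous_on_subset[OF assms(3)] in
         \<open>auto simp: min_def max_def has_real_derivative_iff_has_vector_derivative[symmetric]
           intro: has_field_derivative_at_within\<close>)
  then show ?thesis using assms(1)
    by (simp add: interval_lebesgue_integral_def set_lebesgue_integral_def einterval_eq_Icc[simplified])
qed

lemma cum_by_parts: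
  assumes p: "integrable lborel p" "\<And>y. y \<notin> {0<..<\<tau>} \<Longrightarrow> p y = 0"
    and \<zeta>: "smooth \<zeta>" "b < \<tau>" "\<And>y. b \<le> y \<Longrightarrow> \<zeta> y = 0"
  shows "integrable lborel (\<lambda>y. cum p y * indicator {0<..<\<tau>} y * dirderiv 1 \<zeta> y)"
    "(LINT y|lborel. cum p y * indicator {0<..<\<tau>} y * dirderiv 1 \<zeta> y) = - (LINT y|lborel. p y * \<zeta> y)"
proof -
  let ?f = "\<lambda>y. indicator {0<..<\<tau>} y * dirderiv 1 \<zeta> y"
  note [measurable] = borel_measurable_integrable[OF p(1), simplified]
  have c: "continuous_on UNIV (dirderiv 1 \<zeta>)" by (intro smooth_continuous smooth_dirderiv \<zeta>)
  have f: "integrable lborel ?f" by (rule integrable_cont_on_interval[OF c])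
  have d: "(\<zeta> has_real_derivative dirderiv 1 \<zeta> y) (at y)" for y
    using dirderiv_line[OF \<zeta>(1), of 0 1 y] by simp
  have "integrable lborel (\<lambda>y. ?f y * cum p y)"
    by (rule integrable_mult_bounded[OF f]) (use cum_bound[OF p(1)] in auto)
  then show "integrable lborel (\<lambda>y. cum p y * indicator {0<..<\<tau>} y * dirderiv 1 \<zeta> y)"
    by (simp add: ac_simps)
  have "(LINT y|lborel. ?f y * cum p y) = (LINT s|lborel. p s * (LINT y|lborel. indicator {s<..} y * ?f y))"
    by (rule triangle_Fubini[OF f p(1)])
  also have "\<dots> = (LINT s|lborel. - (p s * \<zeta> s))"
  proof (intro Bochner_Integration.integral_cong refl)
    fix s
    show "p s * (LINT y|lborel. indicator {s<..} y * ?f y) = - (p s * \<zeta> s)"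
    proof (cases "s \<in> {0<..<\<tau>}")
      case True
      have "(\<lambda>y. indicator {s<..} y * ?f y) = (\<lambda>y. indicator {s<..<\<tau>} y * dirderiv 1 \<zeta> y)"
        using True by (auto simp: indicator_def)
      then have "(LINT y|lborel. indicator {s<..} y * ?f y) = \<zeta> \<tau> - \<zeta> s"
        using integral_FTC_open[OF _ d c, of s \<tau>] True by simp
      then show ?thesis using \<zeta>(2) \<zeta>(3)[of \<tau>] by simp
    qed (use p(2) in auto)
  qed
  finally show "(LINT y|lborel. cum p y * indicator {0<..<\<tau>} y * dirderiv 1 \<zeta> y) = - (LINT y|lborel. p y * \<zeta> y)"
    by (simp add: ac_simps)
qed

lemma integrable_cum_indicator:
  assumes "integrable lborel p"
  shows "integrable lborel (\<lambda>y. cum p y * indicator {0<..<\<tau>} y)"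
proof -
  have "integrable lborel (\<lambda>y. indicator {0<..<\<tau>} y * cum p y)"
    by (rule integrable_mult_bounded[where C = "LINT s|lborel. \<bar>p s\<bar>"])
       (use cum_bound[OF assms] borel_measurable_integrable[OF assms] in
         \<open>auto intro!: integrable_indicator_bounded cum_measurable\<close>)
  then show ?thesis by (simp add: mult.commute)
qed

text \<open>
  The equation \<open>f' = - h\<close> holds weakly with tests that are free at \<open>0\<close>, which encodes the
  boundary condition \<open>f 0 = 0\<close>; therefore no constant of integration appears.
\<close>

lemma AE_eq_cum_of_flux_tests:
  assumes f: "integrable lborel f" "\<And>y. y \<notin> {0<..<\<tau>} \<Longrightarrow> f y = 0"
    and h: "integrable lborel h" "\<And>y. y \<notin> {0<..<\<tau>} \<Longrightarrow> h y = 0"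
    and t: "\<And>\<zeta> b. smooth \<zeta> \<Longrightarrow> b < \<tau> \<Longrightarrow> (\<And>y. b \<le> y \<Longrightarrow> \<zeta> y = 0) \<Longrightarrow>
      (LINT y|lborel. f y * dirderiv 1 \<zeta> y) = (LINT y|lborel. h y * \<zeta> y)"
  shows "AE y in lborel. y \<in> {0<..<\<tau>} \<longrightarrow> f y = - cum h y"
proof -
  let ?F = "\<lambda>y. f y + cum h y * indicator {0<..<\<tau>} y"
  have "AE y in lborel. y \<in> {0<..<\<tau>} \<longrightarrow> ?F y = 0"
  proof (rule AE_zero_of_derivative_tests)
    show "integrable lborel ?F" by (intro Bochner_Integration.integrable_add f integrable_cum_indicator h)
    fix \<zeta> b assume \<zeta>: "smooth \<zeta>" "b < \<tau>" "\<And>y. b \<le> y \<Longrightarrow> \<zeta> y = 0"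
    have c: "continuous_on UNIV (dirderiv 1 \<zeta>)" by (intro smooth_continuous smooth_dirderiv \<zeta>)
    obtain C where C: "\<And>y. y \<in> {0..\<tau>} \<Longrightarrow> \<bar>dirderiv 1 \<zeta> y\<bar> \<le> C"
      using continuous_bound_Icc[OF c] by blast
    have "integrable lborel (\<lambda>y. f y * dirderiv 1 \<zeta> y)"
    proof (rule integrable_mult_bounded[OF f(1)])
      show "\<bar>dirderiv 1 \<zeta> y\<bar> \<le> C" if "f y \<noteq> 0" for y
      proof -
        have "y \<in> {0<..<\<tau>}" using f(2) that by blast
        then show ?thesis using C[of y] by auto
      qed
    qed (simp add: smooth_borel_measurable smooth_dirderiv \<zeta>)
    then show "(LINT y|lborel. ?F y * dirderiv 1 \<zeta> y) = 0"
      using cum_by_parts[OF h \<zeta>] t[OF \<zeta>] by (simp add: distrib_right)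
  qed
  then show ?thesis by (rule AE_mp) (auto intro!: AE_I2)
qed

text \<open>
  A weakly differentiable function on an interval is almost everywhere an antiderivative of its weak
  derivative. The tests vanish at both ends, and the constant of integration is free.
\<close>

lemma AE_eq_const_plus_cum_of_tests:
  assumes \<tau>: "0 < \<tau>" and w: "integrable lborel w" "\<And>y. y \<notin> {0<..<\<tau>} \<Longrightarrow> w y = 0"
    and p: "integrable lborel p" "\<And>y. y \<notin> {0<..<\<tau>} \<Longrightarrow> p y = 0"
    and t: "\<And>\<zeta> a b. smooth \<zeta> \<Longrightarrow> 0 < a \<Longrightarrow> b < \<tau> \<Longrightarrow> (\<And>y. \<zeta> y \<noteq> 0 \<Longrightarrow> a \<le> y \<and> y \<le> b) \<Longrightarrow>
      (LINT y|lborel. w y * dirderiv 1 \<zeta> y) = - (LINT y|lborel. p y * \<zeta> y)"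
  shows "\<exists>c. AE y in lborel. y \<in> {0<..<\<tau>} \<longrightarrow> w y = c + cum p y"
proof -
  let ?F = "\<lambda>y. w y - cum p y * indicator {0<..<\<tau>} y"
  have "\<exists>c. AE y in lborel. y \<in> {0<..<\<tau>} \<longrightarrow> ?F y = c"
  proof (rule AE_const_of_derivative_tests[OF _ \<tau>])
    show "integrable lborel ?F" by (intro Bochner_Integration.integrable_diff w integrable_cum_indicator p)
    fix \<zeta> a b assume \<zeta>: "smooth \<zeta>" "0 < a" "b < \<tau>" "\<And>y. \<zeta> y \<noteq> 0 \<Longrightarrow> a \<le> y \<and> y \<le> b"
    \<comment> \<open>the support may contain \<open>b\<close>; the test vanishes from the midpoint of \<open>b\<close> and \<open>\<tau>\<close> on\<close>
    define b' where "b' = (b + \<tau>) / 2"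
    have b': "b' < \<tau>" "\<And>y. b' \<le> y \<Longrightarrow> \<zeta> y = 0"
    proof -
      show "b' < \<tau>" using \<zeta> by (simp add: b'_def)
      show "\<zeta> y = 0" if "b' \<le> y" for y
        using \<zeta>(4)[of y] that \<zeta>(3) by (cases "\<zeta> y = 0") (auto simp: b'_def)
    qed
    have c: "continuous_on UNIV (dirderiv 1 \<zeta>)" by (intro smooth_continuous smooth_dirderiv \<zeta>)
    obtain C where C: "\<And>y. y \<in> {0..\<tau>} \<Longrightarrow> \<bar>dirderiv 1 \<zeta> y\<bar> \<le> C"
      using continuous_bound_Icc[OF c] by blast
    have "integrable lborel (\<lambda>y. w y * dirderiv 1 \<zeta> y)"
    proof (rule integrable_mult_bounded[OF w(1)])
      show "\<bar>dirderiv 1 \<zeta> y\<bar> \<le> C" if "w y \<noteq> 0" for y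
      proof -
        have "y \<in> {0<..<\<tau>}" using w(2) that by blast
        then show ?thesis using C[of y] by auto
      qed
    qed (simp add: smooth_borel_measurable smooth_dirderiv \<zeta>)
    then show "(LINT y|lborel. ?F y * dirderiv 1 \<zeta> y) = 0"
      using cum_by_parts[OF p \<zeta>(1) b'] t[OF \<zeta>] by (simp add: left_diff_distrib)
  qed
  then obtain c where "AE y in lborel. y \<in> {0<..<\<tau>} \<longrightarrow> ?F y = c" by blast
  then have "AE y in lborel. y \<in> {0<..<\<tau>} \<longrightarrow> w y = c + cum p y"
    by (rule AE_mp) (auto intro!: AE_I2)
  then show ?thesis by blast
qed

lemma cum_diff:
  assumes g: "integrable lborel g" and "s \<le> t"
  shows "cum g t - cum g s = (LINT y|lborel. indicator {s<..} y * (indicator {..<t} y * g y))"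
proof -
  have "AE y in lborel. y \<noteq> s" by (rule AE_lborel_singleton)
  then have "AE y in lborel. indicator {..<t} y * g y - indicator {..<s} y * g y =
      indicator {s<..} y * (indicator {..<t} y * g y)"
    by (rule AE_mp) (use assms(2) in \<open>auto intro!: AE_I2 simp: indicator_def\<close>)
  then have "(LINT y|lborel. indicator {..<t} y * g y - indicator {..<s} y * g y) =
    (LINT y|lborel. indicator {s<..} y * (indicator {..<t} y * g y))"
    using borel_measurable_integrable[OF g]
    by (intro integral_cong_AE) auto
  then show ?thesis unfolding cum_def
    using integrable_indicator_mult[OF g] by simp
qed

lemma positive_part_square_derivative:
  "((\<lambda>s::real. (max 0 s)\<^sup>2) has_real_derivative 2 * max 0 s) (at s)"
proof -
  consider "s > 0" | "s < 0" | "s = 0" by linarith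
  then show ?thesis
  proof cases
    case 1
    have "((\<lambda>s. s\<^sup>2) has_real_derivative 2 * max 0 s) (at s)"
      using 1 by (auto intro!: derivative_eq_intros)
    then show ?thesis
      by (rule has_field_derivative_transform_within_open[of _ _ _ "{0<..}"]) (use 1 in auto)
  next
    case 2
    have "((\<lambda>s. 0) has_real_derivative 2 * max 0 s) (at s)"
      using 2 by auto
    then show ?thesis
      by (rule has_field_derivative_transform_within_open[of _ _ _ "{..<0}"]) (use 2 in auto)
  next
    case 3
    have "((\<lambda>h. max 0 h * (max 0 h / h)) \<longlongrightarrow> 0) (at (0::real))"
    proof (rule tendsto_0_le[OF tendsto_ident_at, where K = 1])
      show "\<forall>\<^sub>F h in at (0::real). norm (max 0 h * (max 0 h / h)) \<le> norm h * 1"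
        by (auto simp: eventually_at_filter max_def abs_mult)
    qed
    then show ?thesis using 3 by (simp add: DERIV_def power2_eq_square)
  qed
qed

text \<open>
  The identity \<open>\<integral> f (Z u)' = \<integral> h Z u\<close> for \<open>f' = - h\<close> with \<open>f 0 = 0\<close> and \<open>Z y = (max 0 (R - y))\<^sup>2\<close>.
  Here \<open>u\<close> is only known to be an antiderivative of \<open>p\<close> almost everywhere, so the product rule for
  \<open>Z u\<close> and the integration by parts are both replaced by exchanging the order of integration.
\<close>

lemma flux_tested_with_cutoff:
  fixes \<tau> R :: real
  assumes R: "0 < R" "R \<le> \<tau>"
    and p: "integrable lborel p" "\<And>y. y \<notin> {0<..<\<tau>} \<Longrightarrow> p y = 0"
    and h: "integrable lborel h" "\<And>y. y \<notin> {0<..<\<tau>} \<Longrightarrow> h y = 0"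
    and u: "integrable lborel u" "\<And>y. y \<notin> {0<..<\<tau>} \<Longrightarrow> u y = 0"
    and f: "\<And>y. y \<notin> {0<..<\<tau>} \<Longrightarrow> f y = 0" "f \<in> borel_measurable borel"
    and uc: "AE y in lborel. y \<in> {0<..<\<tau>} \<longrightarrow> u y = c + cum p y"
    and fc: "AE y in lborel. y \<in> {0<..<\<tau>} \<longrightarrow> f y = - cum h y"
  shows "(LINT y|lborel. f y * ((max 0 (R - y))\<^sup>2 * p y - 2 * max 0 (R - y) * u y)) =
         (LINT y|lborel. h y * ((max 0 (R - y))\<^sup>2 * u y))"
proof -
  define Z where "Z y = (max 0 (R - y))\<^sup>2" for y
  define z where "z y = 2 * max 0 (R - y)" for y
  define U where "U y = c + cum p y" for y
  define q where "q y = Z y * p y - z y * u y" for y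
  note [measurable] = borel_measurable_integrable[OF p(1), simplified] borel_measurable_integrable[OF h(1), simplified]
    borel_measurable_integrable[OF u(1), simplified] f(2)
  have [measurable]: "Z \<in> borel_measurable borel" "z \<in> borel_measurable borel" "U \<in> borel_measurable borel"
    unfolding Z_def[abs_def] z_def[abs_def] U_def[abs_def] by measurable
  have Zb: "\<bar>Z y\<bar> \<le> R\<^sup>2" "\<bar>z y\<bar> \<le> 2 * R" if "y > 0" for y
    using that R by (auto simp: Z_def z_def max_def intro!: power_mono)
  have iZp: "integrable lborel (\<lambda>y. p y * Z y)"
    by (rule integrable_mult_bounded[OF p(1), where C = "R\<^sup>2"]) (use Zb p(2) in \<open>auto simp del: abs_power2\<close>)
  have izu: "integrable lborel (\<lambda>y. u y * z y)"
    by (rule integrable_mult_bounded[OF u(1), where C = "2 * R"]) (use Zb u(2) in \<open>auto\<close>)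
  have iq: "integrable lborel q"
    unfolding q_def using iZp izu by (simp add: mult.commute)
  have Ub: "\<bar>U y\<bar> \<le> \<bar>c\<bar> + (LINT s|lborel. \<bar>p s\<bar>)" for y
    using cum_bound[OF p(1), of y] by (auto simp: U_def)
  define zz where "zz y = indicator {0<..<\<tau>} y * z y" for y
  have izz: "integrable lborel zz"
    unfolding zz_def by (rule integrable_cont_on_interval) (auto simp: z_def intro!: continuous_intros)
  have izzU: "integrable lborel (\<lambda>y. zz y * U y)"
    by (rule integrable_mult_bounded[OF izz]) (use Ub in auto)
  have ZI: "(LINT t|lborel. indicator {y<..} t * zz t) = Z y" if y: "y \<in> {0<..<\<tau>}" for y
  proof -
    have d: "((\<lambda>t. - Z t) has_real_derivative z t) (at t)" for t
    proof -
      have "((\<lambda>t. R - t) has_real_derivative - 1) (at t)" by (auto intro!: derivative_eq_intros)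
      from DERIV_minus[OF DERIV_chain2[OF positive_part_square_derivative this]]
      show ?thesis by (simp add: Z_def[abs_def] z_def)
    qed
    have "(\<lambda>t. indicator {y<..} t * zz t) = (\<lambda>t. indicator {y<..<\<tau>} t * z t)"
      using y by (auto simp: indicator_def zz_def)
    then have "(LINT t|lborel. indicator {y<..} t * zz t) = (- Z \<tau>) - (- Z y)"
      using integral_FTC_open[OF _ d, of y \<tau>] y by (simp add: z_def[abs_def] continuous_intros)
    then show ?thesis using R by (simp add: Z_def)
  qed
  \<comment> \<open>the product rule in integrated form: \<open>q\<close> is the derivative of \<open>Z u\<close>, and \<open>Z\<close> vanishes at \<open>\<tau>\<close>\<close>
  have tail: "(LINT y|lborel. indicator {s<..} y * q y) = - (Z s * U s)" if s: "s \<in> {0<..<\<tau>}" for s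
  proof -
    let ?g = "\<lambda>y. indicator {s<..} y * p y"
    have ig: "integrable lborel ?g" by (rule integrable_indicator_mult[OF p(1)]) auto
    have "(LINT y|lborel. ?g y * Z y) = (LINT y|lborel. ?g y * (LINT t|lborel. indicator {y<..} t * zz t))"
    proof (intro Bochner_Integration.integral_cong refl)
      show "?g y * Z y = ?g y * (LINT t|lborel. indicator {y<..} t * zz t)" for y
        by (cases "y \<in> {0<..<\<tau>}") (simp add: ZI, simp add: p(2))
    qed
    also have "\<dots> = (LINT t|lborel. zz t * cum ?g t)"
      by (rule triangle_Fubini[OF izz ig, symmetric])
    also have "\<dots> = (LINT t|lborel. indicator {s<..} t * (zz t * U t) - U s * (indicator {s<..} t * zz t))"
    proof (intro Bochner_Integration.integral_cong refl)
      fix t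
      have "cum ?g t = (LINT y|lborel. indicator {s<..} y * (indicator {..<t} y * p y))"
        unfolding cum_def by (intro Bochner_Integration.integral_cong) auto
      also have "\<dots> = indicator {s<..} t * (U t - U s)"
      proof (cases "s < t")
        case True
        then show ?thesis using cum_diff[OF p(1), of s t] by (simp add: U_def)
      next
        case False
        then have "(\<lambda>y. indicator {s<..} y * (indicator {..<t} y * p y)) = (\<lambda>y. 0)"
          by (auto simp: indicator_def)
        then show ?thesis using False by simp
      qed
      finally have cg: "cum ?g t = indicator {s<..} t * (U t - U s)" .
      show "zz t * cum ?g t = indicator {s<..} t * (zz t * U t) - U s * (indicator {s<..} t * zz t)"
        unfolding cg by (simp add: algebra_simps)
    qed
    also have "\<dots> = (LINT t|lborel. indicator {s<..} t * (zz t * U t)) - U s * Z s"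
      using integrable_indicator_mult[OF izzU, of "{s<..}"] integrable_indicator_mult[OF izz, of "{s<..}"]
      by (simp add: ZI[OF s])
    also have "(LINT t|lborel. indicator {s<..} t * (zz t * U t)) = (LINT t|lborel. indicator {s<..} t * (u t * z t))"
    proof (rule integral_cong_AE)
      show "AE t in lborel. indicator {s<..} t * (zz t * U t) = indicator {s<..} t * (u t * z t)"
        using uc
      proof eventually_elim
        case (elim t)
        then show ?case using u(2)[of t] by (cases "t \<in> {0<..<\<tau>}") (auto simp: zz_def U_def)
      qed
    qed (auto simp: zz_def)
    finally have 1: "(LINT y|lborel. ?g y * Z y) = (LINT t|lborel. indicator {s<..} t * (u t * z t)) - U s * Z s" .
    have "indicator {s<..} y * q y = ?g y * Z y - indicator {s<..} y * (u y * z y)" for y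
      by (simp add: q_def algebra_simps)
    moreover have "integrable lborel (\<lambda>y. ?g y * Z y)"
      using integrable_indicator_mult[OF iZp, of "{s<..}"] by (simp add: ac_simps)
    ultimately show ?thesis
      using 1 integrable_indicator_mult[OF izu, of "{s<..}"] by (simp add: mult.commute)
  qed
  have q0: "q y = 0" if "y \<notin> {0<..<\<tau>}" for y using p(2) u(2) that by (auto simp: q_def)
  have "(LINT y|lborel. f y * q y) = (LINT y|lborel. - (q y * cum h y))"
  proof (rule integral_cong_AE)
    show "AE y in lborel. f y * q y = - (q y * cum h y)"
      using fc by eventually_elim (use q0 in force)
  qed (auto simp: q_def)
  also have "\<dots> = - (LINT y|lborel. q y * cum h y)" by simp
  also have "\<dots> = - (LINT s|lborel. h s * (LINT y|lborel. indicator {s<..} y * q y))"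
    by (simp add: triangle_Fubini[OF iq h(1)])
  also have "\<dots> = - (LINT s|lborel. - (h s * (Z s * u s)))"
  proof (rule arg_cong[where f = uminus], rule integral_cong_AE)
    show "AE s in lborel. h s * (LINT y|lborel. indicator {s<..} y * q y) = - (h s * (Z s * u s))"
      using uc
    proof eventually_elim
      case (elim s)
      then show ?case using h(2)[of s] tail[of s] by (cases "s \<in> {0<..<\<tau>}") (auto simp: U_def)
    qed
    have "(\<lambda>s. LINT y|lborel. (if s < y then 1 else 0) * q y) \<in> borel_measurable borel"
      unfolding q_def by (rule lborel.borel_measurable_lebesgue_integral) measurable
    moreover have "(LINT y|lborel. (if s < y then 1 else 0) * q y) = (LINT y|lborel. indicator {s<..} y * q y)" for s
      by (intro Bochner_Integration.integral_cong) auto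
    ultimately show "(\<lambda>s. h s * (LINT y|lborel. indicator {s<..} y * q y)) \<in> borel_measurable lborel"
      by simp
  qed simp
  finally show ?thesis by (simp add: q_def Z_def z_def)
qed

lemma integral_pos_on_interval:
  fixes f :: "real \<Rightarrow> real"
  assumes i: "integrable lborel (\<lambda>y. indicator {0<..<\<rho>} y * f y)" and f: "\<And>y. 0 < f y" and r: "0 < \<rho>"
  shows "0 < (LINT y|lborel. indicator {0<..<\<rho>} y * f y)"
proof -
  have nn: "0 \<le> indicator {0<..<\<rho>} s * f s" for s using less_imp_le[OF f[of s]] by simp
  have "(LINT y|lborel. indicator {0<..<\<rho>} y * f y) \<noteq> 0"
  proof
    assume "(LINT y|lborel. indicator {0<..<\<rho>} y * f y) = 0"
    then have "AE s in lborel. indicator {0<..<\<rho>} s * f s = 0"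
      using integral_nonneg_eq_0_iff_AE[OF i] nn by simp
    then have "AE s in lborel. s \<notin> {0<..<\<rho>}"
    proof eventually_elim
      case (elim s)
      then show ?case using f[of s] by (auto simp: indicator_def)
    qed
    then have "emeasure lborel {0<..<\<rho>} = 0"
      by (subst (asm) AE_iff_measurable[where N = "{0<..<\<rho>}"]) auto
    then show False using r by (simp add: ennreal_eq_0_iff)
  qed
  moreover have "0 \<le> (LINT y|lborel. indicator {0<..<\<rho>} y * f y)" using nn by (intro Bochner_Integration.integral_nonneg)
  ultimately show ?thesis by linarith
qed

section \<open>Horizontal mollification of a solution\<close>

text \<open>
  This measure equals \<open>lborel\<close> on the product type; as a product measure it is in the form needed
  for Fubini's theorem.
\<close>

abbreviation M2 :: "('a::euclidean_space \<times> real) measure" where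
  "M2 \<equiv> lborel \<Otimes>\<^sub>M lborel"

text \<open>
  Mollification in the horizontal variables only.
\<close>

definition conv :: "('a::euclidean_space \<times> real \<Rightarrow> real) \<Rightarrow> ('a \<Rightarrow> real) \<Rightarrow> 'a \<times> real \<Rightarrow> real" where
  "conv F \<kappa> X = (LINT z|lborel. F (z, snd X) * \<kappa> (fst X - z))"

text \<open>
  Kernels may change sign and have any total mass, so that derivatives of kernels are kernels.
\<close>

definition kernel :: "real \<Rightarrow> ('a::euclidean_space \<Rightarrow> real) \<Rightarrow> bool" where
  "kernel \<epsilon> \<kappa> \<longleftrightarrow> smooth \<kappa> \<and> (\<forall>w. \<kappa> w \<noteq> 0 \<longrightarrow> norm w \<le> \<epsilon>)"

lemma kernel_smooth: "kernel \<epsilon> \<kappa> \<Longrightarrow> smooth \<kappa>" by (simp add: kernel_def)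
lemma kernel_measurable: "kernel \<epsilon> \<kappa> \<Longrightarrow> \<kappa> \<in> borel_measurable borel"
  by (simp add: kernel_def smooth_borel_measurable)

lemma kernel_dirderiv: 
  assumes "kernel \<epsilon> \<kappa>" shows "kernel \<epsilon> (dirderiv h \<kappa>)"
proof -
  have "norm w \<le> \<epsilon>" if "dirderiv h \<kappa> w \<noteq> 0" for w
    using dirderiv_zero_off_closed[of "cball 0 \<epsilon>" \<kappa> h w] that assms by (auto simp: kernel_def)
  then show ?thesis using assms by (auto simp: kernel_def smooth_dirderiv)
qed

lemma kernel_bounded:
  assumes "kernel \<epsilon> \<kappa>" obtains C where "0 \<le> C" "\<And>w. \<bar>\<kappa> w\<bar> \<le> C"
proof -
  have "bounded (\<kappa> ` cball 0 \<epsilon>)"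
    using assms by (intro compact_imp_bounded compact_continuous_image)
      (auto simp: kernel_def intro: smooth_continuous)
  then obtain C where C: "\<forall>x\<in>\<kappa> ` cball 0 \<epsilon>. norm x \<le> C" unfolding bounded_iff by blast
  have "\<bar>\<kappa> w\<bar> \<le> max C 0" for w
  proof (cases "\<kappa> w = 0")
    case False
    then have "w \<in> cball 0 \<epsilon>" using assms by (auto simp: kernel_def)
    then have "norm (\<kappa> w) \<le> C" using C by blast
    then show ?thesis by simp
  qed simp
  then show thesis using that[of "max C 0"] by simp
qed

lemma dirderiv_reflect:
  assumes "smooth \<kappa>"
  shows "smooth (\<lambda>z. \<kappa> (x - z))" "dirderiv h (\<lambda>z. \<kappa> (x - z)) z = - dirderiv h \<kappa> (x - z)"
proof -
  have bl: "bounded_linear (\<lambda>z::'a. - z)" by (rule bounded_linear_minus[OF bounded_linear_ident])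
  have eq: "(\<lambda>z. \<kappa> (x - z)) = (\<lambda>z. \<kappa> (- z + x))" by simp
  show "smooth (\<lambda>z. \<kappa> (x - z))" unfolding eq by (rule smooth_affine[OF bl assms])
  have "dirderiv h (\<lambda>z. \<kappa> (x - z)) z = dirderiv (- h) \<kappa> (x - z)"
    unfolding eq by (subst dirderiv_affine[OF bl assms]) simp
  also have "\<dots> = - dirderiv h \<kappa> (x - z)"
    using dirderiv_basis_sum[OF assms, of "- h"] dirderiv_basis_sum[OF assms, of h]
    by (simp add: sum_negf)
  finally show "dirderiv h (\<lambda>z. \<kappa> (x - z)) z = - dirderiv h \<kappa> (x - z)" .
qed

lemma kernel_reflect_support:
  assumes "kernel \<epsilon> \<kappa>" "\<kappa> (x - z) \<noteq> 0" shows "norm z \<le> norm x + \<epsilon>"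
proof -
  have "norm (x - z) \<le> \<epsilon>" using assms by (auto simp: kernel_def)
  then show ?thesis using norm_triangle_sub[of z x] by (simp add: norm_minus_commute)
qed

lemma conv_measurable:
  fixes F :: "'a::euclidean_space \<times> real \<Rightarrow> real"
  assumes [measurable]: "F \<in> borel_measurable M2" "\<kappa> \<in> borel_measurable borel"
  shows "conv F \<kappa> \<in> borel_measurable M2"
  unfolding conv_def[abs_def] by measurable

lemma conv_slice_measurable:
  fixes F :: "'a::euclidean_space \<times> real \<Rightarrow> real"
  assumes [measurable]: "F \<in> borel_measurable M2" "\<kappa> \<in> borel_measurable borel"
  shows "(\<lambda>y. conv F \<kappa> (x, y)) \<in> borel_measurable borel"
    "(\<lambda>x. conv F \<kappa> (x, y)) \<in> borel_measurable borel"
proof -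
  note [measurable] = conv_measurable[OF assms]
  have "(\<lambda>y. conv F \<kappa> (x, y)) \<in> borel_measurable lborel" by measurable
  then show "(\<lambda>y. conv F \<kappa> (x, y)) \<in> borel_measurable borel" by simp
  have "(\<lambda>x. conv F \<kappa> (x, y)) \<in> borel_measurable lborel" by measurable
  then show "(\<lambda>x. conv F \<kappa> (x, y)) \<in> borel_measurable borel" by simp
qed

lemma slice_measurable:
  fixes F :: "'a::euclidean_space \<times> real \<Rightarrow> real"
  assumes [measurable]: "F \<in> borel_measurable M2"
  shows "(\<lambda>z. F (z, y)) \<in> borel_measurable borel"
proof -
  have "(\<lambda>z. F (z, y)) \<in> borel_measurable lborel" by measurable
  then show ?thesis by simp
qed

lemma conv_integrable:
  fixes F :: "'a::euclidean_space \<times> real \<Rightarrow> real"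
  assumes "integrable lborel (\<lambda>z. F (z, y))" "\<kappa> \<in> borel_measurable borel" "\<And>w. \<bar>\<kappa> w\<bar> \<le> C"
  shows "integrable lborel (\<lambda>z. F (z, y) * \<kappa> (x - z))"
  by (rule integrable_mult_bounded[OF assms(1), where C = C]) (use assms(2,3) in auto)

lemma conv_bound:
  fixes F :: "'a::euclidean_space \<times> real \<Rightarrow> real"
  assumes F: "integrable lborel (\<lambda>z. F (z, y))" and k: "\<kappa> \<in> borel_measurable borel" "\<And>w. \<bar>\<kappa> w\<bar> \<le> C"
  shows "\<bar>conv F \<kappa> (x, y)\<bar> \<le> C * (LINT z|lborel. \<bar>F (z, y)\<bar>)"
proof -
  have "\<bar>conv F \<kappa> (x, y)\<bar> \<le> (LINT z|lborel. \<bar>F (z, y) * \<kappa> (x - z)\<bar>)"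
    unfolding conv_def by (simp add: integral_abs_bound)
  also have "\<dots> \<le> (LINT z|lborel. C * \<bar>F (z, y)\<bar>)"
  proof (intro integral_mono integrable_abs conv_integrable[OF F k] integrable_mult_right F)
    show "\<bar>F (z, y) * \<kappa> (x - z)\<bar> \<le> C * \<bar>F (z, y)\<bar>" for z
      using mult_right_mono[OF k(2)[of "x - z"], of "\<bar>F (z, y)\<bar>"] by (simp add: abs_mult mult.commute)
  qed
  finally show ?thesis by simp
qed

text \<open>
  Derivatives of a mollification fall on the kernel, by dominated convergence. The derivative exists
  for every \<open>x\<close> at every height \<open>y\<close> whose slice is integrable.
\<close>

lemma conv_has_derivative:
  fixes F :: "'a::euclidean_space \<times> real \<Rightarrow> real"
  assumes F: "integrable lborel (\<lambda>z. F (z, y))" and k: "kernel \<epsilon> \<kappa>"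
  shows "((\<lambda>t. conv F \<kappa> (x + t *\<^sub>R h, y)) has_real_derivative conv F (dirderiv h \<kappa>) (x + t *\<^sub>R h, y)) (at t)"
proof -
  have main: "((\<lambda>t. conv F \<kappa> (x + t *\<^sub>R h, y)) has_real_derivative conv F (dirderiv h \<kappa>) (x, y)) (at 0)" for x
    unfolding DERIV_def tendsto_at_iff_sequentially
  proof (intro allI impI)
    fix s :: "nat \<Rightarrow> real" assume s: "\<forall>i. s i \<in> UNIV - {0}" "s \<longlonglongrightarrow> 0"
    note kd = kernel_dirderiv[OF k, of h]
    obtain C where C: "0 \<le> C" "\<And>w. \<bar>dirderiv h \<kappa> w\<bar> \<le> C" using kernel_bounded[OF kd] by blast
    obtain C' where C': "0 \<le> C'" "\<And>w. \<bar>\<kappa> w\<bar> \<le> C'" using kernel_bounded[OF k] by blast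
    note [measurable] = kernel_measurable[OF k] kernel_measurable[OF kd] borel_measurable_integrable[OF F, simplified]
    let ?q = "\<lambda>i z. F (z, y) * ((\<kappa> (x - z + s i *\<^sub>R h) - \<kappa> (x - z)) / s i)"
    have "(\<lambda>i. LINT z|lborel. ?q i z) \<longlonglongrightarrow> (LINT z|lborel. F (z, y) * dirderiv h \<kappa> (x - z))"
    proof (rule integral_dominated_convergence[where w = "\<lambda>z. C * \<bar>F (z, y)\<bar>"])
      show "integrable lborel (\<lambda>z. C * \<bar>F (z, y)\<bar>)" using F by simp
      show "AE z in lborel. (\<lambda>i. ?q i z) \<longlonglongrightarrow> F (z, y) * dirderiv h \<kappa> (x - z)"
      proof (intro AE_I2 tendsto_mult tendsto_const)
        fix z
        have "((\<lambda>t. (\<kappa> (x - z + t *\<^sub>R h) - \<kappa> (x - z)) / t) \<longlongrightarrow> dirderiv h \<kappa> (x - z)) (at 0)"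
          using dirderiv_line[OF kernel_smooth[OF k], of "x - z" h 0] by (simp add: DERIV_def)
        then show "(\<lambda>i. (\<kappa> (x - z + s i *\<^sub>R h) - \<kappa> (x - z)) / s i) \<longlonglongrightarrow> dirderiv h \<kappa> (x - z)"
          unfolding tendsto_at_iff_sequentially using s by (auto simp: o_def)
      qed
      show "AE z in lborel. norm (?q i z) \<le> C * \<bar>F (z, y)\<bar>" for i
      proof (intro AE_I2)
        fix z
        have "\<bar>\<kappa> (x - z + s i *\<^sub>R h) - \<kappa> (x - z)\<bar> \<le> C * \<bar>s i - 0\<bar>"
          using field_differentiable_bound[of UNIV "\<lambda>t. \<kappa> (x - z + t *\<^sub>R h)" "\<lambda>t. dirderiv h \<kappa> (x - z + t *\<^sub>R h)" C 0 "s i"]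
            dirderiv_line[OF kernel_smooth[OF k], of "x - z" h] C(2) by simp
        then have "\<bar>(\<kappa> (x - z + s i *\<^sub>R h) - \<kappa> (x - z)) / s i\<bar> \<le> C"
          using s(1) by (simp add: abs_divide field_simps)
        then show "norm (?q i z) \<le> C * \<bar>F (z, y)\<bar>"
          using mult_right_mono[of "\<bar>(\<kappa> (x - z + s i *\<^sub>R h) - \<kappa> (x - z)) / s i\<bar>" C "\<bar>F (z, y)\<bar>"]
          by (simp add: abs_mult mult.commute)
      qed
    qed measurable
    moreover have eq: "(LINT z|lborel. ?q i z) = (conv F \<kappa> (x + s i *\<^sub>R h, y) - conv F \<kappa> (x, y)) / s i" for i
    proof -
      have i: "integrable lborel (\<lambda>z. F (z, y) * \<kappa> (x + s i *\<^sub>R h - z))" "integrable lborel (\<lambda>z. F (z, y) * \<kappa> (x - z))"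
        by (rule conv_integrable[OF F _ C'(2)]; simp)+
      have "conv F \<kappa> (x + s i *\<^sub>R h, y) - conv F \<kappa> (x, y) =
         (LINT z|lborel. F (z, y) * \<kappa> (x + s i *\<^sub>R h - z) - F (z, y) * \<kappa> (x - z))"
        unfolding conv_def using i by simp
      then have "(conv F \<kappa> (x + s i *\<^sub>R h, y) - conv F \<kappa> (x, y)) / s i =
         (LINT z|lborel. (F (z, y) * \<kappa> (x + s i *\<^sub>R h - z) - F (z, y) * \<kappa> (x - z)) / s i)"
        by simp
      also have "\<dots> = (LINT z|lborel. ?q i z)"
        by (intro Bochner_Integration.integral_cong) (auto simp: algebra_simps diff_divide_distrib)
      finally show ?thesis by (rule sym)
    qed
    ultimately have "(\<lambda>i. (conv F \<kappa> (x + s i *\<^sub>R h, y) - conv F \<kappa> (x, y)) / s i)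
        \<longlonglongrightarrow> (LINT z|lborel. F (z, y) * dirderiv h \<kappa> (x - z))"
      unfolding eq by blast
    then show "((\<lambda>t. (conv F \<kappa> (x + (0 + t) *\<^sub>R h, y) - conv F \<kappa> (x + 0 *\<^sub>R h, y)) / t) \<circ> s)
        \<longlonglongrightarrow> conv F (dirderiv h \<kappa>) (x, y)"
      by (simp add: o_def conv_def[of F "dirderiv h \<kappa>"])
  qed
  show ?thesis
    using main[of "x + t *\<^sub>R h"] DERIV_shift[of "\<lambda>t. conv F \<kappa> (x + t *\<^sub>R h, y)" _ 0 t]
    by (simp add: algebra_simps)
qed

text \<open>
  A weak solution in terms of Borel functions: \<open>V\<close> stands for the solution, \<open>P\<close> and \<open>p0\<close> for
  its horizontal and vertical derivatives, \<open>m\<close> for the weight, and \<open>aa\<close>, \<open>bb\<close> for the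
  coefficients. The bounds on the weight and on the coefficients hold everywhere and all horizontal
  slices are integrable, so that mollifications are defined at every point. The function \<open>N\<close>
  majorises the \<open>L\<^sup>1\<close> norms of the slices and is square integrable with respect to the weight; it
  serves as the dominating function for all mollifications.

  The last three assumptions are the definition of the weak derivatives and the equation, tested with
  products. In the equation, the vertical factor \<open>\<zeta>\<close> need not vanish near \<open>0\<close>. This is the
  conormal condition.
\<close>

locale cylinder_solution =
  fixes \<tau> \<Lambda> K C\<^sub>0 :: real and m bb :: "real \<Rightarrow> real"
    and aa :: "'a::euclidean_space \<Rightarrow> 'a \<Rightarrow> real \<Rightarrow> real"
    and V :: "'a \<times> real \<Rightarrow> real" and P :: "'a \<times> real \<Rightarrow> 'a" and p0 :: "'a \<times> real \<Rightarrow> real"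
    and N :: "real \<Rightarrow> real"
  assumes \<tau>: "0 < \<tau>" and \<Lambda>: "1 \<le> \<Lambda>"
    and m_meas [measurable]: "m \<in> borel_measurable borel" and m_pos: "\<And>y. 0 < m y"
    and bb_meas [measurable]: "bb \<in> borel_measurable borel"
    and bb_bounds: "\<And>y. inverse \<Lambda> \<le> bb y" "\<And>y. bb y \<le> \<Lambda>"
    and aa_meas [measurable]: "\<And>e e'. aa e e' \<in> borel_measurable borel"
    and aa_bound: "\<And>e e' y. \<bar>aa e e' y\<bar> \<le> \<Lambda>"
    and aa_elliptic: "\<And>\<xi> y. inverse \<Lambda> * (norm \<xi>)\<^sup>2 \<le> (\<Sum>e\<in>Basis. \<Sum>e'\<in>Basis. aa e e' y * (\<xi> \<bullet> e) * (\<xi> \<bullet> e'))"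
    and V_meas [measurable]: "V \<in> borel_measurable M2"
    and P_meas [measurable]: "\<And>e. (\<lambda>X. P X \<bullet> e) \<in> borel_measurable M2"
    and p0_meas [measurable]: "p0 \<in> borel_measurable M2"
    and slice_integrable: "\<And>y. integrable lborel (\<lambda>z. V (z, y))"
      "\<And>y e. e \<in> Basis \<Longrightarrow> integrable lborel (\<lambda>z. P (z, y) \<bullet> e)" "\<And>y. integrable lborel (\<lambda>z. p0 (z, y))"
    and N_bounds: "\<And>y. (LINT z|lborel. \<bar>V (z, y)\<bar>) \<le> N y"
      "\<And>y e. e \<in> Basis \<Longrightarrow> (LINT z|lborel. \<bar>P (z, y) \<bullet> e\<bar>) \<le> N y" "\<And>y. (LINT z|lborel. \<bar>p0 (z, y)\<bar>) \<le> N y"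
    and N_meas [measurable]: "N \<in> borel_measurable borel"
    and N_zero: "\<And>y. y \<notin> {0<..<\<tau>} \<Longrightarrow> N y = 0"
    and N_square: "integrable lborel (\<lambda>y. (N y)\<^sup>2 * m y)"
    and m_int: "integrable lborel (\<lambda>y. indicator {0<..<\<tau>} y * m y)"
    and m_inv_int: "integrable lborel (\<lambda>y. indicator {0<..<\<tau>} y * inverse (m y))"
    and A2: "(LINT y|lborel. indicator {0<..<\<tau>} y * m y) * (LINT y|lborel. indicator {0<..<\<tau>} y * inverse (m y)) \<le> K * \<tau>\<^sup>2"
    and P_square: "integrable M2 (\<lambda>X. (norm (P X))\<^sup>2 * m (snd X))"
    and C0_pos: "0 \<le> C\<^sub>0"
    and flux_weight: "AE y in lborel. y \<in> {0<..<\<tau>} \<longrightarrow> cum (\<lambda>s. indicator {0<..<\<tau>} s * m s) y \<le> C\<^sub>0 * \<tau> * m y"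
    and weak_x: "\<And>\<eta> \<zeta> r a b e. \<lbrakk>smooth \<eta>; r < \<tau>; \<And>z. \<eta> z \<noteq> 0 \<Longrightarrow> norm z \<le> r; smooth \<zeta>; 0 < a; b < \<tau>;
        \<And>y. \<zeta> y \<noteq> 0 \<Longrightarrow> a \<le> y \<and> y \<le> b; e \<in> Basis\<rbrakk> \<Longrightarrow>
      (LINT X|M2. V X * \<zeta> (snd X) * dirderiv e \<eta> (fst X)) = - (LINT X|M2. (P X \<bullet> e) * \<zeta> (snd X) * \<eta> (fst X))"
    and weak_y: "\<And>\<eta> \<zeta> r a b. \<lbrakk>smooth \<eta>; r < \<tau>; \<And>z. \<eta> z \<noteq> 0 \<Longrightarrow> norm z \<le> r; smooth \<zeta>; 0 < a; b < \<tau>;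
        \<And>y. \<zeta> y \<noteq> 0 \<Longrightarrow> a \<le> y \<and> y \<le> b\<rbrakk> \<Longrightarrow>
      (LINT X|M2. V X * dirderiv 1 \<zeta> (snd X) * \<eta> (fst X)) = - (LINT X|M2. p0 X * \<zeta> (snd X) * \<eta> (fst X))"
    and weak_eq: "\<And>\<eta> \<zeta> r b. \<lbrakk>smooth \<eta>; r < \<tau>; \<And>z. \<eta> z \<noteq> 0 \<Longrightarrow> norm z \<le> r; smooth \<zeta>; b < \<tau>;
        \<And>y. b \<le> y \<Longrightarrow> \<zeta> y = 0\<rbrakk> \<Longrightarrow>
      (LINT X|M2. (\<Sum>e\<in>Basis. \<Sum>e'\<in>Basis. (P X \<bullet> e) * (m (snd X) * aa e e' (snd X) * \<zeta> (snd X)) * dirderiv e' \<eta> (fst X))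
         + p0 X * (m (snd X) * bb (snd X) * dirderiv 1 \<zeta> (snd X)) * \<eta> (fst X)) = 0"
begin

text \<open>
  The functions whose mollifications are controlled by the common majorant \<open>N\<close>.
\<close>

definition slice_ok :: "('a \<times> real \<Rightarrow> real) \<Rightarrow> bool" where
  "slice_ok F \<longleftrightarrow> F \<in> borel_measurable M2 \<and>
     (\<forall>y. integrable lborel (\<lambda>z. F (z, y)) \<and> (LINT z|lborel. \<bar>F (z, y)\<bar>) \<le> N y)"

lemma slice_okD:
  assumes "slice_ok F"
  shows "F \<in> borel_measurable M2" "integrable lborel (\<lambda>z. F (z, y))" "(LINT z|lborel. \<bar>F (z, y)\<bar>) \<le> N y"
  using assms by (auto simp: slice_ok_def)

lemma slice_ok: "slice_ok V" "e \<in> Basis \<Longrightarrow> slice_ok (\<lambda>X. P X \<bullet> e)" "slice_ok p0"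
  using slice_integrable N_bounds by (auto simp: slice_ok_def)

lemma N_nonneg: "0 \<le> N y"
proof -
  have "0 \<le> (LINT z|lborel. \<bar>V (z, y)\<bar>)" by simp
  then show ?thesis using N_bounds(1)[of y] by linarith
qed

text \<open>
  Since \<open>N\<close> vanishes outside \<open>(0, \<tau>)\<close>, the bound \<open>N \<le> N\<^sup>2 + 1\<close> there reduces the claim to the
  integrability of \<open>N\<^sup>2 m\<close> and of \<open>m\<close>.
\<close>

lemma N_m_integrable: "integrable lborel (\<lambda>y. N y * m y)"
proof (rule Bochner_Integration.integrable_bound)
  show "integrable lborel (\<lambda>y. (N y)\<^sup>2 * m y + indicator {0<..<\<tau>} y * m y)"
    by (intro Bochner_Integration.integrable_add N_square m_int)
  show "AE y in lborel. norm (N y * m y) \<le> norm ((N y)\<^sup>2 * m y + indicator {0<..<\<tau>} y * m y)"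
  proof (intro AE_I2)
    fix y
    have "N y \<le> (N y)\<^sup>2 + indicator {0<..<\<tau>} y"
      using N_zero[of y] sum_power2_ge_zero[of "N y - 1" 0] N_nonneg[of y]
      by (cases "y \<in> {0<..<\<tau>}") (auto simp: power2_eq_square algebra_simps)
    then have "N y * m y \<le> ((N y)\<^sup>2 + indicator {0<..<\<tau>} y) * m y"
      using m_pos[of y] by (intro mult_right_mono) auto
    then show "norm (N y * m y) \<le> norm ((N y)\<^sup>2 * m y + indicator {0<..<\<tau>} y * m y)"
      using N_nonneg[of y] m_pos[of y] by (simp add: abs_mult distrib_right)
  qed
qed simp

lemma N_integrable: "integrable lborel N"
proof (rule Bochner_Integration.integrable_bound)
  show "integrable lborel (\<lambda>y. (N y)\<^sup>2 * m y + indicator {0<..<\<tau>} y * inverse (m y))"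
    by (intro Bochner_Integration.integrable_add N_square m_inv_int)
  show "AE y in lborel. norm (N y) \<le> norm ((N y)\<^sup>2 * m y + indicator {0<..<\<tau>} y * inverse (m y))"
  proof (intro AE_I2)
    fix y
    have mp: "0 < m y" by (rule m_pos)
    have "N y \<le> (N y)\<^sup>2 * m y + indicator {0<..<\<tau>} y * inverse (m y)"
    proof (cases "y \<in> {0<..<\<tau>}")
      case True
      have "0 \<le> (N y * m y - 1)\<^sup>2 + N y * m y"
        using N_nonneg[of y] mp by simp
      then have "N y * m y \<le> (N y * m y)\<^sup>2 + 1" by (simp add: power2_eq_square algebra_simps)
      then have "N y \<le> ((N y * m y)\<^sup>2 + 1) / m y" using mp by (simp add: field_simps)
      also have "\<dots> = (N y)\<^sup>2 * m y + inverse (m y)"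
        using mp by (simp add: power2_eq_square field_simps)
      finally show ?thesis using True by simp
    qed (simp add: N_zero)
    then show "norm (N y) \<le> norm ((N y)\<^sup>2 * m y + indicator {0<..<\<tau>} y * inverse (m y))"
      using N_nonneg[of y] by simp
  qed
qed simp

text \<open>
  Fubini's theorem for a product test function. With the reflected kernel \<open>\<kappa> (x - z)\<close> in place of
  \<open>\<eta>\<close>, the inner integral is the mollification at \<open>x\<close>.
\<close>

lemma slice_product_integral:
  assumes F: "slice_ok F" and [measurable]: "g \<in> borel_measurable borel" "\<eta> \<in> borel_measurable borel"
    and g: "integrable lborel (\<lambda>y. N y * g y)" and C: "\<And>z. \<bar>\<eta> z\<bar> \<le> C"
  shows "integrable M2 (\<lambda>X. F X * g (snd X) * \<eta> (fst X))"
    "(LINT X|M2. F X * g (snd X) * \<eta> (fst X)) = (LINT y|lborel. g y * (LINT z|lborel. F (z, y) * \<eta> z))"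
proof -
  note [measurable] = slice_okD(1)[OF F]
  have C0: "0 \<le> C" using C[of 0] by linarith
  let ?G = "\<lambda>(y, z). F (z, y) * g y * \<eta> z"
  have sl: "integrable lborel (\<lambda>z. F (z, y) * g y * \<eta> z)" for y
    using integrable_mult_right[OF integrable_mult_bounded[OF slice_okD(2)[OF F, of y], of \<eta> C], of "g y"] C
    by (simp add: ac_simps)
  have "integrable (lborel \<Otimes>\<^sub>M lborel) ?G"
  proof (rule lborel_pair.Fubini_integrable)
    show "integrable lborel (\<lambda>y. LINT z|lborel. norm (?G (y, z)))"
    proof (rule Bochner_Integration.integrable_bound)
      show "integrable lborel (\<lambda>y. C * (N y * g y))" using g by simp
      show "AE y in lborel. norm (LINT z|lborel. norm (?G (y, z))) \<le> norm (C * (N y * g y))"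
      proof (intro AE_I2)
        fix y
        have "(LINT z|lborel. norm (?G (y, z))) \<le> (LINT z|lborel. C * \<bar>g y\<bar> * \<bar>F (z, y)\<bar>)"
        proof (intro integral_mono)
          show "integrable lborel (\<lambda>z. norm (?G (y, z)))" using sl[of y] by simp
          show "integrable lborel (\<lambda>z. C * \<bar>g y\<bar> * \<bar>F (z, y)\<bar>)" using slice_okD(2)[OF F, of y] by simp
          fix z
          have "\<bar>F (z, y)\<bar> * \<bar>g y\<bar> * \<bar>\<eta> z\<bar> \<le> \<bar>F (z, y)\<bar> * \<bar>g y\<bar> * C"
            by (intro mult_left_mono C) simp
          then show "norm (?G (y, z)) \<le> C * \<bar>g y\<bar> * \<bar>F (z, y)\<bar>" by (simp add: abs_mult ac_simps)
        qed
        also have "\<dots> \<le> C * \<bar>g y\<bar> * N y"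
          using slice_okD(3)[OF F, of y] C0 by (simp add: mult_left_mono)
        finally show "norm (LINT z|lborel. norm (?G (y, z))) \<le> norm (C * (N y * g y))"
          using N_nonneg[of y] C0 by (simp add: abs_mult ac_simps)
      qed
    qed measurable
  qed (use sl in auto)
  then have int: "integrable M2 (\<lambda>X. F X * g (snd X) * \<eta> (fst X))"
    using lborel_pair.integrable_product_swap[of ?G] by (simp add: case_prod_beta')
  then show "integrable M2 (\<lambda>X. F X * g (snd X) * \<eta> (fst X))" .
  have "(LINT X|M2. F X * g (snd X) * \<eta> (fst X)) = (LINT y|lborel. (LINT z|lborel. F (z, y) * g y * \<eta> z))"
    using lborel_pair.integral_snd[of "\<lambda>z y. F (z, y) * g y * \<eta> z"] int by (simp add: case_prod_beta')
  also have "\<dots> = (LINT y|lborel. g y * (LINT z|lborel. F (z, y) * \<eta> z))"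
    by (intro Bochner_Integration.integral_cong refl)
       (subst integral_mult_right_zero[symmetric], simp add: ac_simps)
  finally show "(LINT X|M2. F X * g (snd X) * \<eta> (fst X)) = (LINT y|lborel. g y * (LINT z|lborel. F (z, y) * \<eta> z))" .
qed

lemma conv_bound_N:
  assumes F: "slice_ok F" and k: "kernel \<epsilon> \<kappa>"
  obtains C where "0 \<le> C" "\<And>x y. \<bar>conv F \<kappa> (x, y)\<bar> \<le> C * N y"
proof -
  obtain C where C: "0 \<le> C" "\<And>w. \<bar>\<kappa> w\<bar> \<le> C" using kernel_bounded[OF k] by blast
  have "\<bar>conv F \<kappa> (x, y)\<bar> \<le> C * N y" for x y
    using conv_bound[OF slice_okD(2)[OF F] kernel_measurable[OF k] C(2), of x y]
      mult_left_mono[OF slice_okD(3)[OF F, of y] C(1)] by linarith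
  with C(1) that show thesis by blast
qed

lemma conv_zero_outside:
  assumes F: "slice_ok F" and k: "kernel \<epsilon> \<kappa>" and y: "y \<notin> {0<..<\<tau>}"
  shows "conv F \<kappa> (x, y) = 0"
proof -
  obtain C where "0 \<le> C" "\<And>x y. \<bar>conv F \<kappa> (x, y)\<bar> \<le> C * N y" using conv_bound_N[OF F k] by blast
  from this(2)[of x y] show ?thesis using N_zero[OF y] by simp
qed

lemma conv_line_integrable:
  assumes F: "slice_ok F" and k: "kernel \<epsilon> \<kappa>"
    and [measurable]: "g \<in> borel_measurable borel" and g: "integrable lborel (\<lambda>y. N y * g y)"
  shows "integrable lborel (\<lambda>y. conv F \<kappa> (x, y) * g y)"
proof -
  note [measurable] = conv_slice_measurable(1)[OF slice_okD(1)[OF F] kernel_measurable[OF k], of x]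
  obtain C where C: "0 \<le> C" "\<And>x y. \<bar>conv F \<kappa> (x, y)\<bar> \<le> C * N y" using conv_bound_N[OF F k] by blast
  show ?thesis
  proof (rule Bochner_Integration.integrable_bound)
    show "integrable lborel (\<lambda>y. C * (N y * g y))" using g by simp
    show "AE y in lborel. norm (conv F \<kappa> (x, y) * g y) \<le> norm (C * (N y * g y))"
    proof (intro AE_I2)
      fix y
      show "norm (conv F \<kappa> (x, y) * g y) \<le> norm (C * (N y * g y))"
        using mult_right_mono[OF C(2)[of x y], of "\<bar>g y\<bar>"] C(1) N_nonneg[of y]
        by (simp add: abs_mult ac_simps)
    qed
  qed simp
qed

lemma N_times_cont_integrable:
  assumes c: "continuous_on UNIV \<zeta>" and g: "integrable lborel (\<lambda>y. N y * g y)"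
  shows "integrable lborel (\<lambda>y. N y * (g y * \<zeta> y))"
proof -
  obtain C where C: "\<And>y. y \<in> {0..\<tau>} \<Longrightarrow> \<bar>\<zeta> y\<bar> \<le> C" using continuous_bound_Icc[OF c] by blast
  have "integrable lborel (\<lambda>y. (N y * g y) * \<zeta> y)"
  proof (rule integrable_mult_bounded[OF g, where C = C])
    show "\<bar>\<zeta> y\<bar> \<le> C" if "N y * g y \<noteq> 0" for y
    proof -
      have "y \<in> {0<..<\<tau>}" using N_zero that by auto
      then show ?thesis using C[of y] by auto
    qed
  qed (use borel_measurable_continuous_onI[OF c] in simp)
  then show ?thesis by (simp add: ac_simps)
qed

lemma box_bump_real_support:
  assumes "cbox a b \<subseteq> {0<..<\<tau>}" "box a b \<noteq> {}"
  shows "0 < a" "b < \<tau>" "\<And>y. box_bump k a b y \<noteq> 0 \<Longrightarrow> a \<le> y \<and> y \<le> b"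
proof -
  have "a < b" using assms(2) by auto
  then have "a \<in> cbox a b" "b \<in> cbox a b" by auto
  then have "a \<in> {0<..<\<tau>}" "b \<in> {0<..<\<tau>}" using assms(1) by blast+
  then show "0 < a" "b < \<tau>" by auto
  show "a \<le> y \<and> y \<le> b" if "box_bump k a b y \<noteq> 0" for y
    using that box_bump_nonzero[of k a b y] by auto
qed

text \<open>
  Mollification commutes with horizontal weak derivatives at distance more than \<open>\<epsilon>\<close> from the
  lateral boundary: test with \<open>\<kappa> (x - z) \<zeta> (y)\<close>, where \<open>\<zeta>\<close> runs through the bumps.
\<close>

lemma conv_gradient:
  assumes k: "kernel \<epsilon> \<kappa>" and x: "norm x + \<epsilon> < \<tau>" and e: "e \<in> Basis"
  shows "AE y in lborel. conv (\<lambda>X. P X \<bullet> e) \<kappa> (x, y) = conv V (dirderiv e \<kappa>) (x, y)"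
proof -
  note kd = kernel_dirderiv[OF k, of e]
  note ks = kernel_smooth[OF k]
  let ?f = "\<lambda>y. conv (\<lambda>X. P X \<bullet> e) \<kappa> (x, y) - conv V (dirderiv e \<kappa>) (x, y)"
  have i1: "integrable lborel (\<lambda>y. conv (\<lambda>X. P X \<bullet> e) \<kappa> (x, y))"
    using conv_line_integrable[OF slice_ok(2)[OF e] k, of "\<lambda>_. 1" x] N_integrable by simp
  have i2: "integrable lborel (\<lambda>y. conv V (dirderiv e \<kappa>) (x, y))"
    using conv_line_integrable[OF slice_ok(1) kd, of "\<lambda>_. 1" x] N_integrable by simp
  have "AE y in lborel. y \<in> {0<..<\<tau>} \<longrightarrow> ?f y = 0"
  proof (rule AE_lborel_zero_of_box_bumps)
    fix a b :: real and j assume ab: "cbox a b \<subseteq> {0<..<\<tau>}" "box a b \<noteq> {}"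
    let ?\<zeta> = "box_bump j a b :: real \<Rightarrow> real"
    note supp = box_bump_real_support[OF ab]
    have N\<zeta>: "integrable lborel (\<lambda>y. N y * ?\<zeta> y)"
      by (rule integrable_bump[OF N_integrable])
    obtain C where C: "\<And>w. \<bar>\<kappa> w\<bar> \<le> C" using kernel_bounded[OF k] by blast
    obtain C' where C': "\<And>w. \<bar>dirderiv e \<kappa> w\<bar> \<le> C'" using kernel_bounded[OF kd] by blast
    have "(LINT X|M2. V X * ?\<zeta> (snd X) * dirderiv e (\<lambda>z. \<kappa> (x - z)) (fst X)) =
      - (LINT X|M2. (P X \<bullet> e) * ?\<zeta> (snd X) * \<kappa> (x - fst X))"
      by (rule weak_x[OF dirderiv_reflect(1)[OF ks] x _ smooth_box_bump supp e])
         (use kernel_reflect_support[OF k] in auto)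
    moreover have "(LINT X|M2. V X * ?\<zeta> (snd X) * dirderiv e (\<lambda>z. \<kappa> (x - z)) (fst X)) =
        - (LINT y|lborel. ?\<zeta> y * conv V (dirderiv e \<kappa>) (x, y))"
      using slice_product_integral(2)[OF slice_ok(1) _ _ N\<zeta>, of "\<lambda>z. - dirderiv e \<kappa> (x - z)" C']
        C' kernel_measurable[OF kd]
      by (simp add: dirderiv_reflect(2)[OF ks] conv_def smooth_borel_measurable smooth_box_bump)
    moreover have "(LINT X|M2. (P X \<bullet> e) * ?\<zeta> (snd X) * \<kappa> (x - fst X)) =
        (LINT y|lborel. ?\<zeta> y * conv (\<lambda>X. P X \<bullet> e) \<kappa> (x, y))"
      using slice_product_integral(2)[OF slice_ok(2)[OF e] _ _ N\<zeta>, of "\<lambda>z. \<kappa> (x - z)" C]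
        C kernel_measurable[OF k]
      by (simp add: conv_def smooth_borel_measurable smooth_box_bump)
    ultimately have "(LINT y|lborel. ?\<zeta> y * conv V (dirderiv e \<kappa>) (x, y)) =
        (LINT y|lborel. ?\<zeta> y * conv (\<lambda>X. P X \<bullet> e) \<kappa> (x, y))" by linarith
    then show "(LINT y|lborel. ?f y * ?\<zeta> y) = 0"
      using integrable_bump[OF i1, of j a b] integrable_bump[OF i2, of j a b]
      by (simp add: left_diff_distrib) (simp add: mult.commute)
  qed (use i1 i2 in auto)
  then show ?thesis
  proof eventually_elim
    case (elim y)
    then show ?case
      using conv_zero_outside[OF slice_ok(2)[OF e] k, of y x] conv_zero_outside[OF slice_ok(1) kd, of y x]
      by (cases "y \<in> {0<..<\<tau>}") auto
  qed
qed

text \<open>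
  On each vertical line the mollified solution is an antiderivative of the mollified vertical
  derivative, because \<open>\<kappa> (x - z) \<zeta> (y)\<close> is an admissible test for every \<open>\<zeta>\<close>.
\<close>

lemma conv_absolutely_continuous:
  assumes k: "kernel \<epsilon> \<kappa>" and x: "norm x + \<epsilon> < \<tau>"
  shows "\<exists>c. AE y in lborel. y \<in> {0<..<\<tau>} \<longrightarrow> conv V \<kappa> (x, y) = c + cum (\<lambda>s. conv p0 \<kappa> (x, s)) y"
proof (rule AE_eq_const_plus_cum_of_tests[OF \<tau>])
  note ks = kernel_smooth[OF k]
  show "integrable lborel (\<lambda>y. conv V \<kappa> (x, y))" "integrable lborel (\<lambda>y. conv p0 \<kappa> (x, y))"
    using conv_line_integrable[OF slice_ok(1) k, of "\<lambda>_. 1" x] conv_line_integrable[OF slice_ok(3) k, of "\<lambda>_. 1" x]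
      N_integrable by simp_all
  show "conv V \<kappa> (x, y) = 0" "conv p0 \<kappa> (x, y) = 0" if "y \<notin> {0<..<\<tau>}" for y
    using conv_zero_outside[OF _ k that] slice_ok by auto
  fix \<zeta> a b assume \<zeta>: "smooth \<zeta>" "0 < a" "b < \<tau>" "\<And>y. \<zeta> y \<noteq> 0 \<Longrightarrow> a \<le> y \<and> y \<le> b"
  obtain C where C: "\<And>w. \<bar>\<kappa> w\<bar> \<le> C" using kernel_bounded[OF k] by blast
  have N\<zeta>: "integrable lborel (\<lambda>y. N y * \<zeta> y)" "integrable lborel (\<lambda>y. N y * dirderiv 1 \<zeta> y)"
    using N_times_cont_integrable[of \<zeta> "\<lambda>_. 1"] N_times_cont_integrable[of "dirderiv 1 \<zeta>" "\<lambda>_. 1"]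
      N_integrable smooth_continuous[OF \<zeta>(1)] smooth_continuous[OF smooth_dirderiv[OF \<zeta>(1)]] by simp_all
  have "(LINT X|M2. V X * dirderiv 1 \<zeta> (snd X) * \<kappa> (x - fst X)) = - (LINT X|M2. p0 X * \<zeta> (snd X) * \<kappa> (x - fst X))"
    by (rule weak_y[OF dirderiv_reflect(1)[OF ks] x _ \<zeta>]) (use kernel_reflect_support[OF k] in auto)
  moreover have "(LINT X|M2. V X * dirderiv 1 \<zeta> (snd X) * \<kappa> (x - fst X)) = (LINT y|lborel. dirderiv 1 \<zeta> y * conv V \<kappa> (x, y))"
    using slice_product_integral(2)[OF slice_ok(1) _ _ N\<zeta>(2), of "\<lambda>z. \<kappa> (x - z)" C] C kernel_measurable[OF k]
    by (simp add: conv_def smooth_borel_measurable smooth_dirderiv \<zeta>)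
  moreover have "(LINT X|M2. p0 X * \<zeta> (snd X) * \<kappa> (x - fst X)) = (LINT y|lborel. \<zeta> y * conv p0 \<kappa> (x, y))"
    using slice_product_integral(2)[OF slice_ok(3) _ _ N\<zeta>(1), of "\<lambda>z. \<kappa> (x - z)" C] C kernel_measurable[OF k]
    by (simp add: conv_def smooth_borel_measurable \<zeta>)
  ultimately show "(LINT y|lborel. conv V \<kappa> (x, y) * dirderiv 1 \<zeta> y) = - (LINT y|lborel. conv p0 \<kappa> (x, y) * \<zeta> y)"
    by (simp add: mult.commute)
qed

text \<open>
  The horizontal second order part of the operator applied to the mollified solution.
\<close>

definition hess :: "('a \<Rightarrow> real) \<Rightarrow> 'a \<times> real \<Rightarrow> real" where
  "hess \<kappa> X = (\<Sum>e\<in>Basis. \<Sum>e'\<in>Basis. aa e e' (snd X) * conv V (dirderiv e (dirderiv e' \<kappa>)) X)"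

lemma aa_line_integrable:
  assumes F: "slice_ok F" and k: "kernel \<epsilon> \<kappa>"
  shows "integrable lborel (\<lambda>y. conv F \<kappa> (x, y) * (m y * aa e e' y))"
proof -
  have "integrable lborel (\<lambda>y. (N y * m y) * aa e e' y)"
    by (rule integrable_mult_bounded[OF N_m_integrable, where C = \<Lambda>]) (use aa_bound in auto)
  then show ?thesis by (intro conv_line_integrable[OF F k]) (simp_all add: ac_simps)
qed

lemma bb_line_integrable:
  assumes F: "slice_ok F" and k: "kernel \<epsilon> \<kappa>"
  shows "integrable lborel (\<lambda>y. conv F \<kappa> (x, y) * (m y * bb y))"
proof -
  have b: "\<bar>bb y\<bar> \<le> \<Lambda>" for y
    using bb_bounds[of y] \<Lambda> by (smt (verit) positive_imp_inverse_positive)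
  have "integrable lborel (\<lambda>y. (N y * m y) * bb y)"
    by (rule integrable_mult_bounded[OF N_m_integrable, where C = \<Lambda>]) (use b in auto)
  then show ?thesis by (intro conv_line_integrable[OF F k]) (simp_all add: ac_simps)
qed

lemma hess_line_integrable:
  assumes k: "kernel \<epsilon> \<kappa>"
  shows "integrable lborel (\<lambda>y. m y * hess \<kappa> (x, y))"
proof -
  have "m y * hess \<kappa> (x, y) = (\<Sum>e\<in>Basis. \<Sum>e'\<in>Basis. conv V (dirderiv e (dirderiv e' \<kappa>)) (x, y) * (m y * aa e e' y))" for y
    by (simp add: hess_def sum_distrib_left ac_simps)
  moreover have "integrable lborel \<dots>" 
    by (intro Bochner_Integration.integrable_sum aa_line_integrable[OF slice_ok(1) kernel_dirderiv[OF kernel_dirderiv[OF k]]])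
  ultimately show ?thesis by simp
qed

text \<open>
  The equation on a vertical line. The coefficients depend on \<open>y\<close> only, hence the horizontal
  derivatives of the test function can all be moved to the kernel. The vertical factor of the test is
  free at \<open>0\<close>, and so the conormal flux at height \<open>y\<close> is an integral from \<open>0\<close> without
  additional constant.
\<close>

lemma conv_flux:
  assumes k: "kernel \<epsilon> \<kappa>" and x: "norm x + \<epsilon> < \<tau>"
  shows "AE y in lborel. y \<in> {0<..<\<tau>} \<longrightarrow> m y * bb y * conv p0 \<kappa> (x, y) = - cum (\<lambda>s. m s * hess \<kappa> (x, s)) y"
proof -
  note ks = kernel_smooth[OF k]
  let ?f = "\<lambda>y. conv p0 \<kappa> (x, y) * (m y * bb y)"
  let ?h = "\<lambda>y. \<Sum>e\<in>Basis. \<Sum>e'\<in>Basis. conv (\<lambda>X. P X \<bullet> e) (dirderiv e' \<kappa>) (x, y) * (m y * aa e e' y)"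
  have ih: "integrable lborel ?h"
    by (intro Bochner_Integration.integrable_sum aa_line_integrable[OF _ kernel_dirderiv[OF k]] slice_ok)
  have "AE y in lborel. y \<in> {0<..<\<tau>} \<longrightarrow> ?f y = - cum ?h y"
  proof (rule AE_eq_cum_of_flux_tests)
    show "integrable lborel ?f" by (rule bb_line_integrable[OF slice_ok(3) k])
    show "integrable lborel ?h" by (rule ih)
    show "?f y = 0" "?h y = 0" if "y \<notin> {0<..<\<tau>}" for y
      using conv_zero_outside[OF slice_ok(3) k that] conv_zero_outside[OF slice_ok(2) kernel_dirderiv[OF k] that]
      by (auto simp del: sum_eq_0_iff intro!: sum.neutral)
    fix \<zeta> b assume \<zeta>: "smooth \<zeta>" "b < \<tau>" "\<And>y. b \<le> y \<Longrightarrow> \<zeta> y = 0"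
    note [measurable] = smooth_borel_measurable[OF \<zeta>(1)] smooth_borel_measurable[OF smooth_dirderiv[OF \<zeta>(1)], of 1]
    have c: "continuous_on UNIV \<zeta>" "continuous_on UNIV (dirderiv 1 \<zeta>)"
      using smooth_continuous smooth_dirderiv \<zeta>(1) by blast+
    obtain C where C: "\<And>w. \<bar>\<kappa> w\<bar> \<le> C" using kernel_bounded[OF k] by blast
    have Na: "integrable lborel (\<lambda>y. N y * (m y * aa e e' y * \<zeta> y))" for e e'
    proof -
      have "integrable lborel (\<lambda>y. (N y * m y) * aa e e' y)"
        by (rule integrable_mult_bounded[OF N_m_integrable, where C = \<Lambda>]) (use aa_bound in auto)
      then show ?thesis by (intro N_times_cont_integrable[OF c(1)]) (simp add: ac_simps)
    qed
    have Nb: "integrable lborel (\<lambda>y. N y * (m y * bb y * dirderiv 1 \<zeta> y))"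
    proof -
      have b: "\<bar>bb y\<bar> \<le> \<Lambda>" for y
        using bb_bounds[of y] \<Lambda> by (smt (verit) positive_imp_inverse_positive)
      have "integrable lborel (\<lambda>y. (N y * m y) * bb y)"
        by (rule integrable_mult_bounded[OF N_m_integrable, where C = \<Lambda>]) (use b in auto)
      then show ?thesis by (intro N_times_cont_integrable[OF c(2)]) (simp add: ac_simps)
    qed
    let ?\<eta> = "\<lambda>z. \<kappa> (x - z)"
    let ?A = "\<lambda>e e' X. (P X \<bullet> e) * (m (snd X) * aa e e' (snd X) * \<zeta> (snd X)) * dirderiv e' ?\<eta> (fst X)"
    let ?B = "\<lambda>X. p0 X * (m (snd X) * bb (snd X) * dirderiv 1 \<zeta> (snd X)) * ?\<eta> (fst X)"
    have A: "integrable M2 (?A e e')"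
      "(LINT X|M2. ?A e e' X) = - (LINT y|lborel. (m y * aa e e' y * \<zeta> y) * conv (\<lambda>X. P X \<bullet> e) (dirderiv e' \<kappa>) (x, y))"
      if e: "e \<in> Basis" for e e'
    proof -
      obtain C' where C': "\<And>w. \<bar>dirderiv e' \<kappa> w\<bar> \<le> C'" using kernel_bounded[OF kernel_dirderiv[OF k]] by blast
      note km = kernel_measurable[OF kernel_dirderiv[OF k], of e']
      show "integrable M2 (?A e e')"
        using slice_product_integral(1)[OF slice_ok(2)[OF e] _ _ Na, of e e' "\<lambda>z. - dirderiv e' \<kappa> (x - z)" C'] C' km
        by (simp add: dirderiv_reflect(2)[OF ks])
      show "(LINT X|M2. ?A e e' X) = - (LINT y|lborel. (m y * aa e e' y * \<zeta> y) * conv (\<lambda>X. P X \<bullet> e) (dirderiv e' \<kappa>) (x, y))"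
        using slice_product_integral(2)[OF slice_ok(2)[OF e] _ _ Na, of e e' "\<lambda>z. - dirderiv e' \<kappa> (x - z)" C'] C' km
        by (simp add: dirderiv_reflect(2)[OF ks] conv_def)
    qed
    have B: "integrable M2 ?B" "(LINT X|M2. ?B X) = (LINT y|lborel. (m y * bb y * dirderiv 1 \<zeta> y) * conv p0 \<kappa> (x, y))"
      using slice_product_integral[OF slice_ok(3) _ _ Nb, of ?\<eta> C] C kernel_measurable[OF k]
      by (simp_all add: conv_def)
    have iA: "integrable lborel (\<lambda>y. (m y * aa e e' y * \<zeta> y) * conv (\<lambda>X. P X \<bullet> e) (dirderiv e' \<kappa>) (x, y))"
      if e: "e \<in> Basis" for e e'
      using conv_line_integrable[OF slice_ok(2)[OF e] kernel_dirderiv[OF k, of e'] _ Na[of e e'], of x] by (simp add: mult.commute)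
    have "0 = (LINT X|M2. (\<Sum>e\<in>Basis. \<Sum>e'\<in>Basis. ?A e e' X) + ?B X)"
      by (rule weak_eq[OF dirderiv_reflect(1)[OF ks] x _ \<zeta>, symmetric]) (use kernel_reflect_support[OF k] in auto)
    also have "\<dots> = (\<Sum>e\<in>Basis. \<Sum>e'\<in>Basis. LINT X|M2. ?A e e' X) + (LINT X|M2. ?B X)"
      using A(1) B(1) by simp
    also have "\<dots> = - (LINT y|lborel. (\<Sum>e\<in>Basis. \<Sum>e'\<in>Basis. (m y * aa e e' y * \<zeta> y) * conv (\<lambda>X. P X \<bullet> e) (dirderiv e' \<kappa>) (x, y)))
        + (LINT y|lborel. (m y * bb y * dirderiv 1 \<zeta> y) * conv p0 \<kappa> (x, y))"
      using A(2) B(2) iA by (simp add: sum_negf)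
    finally have "(LINT y|lborel. (m y * bb y * dirderiv 1 \<zeta> y) * conv p0 \<kappa> (x, y)) =
      (LINT y|lborel. (\<Sum>e\<in>Basis. \<Sum>e'\<in>Basis. (m y * aa e e' y * \<zeta> y) * conv (\<lambda>X. P X \<bullet> e) (dirderiv e' \<kappa>) (x, y)))"
      by linarith
    moreover have "?f y * dirderiv 1 \<zeta> y = (m y * bb y * dirderiv 1 \<zeta> y) * conv p0 \<kappa> (x, y)" for y
      by (simp add: ac_simps)
    moreover have "?h y * \<zeta> y = (\<Sum>e\<in>Basis. \<Sum>e'\<in>Basis. (m y * aa e e' y * \<zeta> y) * conv (\<lambda>X. P X \<bullet> e) (dirderiv e' \<kappa>) (x, y))" for y
      by (simp add: sum_distrib_right sum_distrib_left ac_simps)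
    ultimately show "(LINT y|lborel. ?f y * dirderiv 1 \<zeta> y) = (LINT y|lborel. ?h y * \<zeta> y)" by (simp only:)
  qed
  moreover have "cum ?h y = cum (\<lambda>s. m s * hess \<kappa> (x, s)) y" for y
  proof -
    have "AE s in lborel. \<forall>e\<in>Basis. \<forall>e'\<in>Basis. conv (\<lambda>X. P X \<bullet> e) (dirderiv e' \<kappa>) (x, s) = conv V (dirderiv e (dirderiv e' \<kappa>)) (x, s)"
      using conv_gradient[OF kernel_dirderiv[OF k] x] by (intro AE_finite_allI) auto
    then have "AE s in lborel. indicator {..<y} s * ?h s = indicator {..<y} s * (m s * hess \<kappa> (x, s))"
      by eventually_elim (simp add: hess_def sum_distrib_left ac_simps)
    then show ?thesis unfolding cum_def
      using borel_measurable_integrable[OF ih] borel_measurable_integrable[OF hess_line_integrable[OF k, of x]]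
      by (intro integral_cong_AE) auto
  qed
  ultimately show ?thesis by (simp add: ac_simps)
qed

end

section \<open>Weak gradients on open sets\<close>

lemma smooth_fst_mult_snd:
  fixes \<eta> :: "'a::euclidean_space \<Rightarrow> real" and \<zeta> :: "real \<Rightarrow> real"
  assumes "smooth \<eta>" "smooth \<zeta>"
  shows "smooth (\<lambda>X. \<eta> (fst X) * \<zeta> (snd X))"
    "dirderiv h (\<lambda>X. \<eta> (fst X) * \<zeta> (snd X)) X = \<eta> (fst X) * dirderiv (snd h) \<zeta> (snd X) + dirderiv (fst h) \<eta> (fst X) * \<zeta> (snd X)"
proof -
  have s: "smooth (\<lambda>X::'a \<times> real. \<eta> (fst X))" "smooth (\<lambda>X::'a \<times> real. \<zeta> (snd X))"
    by (rule smooth_linear[OF bounded_linear_fst assms(1)] smooth_linear[OF bounded_linear_snd assms(2)])+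
  show "smooth (\<lambda>X. \<eta> (fst X) * \<zeta> (snd X))" by (rule smooth_mult[OF s])
  show "dirderiv h (\<lambda>X. \<eta> (fst X) * \<zeta> (snd X)) X = \<eta> (fst X) * dirderiv (snd h) \<zeta> (snd X) + dirderiv (fst h) \<eta> (fst X) * \<zeta> (snd X)"
    unfolding dirderiv_mult[OF s]
    using dirderiv_affine[OF bounded_linear_fst assms(1), of h 0 X] dirderiv_affine[OF bounded_linear_snd assms(2), of h 0 X]
    by simp
qed

text \<open>
  Local integrability refers to compact subsets only; measurability on \<open>E\<close> follows by exhausting
  \<open>E\<close> with finite unions of boxes.
\<close>

lemma locally_integrable_measurable:
  fixes f :: "'a::euclidean_space \<Rightarrow> real"
  assumes E: "open E" and f: "locally_integrable_on f E"
  shows "(\<lambda>x. indicator E x * f x) \<in> borel_measurable lebesgue"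
proof -
  obtain \<D> where D: "countable \<D>" "\<D> \<subseteq> Pow E" "\<And>X. X \<in> \<D> \<Longrightarrow> \<exists>a b. X = cbox a b" "\<Union>\<D> = E"
    using open_countable_Union_open_cbox[OF E] by metis
  show ?thesis
  proof (cases "\<D> = {}")
    case True
    then have "E = {}" using D(4) by simp
    then show ?thesis by simp
  next
    case False
    define C where "C = from_nat_into \<D>"
    have CD: "C i \<in> \<D>" for i unfolding C_def by (rule from_nat_into[OF False])
    define U where "U n = (\<Union>i\<le>n. C i)" for n
    have U: "compact (U n)" "U n \<subseteq> E" for n
    proof -
      have "compact (C i)" for i
      proof -
        obtain a b where "C i = cbox a b" using D(3)[OF CD[of i]] by blast
        then show ?thesis using compact_cbox by simp
      qed
      then show "compact (U n)" unfolding U_def by (intro compact_UN) auto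
      show "U n \<subseteq> E" unfolding U_def using CD D(2) by blast
    qed
    have m: "(\<lambda>x. indicator (U n) x * f x) \<in> borel_measurable lebesgue" for n
    proof -
      have "set_integrable lebesgue (U n) f" using f U by (simp add: locally_integrable_on_def)
      then show ?thesis unfolding set_integrable_def by (simp add: borel_measurable_integrable)
    qed
    show ?thesis
    proof (rule borel_measurable_LIMSEQ_real[OF _ m])
      fix x
      show "(\<lambda>n. indicator (U n) x * f x) \<longlonglongrightarrow> indicator E x * f x"
      proof (cases "x \<in> E")
        case True
        then obtain X where X: "X \<in> \<D>" "x \<in> X" using D(4) by blast
        then obtain i where i: "C i = X" using from_nat_into_surj[OF D(1)] by (auto simp: C_def)
        have "\<forall>\<^sub>F n in sequentially. indicator (U n) x * f x = indicator E x * f x"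
          using eventually_ge_at_top[of i]
        proof eventually_elim
          case (elim n)
          then have "x \<in> U n" using X i by (auto simp: U_def)
          then show ?case using True by simp
        qed
        then show ?thesis by (rule tendsto_eventually)
      next
        case False
        then have "x \<notin> U n" for n using U(2) by blast
        then show ?thesis using False by simp
      qed
    qed
  qed
qed

lemma borel_representative:
  fixes f :: "'a::euclidean_space \<Rightarrow> real"
  assumes m: "(\<lambda>x. indicator E x * f x) \<in> borel_measurable lebesgue" and E: "E \<in> sets borel"
  shows "\<exists>f'\<in>borel_measurable borel. (\<forall>x. x \<notin> E \<longrightarrow> f' x = 0) \<and> (AE x in lborel. x \<in> E \<longrightarrow> f x = f' x)"
proof -
  obtain f0 where f0: "f0 \<in> borel_measurable lborel" "AE x in lborel. indicator E x * f x = f0 x"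
    using completion_ex_borel_measurable_real[OF m] by auto
  show ?thesis
  proof (intro bexI conjI allI impI)
    show "(\<lambda>x. indicator E x * f0 x) \<in> borel_measurable borel"
      using f0(1) E by (intro borel_measurable_times borel_measurable_indicator) auto
    show "AE x in lborel. x \<in> E \<longrightarrow> f x = indicator E x * f0 x"
      using f0(2) by eventually_elim auto
  qed auto
qed

lemma closure_box_bump_support:
  assumes "box a b \<noteq> {}" shows "closure {x. box_bump k a b x \<noteq> 0} = cbox a b"
  using closure_box[OF assms] by (simp add: box_bump_nonzero)

lemma has_weak_gradient_component:
  assumes "has_weak_gradient E v g" shows "locally_integrable_on (\<lambda>X. g X \<bullet> e) E"
proof -
  have "locally_integrable_on g E" using assms by (simp add: has_weak_gradient_def)
  then show ?thesis
    unfolding locally_integrable_on_def using absolutely_integrable_component by blast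
qed

text \<open>
  Two weak gradients have the same integrals against all bumps, and bumps detect functions up to null
  sets. So any property of one weak gradient transfers to the one selected by \<open>wgrad\<close>.
\<close>

lemma weak_gradient_unique:
  fixes g1 g2 :: "'a::euclidean_space \<Rightarrow> 'a"
  assumes E: "open E" and g: "has_weak_gradient E v g1" "has_weak_gradient E v g2"
  shows "AE X in lebesgue. X \<in> E \<longrightarrow> g1 X = g2 X"
proof -
  have comp: "AE X in lebesgue. X \<in> E \<longrightarrow> (g1 X - g2 X) \<bullet> e = 0" if e: "e \<in> Basis" for e
  proof (rule AE_zero_of_box_bumps[OF E])
    have l: "locally_integrable_on (\<lambda>X. g1 X \<bullet> e) E" "locally_integrable_on (\<lambda>X. g2 X \<bullet> e) E"
      using g has_weak_gradient_component by blast+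
    show "locally_integrable_on (\<lambda>X. (g1 X - g2 X) \<bullet> e) E"
      unfolding locally_integrable_on_def inner_diff_left
    proof (intro allI impI)
      fix S assume "compact S \<and> S \<subseteq> E"
      then show "(\<lambda>x. g1 x \<bullet> e - g2 x \<bullet> e) absolutely_integrable_on S"
        using l by (intro set_integral_diff) (auto simp: locally_integrable_on_def)
    qed
    fix a b :: 'a and k assume ab: "cbox a b \<subseteq> E" "box a b \<noteq> {}"
    let ?\<phi> = "box_bump k a b"
    have sup: "compact (closure {X. ?\<phi> X \<noteq> 0})" "closure {X. ?\<phi> X \<noteq> 0} \<subseteq> E"
      using closure_box_bump_support[OF ab(2), of k] ab(1) by auto
    have i: "integrable lebesgue (\<lambda>X. (h X \<bullet> e) * ?\<phi> X)" "(LINT X:E|lebesgue. (h X \<bullet> e) * ?\<phi> X) = (LINT X|lebesgue. (h X \<bullet> e) * ?\<phi> X)"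
      if "locally_integrable_on (\<lambda>X. h X \<bullet> e) E" for h :: "'a \<Rightarrow> 'a"
    proof -
      have s: "set_integrable lebesgue (cbox a b) (\<lambda>X. h X \<bullet> e)" using that ab by (simp add: locally_integrable_on_def)
      have z: "?\<phi> X = 0" if "X \<notin> cbox a b" for X using that box_bump_nonzero[of k a b X] box_subset_cbox by blast
      have e1: "(h X \<bullet> e) * ?\<phi> X = (indicator (cbox a b) X *\<^sub>R (h X \<bullet> e)) * ?\<phi> X" for X
        using z[of X] by (cases "X \<in> cbox a b") auto
      have e2: "indicator E X *\<^sub>R ((h X \<bullet> e) * ?\<phi> X) = (h X \<bullet> e) * ?\<phi> X" for X
        using z[of X] ab(1) by (cases "X \<in> E") auto
      have bm: "?\<phi> \<in> borel_measurable lebesgue"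
        by (intro measurable_completion) (simp add: smooth_borel_measurable smooth_box_bump)
      show "integrable lebesgue (\<lambda>X. (h X \<bullet> e) * ?\<phi> X)"
        unfolding e1
      proof (rule Bochner_Integration.integrable_bound[OF s[unfolded set_integrable_def]])
        show "AE X in lebesgue. norm (indicator (cbox a b) X *\<^sub>R (h X \<bullet> e) * ?\<phi> X) \<le> norm (indicator (cbox a b) X *\<^sub>R (h X \<bullet> e))"
          using box_bump_bounds[of k a b] by (intro AE_I2) (simp add: abs_mult mult_left_le)
      qed (use borel_measurable_integrable[OF s[unfolded set_integrable_def]] bm in \<open>rule borel_measurable_times\<close>)
      show "(LINT X:E|lebesgue. (h X \<bullet> e) * ?\<phi> X) = (LINT X|lebesgue. (h X \<bullet> e) * ?\<phi> X)"
        unfolding set_lebesgue_integral_def e2 ..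
    qed
    have "(LINT X:E|lebesgue. (g1 X \<bullet> e) * ?\<phi> X) = (LINT X:E|lebesgue. (g2 X \<bullet> e) * ?\<phi> X)"
      using g[unfolded has_weak_gradient_def, THEN conjunct2, THEN conjunct2, rule_format, of ?\<phi> e]
        e sup smooth_box_bump[of k a b] by simp
    then show "(LINT X|lebesgue. (g1 X - g2 X) \<bullet> e * ?\<phi> X) = 0"
      using i[OF l(1)] i[OF l(2)] by (simp add: inner_diff_left left_diff_distrib)
  qed
  have "AE X in lebesgue. \<forall>e\<in>Basis. X \<in> E \<longrightarrow> (g1 X - g2 X) \<bullet> e = 0"
    by (rule AE_finite_allI[OF finite_Basis comp])
  then show ?thesis
  proof eventually_elim
    case (elim X)
    show ?case
    proof
      assume "X \<in> E"
      then have "(g1 X - g2 X) \<bullet> e = 0" if "e \<in> Basis" for e using elim that by blast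
      then have "g1 X \<bullet> e = g2 X \<bullet> e" if "e \<in> Basis" for e using that by (simp add: inner_diff_left)
      then show "g1 X = g2 X" by (rule euclidean_eqI)
    qed
  qed
qed

lemma wgrad_has_weak_gradient: "has_weak_gradient E v g \<Longrightarrow> has_weak_gradient E v (wgrad E v)"
  using someI[of "\<lambda>g. has_weak_gradient E v g" g] by (simp add: wgrad_def)

definition grad :: "('a::euclidean_space \<Rightarrow> real) \<Rightarrow> 'a \<Rightarrow> 'a" where
  "grad \<psi> X = (\<Sum>e\<in>Basis. dirderiv e \<psi> X *\<^sub>R e)"

lemma grad_inner: "e \<in> Basis \<Longrightarrow> grad \<psi> X \<bullet> e = dirderiv e \<psi> X"
  by (simp add: grad_def)

lemma grad_continuous: "smooth \<psi> \<Longrightarrow> continuous_on A (grad \<psi>)"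
  unfolding grad_def[abs_def] by (intro continuous_intros smooth_continuous smooth_dirderiv)

lemma kernel_integrable:
  assumes "kernel \<epsilon> \<kappa>" shows "integrable lborel \<kappa>"
proof -
  obtain C where C: "\<And>w. \<bar>\<kappa> w\<bar> \<le> C" using kernel_bounded[OF assms] by blast
  have "integrable lborel (\<lambda>w. indicator (cball 0 \<epsilon>) w * \<kappa> w)"
    by (rule integrable_mult_bounded[OF integrable_indicator_bounded, where C = C])
       (use C kernel_measurable[OF assms] in auto)
  moreover have "(\<lambda>w. indicator (cball 0 \<epsilon>) w * \<kappa> w) = \<kappa>"
  proof
    show "indicator (cball 0 \<epsilon>) w * \<kappa> w = \<kappa> w" for w
      using assms by (cases "\<kappa> w = 0") (auto simp: kernel_def)
  qed
  ultimately show ?thesis by simp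
qed

lemma continuous_locally_integrable:
  fixes f :: "'a::euclidean_space \<Rightarrow> 'b::euclidean_space"
  assumes "continuous_on UNIV f" shows "locally_integrable_on f E"
  unfolding locally_integrable_on_def
proof (intro allI impI)
  fix S assume S: "compact S \<and> S \<subseteq> E"
  then obtain a where a: "S \<subseteq> cbox (- a) a"
    using bounded_subset_cbox_symmetric compact_imp_bounded by metis
  have "f absolutely_integrable_on cbox (- a) a"
    by (rule absolutely_integrable_continuous[OF continuous_on_subset[OF assms]]) simp
  moreover have "S \<in> sets lebesgue" using S by (auto intro: lmeasurable_compact fmeasurableD)
  ultimately show "f absolutely_integrable_on S" using a by (rule set_integrable_subset)
qed

lemma kernel_integral_lebesgue:
  assumes k: "kernel r \<kappa>" and z: "\<And>X. X \<notin> E \<Longrightarrow> \<kappa> X = 0"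
  shows "(LINT X:E|lebesgue. \<kappa> X) = (LINT X|lborel. \<kappa> X)"
proof -
  have "(\<lambda>X. indicator E X *\<^sub>R \<kappa> X) = \<kappa>"
  proof
    show "indicator E X *\<^sub>R \<kappa> X = \<kappa> X" for X using z[of X] by (cases "X \<in> E") auto
  qed
  then show ?thesis
    unfolding set_lebesgue_integral_def using kernel_measurable[OF k] by (simp add: integral_completion)
qed

text \<open>
  Needed for test functions, whose gradients enter the equation through \<open>wgrad\<close>.
\<close>

lemma smooth_has_weak_gradient:
  fixes \<psi> :: "'a::euclidean_space \<Rightarrow> real"
  assumes \<psi>: "smooth \<psi>"
  shows "has_weak_gradient E \<psi> (grad \<psi>)"
  unfolding has_weak_gradient_def
proof (intro conjI allI impI ballI)
  show "locally_integrable_on \<psi> E" "locally_integrable_on (grad \<psi>) E"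
    by (rule continuous_locally_integrable, rule smooth_continuous[OF \<psi>] grad_continuous[OF \<psi>])+
  fix \<phi> and e :: 'a
  assume "smooth \<phi> \<and> compact (closure {X. \<phi> X \<noteq> 0}) \<and> closure {X. \<phi> X \<noteq> 0} \<subseteq> E" and e: "e \<in> Basis"
  then have \<phi>: "smooth \<phi>" "compact (closure {X. \<phi> X \<noteq> 0})" "closure {X. \<phi> X \<noteq> 0} \<subseteq> E" by auto
  let ?S = "closure {X. \<phi> X \<noteq> 0}"
  obtain r where r: "\<And>X. X \<in> ?S \<Longrightarrow> norm X \<le> r"
  proof -
    obtain r where "\<forall>X\<in>?S. norm X \<le> r" using compact_imp_bounded[OF \<phi>(2)] unfolding bounded_iff ..
    then show thesis using that by auto
  qed
  have sup: "X \<in> ?S" if "\<phi> X \<noteq> 0" for X using that closure_subset[of "{X. \<phi> X \<noteq> 0}"] by auto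
  have supd: "X \<in> ?S" if "dirderiv e \<phi> X \<noteq> 0" for X
    using dirderiv_zero_off_closed[OF closed_closure sup that] .
  have k: "kernel r (\<lambda>X. \<psi> X * \<phi> X)" "kernel r (\<lambda>X. \<psi> X * dirderiv e \<phi> X)" "kernel r (\<lambda>X. dirderiv e \<psi> X * \<phi> X)"
    using sup supd r unfolding kernel_def
    by (auto intro!: smooth_mult smooth_dirderiv \<psi> \<phi>)
  note kd = kernel_dirderiv[OF k(1), of e]
  obtain C1 where C1: "\<And>w. \<bar>\<psi> w * \<phi> w\<bar> \<le> C1" using kernel_bounded[OF k(1)] by blast
  obtain C2 where C2: "\<And>w. \<bar>dirderiv e (\<lambda>X. \<psi> X * \<phi> X) w\<bar> \<le> C2" using kernel_bounded[OF kd] by blast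
  have "(LINT X|lborel. dirderiv e (\<lambda>X. \<psi> X * \<phi> X) X) = 0"
  proof (rule integral_directional_derivative_eq_0)
    show "(\<lambda>X. \<psi> X * \<phi> X) \<in> borel_measurable borel" by (rule kernel_measurable[OF k(1)])
    show "dirderiv e (\<lambda>X. \<psi> X * \<phi> X) \<in> borel_measurable borel" by (rule kernel_measurable[OF kd])
    show "((\<lambda>t. \<psi> (x + t *\<^sub>R e) * \<phi> (x + t *\<^sub>R e)) has_real_derivative dirderiv e (\<lambda>X. \<psi> X * \<phi> X) x) (at 0)" for x
      using dirderiv_line[OF kernel_smooth[OF k(1)], of x e 0] by simp
    show "\<bar>\<psi> x * \<phi> x\<bar> \<le> max C1 C2" "\<bar>dirderiv e (\<lambda>X. \<psi> X * \<phi> X) x\<bar> \<le> max C1 C2" for x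
      using C1[of x] C2[of x] by auto
    show "\<psi> x * \<phi> x = 0" if "norm x > r" for x using sup[of x] r[of x] that by force
  qed
  then have "(LINT X|lborel. \<psi> X * dirderiv e \<phi> X + dirderiv e \<psi> X * \<phi> X) = 0"
    by (simp add: dirderiv_mult[OF \<psi> \<phi>(1)])
  then have "(LINT X|lborel. \<psi> X * dirderiv e \<phi> X) = - (LINT X|lborel. dirderiv e \<psi> X * \<phi> X)"
    using kernel_integrable[OF k(2)] kernel_integrable[OF k(3)] by simp
  moreover have "(LINT X:E|lebesgue. \<psi> X * frechet_derivative \<phi> (at X) e) = (LINT X|lborel. \<psi> X * dirderiv e \<phi> X)"
    unfolding dirderiv_def[symmetric] by (rule kernel_integral_lebesgue[OF k(2)]) (use supd \<phi>(3) in force)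
  moreover have "(LINT X:E|lebesgue. (grad \<psi> X \<bullet> e) * \<phi> X) = (LINT X|lborel. dirderiv e \<psi> X * \<phi> X)"
    unfolding grad_inner[OF e] by (rule kernel_integral_lebesgue[OF k(3)]) (use sup \<phi>(3) in force)
  ultimately show "(LINT X:E|lebesgue. \<psi> X * frechet_derivative \<phi> (at X) e) = - (LINT X:E|lebesgue. (grad \<psi> X \<bullet> e) * \<phi> X)"
    by simp
qed

section \<open>The Caccioppoli inequality and its iteration\<close>

definition cyl :: "real \<Rightarrow> ('a::euclidean_space \<times> real) set" where
  "cyl r = ball 0 r \<times> {0<..<r}"

lemma cyl_measurable [measurable]: "cyl r \<in> sets M2"
  unfolding cyl_def by (intro pair_measureI) auto

lemma cyl_mono: "r \<le> s \<Longrightarrow> cyl r \<subseteq> cyl s"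
  by (auto simp: cyl_def)

text \<open>
  The algebra of the Caccioppoli inequality at one point: \<open>p\<close> is the vertical derivative, \<open>s\<close> the
  length of the horizontal gradient, \<open>k\<close> and \<open>f\<close> are the cutoffs, \<open>B\<close> is the horizontal quadratic form
  and \<open>A\<close> the term in which a derivative falls on the horizontal cutoff.
\<close>

lemma caccioppoli_pointwise:
  fixes \<Lambda> :: real
  assumes \<Lambda>: "1 \<le> \<Lambda>" and k: "0 \<le> k" "k \<le> R" and f: "0 \<le> f" "f \<le> R\<^sup>2" and n: "1 \<le> n"
    and A: "\<bar>A\<bar> \<le> \<Lambda> * 4 * f * n\<^sup>2 * R * \<bar>u\<bar> * s" and B: "s\<^sup>2 / \<Lambda> \<le> B" and b: "inverse \<Lambda> \<le> b" "b \<le> \<Lambda>"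
  shows "(1 / (2 * \<Lambda>)) * k\<^sup>2 * f\<^sup>2 * (p\<^sup>2 + s\<^sup>2) - 10 * \<Lambda> ^ 3 * n ^ 4 * R ^ 4 * u\<^sup>2
     \<le> b * p * (k\<^sup>2 * p - 2 * k * u) * f\<^sup>2 + k\<^sup>2 * (A + f\<^sup>2 * B)"
proof -
  have L0: "0 < \<Lambda>" using \<Lambda> by linarith
  have b0: "0 \<le> b" using b(1) L0 by (meson inverse_nonnegative_iff_nonnegative less_imp_le order_trans)
  \<comment> \<open>both mixed terms are absorbed by completing a square\<close>
  have "0 \<le> (k * \<bar>p\<bar> - 2 * \<Lambda>\<^sup>2 * \<bar>u\<bar>)\<^sup>2 / (2 * \<Lambda>)" using L0 by simp
  also have "\<dots> = k\<^sup>2 * p\<^sup>2 / (2 * \<Lambda>) + 2 * \<Lambda> ^ 3 * u\<^sup>2 - 2 * \<Lambda> * k * \<bar>p\<bar> * \<bar>u\<bar>"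
    using L0 by (simp add: power2_diff power_mult_distrib diff_divide_distrib add_divide_distrib)
      (simp add: power2_eq_square power3_eq_cube power4_eq_xxxx field_simps)
  finally have 1: "2 * \<Lambda> * k * \<bar>p\<bar> * \<bar>u\<bar> \<le> k\<^sup>2 * p\<^sup>2 / (2 * \<Lambda>) + 2 * \<Lambda> ^ 3 * u\<^sup>2" by linarith
  have "b * (2 * k * (\<bar>p\<bar> * \<bar>u\<bar>)) \<le> \<Lambda> * (2 * k * (\<bar>p\<bar> * \<bar>u\<bar>))"
    by (intro mult_right_mono b) (use k in auto)
  moreover have "b * (2 * k * (p * u)) \<le> b * (2 * k * (\<bar>p\<bar> * \<bar>u\<bar>))"
    using b0 k by (intro mult_left_mono) (auto simp: abs_mult[symmetric])
  ultimately have "b * (2 * k * (p * u)) \<le> k\<^sup>2 * p\<^sup>2 / (2 * \<Lambda>) + 2 * \<Lambda> ^ 3 * u\<^sup>2" using 1 by (simp add: ac_simps)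
  moreover have "k\<^sup>2 * p\<^sup>2 / \<Lambda> \<le> b * (k\<^sup>2 * p\<^sup>2)"
    using mult_right_mono[OF b(1), of "k\<^sup>2 * p\<^sup>2"] by (simp add: divide_inverse mult.commute)
  ultimately have "k\<^sup>2 * p\<^sup>2 / (2 * \<Lambda>) - 2 * \<Lambda> ^ 3 * u\<^sup>2 \<le> b * p * (k\<^sup>2 * p - 2 * k * u)"
    by (simp add: algebra_simps power2_eq_square)
  then have "(k\<^sup>2 * p\<^sup>2 / (2 * \<Lambda>) - 2 * \<Lambda> ^ 3 * u\<^sup>2) * f\<^sup>2 \<le> b * p * (k\<^sup>2 * p - 2 * k * u) * f\<^sup>2"
    by (intro mult_right_mono) auto
  moreover have "2 * \<Lambda> ^ 3 * u\<^sup>2 * f\<^sup>2 \<le> 2 * \<Lambda> ^ 3 * n ^ 4 * R ^ 4 * u\<^sup>2"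
  proof -
    have "f\<^sup>2 \<le> (R\<^sup>2)\<^sup>2" using f by (intro power_mono) auto
    moreover have "(R\<^sup>2)\<^sup>2 = 1 * R ^ 4" by simp
    moreover have "1 * R ^ 4 \<le> n ^ 4 * R ^ 4" by (intro mult_right_mono one_le_power n) simp
    ultimately have "f\<^sup>2 \<le> n ^ 4 * R ^ 4" by linarith
    then have "2 * \<Lambda> ^ 3 * u\<^sup>2 * f\<^sup>2 \<le> 2 * \<Lambda> ^ 3 * u\<^sup>2 * (n ^ 4 * R ^ 4)"
      using L0 by (intro mult_left_mono) auto
    then show ?thesis by (simp add: ac_simps)
  qed
  moreover have "k\<^sup>2 * (s\<^sup>2 * f\<^sup>2 / (2 * \<Lambda>)) - 8 * \<Lambda> ^ 3 * n ^ 4 * R ^ 4 * u\<^sup>2 \<le> k\<^sup>2 * (A + f\<^sup>2 * B)"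
  proof -
    have "0 \<le> (f * s - 4 * \<Lambda>\<^sup>2 * n\<^sup>2 * R * \<bar>u\<bar>)\<^sup>2 / (2 * \<Lambda>)" using L0 by simp
    also have "\<dots> = s\<^sup>2 * f\<^sup>2 / (2 * \<Lambda>) + 8 * \<Lambda> ^ 3 * n ^ 4 * R\<^sup>2 * u\<^sup>2 - \<Lambda> * 4 * f * n\<^sup>2 * R * \<bar>u\<bar> * s"
      using L0 by (simp add: power2_diff power_mult_distrib diff_divide_distrib add_divide_distrib)
       (simp add: power2_eq_square power3_eq_cube power4_eq_xxxx field_simps)
    finally have 2: "\<Lambda> * 4 * f * n\<^sup>2 * R * \<bar>u\<bar> * s \<le> s\<^sup>2 * f\<^sup>2 / (2 * \<Lambda>) + 8 * \<Lambda> ^ 3 * n ^ 4 * R\<^sup>2 * u\<^sup>2" by linarith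
    have "s\<^sup>2 * f\<^sup>2 / \<Lambda> \<le> f\<^sup>2 * B" using mult_left_mono[OF B, of "f\<^sup>2"] by (simp add: ac_simps)
    then have "s\<^sup>2 * f\<^sup>2 / (2 * \<Lambda>) - 8 * \<Lambda> ^ 3 * n ^ 4 * R\<^sup>2 * u\<^sup>2 \<le> A + f\<^sup>2 * B"
      using 2 A by (simp add: field_simps)
    then have "k\<^sup>2 * (s\<^sup>2 * f\<^sup>2 / (2 * \<Lambda>) - 8 * \<Lambda> ^ 3 * n ^ 4 * R\<^sup>2 * u\<^sup>2) \<le> k\<^sup>2 * (A + f\<^sup>2 * B)"
      by (intro mult_left_mono) auto
    moreover have "k\<^sup>2 * (8 * \<Lambda> ^ 3 * n ^ 4 * R\<^sup>2 * u\<^sup>2) \<le> R\<^sup>2 * (8 * \<Lambda> ^ 3 * n ^ 4 * R\<^sup>2 * u\<^sup>2)"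
      using k L0 n by (intro mult_right_mono power_mono) auto
    moreover have "R\<^sup>2 * (8 * \<Lambda> ^ 3 * n ^ 4 * R\<^sup>2 * u\<^sup>2) = 8 * \<Lambda> ^ 3 * n ^ 4 * R ^ 4 * u\<^sup>2"
      by (simp add: power2_eq_square power4_eq_xxxx)
    ultimately show ?thesis by (simp add: right_diff_distrib)
  qed
  ultimately show ?thesis by (simp add: algebra_simps add_divide_distrib)
qed

text \<open>
  Its square is continuously differentiable, with an explicit derivative.
\<close>

definition ball_cutoff :: "real \<Rightarrow> 'a::euclidean_space \<Rightarrow> real" where
  "ball_cutoff R x = max 0 (R\<^sup>2 - (norm x)\<^sup>2)"

lemma ball_cutoff_bounds: "0 \<le> ball_cutoff R x" "ball_cutoff R x \<le> R\<^sup>2"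
  by (auto simp: ball_cutoff_def)

lemma ball_cutoff_zero: "0 \<le> R \<Longrightarrow> R \<le> norm x \<Longrightarrow> ball_cutoff R x = 0"
  by (auto simp: ball_cutoff_def max_def intro: power_mono)

lemma ball_cutoff_measurable [measurable]: "ball_cutoff R \<in> borel_measurable borel"
  unfolding ball_cutoff_def[abs_def] by measurable

lemma ball_cutoff_square_derivative:
  "((\<lambda>t. (ball_cutoff R (x + t *\<^sub>R e))\<^sup>2) has_real_derivative - 4 * ball_cutoff R x * (x \<bullet> e)) (at 0)"
proof -
  have "((\<lambda>t. R\<^sup>2 - ((x + t *\<^sub>R e) \<bullet> (x + t *\<^sub>R e))) has_real_derivative - 2 * (x \<bullet> e)) (at 0)"
    by (simp add: inner_add_left inner_add_right) (auto intro!: derivative_eq_intros simp: inner_commute)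
  then have "((\<lambda>t. R\<^sup>2 - (norm (x + t *\<^sub>R e))\<^sup>2) has_real_derivative - 2 * (x \<bullet> e)) (at 0)"
    by (simp add: power2_norm_eq_inner)
  from DERIV_chain2[OF positive_part_square_derivative this]
  show ?thesis by (simp add: ball_cutoff_def algebra_simps)
qed

context cylinder_solution
begin

definition energy :: "real \<Rightarrow> ('a \<times> real \<Rightarrow> real) \<Rightarrow> real" where
  "energy r F = (LINT X|M2. indicator (cyl r) X * ((F X)\<^sup>2 * m (snd X)))"

lemma dominated_integrable:
  fixes G :: "'a \<times> real \<Rightarrow> real"
  assumes [measurable]: "G \<in> borel_measurable M2"
    and le: "\<And>x y. \<bar>G (x, y)\<bar> \<le> C * (indicator (ball 0 R) x * ((N y)\<^sup>2 * m y))"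
  shows "integrable M2 G"
proof (rule Bochner_Integration.integrable_bound)
  have "integrable M2 (\<lambda>(x, y). indicator (ball (0::'a) R) x * ((N y)\<^sup>2 * m y))"
    by (rule integrable_product[OF integrable_indicator_bounded N_square]) auto
  then show "integrable M2 (\<lambda>(x::'a, y). C * (indicator (ball 0 R) x * ((N y)\<^sup>2 * m y)))"
    by (simp add: case_prod_beta')
  show "AE X in M2. norm (G X) \<le> norm (case X of (x::'a, y) \<Rightarrow> C * (indicator (ball 0 R) x * ((N y)\<^sup>2 * m y)))"
  proof (intro AE_I2)
    fix X :: "'a \<times> real"
    obtain x y where X: "X = (x, y)" by force
    have "\<bar>G (x, y)\<bar> \<le> C * (indicator (ball 0 R) x * ((N y)\<^sup>2 * m y))" by (rule le)
    then show "norm (G X) \<le> norm (case X of (x, y) \<Rightarrow> C * (indicator (ball 0 R) x * ((N y)\<^sup>2 * m y)))"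
      unfolding X by (simp only: real_norm_def prod.case)
  qed
qed simp

lemma energy_integrable:
  assumes F: "slice_ok F" and k: "kernel \<epsilon> \<kappa>"
  shows "integrable M2 (\<lambda>X. indicator (cyl r) X * ((conv F \<kappa> X)\<^sup>2 * m (snd X)))"
proof -
  note [measurable] = conv_measurable[OF slice_okD(1)[OF F] kernel_measurable[OF k]]
  obtain C where C: "0 \<le> C" "\<And>x y. \<bar>conv F \<kappa> (x, y)\<bar> \<le> C * N y" using conv_bound_N[OF F k] by blast
  show ?thesis
  proof (rule dominated_integrable)
    fix x y
    have "(conv F \<kappa> (x, y))\<^sup>2 \<le> (C * N y)\<^sup>2"
      using power_mono[OF C(2)[of x y], of 2] by simp
    then have "(conv F \<kappa> (x, y))\<^sup>2 * m y \<le> (C * N y)\<^sup>2 * m y"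
      using m_pos[of y] by (intro mult_right_mono) auto
    then show "\<bar>indicator (cyl r) (x, y) * ((conv F \<kappa> (x, y))\<^sup>2 * m (snd (x, y)))\<bar>
        \<le> C\<^sup>2 * (indicator (ball 0 r) x * ((N y)\<^sup>2 * m y))"
      using m_pos[of y] by (auto simp: indicator_def cyl_def power_mult_distrib abs_mult ac_simps)
  qed measurable
qed

lemma energy_nonneg: "0 \<le> energy r F"
  unfolding energy_def using less_imp_le[OF m_pos]
  by (intro Bochner_Integration.integral_nonneg mult_nonneg_nonneg) auto

lemma triple_bound:
  fixes a b c d A B C D n :: real
  assumes "\<bar>a\<bar> \<le> A" "\<bar>b\<bar> \<le> B * n" "\<bar>c\<bar> \<le> C * n"
  shows "\<bar>a * b * c\<bar> \<le> A * B * C * n\<^sup>2"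
proof -
  have 0: "0 \<le> A" "0 \<le> B * n" using assms(1,2) abs_ge_zero order_trans by blast+
  have "\<bar>a * b * c\<bar> \<le> A * (B * n) * (C * n)"
    unfolding abs_mult
  proof (rule mult_mono)
    show "\<bar>a\<bar> * \<bar>b\<bar> \<le> A * (B * n)" by (rule mult_mono[OF assms(1,2) 0(1)]) simp
    show "0 \<le> A * (B * n)" using 0 by (rule mult_nonneg_nonneg)
  qed (use assms in simp_all)
  then show ?thesis by (simp add: power2_eq_square ac_simps)
qed

text \<open>
  Multiply the equation for the mollified solution \<open>u\<close> by \<open>f\<^sup>2 k\<^sup>2 u\<close>, where \<open>f\<close> cuts off in \<open>x\<close>
  and \<open>k\<close> in \<open>y\<close>. The vertical part is integrated by parts on each vertical line by means of the flux identity,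
  the horizontal part on each horizontal slice, where \<open>u\<close> is smooth. The cutoff \<open>k\<close> does not
  vanish at \<open>y = 0\<close>; the boundary term there is absent since the flux vanishes.

  The cutoffs are not normalised: \<open>f\<close> is bounded by \<open>R\<^sup>2\<close> and \<open>k\<close> by \<open>R\<close>, while on the smaller
  cylinder they are at least \<open>R (R - r)\<close> and \<open>R - r\<close>. This explains the shape of the constant.
\<close>

lemma caccioppoli:
  assumes k: "kernel \<epsilon> \<kappa>" and R: "0 < r" "r < R" "R + \<epsilon> < \<tau>" "R \<le> \<tau>"
  shows "energy r (conv p0 \<kappa>) + (\<Sum>e\<in>Basis. energy r (conv V (dirderiv e \<kappa>)))
    \<le> 20 * DIM('a) ^ 4 * \<Lambda> ^ 4 * R\<^sup>2 / (R - r) ^ 4 * energy R (conv V \<kappa>)"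
proof -
  define u where "u = conv V \<kappa>"
  define p where "p = conv p0 \<kappa>"
  define d where "d e = conv V (dirderiv e \<kappa>)" for e
  define dd where "dd e e' = conv V (dirderiv e (dirderiv e' \<kappa>))" for e e'
  define f where "f = (ball_cutoff R :: 'a \<Rightarrow> real)"
  define k where "k y = max 0 (R - y)" for y
  note kd = kernel_dirderiv[OF assms(1)] kernel_dirderiv[OF kernel_dirderiv[OF assms(1)]]
  have [measurable]: "u \<in> borel_measurable M2" "p \<in> borel_measurable M2" "\<And>e. d e \<in> borel_measurable M2"
     "\<And>e e'. dd e e' \<in> borel_measurable M2" "f \<in> borel_measurable borel" "k \<in> borel_measurable borel"
    unfolding u_def p_def d_def dd_def f_def k_def[abs_def]
  proof -
    show "conv V \<kappa> \<in> borel_measurable M2" "conv p0 \<kappa> \<in> borel_measurable M2"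
      by (rule conv_measurable[OF V_meas kernel_measurable[OF assms(1)]] conv_measurable[OF p0_meas kernel_measurable[OF assms(1)]])+
    show "conv V (dirderiv e \<kappa>) \<in> borel_measurable M2" "conv V (dirderiv e (dirderiv e' \<kappa>)) \<in> borel_measurable M2" for e e'
      by (rule conv_measurable[OF V_meas kernel_measurable[OF kd(1)]] conv_measurable[OF V_meas kernel_measurable[OF kd(2)]])+
  qed measurable
  obtain Cu where Cu: "0 \<le> Cu" "\<And>x y. \<bar>u (x, y)\<bar> \<le> Cu * N y"
    unfolding u_def using conv_bound_N[OF slice_ok(1) assms(1)] by blast
  obtain Cp where Cp: "0 \<le> Cp" "\<And>x y. \<bar>p (x, y)\<bar> \<le> Cp * N y"
    unfolding p_def using conv_bound_N[OF slice_ok(3) assms(1)] by blast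
  have "\<exists>C. 0 \<le> C \<and> (\<forall>x y. \<bar>d e (x, y)\<bar> \<le> C * N y)" for e
    unfolding d_def using conv_bound_N[OF slice_ok(1) kd(1)] by metis
  then obtain Cd where Cd: "\<And>e. 0 \<le> Cd e" "\<And>e x y. \<bar>d e (x, y)\<bar> \<le> Cd e * N y" by metis
  have "\<exists>C. 0 \<le> C \<and> (\<forall>x y. \<bar>dd e e' (x, y)\<bar> \<le> C * N y)" for e e'
    unfolding dd_def using conv_bound_N[OF slice_ok(1) kd(2)] by metis
  then obtain Cdd where Cdd: "\<And>e e'. 0 \<le> Cdd e e'" "\<And>e e' x y. \<bar>dd e e' (x, y)\<bar> \<le> Cdd e e' * N y" by metis
  have f: "0 \<le> f x" "f x \<le> R\<^sup>2" for x using ball_cutoff_bounds[of R x] by (simp_all add: f_def)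
  have f0: "f x = 0" if "R \<le> norm x" for x using ball_cutoff_zero[of R x] that R by (simp add: f_def)
  have kb: "0 \<le> k y" for y by (simp add: k_def)
  have kR: "k y \<le> R" if "0 < y" for y using that R by (simp add: k_def)
  have R0: "0 < R" using R by simp
  have fi: "\<bar>f x\<bar> \<le> R\<^sup>2 * indicator (ball 0 R) x" "\<bar>(f x)\<^sup>2\<bar> \<le> R ^ 4 * indicator (ball 0 R) x"
     "\<bar>f x * (x \<bullet> e)\<bar> \<le> R\<^sup>2 * (R * norm e) * indicator (ball 0 R) x" for x e
  proof -
    show 1: "\<bar>f x\<bar> \<le> R\<^sup>2 * indicator (ball 0 R) x" using f[of x] f0[of x] by (cases "norm x < R") auto
    have "(f x)\<^sup>2 \<le> (R\<^sup>2)\<^sup>2" using f by (intro power_mono) auto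
    then show "\<bar>(f x)\<^sup>2\<bar> \<le> R ^ 4 * indicator (ball 0 R) x" using f0[of x] by (cases "norm x < R") auto
    show "\<bar>f x * (x \<bullet> e)\<bar> \<le> R\<^sup>2 * (R * norm e) * indicator (ball 0 R) x"
    proof (cases "norm x < R")
      case True
      have "\<bar>x \<bullet> e\<bar> \<le> R * norm e"
        using Cauchy_Schwarz_ineq2[of x e] True by (meson mult_right_mono norm_ge_zero less_imp_le order_trans)
      then have "\<bar>f x\<bar> * \<bar>x \<bullet> e\<bar> \<le> R\<^sup>2 * (R * norm e)"
        using f[of x] by (intro mult_mono) auto
      then show ?thesis using True by (simp add: abs_mult)
    qed (use f0 in simp)
  qed
  have mN: "0 \<le> m y * (N y)\<^sup>2" for y using m_pos[of y] by simp
  \<comment> \<open>every term occurring below is dominated by a constant times \<open>N\<^sup>2 m\<close> on a bounded set\<close>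
  have dom: "integrable M2 (\<lambda>X. c (snd X) * m (snd X) * (g (fst X) * F X * G X))"
    if [measurable]: "c \<in> borel_measurable borel" "g \<in> borel_measurable borel" "F \<in> borel_measurable M2" "G \<in> borel_measurable M2"
      and b: "\<And>y. 0 < y \<Longrightarrow> \<bar>c y\<bar> \<le> C1" "\<And>x. \<bar>g x\<bar> \<le> C2 * indicator (ball 0 R) x" "\<And>x y. \<bar>F (x, y)\<bar> \<le> C3 * N y"
        "\<And>x y. \<bar>G (x, y)\<bar> \<le> C4 * N y" for c :: "real \<Rightarrow> real" and g :: "'a \<Rightarrow> real" and F G :: "'a \<times> real \<Rightarrow> real" and C1 C2 C3 C4 :: real
  proof (rule dominated_integrable)
    fix x y
    show "\<bar>c (snd (x, y)) * m (snd (x, y)) * (g (fst (x, y)) * F (x, y) * G (x, y))\<bar>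
      \<le> C1 * C2 * C3 * C4 * (indicator (ball 0 R) x * ((N y)\<^sup>2 * m y))"
    proof (cases "y \<in> {0<..<\<tau>}")
      case True
      have t: "\<bar>g x * F (x, y) * G (x, y)\<bar> \<le> (C2 * indicator (ball 0 R) x) * C3 * C4 * (N y)\<^sup>2"
        by (rule triple_bound[OF b(2,3,4)])
      have c1: "\<bar>c y\<bar> \<le> C1" "0 \<le> C1" using b(1)[of y] True by auto
      have "\<bar>c y\<bar> * m y * \<bar>g x * F (x, y) * G (x, y)\<bar> \<le> C1 * m y * ((C2 * indicator (ball 0 R) x) * C3 * C4 * (N y)\<^sup>2)"
        using m_pos[of y] c1 t by (intro mult_mono) auto
      then show ?thesis using m_pos[of y] by (simp add: abs_mult ac_simps)
    next
      case False
      then have "F (x, y) = 0" using b(3)[of x y] N_zero[of y] by simp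
      then show ?thesis using N_zero[OF False] by simp
    qed
  qed measurable
  have cb: "\<bar>bb y * (k y)\<^sup>2\<bar> \<le> \<Lambda> * R\<^sup>2" "\<bar>bb y * (2 * k y)\<bar> \<le> \<Lambda> * (2 * R)"
     "\<bar>(k y)\<^sup>2 * aa e e' y\<bar> \<le> R\<^sup>2 * \<Lambda>" if "0 < y" for y e e'
  proof -
    have b: "\<bar>bb y\<bar> \<le> \<Lambda>"
      using bb_bounds[of y] \<Lambda> by (smt (verit) positive_imp_inverse_positive)
    have k2: "(k y)\<^sup>2 \<le> R\<^sup>2" using kb kR that by (intro power_mono) auto
    show "\<bar>bb y * (k y)\<^sup>2\<bar> \<le> \<Lambda> * R\<^sup>2" unfolding abs_mult using b k2 \<Lambda> by (intro mult_mono) auto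
    show "\<bar>bb y * (2 * k y)\<bar> \<le> \<Lambda> * (2 * R)" unfolding abs_mult using b kR[OF that] kb[of y] \<Lambda> by (intro mult_mono) auto
    show "\<bar>(k y)\<^sup>2 * aa e e' y\<bar> \<le> R\<^sup>2 * \<Lambda>" unfolding abs_mult using aa_bound[of e e' y] k2 \<Lambda> by (intro mult_mono) auto
  qed
  \<comment> \<open>\<open>T1 - T2\<close> is the flux times the vertical derivative of \<open>k\<^sup>2 u\<close>; \<open>T3\<close>, \<open>T4\<close>, \<open>T5\<close> arise when the horizontal derivative of \<open>f\<^sup>2 u d e'\<close> falls on the last factor, on \<open>u\<close> and on the cutoff\<close>
  define T1 where "T1 X = (bb (snd X) * (k (snd X))\<^sup>2) * m (snd X) * ((f (fst X))\<^sup>2 * p X * p X)" for X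
  define T2 where "T2 X = (bb (snd X) * (2 * k (snd X))) * m (snd X) * ((f (fst X))\<^sup>2 * p X * u X)" for X
  define T3 where "T3 e e' X = ((k (snd X))\<^sup>2 * aa e e' (snd X)) * m (snd X) * ((f (fst X))\<^sup>2 * u X * dd e e' X)" for e e' X
  define T4 where "T4 e e' X = ((k (snd X))\<^sup>2 * aa e e' (snd X)) * m (snd X) * ((f (fst X))\<^sup>2 * d e X * d e' X)" for e e' X
  define T5 where "T5 e e' X = ((k (snd X))\<^sup>2 * aa e e' (snd X)) * m (snd X) * ((- 4 * (f (fst X) * (fst X \<bullet> e))) * u X * d e' X)" for e e' X
  have g5: "\<bar>- 4 * (f x * (x \<bullet> e))\<bar> \<le> (4 * (R\<^sup>2 * (R * norm e))) * indicator (ball 0 R) x" for x e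
    using fi(3)[of x e] by (simp add: abs_mult)
  have iT: "integrable M2 T1" "integrable M2 T2" "integrable M2 (T3 e e')" "integrable M2 (T4 e e')" "integrable M2 (T5 e e')" for e e'
    unfolding T1_def T2_def T3_def T4_def T5_def
    by (rule dom[OF _ _ _ _ cb(1) fi(2) Cp(2) Cp(2)] dom[OF _ _ _ _ cb(2) fi(2) Cp(2) Cu(2)]
         dom[OF _ _ _ _ cb(3) fi(2) Cu(2) Cdd(2)] dom[OF _ _ _ _ cb(3) fi(2) Cd(2) Cd(2)]
         dom[OF _ _ _ _ cb(3) g5 Cu(2) Cd(2)]; measurable)+
  \<comment> \<open>testing the equation on each vertical line with \<open>f\<^sup>2 k\<^sup>2 u\<close>\<close>
  have A: "(LINT X|M2. T1 X - T2 X - (\<Sum>e\<in>Basis. \<Sum>e'\<in>Basis. T3 e e' X)) = 0"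
  proof -
    have int: "integrable M2 (\<lambda>X. T1 X - T2 X - (\<Sum>e\<in>Basis. \<Sum>e'\<in>Basis. T3 e e' X))"
      using iT by (intro Bochner_Integration.integrable_diff Bochner_Integration.integrable_sum) auto
    have "(LINT y|lborel. T1 (x, y) - T2 (x, y) - (\<Sum>e\<in>Basis. \<Sum>e'\<in>Basis. T3 e e' (x, y))) = 0"
      if sec: "integrable lborel (\<lambda>y. T1 (x, y) - T2 (x, y))" "integrable lborel (\<lambda>y. \<Sum>e\<in>Basis. \<Sum>e'\<in>Basis. T3 e e' (x, y))" for x
    proof (cases "norm x < R")
      case False
      then have "f x = 0" using f0 by simp
      then show ?thesis by (simp add: T1_def T2_def T3_def)
    next
      case True
      then have x: "norm x + \<epsilon> < \<tau>" using R by linarith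
      obtain c where c: "AE y in lborel. y \<in> {0<..<\<tau>} \<longrightarrow> u (x, y) = c + cum (\<lambda>s. p (x, s)) y"
        using conv_absolutely_continuous[OF assms(1) x] unfolding u_def p_def by blast
      note fl = conv_flux[OF assms(1) x, folded p_def]
      have ip: "integrable lborel (\<lambda>y. p (x, y))" and iu: "integrable lborel (\<lambda>y. u (x, y))"
        unfolding p_def u_def
        using conv_line_integrable[OF slice_ok(1) assms(1), of "\<lambda>_. 1" x] conv_line_integrable[OF slice_ok(3) assms(1), of "\<lambda>_. 1" x]
          N_integrable by simp_all
      have z: "p (x, y) = 0" "u (x, y) = 0" "dd e e' (x, y) = 0" if "y \<notin> {0<..<\<tau>}" for y e e'
        unfolding p_def u_def dd_def
        using conv_zero_outside[OF slice_ok(3) assms(1) that] conv_zero_outside[OF slice_ok(1) assms(1) that]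
          conv_zero_outside[OF slice_ok(1) kd(2) that] by auto
      have hz: "m y * hess \<kappa> (x, y) = 0" if "y \<notin> {0<..<\<tau>}" for y
        using z(3)[OF that] by (simp add: hess_def dd_def)
      have pz: "m y * bb y * p (x, y) = 0" if "y \<notin> {0<..<\<tau>}" for y
        using z(1)[OF that] by simp
      have pm: "(\<lambda>y. m y * bb y * p (x, y)) \<in> borel_measurable borel"
        using borel_measurable_integrable[OF ip] by simp
      have "(LINT y|lborel. (m y * bb y * p (x, y)) * ((max 0 (R - y))\<^sup>2 * p (x, y) - 2 * max 0 (R - y) * u (x, y))) =
         (LINT y|lborel. (m y * hess \<kappa> (x, y)) * ((max 0 (R - y))\<^sup>2 * u (x, y)))"
        by (rule flux_tested_with_cutoff[OF R0 R(4) ip z(1) hess_line_integrable[OF assms(1)] hz iu z(2) pz pm c fl])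
      then have "(f x)\<^sup>2 * (LINT y|lborel. (m y * bb y * p (x, y)) * ((k y)\<^sup>2 * p (x, y) - 2 * k y * u (x, y))) =
         (f x)\<^sup>2 * (LINT y|lborel. (m y * hess \<kappa> (x, y)) * ((k y)\<^sup>2 * u (x, y)))"
        unfolding k_def by simp
      moreover have "(LINT y|lborel. T1 (x, y) - T2 (x, y)) =
          (f x)\<^sup>2 * (LINT y|lborel. (m y * bb y * p (x, y)) * ((k y)\<^sup>2 * p (x, y) - 2 * k y * u (x, y)))"
        by (subst integral_mult_right_zero[symmetric]) (simp add: T1_def T2_def algebra_simps power2_eq_square)
      moreover have "(LINT y|lborel. (\<Sum>e\<in>Basis. \<Sum>e'\<in>Basis. T3 e e' (x, y))) =
          (f x)\<^sup>2 * (LINT y|lborel. (m y * hess \<kappa> (x, y)) * ((k y)\<^sup>2 * u (x, y)))"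
      proof -
        have "(\<Sum>e\<in>Basis. \<Sum>e'\<in>Basis. T3 e e' (x, y)) = (f x)\<^sup>2 * ((m y * hess \<kappa> (x, y)) * ((k y)\<^sup>2 * u (x, y)))" for y
          by (simp add: T3_def hess_def dd_def sum_distrib_left sum_distrib_right ac_simps)
        then show ?thesis by (simp only: integral_mult_right_zero)
      qed
      ultimately show ?thesis using sec by simp
    qed
    moreover have "AE x in lborel. integrable lborel (\<lambda>y. T1 (x, y) - T2 (x, y))"
      using lborel_pair.AE_integrable_fst'[OF Bochner_Integration.integrable_diff[OF iT(1,2)]] by simp
    moreover have "AE x in lborel. integrable lborel (\<lambda>y. \<Sum>e\<in>Basis. \<Sum>e'\<in>Basis. T3 e e' (x, y))"
      using lborel_pair.AE_integrable_fst'[of "\<lambda>X. \<Sum>e\<in>Basis. \<Sum>e'\<in>Basis. T3 e e' X"] iT(3)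
      by (simp add: Bochner_Integration.integrable_sum)
    ultimately have "AE x in lborel. (LINT y|lborel. T1 (x, y) - T2 (x, y) - (\<Sum>e\<in>Basis. \<Sum>e'\<in>Basis. T3 e e' (x, y))) = 0"
      by (auto elim: eventually_elim2)
    then have "(LINT x|lborel. (LINT y|lborel. T1 (x, y) - T2 (x, y) - (\<Sum>e\<in>Basis. \<Sum>e'\<in>Basis. T3 e e' (x, y)))) = 0"
      by (rule integral_eq_zero_AE)
    then show ?thesis using lborel_pair.integral_fst'[OF int] by simp
  qed
  \<comment> \<open>integration by parts on each horizontal slice\<close>
  have B: "(LINT X|M2. T5 e e' X + T4 e e' X + T3 e e' X) = 0" if e: "e \<in> Basis" for e e'
  proof -
    have int: "integrable M2 (\<lambda>X. T5 e e' X + T4 e e' X + T3 e e' X)"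
      by (intro Bochner_Integration.integrable_add iT)
    have "(LINT x|lborel. T5 e e' (x, y) + T4 e e' (x, y) + T3 e e' (x, y)) = 0" for y
    proof -
      define h where "h x = (f x)\<^sup>2 * u (x, y) * d e' (x, y)" for x
      define h' where "h' x = - 4 * (f x * (x \<bullet> e)) * u (x, y) * d e' (x, y) + (f x)\<^sup>2 * d e (x, y) * d e' (x, y)
          + (f x)\<^sup>2 * u (x, y) * dd e e' (x, y)" for x
      have sm [measurable]: "(\<lambda>x. u (x, y)) \<in> borel_measurable borel" "(\<lambda>x. d e (x, y)) \<in> borel_measurable borel"
         "(\<lambda>x. dd e e' (x, y)) \<in> borel_measurable borel" for e e'
        unfolding u_def d_def dd_def
        by (rule conv_slice_measurable V_meas kernel_measurable[OF kd(1)] kernel_measurable[OF kd(2)] kernel_measurable[OF assms(1)])+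
      have ib: "\<bar>indicator (ball 0 R) (x::'a) :: real\<bar> \<le> 1" for x by (simp add: indicator_def)
      have b1: "\<bar>(f x)\<^sup>2\<bar> \<le> R ^ 4" "\<bar>- 4 * (f x * (x \<bullet> e))\<bar> \<le> 4 * (R\<^sup>2 * (R * norm e))" for x
      proof -
        show "\<bar>(f x)\<^sup>2\<bar> \<le> R ^ 4" using fi(2)[of x] R0 by (cases "x \<in> ball 0 R") auto
        show "\<bar>- 4 * (f x * (x \<bullet> e))\<bar> \<le> 4 * (R\<^sup>2 * (R * norm e))" using g5[of x e] R0 by (cases "x \<in> ball 0 R") auto
      qed
      define C where "C = (R ^ 4 * Cu * Cd e' * (N y)\<^sup>2) + (4 * (R\<^sup>2 * (R * norm e)) * Cu * Cd e' * (N y)\<^sup>2)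
        + (R ^ 4 * Cd e * Cd e' * (N y)\<^sup>2) + (R ^ 4 * Cu * Cdd e e' * (N y)\<^sup>2)"
      have "(LINT x|lborel. h' x) = 0"
      proof (rule integral_directional_derivative_eq_0)
        show "h \<in> borel_measurable borel" "h' \<in> borel_measurable borel"
          unfolding h_def[abs_def] h'_def[abs_def] by measurable
        show "((\<lambda>t. h (x + t *\<^sub>R e)) has_real_derivative h' x) (at 0)" for x
        proof -
          have 1: "((\<lambda>t. (f (x + t *\<^sub>R e))\<^sup>2) has_real_derivative - 4 * f x * (x \<bullet> e)) (at 0)"
            unfolding f_def by (rule ball_cutoff_square_derivative)
          have 2: "((\<lambda>t. u (x + t *\<^sub>R e, y)) has_real_derivative d e (x, y)) (at 0)"
            using conv_has_derivative[OF slice_okD(2)[OF slice_ok(1)] assms(1), of x e y 0] by (simp add: u_def d_def)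
          have 3: "((\<lambda>t. d e' (x + t *\<^sub>R e, y)) has_real_derivative dd e e' (x, y)) (at 0)"
            using conv_has_derivative[OF slice_okD(2)[OF slice_ok(1)] kernel_dirderiv[OF assms(1), of e'], of x e y 0] by (simp add: d_def dd_def)
          show ?thesis
            unfolding h_def h'_def using DERIV_mult[OF DERIV_mult[OF 1 2] 3] by (simp add: algebra_simps)
        qed
        have t: "\<bar>(f x)\<^sup>2 * u (x, y) * d e' (x, y)\<bar> \<le> R ^ 4 * Cu * Cd e' * (N y)\<^sup>2"
          "\<bar>- 4 * (f x * (x \<bullet> e)) * u (x, y) * d e' (x, y)\<bar> \<le> 4 * (R\<^sup>2 * (R * norm e)) * Cu * Cd e' * (N y)\<^sup>2"
          "\<bar>(f x)\<^sup>2 * d e (x, y) * d e' (x, y)\<bar> \<le> R ^ 4 * Cd e * Cd e' * (N y)\<^sup>2"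
          "\<bar>(f x)\<^sup>2 * u (x, y) * dd e e' (x, y)\<bar> \<le> R ^ 4 * Cu * Cdd e e' * (N y)\<^sup>2" for x
          by (rule triple_bound[OF b1(1) Cu(2) Cd(2)] triple_bound[OF b1(2) Cu(2) Cd(2)]
              triple_bound[OF b1(1) Cd(2) Cd(2)] triple_bound[OF b1(1) Cu(2) Cdd(2)])+
        have "0 \<le> R ^ 4 * Cu * Cd e' * (N y)\<^sup>2" "0 \<le> 4 * (R\<^sup>2 * (R * norm e)) * Cu * Cd e' * (N y)\<^sup>2"
          "0 \<le> R ^ 4 * Cd e * Cd e' * (N y)\<^sup>2" "0 \<le> R ^ 4 * Cu * Cdd e e' * (N y)\<^sup>2"
          using R0 Cu(1) Cd(1) Cdd(1) by (intro mult_nonneg_nonneg; simp)+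
        then show "\<bar>h x\<bar> \<le> C" "\<bar>h' x\<bar> \<le> C" for x
          using t[of x] unfolding h_def h'_def C_def by linarith+
        show "h x = 0" if "norm x > R" for x using f0[of x] that by (simp add: h_def)
      qed
      moreover have "T5 e e' (x, y) + T4 e e' (x, y) + T3 e e' (x, y) = ((k y)\<^sup>2 * aa e e' y) * m y * h' x" for x
        by (simp add: T3_def T4_def T5_def h'_def algebra_simps)
      ultimately show ?thesis by simp
    qed
    then show ?thesis
      using lborel_pair.integral_snd[of "\<lambda>x y. T5 e e' (x, y) + T4 e e' (x, y) + T3 e e' (x, y)"] int
      by (simp add: case_prod_beta')
  qed
  \<comment> \<open>the second derivatives \<open>T3\<close> cancel when the two identities are added\<close>
  define H where "H X = T1 X - T2 X + (\<Sum>e\<in>Basis. \<Sum>e'\<in>Basis. T5 e e' X + T4 e e' X)" for X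
  have iH: "integrable M2 H"
    unfolding H_def using iT by (intro Bochner_Integration.integrable_add Bochner_Integration.integrable_diff Bochner_Integration.integrable_sum) auto
  have H0: "(LINT X|M2. H X) = 0"
  proof -
    have "H X = (T1 X - T2 X - (\<Sum>e\<in>Basis. \<Sum>e'\<in>Basis. T3 e e' X)) + (\<Sum>e\<in>Basis. \<Sum>e'\<in>Basis. T5 e e' X + T4 e e' X + T3 e e' X)" for X
      by (simp add: H_def sum.distrib)
    moreover have "integrable M2 (\<lambda>X. T1 X - T2 X - (\<Sum>e\<in>Basis. \<Sum>e'\<in>Basis. T3 e e' X))"
      using iT by (intro Bochner_Integration.integrable_diff Bochner_Integration.integrable_sum) auto
    moreover have "integrable M2 (\<lambda>X. T5 e e' X + T4 e e' X + T3 e e' X)" for e e'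
      by (intro Bochner_Integration.integrable_add iT)
    ultimately show ?thesis using A B by (simp add: Bochner_Integration.integral_add Bochner_Integration.integral_sum Bochner_Integration.integrable_sum)
  qed
  define S where "S X = (\<Sum>e\<in>Basis. (d e X)\<^sup>2)" for X
  define c1 where "c1 = 1 / (2 * \<Lambda>) * ((R - r)\<^sup>2 * (R\<^sup>2 * (R - r)\<^sup>2))"
  define c2 where "c2 = 10 * \<Lambda> ^ 3 * DIM('a) ^ 4 * R ^ 4"
  have pw: "c1 * (indicator (cyl r) X * (((p X)\<^sup>2 + S X) * m (snd X))) - c2 * (indicator (cyl R) X * ((u X)\<^sup>2 * m (snd X))) \<le> H X" for X
  proof -
    obtain x y where X: "X = (x, y)" by force
    show ?thesis
    proof (cases "X \<in> cyl R")
      case False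
      then consider "y \<notin> {0<..<\<tau>}" | "R \<le> norm x" | "R \<le> y" using R by (auto simp: X cyl_def not_less)
      then have "H X = 0"
      proof cases
        case 1
        then have "N y = 0" using N_zero by simp
        then have "p X = 0" "u X = 0" "\<And>e. d e X = 0" using Cp(2)[of x y] Cu(2)[of x y] Cd(2)[of _ x y] by (auto simp: X)
        then show ?thesis by (simp add: H_def T1_def T2_def T4_def T5_def)
      next
        case 2
        then have "f x = 0" using f0 by simp
        then show ?thesis by (simp add: H_def T1_def T2_def T4_def T5_def X)
      next
        case 3
        then have "k y = 0" by (simp add: k_def)
        then show ?thesis by (simp add: H_def T1_def T2_def T4_def T5_def X)
      qed
      moreover have "X \<notin> cyl r" using False cyl_mono[of r R] R by auto
      ultimately show ?thesis using False by simp
    next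
      case True
      then have xy: "norm x < R" "0 < y" "y < R" by (auto simp: X cyl_def)
      define \<xi> where "\<xi> = (\<Sum>e\<in>Basis. d e (x, y) *\<^sub>R e)"
      have \<xi>: "\<xi> \<bullet> e = d e (x, y)" if "e \<in> Basis" for e using that by (simp add: \<xi>_def inner_sum_left_Basis)
      define s where "s = norm \<xi>"
      have s2: "s\<^sup>2 = S (x, y)"
      proof -
        have "s\<^sup>2 = \<xi> \<bullet> \<xi>" by (simp add: s_def power2_norm_eq_inner)
        also have "\<dots> = (\<Sum>e\<in>Basis. (\<xi> \<bullet> e) * (\<xi> \<bullet> e))" by (rule euclidean_inner)
        also have "\<dots> = S (x, y)" by (simp add: S_def \<xi> power2_eq_square)
        finally show ?thesis .
      qed
      define Bq where "Bq = (\<Sum>e\<in>Basis. \<Sum>e'\<in>Basis. aa e e' y * d e (x, y) * d e' (x, y))"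
      define Aq where "Aq = (\<Sum>e\<in>Basis. \<Sum>e'\<in>Basis. aa e e' y * (- 4 * (f x * (x \<bullet> e))) * u (x, y) * d e' (x, y))"
      have HX: "H X = m y * (bb y * p (x, y) * ((k y)\<^sup>2 * p (x, y) - 2 * k y * u (x, y)) * (f x)\<^sup>2 + (k y)\<^sup>2 * (Aq + (f x)\<^sup>2 * Bq))"
        by (simp add: H_def T1_def T2_def T4_def T5_def X Aq_def Bq_def sum.distrib sum_subtractf sum_negf sum_distrib_left algebra_simps power2_eq_square)
      have B1: "s\<^sup>2 / \<Lambda> \<le> Bq"
        using aa_elliptic[of \<xi> y] by (simp add: Bq_def s_def \<xi> divide_inverse mult.commute)
      have A1: "\<bar>Aq\<bar> \<le> \<Lambda> * 4 * f x * (real DIM('a))\<^sup>2 * R * \<bar>u (x, y)\<bar> * s"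
      proof -
        have "\<bar>Aq\<bar> \<le> (\<Sum>e\<in>(Basis::'a set). \<Sum>e'\<in>(Basis::'a set). \<Lambda> * (4 * (f x * R)) * \<bar>u (x, y)\<bar> * s)"
          unfolding Aq_def
        proof (rule order_trans[OF sum_abs], rule sum_mono, rule order_trans[OF sum_abs], rule sum_mono)
          fix e e' :: 'a assume e: "e \<in> Basis" "e' \<in> Basis"
          have "\<bar>x \<bullet> e\<bar> \<le> R" using Basis_le_norm[OF e(1), of x] xy by simp
          then have 1: "\<bar>- 4 * (f x * (x \<bullet> e))\<bar> \<le> 4 * (f x * R)"
            using f(1)[of x] by (simp add: abs_mult mult_left_mono)
          have 2: "\<bar>d e' (x, y)\<bar> \<le> s" using Basis_le_norm[OF e(2), of \<xi>] e by (simp add: \<xi> s_def)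
          show "\<bar>aa e e' y * (- 4 * (f x * (x \<bullet> e))) * u (x, y) * d e' (x, y)\<bar> \<le> \<Lambda> * (4 * (f x * R)) * \<bar>u (x, y)\<bar> * s"
            unfolding abs_mult[of _ "d e' (x, y)"] abs_mult[of _ "u (x, y)"] abs_mult[of "aa e e' y"]
            using 1 2 aa_bound[of e e' y] \<Lambda> f(1)[of x] R0 by (intro mult_mono) auto
        qed
        also have "\<dots> = \<Lambda> * 4 * f x * (real DIM('a))\<^sup>2 * R * \<bar>u (x, y)\<bar> * s"
          by (simp add: power2_eq_square)
        finally show ?thesis .
      qed
      have n1: "1 \<le> real DIM('a)" using DIM_positive[where 'a='a] by linarith
      note key = caccioppoli_pointwise[OF \<Lambda> kb[of y] kR[OF xy(2)] f(1)[of x] f(2)[of x] n1 A1 B1 bb_bounds[of y], of "p (x, y)"]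
      have lower: "c1 * (indicator (cyl r) X * ((p X)\<^sup>2 + S X)) \<le> (1 / (2 * \<Lambda>)) * (k y)\<^sup>2 * (f x)\<^sup>2 * ((p (x, y))\<^sup>2 + s\<^sup>2)"
      proof (cases "X \<in> cyl r")
        case True
        then have xr: "norm x < r" "y < r" by (auto simp: X cyl_def)
        have "(R - r)\<^sup>2 \<le> (k y)\<^sup>2" using xr R by (intro power_mono) (auto simp: k_def)
        moreover have "R * (R - r) \<le> f x"
        proof -
          have "(norm x)\<^sup>2 \<le> R * r"
            using xr R by (simp add: power2_eq_square mult_mono)
          then show ?thesis by (simp add: f_def ball_cutoff_def power2_eq_square algebra_simps)
        qed
        then have "R\<^sup>2 * (R - r)\<^sup>2 \<le> (f x)\<^sup>2"
          using R by (subst power_mult_distrib[symmetric]) (intro power_mono, auto)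
        ultimately have "(R - r)\<^sup>2 * (R\<^sup>2 * (R - r)\<^sup>2) \<le> (k y)\<^sup>2 * (f x)\<^sup>2" by (intro mult_mono) auto
        then have "1 / (2 * \<Lambda>) * ((R - r)\<^sup>2 * (R\<^sup>2 * (R - r)\<^sup>2)) \<le> 1 / (2 * \<Lambda>) * ((k y)\<^sup>2 * (f x)\<^sup>2)"
          using \<Lambda> by (intro mult_left_mono) auto
        then have "c1 * ((p (x, y))\<^sup>2 + s\<^sup>2) \<le> 1 / (2 * \<Lambda>) * ((k y)\<^sup>2 * (f x)\<^sup>2) * ((p (x, y))\<^sup>2 + s\<^sup>2)"
          unfolding c1_def by (intro mult_right_mono) auto
        then show ?thesis using True by (simp add: X s2 ac_simps)
      qed (use \<Lambda> in simp)
      have "c1 * (indicator (cyl r) X * ((p X)\<^sup>2 + S X)) - c2 * (u X)\<^sup>2 \<le>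
         bb y * p (x, y) * ((k y)\<^sup>2 * p (x, y) - 2 * k y * u (x, y)) * (f x)\<^sup>2 + (k y)\<^sup>2 * (Aq + (f x)\<^sup>2 * Bq)"
        using key lower by (simp add: c2_def X)
      from mult_left_mono[OF this, of "m y"] m_pos[of y] True show ?thesis
        unfolding HX by (simp add: X algebra_simps)
    qed
  qed
  have iE: "integrable M2 (\<lambda>X. indicator (cyl r) X * ((p X)\<^sup>2 * m (snd X)))"
     "integrable M2 (\<lambda>X. indicator (cyl r) X * ((d e X)\<^sup>2 * m (snd X)))"
     "integrable M2 (\<lambda>X. indicator (cyl R) X * ((u X)\<^sup>2 * m (snd X)))" for e
    unfolding p_def d_def u_def using energy_integrable slice_ok assms(1) kd(1) by blast+
  have split: "indicator (cyl r) X * (((p X)\<^sup>2 + S X) * m (snd X)) =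
     indicator (cyl r) X * ((p X)\<^sup>2 * m (snd X)) + (\<Sum>e\<in>Basis. indicator (cyl r) X * ((d e X)\<^sup>2 * m (snd X)))" for X
    by (simp add: S_def sum_distrib_left sum_distrib_right distrib_left distrib_right)
  define E where "E = energy r p + (\<Sum>e\<in>Basis. energy r (d e))"
  have iS: "integrable M2 (\<lambda>X. indicator (cyl r) X * (((p X)\<^sup>2 + S X) * m (snd X)))"
    unfolding split using iE by (intro Bochner_Integration.integrable_add Bochner_Integration.integrable_sum) auto
  have ES: "(LINT X|M2. indicator (cyl r) X * (((p X)\<^sup>2 + S X) * m (snd X))) = E"
    unfolding split E_def energy_def
    by (simp only: Bochner_Integration.integral_add[OF iE(1) Bochner_Integration.integrable_sum[OF iE(2)]]
        Bochner_Integration.integral_sum[OF iE(2)])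
  have "c1 * E - c2 * energy R u = (LINT X|M2. c1 * (indicator (cyl r) X * (((p X)\<^sup>2 + S X) * m (snd X))) - c2 * (indicator (cyl R) X * ((u X)\<^sup>2 * m (snd X))))"
    using iS iE(3) ES by (simp add: energy_def)
  also have "\<dots> \<le> (LINT X|M2. H X)"
    using iS iE(3) by (intro integral_mono iH pw Bochner_Integration.integrable_diff integrable_mult_right)
  finally have fin: "c1 * E \<le> c2 * energy R u" using H0 by simp
  have pos: "0 < R - r" "0 < \<Lambda>" using R \<Lambda> by auto
  have "c1 > 0" using pos R0 by (simp add: c1_def)
  then have "E \<le> c2 / c1 * energy R u" using fin by (simp add: field_simps)
  also have "c2 / c1 = 20 * DIM('a) ^ 4 * \<Lambda> ^ 4 * R\<^sup>2 / (R - r) ^ 4"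
    using pos R0 by (simp add: c1_def c2_def field_simps) (simp add: power2_eq_square power3_eq_cube power4_eq_xxxx)
  finally show ?thesis unfolding E_def u_def p_def d_def .
qed

definition iter_deriv :: "'a list \<Rightarrow> ('a \<Rightarrow> real) \<Rightarrow> 'a \<Rightarrow> real" where
  "iter_deriv es \<kappa> = foldr dirderiv es \<kappa>"

lemma iter_deriv_simps [simp]: "iter_deriv [] \<kappa> = \<kappa>" "iter_deriv (e # es) \<kappa> = dirderiv e (iter_deriv es \<kappa>)"
  by (simp_all add: iter_deriv_def)

lemma kernel_iter_deriv: "kernel \<epsilon> \<kappa> \<Longrightarrow> kernel \<epsilon> (iter_deriv es \<kappa>)"
  by (induction es) (auto intro: kernel_dirderiv)

text \<open>
  For a gap \<open>\<delta>\<close> between the cylinders that is a fixed fraction of \<open>R\<close>, the constant has the expected size \<open>1 / \<delta>\<^sup>2\<close>.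
\<close>

lemma caccioppoli_step:
  assumes k: "kernel \<epsilon> \<kappa>" and \<delta>: "0 < \<delta>" "\<delta> < R" "R \<le> L * \<delta>" and R: "R + \<epsilon> < \<tau>" "R \<le> \<tau>" and e: "e \<in> Basis"
  shows "energy (R - \<delta>) (conv V (dirderiv e \<kappa>)) \<le> 20 * DIM('a) ^ 4 * \<Lambda> ^ 4 * L\<^sup>2 / \<delta>\<^sup>2 * energy R (conv V \<kappa>)"
    "energy (R - \<delta>) (conv p0 \<kappa>) \<le> 20 * DIM('a) ^ 4 * \<Lambda> ^ 4 * L\<^sup>2 / \<delta>\<^sup>2 * energy R (conv V \<kappa>)"
proof -
  let ?S = "\<Sum>e\<in>Basis. energy (R - \<delta>) (conv V (dirderiv e \<kappa>))"
  have "energy (R - \<delta>) (conv p0 \<kappa>) + ?S \<le> 20 * DIM('a) ^ 4 * \<Lambda> ^ 4 * R\<^sup>2 / (R - (R - \<delta>)) ^ 4 * energy R (conv V \<kappa>)"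
    by (rule caccioppoli[OF k _ _ R]) (use \<delta> in auto)
  also have "\<dots> \<le> 20 * DIM('a) ^ 4 * \<Lambda> ^ 4 * L\<^sup>2 / \<delta>\<^sup>2 * energy R (conv V \<kappa>)"
  proof (intro mult_right_mono energy_nonneg)
    have "R\<^sup>2 \<le> (L * \<delta>)\<^sup>2" using \<delta> by (intro power_mono) auto
    then have "R\<^sup>2 / \<delta> ^ 4 \<le> (L * \<delta>)\<^sup>2 / \<delta> ^ 4" by (rule divide_right_mono) simp
    also have "\<dots> = L\<^sup>2 / \<delta>\<^sup>2" using \<delta> by (simp add: power_mult_distrib field_simps power2_eq_square power4_eq_xxxx)
    finally have 1: "R\<^sup>2 / \<delta> ^ 4 \<le> L\<^sup>2 / \<delta>\<^sup>2" .
    have "20 * DIM('a) ^ 4 * \<Lambda> ^ 4 * (R\<^sup>2 / \<delta> ^ 4) \<le> 20 * DIM('a) ^ 4 * \<Lambda> ^ 4 * (L\<^sup>2 / \<delta>\<^sup>2)"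
      by (intro mult_left_mono 1) simp
    then show "20 * DIM('a) ^ 4 * \<Lambda> ^ 4 * R\<^sup>2 / (R - (R - \<delta>)) ^ 4 \<le> 20 * DIM('a) ^ 4 * \<Lambda> ^ 4 * L\<^sup>2 / \<delta>\<^sup>2" by simp
  qed
  finally have le: "energy (R - \<delta>) (conv p0 \<kappa>) + ?S \<le> 20 * DIM('a) ^ 4 * \<Lambda> ^ 4 * L\<^sup>2 / \<delta>\<^sup>2 * energy R (conv V \<kappa>)" .
  have "energy (R - \<delta>) (conv V (dirderiv e \<kappa>)) \<le> ?S"
    using e by (intro member_le_sum energy_nonneg) auto
  then show "energy (R - \<delta>) (conv V (dirderiv e \<kappa>)) \<le> 20 * DIM('a) ^ 4 * \<Lambda> ^ 4 * L\<^sup>2 / \<delta>\<^sup>2 * energy R (conv V \<kappa>)"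
    using le energy_nonneg[of "R - \<delta>" "conv p0 \<kappa>"] by linarith
  have "0 \<le> ?S" by (intro sum_nonneg energy_nonneg)
  then show "energy (R - \<delta>) (conv p0 \<kappa>) \<le> 20 * DIM('a) ^ 4 * \<Lambda> ^ 4 * L\<^sup>2 / \<delta>\<^sup>2 * energy R (conv V \<kappa>)"
    using le by linarith
qed

text \<open>
  Horizontal derivatives of the mollified solution are mollifications with differentiated kernels, so
  the Caccioppoli inequality applies to each of them. Every derivative costs one layer of width
  \<open>\<delta>\<close>.
\<close>

lemma iterated_caccioppoli:
  fixes R \<delta> L D :: real
  assumes k: "kernel \<epsilon> \<kappa>" and \<delta>: "0 < \<delta>" "R \<le> L * \<delta>" and R: "R + \<epsilon> < \<tau>" "R \<le> \<tau>"
    and D: "D = 20 * DIM('a) ^ 4 * \<Lambda> ^ 4 * L\<^sup>2 / \<delta>\<^sup>2"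
  shows "set es \<subseteq> Basis \<Longrightarrow> length es * \<delta> < R \<Longrightarrow>
      energy (R - length es * \<delta>) (conv V (iter_deriv es \<kappa>)) \<le> D ^ length es * energy R (conv V \<kappa>)"
    and "set es \<subseteq> Basis \<Longrightarrow> Suc (length es) * \<delta> < R \<Longrightarrow>
      energy (R - Suc (length es) * \<delta>) (conv p0 (iter_deriv es \<kappa>)) \<le> D ^ Suc (length es) * energy R (conv V \<kappa>)"
proof -
  have D0: "0 \<le> D" using D by simp
  show *: "energy (R - length es * \<delta>) (conv V (iter_deriv es \<kappa>)) \<le> D ^ length es * energy R (conv V \<kappa>)"
    if "set es \<subseteq> Basis" "length es * \<delta> < R" for es using that
  proof (induction es)
    case (Cons e es)
    have lt: "length es * \<delta> < R - \<delta>" using Cons.prems by (simp add: algebra_simps)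
    define R' where "R' = R - length es * \<delta>"
    have R': "\<delta> < R'" "R' \<le> L * \<delta>" "R' + \<epsilon> < \<tau>" "R' \<le> \<tau>"
    proof -
      have "0 \<le> length es * \<delta>" using \<delta> by simp
      then show "\<delta> < R'" "R' \<le> L * \<delta>" "R' + \<epsilon> < \<tau>" "R' \<le> \<tau>" using lt R \<delta> unfolding R'_def by linarith+
    qed
    have "energy (R' - \<delta>) (conv V (dirderiv e (iter_deriv es \<kappa>))) \<le> D * energy R' (conv V (iter_deriv es \<kappa>))"
      unfolding D by (rule caccioppoli_step(1)[OF kernel_iter_deriv[OF k] \<delta>(1) R']) (use Cons.prems in auto)
    also have "\<dots> \<le> D * (D ^ length es * energy R (conv V \<kappa>))"
      unfolding R'_def using Cons lt \<delta> by (intro mult_left_mono Cons.IH D0) auto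
    finally show ?case by (simp add: R'_def algebra_simps)
  qed simp
  assume es: "set es \<subseteq> Basis" "Suc (length es) * \<delta> < R"
  have lt: "length es * \<delta> < R - \<delta>" using es by (simp add: algebra_simps)
  define R' where "R' = R - length es * \<delta>"
  have R': "\<delta> < R'" "R' \<le> L * \<delta>" "R' + \<epsilon> < \<tau>" "R' \<le> \<tau>"
  proof -
    have "0 \<le> length es * \<delta>" using \<delta> by simp
    then show "\<delta> < R'" "R' \<le> L * \<delta>" "R' + \<epsilon> < \<tau>" "R' \<le> \<tau>" using lt R \<delta> unfolding R'_def by linarith+
  qed
  obtain e :: 'a where e: "e \<in> Basis" using nonempty_Basis by blast
  have "energy (R' - \<delta>) (conv p0 (iter_deriv es \<kappa>)) \<le> D * energy R' (conv V (iter_deriv es \<kappa>))"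
    unfolding D by (rule caccioppoli_step(2)[OF kernel_iter_deriv[OF k] \<delta>(1) R' e])
  also have "\<dots> \<le> D * (D ^ length es * energy R (conv V \<kappa>))"
    unfolding R'_def using es lt \<delta> by (intro mult_left_mono * D0) auto
  finally show "energy (R - Suc (length es) * \<delta>) (conv p0 (iter_deriv es \<kappa>)) \<le> D ^ Suc (length es) * energy R (conv V \<kappa>)"
    by (simp add: R'_def algebra_simps)
qed

end

section \<open>Averaged Taylor expansion in the horizontal variables\<close>

lemma Cauchy_Schwarz_integral:
  fixes f g :: "'b \<Rightarrow> real"
  assumes [measurable]: "f \<in> borel_measurable M" "g \<in> borel_measurable M"
    and f: "integrable M (\<lambda>x. (f x)\<^sup>2)" and g: "integrable M (\<lambda>x. (g x)\<^sup>2)"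
  shows "integrable M (\<lambda>x. f x * g x)"
    "(LINT x|M. \<bar>f x * g x\<bar>)\<^sup>2 \<le> (LINT x|M. (f x)\<^sup>2) * (LINT x|M. (g x)\<^sup>2)"
proof -
  show fg: "integrable M (\<lambda>x. f x * g x)"
  proof (rule Bochner_Integration.integrable_bound)
    show "integrable M (\<lambda>x. (f x)\<^sup>2 + (g x)\<^sup>2)" using f g by simp
    show "AE x in M. norm (f x * g x) \<le> norm ((f x)\<^sup>2 + (g x)\<^sup>2)"
    proof (intro AE_I2)
      fix x
      have "0 \<le> (\<bar>f x\<bar> - \<bar>g x\<bar>)\<^sup>2" by simp
      then have "2 * (\<bar>f x\<bar> * \<bar>g x\<bar>) \<le> (f x)\<^sup>2 + (g x)\<^sup>2" by (simp add: power2_diff)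
      moreover have "0 \<le> \<bar>f x\<bar> * \<bar>g x\<bar>" by simp
      ultimately have "\<bar>f x\<bar> * \<bar>g x\<bar> \<le> (f x)\<^sup>2 + (g x)\<^sup>2" by linarith
      then show "norm (f x * g x) \<le> norm ((f x)\<^sup>2 + (g x)\<^sup>2)" by (simp add: abs_mult)
    qed
  qed simp
  define A where "A = (LINT x|M. (f x)\<^sup>2)"
  define B where "B = (LINT x|M. (g x)\<^sup>2)"
  define I where "I = (LINT x|M. \<bar>f x * g x\<bar>)"
  have quad: "0 \<le> A - 2 * t * I + t\<^sup>2 * B" for t
  proof -
    have "0 \<le> (LINT x|M. (f x)\<^sup>2 - 2 * t * \<bar>f x * g x\<bar> + t\<^sup>2 * (g x)\<^sup>2)"
    proof (rule Bochner_Integration.integral_nonneg)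
      fix x
      have "(f x)\<^sup>2 - 2 * t * \<bar>f x * g x\<bar> + t\<^sup>2 * (g x)\<^sup>2 = (\<bar>f x\<bar> - t * \<bar>g x\<bar>)\<^sup>2"
        by (simp add: power2_diff power_mult_distrib abs_mult)
      then show "0 \<le> (f x)\<^sup>2 - 2 * t * \<bar>f x * g x\<bar> + t\<^sup>2 * (g x)\<^sup>2" by simp
    qed
    also have "\<dots> = A - 2 * t * I + t\<^sup>2 * B"
      using f g fg by (simp add: A_def B_def I_def)
    finally show ?thesis .
  qed
  have B: "0 \<le> B" unfolding B_def by simp
  have "I\<^sup>2 \<le> A * B"
  proof (cases "B = 0")
    case True
    have "I = 0"
    proof (rule ccontr)
      assume "I \<noteq> 0"
      then show False using quad[of "(A + 1) / (2 * I)"] True by simp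
    qed
    then show ?thesis using True by simp
  next
    case False
    with B have "0 < B" by simp
    then have "A - 2 * (I / B) * I + (I / B)\<^sup>2 * B = (A * B - I\<^sup>2) / B"
      by (simp add: field_simps power2_eq_square)
    with quad[of "I / B"] \<open>0 < B\<close> show ?thesis by (simp add: zero_le_divide_iff)
  qed
  then show "(LINT x|M. \<bar>f x * g x\<bar>)\<^sup>2 \<le> (LINT x|M. (f x)\<^sup>2) * (LINT x|M. (g x)\<^sup>2)"
    by (simp add: A_def B_def I_def)
qed

lemma lborel_integral_scale:
  fixes f :: "'a::euclidean_space \<Rightarrow> real"
  assumes [measurable]: "f \<in> borel_measurable borel" and t: "t \<noteq> 0"
  shows "(LINT h|lborel. \<bar>t\<bar> ^ DIM('a) * f (x + t *\<^sub>R h)) = (LINT z|lborel. f z)"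
proof -
  have "(LINT z|lborel. f z) = (LINT z|density (distr lborel borel (\<lambda>h. x + t *\<^sub>R h)) (\<lambda>_. ennreal (\<bar>t\<bar> ^ DIM('a))). f z)"
    by (subst lborel_affine[OF t, of x, symmetric]) auto
  also have "\<dots> = (LINT z|distr lborel borel (\<lambda>h. x + t *\<^sub>R h). \<bar>t\<bar> ^ DIM('a) * f z)"
    by (subst integral_density) auto
  also have "\<dots> = (LINT h|lborel. \<bar>t\<bar> ^ DIM('a) * f (x + t *\<^sub>R h))"
    by (subst integral_distr) auto
  finally show ?thesis by simp
qed

text \<open>
  Words in the basis directions, as indices of iterated derivatives. Compared with multi-indices,
  they avoid multinomial coefficients in the expansion of a power of a directional derivative.
\<close>

definition basis_lists :: "nat \<Rightarrow> 'a::euclidean_space list set" where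
  "basis_lists j = {es. set es \<subseteq> Basis \<and> length es = j}"

lemma basis_lists_finite: "finite (basis_lists j)"
  unfolding basis_lists_def by (rule finite_lists_length_eq) simp

lemma basis_lists_card: "card (basis_lists j :: 'a::euclidean_space list set) = DIM('a) ^ j"
  unfolding basis_lists_def by (rule card_lists_length_eq) simp

lemma basis_lists_Suc: "basis_lists (Suc j) = (\<lambda>(e, es). e # es) ` (Basis \<times> basis_lists j)"
  by (auto simp: basis_lists_def image_def length_Suc_conv)

lemma dirderiv_cmul: "smooth f \<Longrightarrow> dirderiv h (\<lambda>x. c * f x) x = c * dirderiv h f x"
  by (subst dirderiv_mult[OF smooth_const]) (simp_all add: dirderiv_const)

lemma dirderiv_sum:
  assumes "finite A" "\<And>i. i \<in> A \<Longrightarrow> smooth (g i)"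
  shows "dirderiv h (\<lambda>x. \<Sum>i\<in>A. g i x) x = (\<Sum>i\<in>A. dirderiv h (g i) x)"
  using assms
proof (induction A rule: finite_induct)
  case (insert i A)
  have "smooth (\<lambda>x. \<Sum>i\<in>A. g i x)" using insert by (intro smooth_sum) auto
  then show ?case using insert by (simp add: dirderiv_add)
qed (simp add: dirderiv_const)

context cylinder_solution
begin

lemma dirderiv_power_expansion:
  assumes k: "kernel \<epsilon> \<kappa>"
  shows "(dirderiv h ^^ j) \<kappa> = (\<lambda>w. \<Sum>es\<in>basis_lists j. prod_list (map (\<lambda>e. h \<bullet> e) es) * iter_deriv es \<kappa> w)"
proof (induction j)
  case 0
  have "(basis_lists 0 :: 'a list set) = {[]}" by (auto simp: basis_lists_def)
  then show ?case by simp
next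
  case (Suc j)
  have sm: "smooth (iter_deriv es \<kappa>)" for es using kernel_smooth[OF kernel_iter_deriv[OF k]] .
  have inj: "inj_on (\<lambda>(e, es). e # es) (Basis \<times> basis_lists j)" by (auto simp: inj_on_def)
  show ?case
  proof
    fix w
    let ?c = "\<lambda>es. prod_list (map (\<lambda>e. h \<bullet> e) es)"
    have "(dirderiv h ^^ Suc j) \<kappa> w = dirderiv h (\<lambda>w. \<Sum>es\<in>basis_lists j. ?c es * iter_deriv es \<kappa> w) w"
      by (simp add: Suc)
    also have "\<dots> = (\<Sum>es\<in>basis_lists j. dirderiv h (\<lambda>w. ?c es * iter_deriv es \<kappa> w) w)"
      by (rule dirderiv_sum[OF basis_lists_finite]) (intro smooth_mult smooth_const sm)
    also have "\<dots> = (\<Sum>es\<in>basis_lists j. \<Sum>e\<in>Basis. ?c (e # es) * iter_deriv (e # es) \<kappa> w)"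
    proof (rule sum.cong[OF refl])
      fix es
      have "dirderiv h (\<lambda>w. ?c es * iter_deriv es \<kappa> w) w = ?c es * (\<Sum>e\<in>Basis. (h \<bullet> e) * dirderiv e (iter_deriv es \<kappa>) w)"
        unfolding dirderiv_cmul[OF sm] by (simp only: dirderiv_basis_sum[OF sm, of h])
      then show "dirderiv h (\<lambda>w. ?c es * iter_deriv es \<kappa> w) w = (\<Sum>e\<in>Basis. ?c (e # es) * iter_deriv (e # es) \<kappa> w)"
        by (simp add: sum_distrib_left ac_simps)
    qed
    also have "\<dots> = (\<Sum>e\<in>Basis. \<Sum>es\<in>basis_lists j. ?c (e # es) * iter_deriv (e # es) \<kappa> w)" by (rule sum.swap)
    also have "\<dots> = (\<Sum>(e, es)\<in>Basis \<times> basis_lists j. ?c (e # es) * iter_deriv (e # es) \<kappa> w)"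
      by (rule sum.cartesian_product)
    also have "\<dots> = (\<Sum>es\<in>basis_lists (Suc j). ?c es * iter_deriv es \<kappa> w)"
      unfolding basis_lists_Suc by (subst sum.reindex[OF inj]) (simp add: case_prod_beta')
    finally show "(dirderiv h ^^ Suc j) \<kappa> w = (\<Sum>es\<in>basis_lists (Suc j). ?c es * iter_deriv es \<kappa> w)" .
  qed
qed

lemma kernel_dirderiv_power: "kernel \<epsilon> \<kappa> \<Longrightarrow> kernel \<epsilon> ((dirderiv h ^^ j) \<kappa>)"
  by (induction j) (auto intro: kernel_dirderiv)

lemma conv_dirderiv_power_bound:
  assumes F: "slice_ok F" and k: "kernel \<epsilon> \<kappa>" and h: "norm h \<le> \<delta>"
  shows "\<bar>conv F ((dirderiv h ^^ j) \<kappa>) X\<bar> \<le> \<delta> ^ j * (\<Sum>es\<in>basis_lists j. \<bar>conv F (iter_deriv es \<kappa>) X\<bar>)"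
proof -
  obtain x y where X: "X = (x, y)" by force
  let ?c = "\<lambda>es. prod_list (map (\<lambda>e. h \<bullet> e) es)"
  have int: "integrable lborel (\<lambda>z. F (z, y) * iter_deriv es \<kappa> (x - z))" for es
  proof -
    obtain C where "\<And>w. \<bar>iter_deriv es \<kappa> w\<bar> \<le> C" using kernel_bounded[OF kernel_iter_deriv[OF k]] by blast
    then show ?thesis by (rule conv_integrable[OF slice_okD(2)[OF F] kernel_measurable[OF kernel_iter_deriv[OF k]]])
  qed
  have "conv F ((dirderiv h ^^ j) \<kappa>) X = (LINT z|lborel. (\<Sum>es\<in>basis_lists j. ?c es * (F (z, y) * iter_deriv es \<kappa> (x - z))))"
    unfolding conv_def dirderiv_power_expansion[OF k] X by (simp add: sum_distrib_left ac_simps)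
  also have "\<dots> = (\<Sum>es\<in>basis_lists j. ?c es * conv F (iter_deriv es \<kappa>) X)"
    using int by (subst Bochner_Integration.integral_sum) (auto simp: conv_def X)
  finally have "\<bar>conv F ((dirderiv h ^^ j) \<kappa>) X\<bar> \<le> (\<Sum>es\<in>basis_lists j. \<bar>?c es * conv F (iter_deriv es \<kappa>) X\<bar>)"
    by (simp add: sum_abs)
  also have "\<dots> \<le> (\<Sum>es\<in>basis_lists j. \<delta> ^ j * \<bar>conv F (iter_deriv es \<kappa>) X\<bar>)"
  proof (rule sum_mono)
    fix es :: "'a list" assume es: "es \<in> basis_lists j"
    have "set es \<subseteq> Basis \<Longrightarrow> \<bar>?c es\<bar> \<le> \<delta> ^ length es"
    proof (induction es)
      case (Cons e es)
      have "\<bar>h \<bullet> e\<bar> \<le> \<delta>" using Basis_le_norm[of e h] Cons.prems h by auto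
      moreover have "\<bar>?c es\<bar> \<le> \<delta> ^ length es" using Cons by simp
      moreover have "0 \<le> \<delta>" using h norm_ge_zero order_trans by blast
      ultimately have "\<bar>h \<bullet> e\<bar> * \<bar>?c es\<bar> \<le> \<delta> * \<delta> ^ length es" by (intro mult_mono) auto
      then show ?case by (simp add: abs_mult)
    qed simp
    then have "\<bar>?c es\<bar> \<le> \<delta> ^ j" using es by (auto simp: basis_lists_def)
    then show "\<bar>?c es * conv F (iter_deriv es \<kappa>) X\<bar> \<le> \<delta> ^ j * \<bar>conv F (iter_deriv es \<kappa>) X\<bar>"
      by (simp add: abs_mult mult_right_mono)
  qed
  finally show ?thesis by (simp add: sum_distrib_left)
qed

text \<open>
  Taylor expansion along the segment from \<open>x + h\<close> to \<open>x\<close>. It is centred at \<open>x + h\<close> so that the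
  lower order terms, like the remainder, can be averaged over \<open>h\<close>.
\<close>

lemma conv_Taylor_bound:
  assumes F: "slice_ok F" and k: "kernel \<epsilon> \<kappa>" and h: "norm h \<le> \<delta>"
  shows "\<bar>conv F \<kappa> (x, y)\<bar> \<le>
     (\<Sum>j<Suc n. \<delta> ^ j * (\<Sum>es\<in>basis_lists j. \<bar>conv F (iter_deriv es \<kappa>) (x + h, y)\<bar>)) +
     \<delta> ^ Suc n * (\<Sum>es\<in>basis_lists (Suc n).
        LINT s|lborel. indicator {0..1} s * ((1 - s) ^ n * \<bar>conv F (iter_deriv es \<kappa>) (x + (1 - s) *\<^sub>R h, y)\<bar>))"
proof -
  define Df where "Df j s = (- 1) ^ j * conv F ((dirderiv h ^^ j) \<kappa>) (x + (1 - s) *\<^sub>R h, y)" for j s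
  have der: "(Df j has_real_derivative Df (Suc j) s) (at s)" for j s
  proof -
    have 1: "((\<lambda>t. conv F ((dirderiv h ^^ j) \<kappa>) (x + t *\<^sub>R h, y)) has_real_derivative
        conv F (dirderiv h ((dirderiv h ^^ j) \<kappa>)) (x + (1 - s) *\<^sub>R h, y)) (at (1 - s))"
      by (rule conv_has_derivative[OF slice_okD(2)[OF F] kernel_dirderiv_power[OF k]])
    have 2: "((\<lambda>s. 1 - s) has_real_derivative - 1) (at s)" by (auto intro!: derivative_eq_intros)
    show ?thesis
      using DERIV_cmult[OF DERIV_chain2[OF 1 2], of "(- 1) ^ j"] by (simp add: Df_def[abs_def])
  qed
  have dv: "(Df j has_vector_derivative Df (Suc j) s) (at s within {0..1})" for j s
    using der[of j s] has_field_derivative_at_within has_real_derivative_iff_has_vector_derivative by blast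
  have cont: "continuous_on S (Df j)" for j S
    using DERIV_continuous_on[of S "Df j"] der has_field_derivative_at_within by blast
  let ?i = "\<lambda>s. ((1 - s) ^ (Suc n - 1) / fact (Suc n - 1)) *\<^sub>R Df (Suc n) s"
  have T: "Df 0 1 = (\<Sum>j<Suc n. ((1 - 0) ^ j / fact j) *\<^sub>R Df j 0) + integral {0..1} ?i"
    by (rule Taylor_integral[of "Suc n" Df "Df 0" 0 1]) (use dv in auto)
  have i2: "?i s = (1 - s) ^ n / fact n * Df (Suc n) s" for s by simp
  let ?g = "\<lambda>es s. (1 - s) ^ n * \<bar>conv F (iter_deriv es \<kappa>) (x + (1 - s) *\<^sub>R h, y)\<bar>"
  have gc: "continuous_on S (?g es)" for S es
  proof -
    have "((\<lambda>s. conv F (iter_deriv es \<kappa>) (x + (1 - s) *\<^sub>R h, y)) has_real_derivative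
       conv F (dirderiv h (iter_deriv es \<kappa>)) (x + (1 - s) *\<^sub>R h, y) * (- 1)) (at s)" for s
      by (rule DERIV_chain2[OF conv_has_derivative[OF slice_okD(2)[OF F] kernel_iter_deriv[OF k]]])
        (auto intro!: derivative_eq_intros)
    then have "continuous_on S (\<lambda>s. conv F (iter_deriv es \<kappa>) (x + (1 - s) *\<^sub>R h, y))"
      by (intro DERIV_continuous_on) (blast intro: has_field_derivative_at_within)
    then show ?thesis by (intro continuous_intros)
  qed
  have gi: "set_integrable lborel {0..1} (?g es)" for es
    by (rule borel_integrable_atLeastAtMost'[OF gc])
  have gI: "integral {0..1} (?g es) = (LINT s|lborel. indicator {0..1} s * ?g es s)" for es
    using set_borel_integral_eq_integral(2)[OF gi, of es] by (simp add: set_lebesgue_integral_def)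
  have d0: "0 \<le> \<delta>" using h norm_ge_zero order_trans by blast
  have "norm (integral {0..1} ?i) \<le> integral {0..1} (\<lambda>s. \<delta> ^ Suc n * (\<Sum>es\<in>basis_lists (Suc n). ?g es s))"
    unfolding i2
  proof (rule integral_norm_bound_integral)
    show "(\<lambda>s. (1 - s) ^ n / fact n * Df (Suc n) s) integrable_on {0..1}"
      by (intro integrable_continuous_real continuous_intros cont) simp
    show "(\<lambda>s. \<delta> ^ Suc n * (\<Sum>es\<in>basis_lists (Suc n). ?g es s)) integrable_on {0..1}"
      by (intro integrable_continuous_real continuous_intros gc)
    fix s :: real assume s: "s \<in> {0..1}"
    have f1: "(1::real) \<le> fact n" by simp
    have "(1 - s) ^ n / fact n \<le> (1 - s) ^ n" using s f1 by (simp add: divide_le_eq mult_left_le_one_le mult_le_cancel_left1)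
    then have "(1 - s) ^ n / fact n * \<bar>Df (Suc n) s\<bar> \<le> (1 - s) ^ n * (\<delta> ^ Suc n * (\<Sum>es\<in>basis_lists (Suc n). \<bar>conv F (iter_deriv es \<kappa>) (x + (1 - s) *\<^sub>R h, y)\<bar>))"
      using conv_dirderiv_power_bound[OF F k h, of "Suc n" "(x + (1 - s) *\<^sub>R h, y)"] s
      by (intro mult_mono) (auto simp: Df_def abs_mult simp del: funpow.simps)
    then show "norm ((1 - s) ^ n / fact n * Df (Suc n) s) \<le> \<delta> ^ Suc n * (\<Sum>es\<in>basis_lists (Suc n). ?g es s)"
      using s by (simp add: abs_mult sum_distrib_left ac_simps)
  qed
  also have "\<dots> = \<delta> ^ Suc n * (\<Sum>es\<in>basis_lists (Suc n). integral {0..1} (?g es))"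
    by (simp add: integral_sum[OF basis_lists_finite integrable_continuous_real[OF gc]])
  finally have rest: "\<bar>integral {0..1} ?i\<bar> \<le> \<delta> ^ Suc n * (\<Sum>es\<in>basis_lists (Suc n). LINT s|lborel. indicator {0..1} s * ?g es s)"
    unfolding gI real_norm_def .
  have "\<bar>\<Sum>j<Suc n. ((1 - 0) ^ j / fact j) *\<^sub>R Df j 0\<bar> \<le> (\<Sum>j<Suc n. \<delta> ^ j * (\<Sum>es\<in>basis_lists j. \<bar>conv F (iter_deriv es \<kappa>) (x + h, y)\<bar>))"
  proof (rule order_trans[OF sum_abs], rule sum_mono)
    fix j
    have "\<bar>((1 - 0) ^ j / fact j) *\<^sub>R Df j 0\<bar> = \<bar>Df j 0\<bar> / fact j" by (simp add: abs_mult)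
    also have "\<dots> \<le> \<bar>Df j 0\<bar>" using divide_left_mono[of 1 "fact j" "\<bar>Df j 0\<bar>"] by simp
    also have "\<dots> \<le> \<delta> ^ j * (\<Sum>es\<in>basis_lists j. \<bar>conv F (iter_deriv es \<kappa>) (x + h, y)\<bar>)"
      using conv_dirderiv_power_bound[OF F k h, of j "(x + h, y)"] by (simp add: Df_def abs_mult)
    finally show "\<bar>((1 - 0) ^ j / fact j) *\<^sub>R Df j 0\<bar> \<le> \<delta> ^ j * (\<Sum>es\<in>basis_lists j. \<bar>conv F (iter_deriv es \<kappa>) (x + h, y)\<bar>)" .
  qed
  moreover have "conv F \<kappa> (x, y) = Df 0 1" by (simp add: Df_def)
  moreover have "\<bar>Df 0 1\<bar> \<le> \<bar>\<Sum>j<Suc n. ((1 - 0) ^ j / fact j) *\<^sub>R Df j 0\<bar> + \<bar>integral {0..1} ?i\<bar>"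
    unfolding T by (rule abs_triangle_ineq)
  ultimately show ?thesis using rest by linarith
qed

text \<open>
  Integrate the Taylor bound over \<open>h\<close> in a ball. In the remainder the substitution
  \<open>z = x + (1 - s) h\<close> produces the factor \<open>(1 - s)\<close> to the power \<open>- n\<close>, where \<open>n\<close> is the
  dimension. A remainder of order \<open>n + 1\<close> carries the weight \<open>(1 - s)\<^sup>n\<close>, which cancels it exactly;
  this is why derivatives up to order \<open>n + 1\<close> are used.
\<close>

lemma conv_average_bound:
  assumes F: "slice_ok F" and k: "kernel \<epsilon> \<kappa>" and \<delta>: "0 < \<delta>"
  shows "\<bar>conv F \<kappa> (x, y)\<bar> * measure lborel (ball (0::'a) \<delta>) \<le>
     (\<Sum>j<Suc (Suc DIM('a)). \<delta> ^ j * (\<Sum>es\<in>basis_lists j.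
        LINT z|lborel. indicator (ball x \<delta>) z * \<bar>conv F (iter_deriv es \<kappa>) (z, y)\<bar>))"
proof -
  let ?n = "DIM('a)"
  let ?w = "\<lambda>es z. \<bar>conv F (iter_deriv es \<kappa>) (z, y)\<bar>"
  have wm [measurable]: "?w es \<in> borel_measurable borel" for es
    using conv_slice_measurable(2)[OF slice_okD(1)[OF F] kernel_measurable[OF kernel_iter_deriv[OF k]]] by simp
  have "\<exists>C. \<forall>z. ?w es z \<le> C" for es
    using conv_bound_N[OF F kernel_iter_deriv[OF k]] by metis
  then obtain C where C: "\<And>es z. ?w es z \<le> C es" by metis
  have iB: "integrable lborel (indicator (ball z \<delta>) :: 'a \<Rightarrow> real)" for z by (rule integrable_indicator_bounded) auto
  have iw: "integrable lborel (\<lambda>z. indicator (ball x \<delta>) z * ?w es z)" for es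
    by (rule integrable_mult_bounded[OF iB, where C = "C es"]) (use C in auto)
  let ?W = "\<lambda>es. LINT z|lborel. indicator (ball x \<delta>) z * ?w es z"
  let ?a = "\<lambda>es h. indicator (ball 0 \<delta>) h * ?w es (x + h)"
  let ?b = "\<lambda>es h. indicator (ball 0 \<delta>) h * (LINT s|lborel. indicator {0..1} s * ((1 - s) ^ ?n * ?w es (x + (1 - s) *\<^sub>R h)))"
  have shift: "indicator (ball (0::'a) \<delta>) h = (indicator (ball x \<delta>) (x + h) :: real)" for h
    by (simp add: indicator_def dist_norm)
  have a: "integrable lborel (?a es)" "(LINT h|lborel. ?a es h) = ?W es" for es
  proof -
    have eq: "?a es h = (\<lambda>z. indicator (ball x \<delta>) z * ?w es z) (x + h)" for h using shift[of h] by simp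
    have gm: "(\<lambda>z. indicator (ball x \<delta>) z * ?w es z) \<in> borel_measurable borel"
      by (intro borel_measurable_times borel_measurable_indicator wm) auto
    show "integrable lborel (?a es)" unfolding eq using iw by (subst lborel_integrable_translate[OF gm])
    show "(LINT h|lborel. ?a es h) = ?W es" unfolding eq by (rule lborel_integral_translate[OF gm])
  qed
  have b: "integrable lborel (?b es)" "(LINT h|lborel. ?b es h) \<le> ?W es" for es
  proof -
    let ?k = "\<lambda>(h::'a, s::real). (indicator (ball 0 \<delta>) h * indicator {0..1} s) * ((1 - s) ^ ?n * ?w es (x + (1 - s) *\<^sub>R h))"
    have iI: "integrable lborel (indicator {0..1} :: real \<Rightarrow> real)" by (rule integrable_indicator_bounded) auto
    have int: "integrable (lborel \<Otimes>\<^sub>M lborel) ?k"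
    proof -
      have "integrable (lborel \<Otimes>\<^sub>M lborel) (\<lambda>X. (case X of (h::'a, s::real) \<Rightarrow> indicator (ball 0 \<delta>) h * indicator {0..1} s) *
          ((1 - snd X) ^ ?n * ?w es (x + (1 - snd X) *\<^sub>R fst X)))"
      proof (rule integrable_mult_bounded[OF integrable_product[OF iB iI], where C = "C es"])
        show "\<bar>(1 - snd X) ^ ?n * ?w es (x + (1 - snd X) *\<^sub>R fst X)\<bar> \<le> C es"
          if "(case X of (h::'a, s::real) \<Rightarrow> indicator (ball 0 \<delta>) h * indicator {0..1} s) \<noteq> (0::real)" for X
        proof -
          have s: "0 \<le> 1 - snd X" "1 - snd X \<le> 1" using that by (auto simp: indicator_def split: if_splits prod.splits)
          have "(1 - snd X) ^ ?n * ?w es (x + (1 - snd X) *\<^sub>R fst X) \<le> 1 * C es"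
            using s C by (intro mult_mono power_le_one) auto
          then show ?thesis using s by (simp add: abs_mult)
        qed
      qed measurable
      then show ?thesis by (simp add: case_prod_beta')
    qed
    have beq: "?b es h = (LINT s|lborel. ?k (h, s))" for h
      by (subst integral_mult_right_zero[symmetric]) (simp add: ac_simps)
    show "integrable lborel (?b es)" unfolding beq using lborel_pair.integrable_fst'[OF int] by simp
    have "(LINT h|lborel. ?b es h) = (LINT s|lborel. LINT h|lborel. ?k (h, s))"
      unfolding beq using lborel_pair.Fubini_integral[of "\<lambda>h s. ?k (h, s)"] int by simp
    also have "\<dots> \<le> (LINT s|lborel. indicator {0..1::real} s * ?W es)"
    proof (rule integral_mono_AE)
      show "integrable lborel (\<lambda>s. LINT h|lborel. ?k (h, s))"
        using lborel_pair.integrable_snd[of "\<lambda>h s. ?k (h, s)"] int by simp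
      show "integrable lborel (\<lambda>s. indicator {0..1::real} s * ?W es)"
        using iI by simp
      have "AE s in lborel. s \<noteq> (1::real)" by (rule AE_lborel_singleton)
      \<comment> \<open>at \<open>s = 1\<close> the substitution degenerates; a single point is negligible\<close>
      then show "AE s in lborel. (LINT h|lborel. ?k (h, s)) \<le> indicator {0..1} s * ?W es"
      proof eventually_elim
        case (elim s)
        show ?case
        proof (cases "s \<in> {0..1}")
          case True
          then have t: "0 < 1 - s" "1 - s \<le> 1" using elim by auto
          have "(LINT h|lborel. ?k (h, s)) = (LINT h|lborel. \<bar>1 - s\<bar> ^ ?n * (\<lambda>z. indicator (ball x ((1 - s) * \<delta>)) z * ?w es z) (x + (1 - s) *\<^sub>R h))"
          proof (intro Bochner_Integration.integral_cong refl)
            fix h :: 'a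
            have "norm ((1 - s) *\<^sub>R h) < (1 - s) * \<delta> \<longleftrightarrow> norm h < \<delta>" using t by simp
            then show "?k (h, s) = \<bar>1 - s\<bar> ^ ?n * (\<lambda>z. indicator (ball x ((1 - s) * \<delta>)) z * ?w es z) (x + (1 - s) *\<^sub>R h)"
              using True t by (simp add: indicator_def dist_norm)
          qed
          also have "\<dots> = (LINT z|lborel. indicator (ball x ((1 - s) * \<delta>)) z * ?w es z)"
            using t by (intro lborel_integral_scale borel_measurable_times borel_measurable_indicator wm) auto
          also have "\<dots> \<le> ?W es"
          proof (rule integral_mono[OF _ iw])
            have "integrable lborel (indicator (ball x ((1 - s) * \<delta>)) :: 'a \<Rightarrow> real)" by (rule integrable_indicator_bounded) auto
            then show "integrable lborel (\<lambda>z. indicator (ball x ((1 - s) * \<delta>)) z * ?w es z)"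
              by (rule integrable_mult_bounded[where C = "C es"]) (use C in auto)
            have "(1 - s) * \<delta> \<le> \<delta>" using t \<delta> by (simp add: mult_left_le_one_le)
            then show "indicator (ball x ((1 - s) * \<delta>)) z * ?w es z \<le> indicator (ball x \<delta>) z * ?w es z" for z
              by (auto simp: indicator_def)
          qed
          finally show ?thesis using True by simp
        qed simp
      qed
    qed
    also have "\<dots> = ?W es" by simp
    finally show "(LINT h|lborel. ?b es h) \<le> ?W es" .
  qed
  let ?T = "\<lambda>h. (\<Sum>j<Suc ?n. \<delta> ^ j * (\<Sum>es\<in>basis_lists j. ?a es h)) + \<delta> ^ Suc ?n * (\<Sum>es\<in>basis_lists (Suc ?n). ?b es h)"
  have iT: "integrable lborel ?T"
    by (intro Bochner_Integration.integrable_add Bochner_Integration.integrable_sum integrable_mult_right a b)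
  have "\<bar>conv F \<kappa> (x, y)\<bar> * measure lborel (ball (0::'a) \<delta>) = (LINT h|lborel. indicator (ball (0::'a) \<delta>) h * \<bar>conv F \<kappa> (x, y)\<bar>)"
    by simp
  also have "\<dots> \<le> (LINT h|lborel. ?T h)"
  proof (rule integral_mono[OF _ iT])
    show "integrable lborel (\<lambda>h. indicator (ball (0::'a) \<delta>) h * \<bar>conv F \<kappa> (x, y)\<bar>)" using iB by simp
    fix h :: 'a
    show "indicator (ball 0 \<delta>) h * \<bar>conv F \<kappa> (x, y)\<bar> \<le> ?T h"
    proof (cases "h \<in> ball 0 \<delta>")
      case True
      then have "norm h \<le> \<delta>" by simp
      from conv_Taylor_bound[OF F k this, of x y ?n] show ?thesis using True by simp
    qed simp
  qed
  also have "\<dots> = (\<Sum>j<Suc ?n. \<delta> ^ j * (\<Sum>es\<in>basis_lists j. ?W es)) + \<delta> ^ Suc ?n * (\<Sum>es\<in>basis_lists (Suc ?n). LINT h|lborel. ?b es h)"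
    by (subst Bochner_Integration.integral_add)
       (simp_all only: a b Bochner_Integration.integral_sum Bochner_Integration.integrable_sum integrable_mult_right integral_mult_right_zero)
  also have "\<dots> \<le> (\<Sum>j<Suc ?n. \<delta> ^ j * (\<Sum>es\<in>basis_lists j. ?W es)) + \<delta> ^ Suc ?n * (\<Sum>es\<in>basis_lists (Suc ?n). ?W es)"
    using \<delta> b(2) by (intro add_left_mono mult_left_mono sum_mono) auto
  finally show ?thesis by simp
qed

end

section \<open>Vertical oscillation and the Muckenhoupt condition\<close>

lemma AE_pair_swap:
  fixes P :: "'a::euclidean_space \<Rightarrow> real \<Rightarrow> bool"
  assumes "Measurable.pred M2 (\<lambda>X. P (fst X) (snd X))" "AE x in lborel. AE y in lborel. P x y"
  shows "AE y in lborel. AE x in lborel. P x y"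
  using assms lborel_pair.AE_commute[of P] by (simp add: pred_def)

lemma pred_le_on_cylinder:
  fixes a c :: "'a::euclidean_space \<times> real \<Rightarrow> real"
  assumes [measurable]: "a \<in> borel_measurable M2" "c \<in> borel_measurable M2"
  shows "Measurable.pred M2 (\<lambda>X. snd X \<in> {0<..<\<rho>} \<longrightarrow> fst X \<in> ball 0 \<rho> \<longrightarrow> a X \<le> c X)"
  unfolding mem_ball_0 greaterThanLessThan_iff by measurable

context cylinder_solution
begin

definition mass :: "real \<Rightarrow> real" where
  "mass \<rho> = (LINT s|lborel. indicator {0<..<\<rho>} s * m s)"

lemma m_integrable: "\<rho> \<le> \<tau> \<Longrightarrow> integrable lborel (\<lambda>s. indicator {0<..<\<rho>} s * m s)"
  "\<rho> \<le> \<tau> \<Longrightarrow> integrable lborel (\<lambda>s. indicator {0<..<\<rho>} s * inverse (m s))"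
proof -
  assume r: "\<rho> \<le> \<tau>"
  have eq: "(\<lambda>s. indicator {0<..<\<rho>} s * (indicator {0<..<\<tau>} s * f s)) = (\<lambda>s. indicator {0<..<\<rho>} s * f s)" for f :: "real \<Rightarrow> real"
    using r by (auto simp: indicator_def)
  show "integrable lborel (\<lambda>s. indicator {0<..<\<rho>} s * m s)"
    using integrable_indicator_mult[OF m_int, of "{0<..<\<rho>}"] by (simp only: eq) simp
  show "integrable lborel (\<lambda>s. indicator {0<..<\<rho>} s * inverse (m s))"
    using integrable_indicator_mult[OF m_inv_int, of "{0<..<\<rho>}"] by (simp only: eq) simp
qed

lemma mass_mono: "\<rho> \<le> \<rho>' \<Longrightarrow> \<rho>' \<le> \<tau> \<Longrightarrow> mass \<rho> \<le> mass \<rho>'"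
  unfolding mass_def using m_integrable(1) less_imp_le[OF m_pos]
  by (intro integral_mono) (auto simp: indicator_def)

lemma mass_pos: "0 < \<rho> \<Longrightarrow> \<rho> \<le> \<tau> \<Longrightarrow> 0 < mass \<rho>"
  unfolding mass_def by (rule integral_pos_on_interval[OF m_integrable(1) m_pos])

text \<open>
  The Muckenhoupt condition on the full interval bounds the product from above on each subinterval;
  the Cauchy-Schwarz inequality bounds it from below.
\<close>

lemma mass_inverse_mass:
  assumes r: "0 < \<rho>" "\<rho> \<le> \<tau>"
  shows "mass \<rho> * (LINT s|lborel. indicator {0<..<\<rho>} s * inverse (m s)) \<le> K * \<tau>\<^sup>2"
    "0 \<le> (LINT s|lborel. indicator {0<..<\<rho>} s * inverse (m s))"
    "\<rho>\<^sup>2 \<le> mass \<rho> * (LINT s|lborel. indicator {0<..<\<rho>} s * inverse (m s))"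
proof -
  have i: "(LINT s|lborel. indicator {0<..<\<rho>} s * inverse (m s)) \<le> (LINT s|lborel. indicator {0<..<\<tau>} s * inverse (m s))"
    using r m_pos less_imp_le[OF m_pos] by (intro integral_mono m_integrable) (auto simp: indicator_def)
  show nn: "0 \<le> (LINT s|lborel. indicator {0<..<\<rho>} s * inverse (m s))"
    using less_imp_le[OF m_pos] by (intro Bochner_Integration.integral_nonneg) auto
  have "mass \<rho> * (LINT s|lborel. indicator {0<..<\<rho>} s * inverse (m s)) \<le> mass \<tau> * (LINT s|lborel. indicator {0<..<\<tau>} s * inverse (m s))"
    using mass_mono[of \<rho> \<tau>] mass_pos[of \<tau>] \<tau> r i nn by (intro mult_mono) auto
  then show "mass \<rho> * (LINT s|lborel. indicator {0<..<\<rho>} s * inverse (m s)) \<le> K * \<tau>\<^sup>2"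
    using A2 by (simp add: mass_def)
  let ?f = "\<lambda>s. indicator {0<..<\<rho>} s * sqrt (m s)" and ?g = "\<lambda>s. indicator {0<..<\<rho>} s * sqrt (inverse (m s))"
  have sq: "(?f s)\<^sup>2 = indicator {0<..<\<rho>} s * m s" "(?g s)\<^sup>2 = indicator {0<..<\<rho>} s * inverse (m s)" for s
    using m_pos[of s] by (auto simp: indicator_def)
  have fg: "\<bar>?f s * ?g s\<bar> = indicator {0<..<\<rho>} s" for s
    using m_pos[of s] by (auto simp: indicator_def real_sqrt_mult[symmetric])
  have "(LINT s|lborel. \<bar>?f s * ?g s\<bar>)\<^sup>2 \<le> (LINT s|lborel. (?f s)\<^sup>2) * (LINT s|lborel. (?g s)\<^sup>2)"
    by (rule Cauchy_Schwarz_integral(2)) (auto simp: sq m_integrable r)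
  then show "\<rho>\<^sup>2 \<le> mass \<rho> * (LINT s|lborel. indicator {0<..<\<rho>} s * inverse (m s))"
    using r by (simp only: fg sq mass_def) simp
qed

lemma K_pos: "0 < K"
proof -
  have "0 < \<tau>\<^sup>2" using \<tau> by simp
  also have "\<dots> \<le> K * \<tau>\<^sup>2"
    using mass_inverse_mass(1,3)[OF \<tau>] by simp
  finally show ?thesis using \<tau> by (simp add: zero_less_mult_iff)
qed

text \<open>
  The lower Cauchy-Schwarz bound on the short interval is compared with the Muckenhoupt bound on the
  long one; the integral of \<open>1/m\<close> drops out.
\<close>

lemma mass_doubling:
  assumes "0 < \<theta>" "\<theta> \<le> 1" shows "\<theta>\<^sup>2 * mass \<tau> \<le> K * mass (\<theta> * \<tau>)"
proof -
  have r: "0 < \<theta> * \<tau>" "\<theta> * \<tau> \<le> \<tau>" using assms \<tau> by auto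
  define W where "W = (LINT s|lborel. indicator {0<..<\<tau>} s * inverse (m s))"
  have W: "mass \<tau> * W \<le> K * \<tau>\<^sup>2" "0 \<le> W" using mass_inverse_mass[of \<tau>] \<tau> by (auto simp: W_def)
  have "(LINT s|lborel. indicator {0<..<\<theta> * \<tau>} s * inverse (m s)) \<le> W"
    unfolding W_def using r m_pos less_imp_le[OF m_pos] by (intro integral_mono m_integrable) (auto simp: indicator_def)
  then have "mass (\<theta> * \<tau>) * (LINT s|lborel. indicator {0<..<\<theta> * \<tau>} s * inverse (m s)) \<le> mass (\<theta> * \<tau>) * W"
    using mass_pos[OF r] by (intro mult_left_mono) auto
  then have 1: "(\<theta> * \<tau>)\<^sup>2 \<le> mass (\<theta> * \<tau>) * W" using mass_inverse_mass(3)[OF r] by linarith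
  have "(\<theta>\<^sup>2 * mass \<tau>) * \<tau>\<^sup>2 = (\<theta> * \<tau>)\<^sup>2 * mass \<tau>" by (simp add: power_mult_distrib)
  also have "\<dots> \<le> (mass (\<theta> * \<tau>) * W) * mass \<tau>" using 1 mass_pos[of \<tau>] \<tau> by (intro mult_right_mono) auto
  also have "\<dots> = mass (\<theta> * \<tau>) * (mass \<tau> * W)" by simp
  also have "\<dots> \<le> mass (\<theta> * \<tau>) * (K * \<tau>\<^sup>2)" using W mass_pos[OF r] by (intro mult_left_mono) auto
  finally have "(\<theta>\<^sup>2 * mass \<tau>) * \<tau>\<^sup>2 \<le> (K * mass (\<theta> * \<tau>)) * \<tau>\<^sup>2" by (simp add: ac_simps)
  then show ?thesis using \<tau> by simp
qed

text \<open>
  Integrated over \<open>z\<close> in a ball, this is a combination of energies on a cylinder. The factor \<open>\<tau>\<^sup>2\<close> in front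
  of the vertical derivative compensates the loss \<open>1 / \<delta>\<^sup>2\<close> of a Caccioppoli step.
\<close>

definition line_energy :: "real \<Rightarrow> ('a \<Rightarrow> real) \<Rightarrow> 'a \<Rightarrow> real" where
  "line_energy \<rho> \<kappa> z = 2 * (LINT s|lborel. indicator {0<..<\<rho>} s * ((conv V \<kappa> (z, s))\<^sup>2 * m s))
     + 2 * K * \<tau>\<^sup>2 * (LINT s|lborel. indicator {0<..<\<rho>} s * ((conv p0 \<kappa> (z, s))\<^sup>2 * m s))"

lemma conv_square_line_integrable:
  assumes F: "slice_ok F" and k: "kernel \<epsilon> \<kappa>"
  shows "integrable lborel (\<lambda>s. indicator {0<..<\<rho>} s * ((conv F \<kappa> (z, s))\<^sup>2 * m s))"
proof -
  obtain C where C: "0 \<le> C" "\<And>x y. \<bar>conv F \<kappa> (x, y)\<bar> \<le> C * N y" using conv_bound_N[OF F k] by blast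
  note [measurable] = conv_slice_measurable(1)[OF slice_okD(1)[OF F] kernel_measurable[OF k], of z]
  have "integrable lborel (\<lambda>s. (conv F \<kappa> (z, s))\<^sup>2 * m s)"
  proof (rule Bochner_Integration.integrable_bound)
    show "integrable lborel (\<lambda>y. C\<^sup>2 * ((N y)\<^sup>2 * m y))" using N_square by simp
    show "AE y in lborel. norm ((conv F \<kappa> (z, y))\<^sup>2 * m y) \<le> norm (C\<^sup>2 * ((N y)\<^sup>2 * m y))"
    proof (intro AE_I2)
      fix y
      have "(conv F \<kappa> (z, y))\<^sup>2 \<le> (C * N y)\<^sup>2" using power_mono[OF C(2)[of z y], of 2] by simp
      then have "(conv F \<kappa> (z, y))\<^sup>2 * m y \<le> (C * N y)\<^sup>2 * m y"
        using m_pos[of y] by (intro mult_right_mono) auto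
      then show "norm ((conv F \<kappa> (z, y))\<^sup>2 * m y) \<le> norm (C\<^sup>2 * ((N y)\<^sup>2 * m y))"
        using m_pos[of y] by (simp add: power_mult_distrib abs_mult)
    qed
  qed simp
  then show ?thesis by (rule integrable_indicator_mult) simp
qed

text \<open>
  The value at one height is compared with the values at all heights \<open>s\<close>, averaged with respect to
  \<open>m\<close>. The oscillation is at most the \<open>L\<^sup>1\<close> norm \<open>I\<close> of the vertical derivative, and the
  Cauchy-Schwarz inequality with the weights \<open>m\<close> and \<open>1/m\<close> together with the Muckenhoupt
  condition bounds \<open>I\<^sup>2\<close> by \<open>K \<tau>\<^sup>2\<close> times an energy divided by the mass.
\<close>

lemma conv_line_bound:
  assumes k: "kernel \<epsilon> \<kappa>" and z: "norm z + \<epsilon> < \<tau>" and r: "0 < \<rho>" "\<rho> \<le> \<tau>"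
  shows "AE y in lborel. y \<in> {0<..<\<rho>} \<longrightarrow> mass \<rho> * (conv V \<kappa> (z, y))\<^sup>2 \<le> line_energy \<rho> \<kappa> z"
proof -
  let ?u = "\<lambda>y. conv V \<kappa> (z, y)" and ?p = "\<lambda>y. conv p0 \<kappa> (z, y)"
  let ?i = "\<lambda>s. indicator {0<..<\<rho>} s :: real"
  obtain c where c: "AE y in lborel. y \<in> {0<..<\<tau>} \<longrightarrow> ?u y = c + cum ?p y"
    using conv_absolutely_continuous[OF k z] by blast
  have ip: "integrable lborel ?p"
    using conv_line_integrable[OF slice_ok(3) k, of "\<lambda>_. 1" z] N_integrable by simp
  note [measurable] = borel_measurable_integrable[OF ip, simplified]
  have p0: "?p y = 0" if "y \<notin> {0<..<\<tau>}" for y by (rule conv_zero_outside[OF slice_ok(3) k that])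
  define I where "I = (LINT s|lborel. \<bar>?i s * ?p s\<bar>)"
  have osc: "\<bar>cum ?p y - cum ?p s\<bar> \<le> I" if y: "y \<in> {0<..<\<rho>}" and s: "s \<in> {0<..<\<rho>}" for y s
  proof -
    have eq: "cum ?p y - cum ?p s = (LINT t|lborel. indicator {..<y} t * ?p t - indicator {..<s} t * ?p t)"
      unfolding cum_def using integrable_indicator_mult[OF ip, of "{..<y}"] integrable_indicator_mult[OF ip, of "{..<s}"] by simp
    have "\<bar>cum ?p y - cum ?p s\<bar> \<le> (LINT t|lborel. \<bar>indicator {..<y} t * ?p t - indicator {..<s} t * ?p t\<bar>)"
      unfolding eq by (rule integral_abs_bound)
    also have "\<dots> \<le> I" unfolding I_def
    proof (rule integral_mono)
      show "integrable lborel (\<lambda>t. \<bar>indicator {..<y} t * ?p t - indicator {..<s} t * ?p t\<bar>)"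
        by (rule integrable_abs[OF Bochner_Integration.integrable_diff[OF integrable_indicator_mult[OF ip] integrable_indicator_mult[OF ip]]]) simp_all
      show "integrable lborel (\<lambda>s. \<bar>?i s * ?p s\<bar>)"
        by (rule integrable_abs[OF integrable_indicator_mult[OF ip]]) simp
      show "\<bar>indicator {..<y} t * ?p t - indicator {..<s} t * ?p t\<bar> \<le> \<bar>?i t * ?p t\<bar>" for t
        using p0[of t] y s r by (cases "0 < t") (auto simp: indicator_def)
    qed
    finally show ?thesis .
  qed
  have I2: "I\<^sup>2 \<le> (LINT s|lborel. ?i s * ((?p s)\<^sup>2 * m s)) * (LINT s|lborel. ?i s * inverse (m s))"
  proof -
    let ?f = "\<lambda>s. ?i s * (?p s * sqrt (m s))" and ?g = "\<lambda>s. ?i s * sqrt (inverse (m s))"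
    have sq: "(?f s)\<^sup>2 = ?i s * ((?p s)\<^sup>2 * m s)" "(?g s)\<^sup>2 = ?i s * inverse (m s)" for s
      using m_pos[of s] by (auto simp: indicator_def power_mult_distrib)
    have fg: "\<bar>?f s * ?g s\<bar> = \<bar>?i s * ?p s\<bar>" for s
      using m_pos[of s] by (auto simp: indicator_def abs_mult real_sqrt_mult[symmetric] mult.assoc)
    have "(LINT s|lborel. \<bar>?f s * ?g s\<bar>)\<^sup>2 \<le> (LINT s|lborel. (?f s)\<^sup>2) * (LINT s|lborel. (?g s)\<^sup>2)"
      by (rule Cauchy_Schwarz_integral(2)) (auto simp: sq m_integrable r intro: conv_square_line_integrable[OF slice_ok(3) k])
    then show ?thesis by (simp only: fg sq I_def)
  qed
  from c show ?thesis
  proof eventually_elim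
    case (elim y)
    show ?case
    proof
      assume y: "y \<in> {0<..<\<rho>}"
      have uy: "?u y = c + cum ?p y" using elim y r by auto
      have "mass \<rho> * (?u y)\<^sup>2 = (LINT s|lborel. ?i s * m s * (?u y)\<^sup>2)" by (simp add: mass_def)
      also have "\<dots> \<le> (LINT s|lborel. 2 * (?i s * ((?u s)\<^sup>2 * m s)) + 2 * I\<^sup>2 * (?i s * m s))"
      proof (rule integral_mono_AE)
        show "integrable lborel (\<lambda>s. ?i s * m s * (?u y)\<^sup>2)" using m_integrable(1)[OF r(2)] by simp
        show "integrable lborel (\<lambda>s. 2 * (?i s * ((?u s)\<^sup>2 * m s)) + 2 * I\<^sup>2 * (?i s * m s))"
          using m_integrable(1)[OF r(2)] conv_square_line_integrable[OF slice_ok(1) k] by simp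
        show "AE s in lborel. ?i s * m s * (?u y)\<^sup>2 \<le> 2 * (?i s * ((?u s)\<^sup>2 * m s)) + 2 * I\<^sup>2 * (?i s * m s)"
          using c
        proof eventually_elim
          case (elim s)
          show ?case
          proof (cases "s \<in> {0<..<\<rho>}")
            case True
            have us: "?u s = c + cum ?p s" using elim True r by auto
            have I0: "(cum ?p y - cum ?p s)\<^sup>2 \<le> I\<^sup>2" using power_mono[OF osc[OF y True], of 2] by simp
            have "(?u y)\<^sup>2 \<le> 2 * (?u s)\<^sup>2 + 2 * (?u y - ?u s)\<^sup>2"
              using sum_power2_ge_zero[of "?u y - 2 * ?u s" 0] by (simp add: power2_eq_square algebra_simps)
            also have "\<dots> \<le> 2 * (?u s)\<^sup>2 + 2 * I\<^sup>2" using I0 by (simp add: uy us)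
            finally have "m s * (?u y)\<^sup>2 \<le> m s * (2 * (?u s)\<^sup>2 + 2 * I\<^sup>2)" using m_pos[of s] by (intro mult_left_mono) auto
            then show ?thesis using True by (simp add: algebra_simps)
          qed simp
        qed
      qed
      also have "\<dots> = 2 * (LINT s|lborel. ?i s * ((?u s)\<^sup>2 * m s)) + 2 * I\<^sup>2 * mass \<rho>"
        using m_integrable(1)[OF r(2)] conv_square_line_integrable[OF slice_ok(1) k] by (simp add: mass_def)
      also have "\<dots> \<le> line_energy \<rho> \<kappa> z"
      proof -
        let ?P = "LINT s|lborel. ?i s * ((?p s)\<^sup>2 * m s)"
        have P: "0 \<le> ?P" using less_imp_le[OF m_pos] by (intro Bochner_Integration.integral_nonneg) auto
        have "I\<^sup>2 * mass \<rho> \<le> (?P * (LINT s|lborel. ?i s * inverse (m s))) * mass \<rho>"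
          using I2 mass_pos[OF r] by (intro mult_right_mono) auto
        also have "\<dots> = ?P * (mass \<rho> * (LINT s|lborel. ?i s * inverse (m s)))" by simp
        also have "\<dots> \<le> ?P * (K * \<tau>\<^sup>2)" using mass_inverse_mass(1)[OF r] P by (intro mult_left_mono) auto
        finally show ?thesis by (simp add: line_energy_def ac_simps)
      qed
      finally show "mass \<rho> * (?u y)\<^sup>2 \<le> line_energy \<rho> \<kappa> z" .
    qed
  qed
qed

lemma energy_mono:
  assumes "slice_ok F" "kernel \<epsilon> \<kappa>" "r \<le> s" shows "energy r (conv F \<kappa>) \<le> energy s (conv F \<kappa>)"
  unfolding energy_def using cyl_mono[OF assms(3)] less_imp_le[OF m_pos]
  by (intro integral_mono energy_integrable[OF assms(1,2)]) (auto simp: indicator_def)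

lemma energy_Fubini:
  assumes F: "slice_ok F" and k: "kernel \<epsilon> \<kappa>"
  shows "integrable lborel (\<lambda>z. indicator (ball 0 r) z * (LINT s|lborel. indicator {0<..<r} s * ((conv F \<kappa> (z, s))\<^sup>2 * m s)))"
    "(LINT z|lborel. indicator (ball 0 r) z * (LINT s|lborel. indicator {0<..<r} s * ((conv F \<kappa> (z, s))\<^sup>2 * m s))) = energy r (conv F \<kappa>)"
proof -
  note int = energy_integrable[OF F k, of r]
  have eq: "(LINT s|lborel. indicator (cyl r) (z, s) * ((conv F \<kappa> (z, s))\<^sup>2 * m (snd (z, s)))) =
      indicator (ball 0 r) z * (LINT s|lborel. indicator {0<..<r} s * ((conv F \<kappa> (z, s))\<^sup>2 * m s))" for z
    by (subst integral_mult_right_zero[symmetric], intro Bochner_Integration.integral_cong) (auto simp: indicator_def cyl_def)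
  show "integrable lborel (\<lambda>z. indicator (ball 0 r) z * (LINT s|lborel. indicator {0<..<r} s * ((conv F \<kappa> (z, s))\<^sup>2 * m s)))"
    using lborel_pair.integrable_fst'[OF int] unfolding eq .
  show "(LINT z|lborel. indicator (ball 0 r) z * (LINT s|lborel. indicator {0<..<r} s * ((conv F \<kappa> (z, s))\<^sup>2 * m s))) = energy r (conv F \<kappa>)"
    using lborel_pair.integral_fst'[OF int] unfolding eq energy_def .
qed

lemma line_energy_measurable:
  assumes k: "kernel \<epsilon> \<kappa>" shows "line_energy \<rho> \<kappa> \<in> borel_measurable borel"
proof -
  note [measurable] = conv_measurable[OF V_meas kernel_measurable[OF k]] conv_measurable[OF p0_meas kernel_measurable[OF k]]
  have "line_energy \<rho> \<kappa> \<in> borel_measurable lborel" unfolding line_energy_def[abs_def] by measurable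
  then show ?thesis by simp
qed

lemma line_energy_integral:
  assumes k: "kernel \<epsilon> \<kappa>"
  shows "integrable lborel (\<lambda>z. indicator (ball 0 \<rho>) z * line_energy \<rho> \<kappa> z)"
    "(LINT z|lborel. indicator (ball 0 \<rho>) z * line_energy \<rho> \<kappa> z) = 2 * energy \<rho> (conv V \<kappa>) + 2 * K * \<tau>\<^sup>2 * energy \<rho> (conv p0 \<kappa>)"
proof -
  have eq: "indicator (ball 0 \<rho>) z * line_energy \<rho> \<kappa> z =
    2 * (indicator (ball 0 \<rho>) z * (LINT s|lborel. indicator {0<..<\<rho>} s * ((conv V \<kappa> (z, s))\<^sup>2 * m s))) +
    (2 * K * \<tau>\<^sup>2) * (indicator (ball 0 \<rho>) z * (LINT s|lborel. indicator {0<..<\<rho>} s * ((conv p0 \<kappa> (z, s))\<^sup>2 * m s)))" for z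
    unfolding line_energy_def by (simp only: distrib_left ac_simps)
  note V' = energy_Fubini[OF slice_ok(1) k, of \<rho>] and p' = energy_Fubini[OF slice_ok(3) k, of \<rho>]
  show "integrable lborel (\<lambda>z. indicator (ball 0 \<rho>) z * line_energy \<rho> \<kappa> z)"
    unfolding eq by (intro Bochner_Integration.integrable_add integrable_mult_right V'(1) p'(1))
  show "(LINT z|lborel. indicator (ball 0 \<rho>) z * line_energy \<rho> \<kappa> z) = 2 * energy \<rho> (conv V \<kappa>) + 2 * K * \<tau>\<^sup>2 * energy \<rho> (conv p0 \<kappa>)"
    unfolding eq
    by (simp only: Bochner_Integration.integral_add[OF integrable_mult_right[OF V'(1)] integrable_mult_right[OF p'(1)]]
       integral_mult_right_zero V'(2) p'(2))
qed

text \<open>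
  The summand \<open>j\<close> collects the \<open>n\<^sup>j\<close> derivatives of order \<open>j\<close>; each of them is controlled by \<open>D\<^sup>j\<close>
  through \<open>j\<close> Caccioppoli steps, and its vertical derivative by one further step.
\<close>

definition sup_const :: "real \<Rightarrow> real \<Rightarrow> real" where
  "sup_const D L = (\<Sum>j<Suc (Suc DIM('a)). real DIM('a) ^ j * sqrt (2 * (1 + K * D * L\<^sup>2) * D ^ j))"

text \<open>
  The horizontal average bound reduces a value to the \<open>L\<^sup>1\<close> norms of the derivatives of order at most
  \<open>n + 1\<close> on a ball at the same height. These are bounded by the \<open>L\<^sup>2\<close> norms, and the
  vertical line bound replaces the integrals at one height by energies on a cylinder, to which
  iterated Caccioppoli inequalities apply. At most \<open>n + 2\<close> steps occur, \<open>n + 1\<close> for the derivatives and one for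
  the vertical derivative; they use up the layers between \<open>R\<close> and \<open>\<rho>\<close>.
\<close>

lemma sup_bound:
  fixes R \<delta> L :: real
  assumes k: "kernel \<epsilon> \<kappa>" and \<delta>: "0 < \<delta>" "\<tau> \<le> L * \<delta>" and R: "R + \<epsilon> < \<tau>" "R \<le> \<tau>"
    and D: "D = 20 * DIM('a) ^ 4 * \<Lambda> ^ 4 * L\<^sup>2"
    and \<rho>: "\<rho> = R - (DIM('a) + 2) * \<delta>" "0 < \<rho>"
  shows "AE y in lborel. y \<in> {0<..<\<rho>} \<longrightarrow> (\<forall>x. norm x + \<delta> \<le> \<rho> \<longrightarrow>
     \<bar>conv V \<kappa> (x, y)\<bar> \<le> sup_const D L * sqrt (energy R (conv V \<kappa>) / (measure lborel (ball (0::'a) \<delta>) * mass \<rho>)))"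
proof -
  let ?n = "DIM('a)"
  define E0 where "E0 = energy R (conv V \<kappa>)"
  define b where "b = measure lborel (ball (0::'a) \<delta>)"
  have E0: "0 \<le> E0" unfolding E0_def by (rule energy_nonneg)
  have b: "0 < b" unfolding b_def using \<delta> by (simp add: content_ball_pos)
  have \<rho>R: "\<rho> \<le> R" using \<rho> \<delta> by simp
  have \<rho>\<tau>: "\<rho> \<le> \<tau>" using \<rho>R R by simp
  have M: "0 < mass \<rho>" by (rule mass_pos[OF \<rho>(2) \<rho>\<tau>])
  have L0: "0 < L" using \<delta> \<tau> by (smt (verit) zero_less_mult_iff)
  have D0: "0 \<le> D" using D by simp
  let ?w = "\<lambda>es z y. conv V (iter_deriv es \<kappa>) (z, y)"
  let ?all = "\<Union>j<Suc (Suc ?n). basis_lists j :: 'a list set"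
  have fin: "finite ?all" using basis_lists_finite by auto
  \<comment> \<open>the exceptional heights of the vertical line bound depend on the line; Fubini exchanges the quantifiers\<close>
  have good: "AE y in lborel. AE z in lborel. y \<in> {0<..<\<rho>} \<longrightarrow> z \<in> ball 0 \<rho> \<longrightarrow> mass \<rho> * (?w es z y)\<^sup>2 \<le> line_energy \<rho> (iter_deriv es \<kappa>) z" for es
  proof (rule AE_pair_swap)
    note ke = kernel_iter_deriv[OF k, of es]
    have "(\<lambda>X. mass \<rho> * (?w es (fst X) (snd X))\<^sup>2) \<in> borel_measurable M2"
      using conv_measurable[OF V_meas kernel_measurable[OF ke]] by simp
    moreover have "(\<lambda>X. line_energy \<rho> (iter_deriv es \<kappa>) (fst X)) \<in> borel_measurable M2"
      using measurable_compose[OF measurable_fst, of "line_energy \<rho> (iter_deriv es \<kappa>)" lborel borel lborel] line_energy_measurable[OF ke] by simp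
    ultimately show "Measurable.pred M2 (\<lambda>X. snd X \<in> {0<..<\<rho>} \<longrightarrow> fst X \<in> ball 0 \<rho> \<longrightarrow> mass \<rho> * (?w es (fst X) (snd X))\<^sup>2 \<le> line_energy \<rho> (iter_deriv es \<kappa>) (fst X))"
      by (rule pred_le_on_cylinder)
    show "AE z in lborel. AE y in lborel. y \<in> {0<..<\<rho>} \<longrightarrow> z \<in> ball 0 \<rho> \<longrightarrow> mass \<rho> * (?w es z y)\<^sup>2 \<le> line_energy \<rho> (iter_deriv es \<kappa>) z"
    proof (rule AE_I2)
      fix z :: 'a
      show "AE y in lborel. y \<in> {0<..<\<rho>} \<longrightarrow> z \<in> ball 0 \<rho> \<longrightarrow> mass \<rho> * (?w es z y)\<^sup>2 \<le> line_energy \<rho> (iter_deriv es \<kappa>) z"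
      proof (cases "z \<in> ball 0 \<rho>")
        case True
        then have "norm z + \<epsilon> < \<tau>" using \<rho>R R by simp
        from conv_line_bound[OF ke this \<rho>(2) \<rho>\<tau>] show ?thesis by (rule AE_mp) auto
      qed simp
    qed
  qed
  have "AE y in lborel. \<forall>es\<in>?all. AE z in lborel. y \<in> {0<..<\<rho>} \<longrightarrow> z \<in> ball 0 \<rho> \<longrightarrow> mass \<rho> * (?w es z y)\<^sup>2 \<le> line_energy \<rho> (iter_deriv es \<kappa>) z"
    by (rule AE_finite_allI[OF fin]) (rule good)
  then show ?thesis
  proof eventually_elim
    case (elim y)
    show ?case
    proof (intro impI allI)
      fix x :: 'a assume y: "y \<in> {0<..<\<rho>}" and x: "norm x + \<delta> \<le> \<rho>"
      let ?W = "\<lambda>es. LINT z|lborel. indicator (ball x \<delta>) z * \<bar>?w es z y\<bar>"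
      have sub: "ball x \<delta> \<subseteq> ball 0 \<rho>" using x by (auto simp: dist_norm) (smt (verit) norm_minus_commute norm_triangle_sub)
      have Wj: "\<delta> ^ j * ?W es \<le> sqrt (2 * (1 + K * D * L\<^sup>2) * D ^ j) * sqrt (b * E0 / mass \<rho>)"
        if j: "j < Suc (Suc ?n)" and es: "es \<in> basis_lists j" for j es
      proof -
        note ke = kernel_iter_deriv[OF k, of es]
        note [measurable] = conv_slice_measurable(2)[OF V_meas kernel_measurable[OF ke], of y] line_energy_measurable[OF ke]
        have esB: "set es \<subseteq> Basis" and len: "length es = j" using es by (auto simp: basis_lists_def)
        obtain C where C: "0 \<le> C" "\<And>x y. \<bar>conv V (iter_deriv es \<kappa>) (x, y)\<bar> \<le> C * N y" using conv_bound_N[OF slice_ok(1) ke] by blast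
        have iB: "integrable lborel (indicator (ball z r) :: 'a \<Rightarrow> real)" for z r by (rule integrable_indicator_bounded) auto
        have iw2: "integrable lborel (\<lambda>z. indicator (ball z' r) z * (?w es z y)\<^sup>2)" for z' r
        proof (rule integrable_mult_bounded[OF iB, where C = "(C * N y)\<^sup>2"])
          show "\<bar>(?w es z y)\<^sup>2\<bar> \<le> (C * N y)\<^sup>2" for z using power_mono[OF C(2)[of z y], of 2] by simp
        qed simp
        have 1: "(indicator (ball x \<delta>) z :: real)\<^sup>2 = indicator (ball x \<delta>) z" for z by (simp add: indicator_def)
        have "(LINT z|lborel. \<bar>indicator (ball x \<delta>) z * (indicator (ball x \<delta>) z * ?w es z y)\<bar>)\<^sup>2
            \<le> (LINT z|lborel. (indicator (ball x \<delta>) z)\<^sup>2) * (LINT z|lborel. (indicator (ball x \<delta>) z * ?w es z y)\<^sup>2)"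
        proof (rule Cauchy_Schwarz_integral(2))
          show "integrable lborel (\<lambda>z. (indicator (ball x \<delta>) z :: real)\<^sup>2)" unfolding 1 by (rule iB)
          show "integrable lborel (\<lambda>z. (indicator (ball x \<delta>) z * ?w es z y)\<^sup>2)"
            unfolding power_mult_distrib 1 by (rule iw2)
          have im: "(\<lambda>z. indicator (ball x \<delta>) z :: real) \<in> borel_measurable lborel"
            by (rule borel_measurable_indicator) simp
          have wm: "(\<lambda>z. ?w es z y) \<in> borel_measurable lborel"
            using conv_slice_measurable(2)[OF V_meas kernel_measurable[OF ke], of y] by simp
          show "(\<lambda>z. indicator (ball x \<delta>) z :: real) \<in> borel_measurable lborel" by (rule im)
          show "(\<lambda>z. indicator (ball x \<delta>) z * ?w es z y) \<in> borel_measurable lborel"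
            by (rule borel_measurable_times[OF im wm])
        qed
        moreover have "(LINT z|lborel. \<bar>indicator (ball x \<delta>) z * (indicator (ball x \<delta>) z * ?w es z y)\<bar>) = ?W es"
          by (intro Bochner_Integration.integral_cong) (auto simp: indicator_def)
        moreover have "(LINT z|lborel. (indicator (ball x \<delta>) z :: real)\<^sup>2) = b"
        proof -
          have "(LINT z|lborel. (indicator (ball x \<delta>) z :: real)\<^sup>2) = (LINT z|lborel. indicator (ball x \<delta>) z)"
            by (intro Bochner_Integration.integral_cong) (auto simp: indicator_def)
          also have "\<dots> = b" unfolding b_def using \<delta> by (simp add: content_ball)
          finally show ?thesis .
        qed
        moreover have "(LINT z|lborel. (indicator (ball x \<delta>) z * ?w es z y)\<^sup>2) \<le> 2 * (1 + K * D * L\<^sup>2) * (D / \<delta>\<^sup>2) ^ j * E0 / mass \<rho>"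
        proof -
          have "mass \<rho> * (LINT z|lborel. (indicator (ball x \<delta>) z * ?w es z y)\<^sup>2) \<le> mass \<rho> * (LINT z|lborel. indicator (ball 0 \<rho>) z * (?w es z y)\<^sup>2)"
          proof (intro mult_left_mono integral_mono iw2)
            show "integrable lborel (\<lambda>z. (indicator (ball x \<delta>) z * ?w es z y)\<^sup>2)"
              unfolding power_mult_distrib 1 by (rule iw2)
            show "(indicator (ball x \<delta>) z * ?w es z y)\<^sup>2 \<le> indicator (ball 0 \<rho>) z * (?w es z y)\<^sup>2" for z
              using sub by (auto simp: indicator_def)
          qed (use M in simp)
          also have "\<dots> = (LINT z|lborel. mass \<rho> * (indicator (ball 0 \<rho>) z * (?w es z y)\<^sup>2))" by simp
          also have "\<dots> \<le> (LINT z|lborel. indicator (ball 0 \<rho>) z * line_energy \<rho> (iter_deriv es \<kappa>) z)"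
          proof (rule integral_mono_AE)
            show "integrable lborel (\<lambda>z. mass \<rho> * (indicator (ball 0 \<rho>) z * (?w es z y)\<^sup>2))" using iw2 by simp
            show "integrable lborel (\<lambda>z. indicator (ball 0 \<rho>) z * line_energy \<rho> (iter_deriv es \<kappa>) z)" by (rule line_energy_integral[OF ke])
            have "AE z in lborel. y \<in> {0<..<\<rho>} \<longrightarrow> z \<in> ball 0 \<rho> \<longrightarrow> mass \<rho> * (?w es z y)\<^sup>2 \<le> line_energy \<rho> (iter_deriv es \<kappa>) z"
              using elim j es by blast
            then show "AE z in lborel. mass \<rho> * (indicator (ball 0 \<rho>) z * (?w es z y)\<^sup>2) \<le> indicator (ball 0 \<rho>) z * line_energy \<rho> (iter_deriv es \<kappa>) z"
              by (rule AE_mp) (use y in \<open>auto intro!: AE_I2 simp: indicator_def\<close>)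
          qed
          also have "\<dots> = 2 * energy \<rho> (conv V (iter_deriv es \<kappa>)) + 2 * K * \<tau>\<^sup>2 * energy \<rho> (conv p0 (iter_deriv es \<kappa>))"
            by (rule line_energy_integral[OF ke])
          also have "\<dots> \<le> 2 * ((D / \<delta>\<^sup>2) ^ j * E0) + 2 * K * \<tau>\<^sup>2 * ((D / \<delta>\<^sup>2) ^ Suc j * E0)"
          proof (intro add_mono mult_left_mono)
            have jn: "real j * \<delta> \<le> (DIM('a) + 2) * \<delta>" "real (Suc j) * \<delta> \<le> (DIM('a) + 2) * \<delta>"
              using j \<delta> by (intro mult_right_mono; simp)+
            have RL: "R \<le> L * \<delta>" using R \<delta> by linarith
            have D': "D / \<delta>\<^sup>2 = 20 * DIM('a) ^ 4 * \<Lambda> ^ 4 * L\<^sup>2 / \<delta>\<^sup>2" by (simp add: D)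
            note IC = iterated_caccioppoli[OF k \<delta>(1) RL R D' esB, unfolded len, folded E0_def]
            have "energy \<rho> (conv V (iter_deriv es \<kappa>)) \<le> energy (R - real j * \<delta>) (conv V (iter_deriv es \<kappa>))"
              by (rule energy_mono[OF slice_ok(1) ke]) (use jn \<rho> in linarith)
            also have "\<dots> \<le> (D / \<delta>\<^sup>2) ^ j * E0" by (rule IC(1)) (use jn \<rho> in linarith)
            finally show "energy \<rho> (conv V (iter_deriv es \<kappa>)) \<le> (D / \<delta>\<^sup>2) ^ j * E0" .
            have "energy \<rho> (conv p0 (iter_deriv es \<kappa>)) \<le> energy (R - real (Suc j) * \<delta>) (conv p0 (iter_deriv es \<kappa>))"
              by (rule energy_mono[OF slice_ok(3) ke]) (use jn \<rho> in linarith)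
            also have "\<dots> \<le> (D / \<delta>\<^sup>2) ^ Suc j * E0" by (rule IC(2)) (use jn \<rho> in linarith)
            finally show "energy \<rho> (conv p0 (iter_deriv es \<kappa>)) \<le> (D / \<delta>\<^sup>2) ^ Suc j * E0" .
          qed (use K_pos in auto)
          also have "\<dots> = 2 * (1 + K * (D * (\<tau>\<^sup>2 / \<delta>\<^sup>2))) * ((D / \<delta>\<^sup>2) ^ j * E0)" by (simp add: algebra_simps)
          also have "\<dots> \<le> 2 * (1 + K * (D * L\<^sup>2)) * ((D / \<delta>\<^sup>2) ^ j * E0)"
          proof -
            have "\<tau>\<^sup>2 \<le> (L * \<delta>)\<^sup>2" using \<delta> \<tau> by (intro power_mono) auto
            then have "\<tau>\<^sup>2 / \<delta>\<^sup>2 \<le> L\<^sup>2" using \<delta> by (simp add: power_mult_distrib field_simps)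
            then have "1 + K * (D * (\<tau>\<^sup>2 / \<delta>\<^sup>2)) \<le> 1 + K * (D * L\<^sup>2)"
              using K_pos D0 by (intro add_left_mono mult_left_mono) auto
            then show ?thesis using D0 E0 by (intro mult_right_mono) auto
          qed
          finally have fin: "mass \<rho> * (LINT z|lborel. (indicator (ball x \<delta>) z * ?w es z y)\<^sup>2) \<le> 2 * (1 + K * (D * L\<^sup>2)) * ((D / \<delta>\<^sup>2) ^ j * E0)" .
          show ?thesis
            by (rule mult_imp_le_div_pos[OF M]) (use fin in \<open>simp only: ac_simps\<close>)
        qed
        ultimately have "(?W es)\<^sup>2 \<le> b * (2 * (1 + K * D * L\<^sup>2) * (D / \<delta>\<^sup>2) ^ j * E0 / mass \<rho>)"
          using b by (smt (verit) mult_left_mono)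
        then have "(\<delta> ^ j)\<^sup>2 * (?W es)\<^sup>2 \<le> (\<delta> ^ j)\<^sup>2 * (b * (2 * (1 + K * D * L\<^sup>2) * (D / \<delta>\<^sup>2) ^ j * E0 / mass \<rho>))"
          by (intro mult_left_mono) auto
        also have "\<dots> = (2 * (1 + K * D * L\<^sup>2) * D ^ j) * (b * E0 / mass \<rho>)"
        proof -
          define q X where "q = (D / \<delta>\<^sup>2) ^ j" and "X = 1 + K * D * L\<^sup>2"
          have "(\<delta> ^ j)\<^sup>2 = (\<delta>\<^sup>2) ^ j" by (simp only: power_mult[symmetric] mult.commute)
          then have "(\<delta> ^ j)\<^sup>2 * q = (\<delta>\<^sup>2 * (D / \<delta>\<^sup>2)) ^ j" unfolding q_def by (simp only: power_mult_distrib)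
          also have "\<dots> = D ^ j" using \<delta> by simp
          finally have "D ^ j = (\<delta> ^ j)\<^sup>2 * q" by simp
          then show ?thesis unfolding q_def[symmetric] X_def[symmetric] by simp
        qed
        finally have "(\<delta> ^ j * ?W es)\<^sup>2 \<le> (2 * (1 + K * D * L\<^sup>2) * D ^ j) * (b * E0 / mass \<rho>)"
          by (simp add: power_mult_distrib)
        then show ?thesis by (simp add: real_le_rsqrt real_sqrt_mult[symmetric])
      qed
      have "\<bar>conv V \<kappa> (x, y)\<bar> * b \<le> (\<Sum>j<Suc (Suc ?n). \<Sum>es\<in>basis_lists j. \<delta> ^ j * ?W es)"
        using conv_average_bound[OF slice_ok(1) k \<delta>(1), of x y] unfolding b_def sum_distrib_left by simp
      also have "\<dots> \<le> (\<Sum>j<Suc (Suc ?n). \<Sum>es\<in>(basis_lists j :: 'a list set). sqrt (2 * (1 + K * D * L\<^sup>2) * D ^ j) * sqrt (b * E0 / mass \<rho>))"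
        by (intro sum_mono Wj) auto
      also have "\<dots> = sup_const D L * sqrt (b * E0 / mass \<rho>)"
        by (simp add: sup_const_def basis_lists_card sum_distrib_right sum_distrib_left ac_simps del: sum.lessThan_Suc)
      finally have "\<bar>conv V \<kappa> (x, y)\<bar> \<le> sup_const D L * (sqrt (b * E0 / mass \<rho>) / b)"
        using b by (simp add: field_simps)
      also have "sqrt (b * E0 / mass \<rho>) / b = sqrt (E0 / (b * mass \<rho>))"
      proof -
        have "sqrt (b * E0 / mass \<rho>) / b = sqrt (b * E0 / mass \<rho>) / sqrt (b\<^sup>2)" using b by simp
        also have "\<dots> = sqrt ((b * E0 / mass \<rho>) / b\<^sup>2)" by (rule real_sqrt_divide[symmetric])
        also have "(b * E0 / mass \<rho>) / b\<^sup>2 = E0 / (b * mass \<rho>)" using b M by (simp add: power2_eq_square field_simps)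
        finally show ?thesis .
      qed
      finally show "\<bar>conv V \<kappa> (x, y)\<bar> \<le> sup_const D L * sqrt (energy R (conv V \<kappa>) / (measure lborel (ball (0::'a) \<delta>) * mass \<rho>))"
        by (simp add: E0_def b_def)
    qed
  qed
qed

end

section \<open>Gradient bounds for the mollified and for the original solution\<close>

text \<open>
  Young's inequality for convolutions, from the Cauchy-Schwarz inequality with \<open>\<bar>\<kappa>\<bar>\<close> as a weight.
  The \<open>L\<^sup>1\<close> norm of the kernel is the quantity that stays bounded when the kernel concentrates.
\<close>

lemma conv_square_Young:
  fixes F :: "'a::euclidean_space \<times> real \<Rightarrow> real"
  assumes F1: "integrable lborel (\<lambda>z. F (z, y))" and F2: "integrable lborel (\<lambda>z. (F (z, y))\<^sup>2)" and k: "kernel \<epsilon> \<kappa>"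
  shows "integrable lborel (\<lambda>x. (conv F \<kappa> (x, y))\<^sup>2)"
    "(LINT x|lborel. (conv F \<kappa> (x, y))\<^sup>2) \<le> (LINT w|lborel. \<bar>\<kappa> w\<bar>)\<^sup>2 * (LINT z|lborel. (F (z, y))\<^sup>2)"
proof -
  define A where "A = (LINT w|lborel. \<bar>\<kappa> w\<bar>)"
  note [measurable] = kernel_measurable[OF k] borel_measurable_integrable[OF F1, simplified]
  obtain C where C: "\<And>w. \<bar>\<kappa> w\<bar> \<le> C" using kernel_bounded[OF k] by blast
  have ik: "integrable lborel \<kappa>" by (rule kernel_integrable[OF k])
  have km: "(\<lambda>w. \<bar>\<kappa> w\<bar>) \<in> borel_measurable borel" by simp
  have ik1: "integrable lborel (\<lambda>z. \<bar>\<kappa> (x - z)\<bar>)" "(LINT z|lborel. \<bar>\<kappa> (x - z)\<bar>) = A" for x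
    using lborel_integrable_reflect[OF km, of x] lborel_integral_reflect[OF km, of x] ik by (simp_all add: A_def)
  have ik2: "integrable lborel (\<lambda>x. \<bar>\<kappa> (x - z)\<bar>)" "(LINT x|lborel. \<bar>\<kappa> (x - z)\<bar>) = A" for z
    using lborel_integrable_translate[OF km, of "- z"] lborel_integral_translate[OF km, of "- z"] ik by (simp_all add: A_def)
  let ?g = "\<lambda>z x. (F (z, y))\<^sup>2 * \<bar>\<kappa> (x - z)\<bar>"
  have int: "integrable (lborel \<Otimes>\<^sub>M lborel) (\<lambda>(z, x). ?g z x)"
  proof (rule lborel_pair.Fubini_integrable)
    show "(\<lambda>(z, x). ?g z x) \<in> borel_measurable (lborel \<Otimes>\<^sub>M lborel)" by measurable
    show "integrable lborel (\<lambda>z. LINT x|lborel. norm (case (z, x) of (z, x) \<Rightarrow> ?g z x))"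
      using F2 ik2 by (simp add: abs_mult)
    show "AE z in lborel. integrable lborel (\<lambda>x. case (z, x) of (z, x) \<Rightarrow> ?g z x)"
      using ik2 by simp
  qed
  define G where "G x = (LINT z|lborel. ?g z x)" for x
  have iG: "integrable lborel G" unfolding G_def using lborel_pair.integrable_snd[OF int] .
  have IG: "(LINT x|lborel. G x) = A * (LINT z|lborel. (F (z, y))\<^sup>2)"
  proof -
    have "(LINT x|lborel. G x) = (LINT z|lborel. LINT x|lborel. ?g z x)"
      unfolding G_def by (rule lborel_pair.Fubini_integral[OF int])
    then show ?thesis using ik2 by (simp add: mult.commute)
  qed
  have pt: "(conv F \<kappa> (x, y))\<^sup>2 \<le> A * G x" for x
  proof -
    let ?f = "\<lambda>z. F (z, y) * sqrt \<bar>\<kappa> (x - z)\<bar>" and ?h = "\<lambda>z. sqrt \<bar>\<kappa> (x - z)\<bar>"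
    have sq: "(?f z)\<^sup>2 = ?g z x" "(?h z)\<^sup>2 = \<bar>\<kappa> (x - z)\<bar>" "\<bar>?f z * ?h z\<bar> = \<bar>F (z, y) * \<kappa> (x - z)\<bar>" for z
      by (simp_all add: power_mult_distrib abs_mult mult.assoc)
    have i1: "integrable lborel (\<lambda>z. ?g z x)"
      by (rule integrable_mult_bounded[OF F2, where C = C]) (use C in auto)
    have "(LINT z|lborel. \<bar>?f z * ?h z\<bar>)\<^sup>2 \<le> (LINT z|lborel. (?f z)\<^sup>2) * (LINT z|lborel. (?h z)\<^sup>2)"
      by (rule Cauchy_Schwarz_integral(2)) (use i1 ik1 in \<open>auto simp: sq\<close>)
    then have "(LINT z|lborel. \<bar>F (z, y) * \<kappa> (x - z)\<bar>)\<^sup>2 \<le> G x * A" by (simp only: sq ik1 G_def)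
    moreover have "\<bar>conv F \<kappa> (x, y)\<bar> \<le> (LINT z|lborel. \<bar>F (z, y) * \<kappa> (x - z)\<bar>)"
      unfolding conv_def by (simp add: integral_abs_bound)
    then have "(conv F \<kappa> (x, y))\<^sup>2 \<le> (LINT z|lborel. \<bar>F (z, y) * \<kappa> (x - z)\<bar>)\<^sup>2"
      using power_mono[of "\<bar>conv F \<kappa> (x, y)\<bar>" _ 2] by simp
    ultimately show ?thesis by (simp add: mult.commute)
  qed
  have cm: "(\<lambda>x. conv F \<kappa> (x, y)) \<in> borel_measurable borel"
    unfolding conv_def by simp
  show i: "integrable lborel (\<lambda>x. (conv F \<kappa> (x, y))\<^sup>2)"
  proof (rule Bochner_Integration.integrable_bound[OF integrable_mult_right[OF iG, of A]])
    show "AE x in lborel. norm ((conv F \<kappa> (x, y))\<^sup>2) \<le> norm (A * G x)"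
      using pt by (intro AE_I2) (metis abs_ge_self abs_power2 order_trans real_norm_def)
  qed (use cm in simp)
  have "(LINT x|lborel. (conv F \<kappa> (x, y))\<^sup>2) \<le> (LINT x|lborel. A * G x)"
    by (intro integral_mono i integrable_mult_right iG pt)
  then show "(LINT x|lborel. (conv F \<kappa> (x, y))\<^sup>2) \<le> (LINT w|lborel. \<bar>\<kappa> w\<bar>)\<^sup>2 * (LINT z|lborel. (F (z, y))\<^sup>2)"
    by (simp add: IG A_def[symmetric] power2_eq_square)
qed

lemma box_bump_Pair:
  "box_bump k c d (x, y) = box_bump k (fst c) (fst d) x * box_bump k (snd c) (snd d) (y::real)"
proof -
  have 1: "(\<Prod>e\<in>(\<lambda>u. (u, 0::real)) ` Basis. f e) = (\<Prod>u\<in>Basis. f (u, 0))" for f :: "'a \<times> real \<Rightarrow> real"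
    by (subst prod.reindex) (auto simp: inj_on_def)
  have "(\<Prod>e\<in>Basis. f e) = (\<Prod>u\<in>Basis. f (u, 0)) * f (0, 1)" for f :: "'a \<times> real \<Rightarrow> real"
    unfolding Basis_prod_def by (subst prod.union_disjoint) (auto simp: 1)
  then show ?thesis by (cases c; cases d) (simp add: box_bump_def)
qed

context cylinder_solution
begin

definition total :: real where
  "total = (LINT X|M2. (norm (P X))\<^sup>2 * m (snd X))"

lemma total_nonneg: "0 \<le> total"
  unfolding total_def using less_imp_le[OF m_pos] by (intro Bochner_Integration.integral_nonneg) auto

text \<open>
  The derivative is moved back from the kernel to the solution; this keeps the \<open>L\<^sup>1\<close> norm of \<open>\<kappa>\<close>
  itself on the right, instead of that of its derivative.
\<close>

lemma gradient_energy:
  assumes k: "kernel \<epsilon> \<kappa>" and R: "R + \<epsilon> < \<tau>" and e: "e \<in> Basis"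
  shows "energy R (conv V (dirderiv e \<kappa>)) \<le> (LINT w|lborel. \<bar>\<kappa> w\<bar>)\<^sup>2 * total"
proof -
  let ?F = "\<lambda>X. P X \<bullet> e" and ?A = "LINT w|lborel. \<bar>\<kappa> w\<bar>"
  have eq: "energy R (conv V (dirderiv e \<kappa>)) = energy R (conv ?F \<kappa>)"
  proof -
    have e1: "indicator (ball 0 R) z * (LINT s|lborel. indicator {0<..<R} s * ((conv V (dirderiv e \<kappa>) (z, s))\<^sup>2 * m s)) =
      indicator (ball 0 R) z * (LINT s|lborel. indicator {0<..<R} s * ((conv ?F \<kappa> (z, s))\<^sup>2 * m s))" for z
    proof (cases "z \<in> ball 0 R")
      case True
      then have z: "norm z + \<epsilon> < \<tau>" using R by simp
      have "(LINT s|lborel. indicator {0<..<R} s * ((conv V (dirderiv e \<kappa>) (z, s))\<^sup>2 * m s)) =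
        (LINT s|lborel. indicator {0<..<R} s * ((conv ?F \<kappa> (z, s))\<^sup>2 * m s))"
      proof (rule integral_cong_AE)
        show "(\<lambda>s. indicator {0<..<R} s * ((conv V (dirderiv e \<kappa>) (z, s))\<^sup>2 * m s)) \<in> borel_measurable lborel"
          by (rule borel_measurable_integrable[OF conv_square_line_integrable[OF slice_ok(1) kernel_dirderiv[OF k]]])
        show "(\<lambda>s. indicator {0<..<R} s * ((conv ?F \<kappa> (z, s))\<^sup>2 * m s)) \<in> borel_measurable lborel"
          by (rule borel_measurable_integrable[OF conv_square_line_integrable[OF slice_ok(2)[OF e] k]])
        show "AE s in lborel. indicator {0<..<R} s * ((conv V (dirderiv e \<kappa>) (z, s))\<^sup>2 * m s) =
            indicator {0<..<R} s * ((conv ?F \<kappa> (z, s))\<^sup>2 * m s)"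
          using conv_gradient[OF k z e] by eventually_elim simp
      qed
      then show ?thesis by simp
    qed simp
    show ?thesis
      unfolding energy_Fubini(2)[OF slice_ok(1) kernel_dirderiv[OF k], of R e, symmetric]
        energy_Fubini(2)[OF slice_ok(2)[OF e] k, of R, symmetric] e1 ..
  qed
  have iF: "integrable M2 (\<lambda>X. (?F X)\<^sup>2 * m (snd X))"
  proof (rule Bochner_Integration.integrable_bound[OF P_square])
    show "AE X in M2. norm ((?F X)\<^sup>2 * m (snd X)) \<le> norm ((norm (P X))\<^sup>2 * m (snd X))"
    proof (intro AE_I2)
      fix X
      have "(?F X)\<^sup>2 \<le> (norm (P X))\<^sup>2" using Basis_le_norm[OF e, of "P X"] by (simp add: abs_le_square_iff[symmetric])
      then show "norm ((?F X)\<^sup>2 * m (snd X)) \<le> norm ((norm (P X))\<^sup>2 * m (snd X))"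
        using m_pos[of "snd X"] by (simp add: abs_mult mult_right_mono)
    qed
  qed measurable
  note iE = energy_integrable[OF slice_ok(2)[OF e] k, of R]
  have sE: "integrable lborel (\<lambda>y. LINT x|lborel. indicator (cyl R) (x, y) * ((conv ?F \<kappa> (x, y))\<^sup>2 * m y))"
    "(LINT y|lborel. LINT x|lborel. indicator (cyl R) (x, y) * ((conv ?F \<kappa> (x, y))\<^sup>2 * m y)) = energy R (conv ?F \<kappa>)"
    using lborel_pair.integrable_snd[of "\<lambda>x y. indicator (cyl R) (x, y) * ((conv ?F \<kappa> (x, y))\<^sup>2 * m y)"]
      lborel_pair.integral_snd[of "\<lambda>x y. indicator (cyl R) (x, y) * ((conv ?F \<kappa> (x, y))\<^sup>2 * m y)"] iE
    by (simp_all add: case_prod_beta' energy_def)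
  have sF: "integrable lborel (\<lambda>y. LINT z|lborel. (?F (z, y))\<^sup>2 * m y)"
    "(LINT y|lborel. LINT z|lborel. (?F (z, y))\<^sup>2 * m y) = (LINT X|M2. (?F X)\<^sup>2 * m (snd X))"
    using lborel_pair.integrable_snd[of "\<lambda>z y. (?F (z, y))\<^sup>2 * m y"] lborel_pair.integral_snd[of "\<lambda>z y. (?F (z, y))\<^sup>2 * m y"] iF
    by (simp_all add: case_prod_beta')
  have "AE y in lborel. integrable lborel (\<lambda>z. (?F (z, y))\<^sup>2 * m y)"
    using lborel_pair.AE_integrable_snd[of "\<lambda>z y. (?F (z, y))\<^sup>2 * m y"] iF by (simp add: case_prod_beta')
  then have le: "AE y in lborel. (LINT x|lborel. indicator (cyl R) (x, y) * ((conv ?F \<kappa> (x, y))\<^sup>2 * m y)) \<le>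
       ?A\<^sup>2 * (LINT z|lborel. (?F (z, y))\<^sup>2 * m y)"
  proof eventually_elim
    case (elim y)
    have mp: "0 < m y" by (rule m_pos)
    have "integrable lborel (\<lambda>z. inverse (m y) * ((?F (z, y))\<^sup>2 * m y))" using elim by simp
    then have F2: "integrable lborel (\<lambda>z. (?F (z, y))\<^sup>2)" using mp by (simp add: field_simps)
    note Y = conv_square_Young[OF slice_okD(2)[OF slice_ok(2)[OF e]] F2 k]
    have "(LINT x|lborel. indicator (cyl R) (x, y) * ((conv ?F \<kappa> (x, y))\<^sup>2 * m y)) \<le> (LINT x|lborel. (conv ?F \<kappa> (x, y))\<^sup>2 * m y)"
    proof (rule integral_mono')
      show "integrable lborel (\<lambda>x. (conv ?F \<kappa> (x, y))\<^sup>2 * m y)" using Y(1) by simp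
    qed (use mp in \<open>auto simp: indicator_def\<close>)
    also have "\<dots> = (LINT x|lborel. (conv ?F \<kappa> (x, y))\<^sup>2) * m y" by simp
    also have "\<dots> \<le> (?A\<^sup>2 * (LINT z|lborel. (?F (z, y))\<^sup>2)) * m y" using Y(2) mp by (intro mult_right_mono) auto
    finally show ?case by simp
  qed
  have "energy R (conv ?F \<kappa>) \<le> (LINT y|lborel. ?A\<^sup>2 * (LINT z|lborel. (?F (z, y))\<^sup>2 * m y))"
    unfolding sE(2)[symmetric] using sE(1) sF(1) le by (intro integral_mono_AE integrable_mult_right)
  also have "\<dots> = ?A\<^sup>2 * (LINT X|M2. (?F X)\<^sup>2 * m (snd X))" by (simp only: integral_mult_right_zero sF(2))
  also have "\<dots> \<le> ?A\<^sup>2 * total"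
    unfolding total_def
  proof (intro mult_left_mono integral_mono iF P_square)
    fix X
    have "(?F X)\<^sup>2 \<le> (norm (P X))\<^sup>2" using Basis_le_norm[OF e, of "P X"] by (simp add: abs_le_square_iff[symmetric])
    then show "(?F X)\<^sup>2 * m (snd X) \<le> (norm (P X))\<^sup>2 * m (snd X)" using m_pos[of "snd X"] by (intro mult_right_mono) auto
  qed simp
  finally show ?thesis unfolding eq .
qed

text \<open>
  Removes the mollifier. A box bump is a product of a bump in \<open>x\<close> and one in \<open>y\<close>, so its integral
  against \<open>F\<close> is an integral over \<open>y\<close> of the mollification of \<open>F\<close> at the corner \<open>a\<close> of the
  box, with the reflected horizontal bump as a kernel. Its \<open>L\<^sup>1\<close> norm is what the average over the
  box has to be compared with.
\<close>

lemma AE_bound_of_mollifications: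
  assumes F: "slice_ok F" and \<epsilon>: "0 < \<epsilon>" and r: "r \<le> \<tau>"
    and H: "\<And>\<kappa> x. kernel \<epsilon> \<kappa> \<Longrightarrow> norm x < r \<Longrightarrow>
      AE y in lborel. y \<in> {0<..<r} \<longrightarrow> \<bar>conv F \<kappa> (x, y)\<bar> \<le> B * (LINT w|lborel. \<bar>\<kappa> w\<bar>)"
  shows "AE X in M2. X \<in> cyl r \<longrightarrow> \<bar>F X\<bar> \<le> B"
proof -
  have M2: "M2 = (lborel :: ('a \<times> real) measure)" by (rule lborel_prod)
  have iF: "integrable M2 F"
    using slice_product_integral(1)[OF F, of "\<lambda>_. 1" "\<lambda>_. 1" 1] N_integrable by simp
  have iF': "integrable lborel F" using iF by (simp only: M2)
  have "open (cyl r :: ('a \<times> real) set)" unfolding cyl_def by (intro open_Times) auto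
  then have "AE X in lebesgue. X \<in> cyl r \<longrightarrow> \<bar>F X\<bar> \<le> B"
  proof (rule AE_le_of_box_averages[OF _ integrable_imp_locally_integrable_on[OF iF'] \<epsilon>])
    fix c d :: "'a \<times> real"
    assume cd: "cbox c d \<subseteq> cyl r" "box c d \<noteq> {}" "norm (d - c) < \<epsilon>"
    obtain a y1 b y2 where c: "c = (a, y1)" and d: "d = (b, y2)" by (metis surj_pair)
    have cm: "c \<in> cbox c d" using cd(2) by (auto simp: box_ne_empty mem_box intro: less_imp_le)
    have a: "norm a < r" using cm cd(1) by (auto simp: cyl_def c)
    have bump: "\<bar>LINT X|M2. F X * box_bump k c d X\<bar> \<le> B * measure lborel (cbox c d)" for k
    proof -
      let ?\<eta> = "box_bump k a b :: 'a \<Rightarrow> real" and ?\<zeta> = "box_bump k y1 y2 :: real \<Rightarrow> real"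
      define \<kappa> where "\<kappa> w = ?\<eta> (a - w)" for w
      have kk: "kernel \<epsilon> \<kappa>"
        unfolding kernel_def
      proof (intro conjI allI impI)
        show "smooth \<kappa>" unfolding \<kappa>_def by (rule dirderiv_reflect(1)[OF smooth_box_bump])
        fix w assume "\<kappa> w \<noteq> 0"
        then have "a - w \<in> box a b" using box_bump_nonzero by (metis \<kappa>_def)
        then have "\<bar>w \<bullet> e\<bar> \<le> \<bar>(b - a) \<bullet> e\<bar>" if "e \<in> Basis" for e
          using that by (auto simp: mem_box inner_diff_left dest!: bspec)
        then have "norm w \<le> norm (b - a)" by (rule norm_le_componentwise)
        also have "\<dots> \<le> norm (d - c)" by (simp add: c d norm_fst_le norm_prod_def)
        finally show "norm w \<le> \<epsilon>" using cd(3) by simp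
      qed
      have K: "(LINT w|lborel. \<bar>\<kappa> w\<bar>) = (LINT z|lborel. ?\<eta> z)"
        using lborel_integral_reflect[OF smooth_borel_measurable[OF smooth_box_bump[of k a b]], of a] box_bump_bounds(1)[of k a b]
        by (simp add: \<kappa>_def)
      have N\<zeta>: "integrable lborel (\<lambda>y. N y * ?\<zeta> y)" by (rule integrable_bump[OF N_integrable])
      have "(LINT X|M2. F X * box_bump k c d X) = (LINT X|M2. F X * ?\<zeta> (snd X) * ?\<eta> (fst X))"
      proof (intro Bochner_Integration.integral_cong refl)
        fix X :: "'a \<times> real"
        show "F X * box_bump k c d X = F X * ?\<zeta> (snd X) * ?\<eta> (fst X)"
          using box_bump_Pair[of k c d "fst X" "snd X"] by (simp add: c d ac_simps)
      qed
      also have "\<dots> = (LINT y|lborel. ?\<zeta> y * (LINT z|lborel. F (z, y) * ?\<eta> z))"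
        using box_bump_bounds[of k a b] by (intro slice_product_integral(2)[OF F _ _ N\<zeta>, of _ 1])
          (auto simp: smooth_borel_measurable smooth_box_bump)
      also have "\<dots> = (LINT y|lborel. ?\<zeta> y * conv F \<kappa> (a, y))" by (simp add: conv_def \<kappa>_def)
      finally have "\<bar>LINT X|M2. F X * box_bump k c d X\<bar> \<le> (LINT y|lborel. \<bar>?\<zeta> y * conv F \<kappa> (a, y)\<bar>)"
        by (simp add: integral_abs_bound)
      also have "\<dots> \<le> (LINT y|lborel. ?\<zeta> y * (B * (LINT z|lborel. ?\<eta> z)))"
      proof (rule integral_mono_AE)
        show "integrable lborel (\<lambda>y. \<bar>?\<zeta> y * conv F \<kappa> (a, y)\<bar>)"
          using conv_line_integrable[OF F kk _ N\<zeta>, of a] by (simp add: mult.commute smooth_borel_measurable smooth_box_bump)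
        show "integrable lborel (\<lambda>y. ?\<zeta> y * (B * (LINT z|lborel. ?\<eta> z)))" using box_bump_integrable[of k y1 y2] by simp
        show "AE y in lborel. \<bar>?\<zeta> y * conv F \<kappa> (a, y)\<bar> \<le> ?\<zeta> y * (B * (LINT z|lborel. ?\<eta> z))"
          using H[OF kk a]
        proof eventually_elim
          case (elim y)
          show ?case
          proof (cases "?\<zeta> y = 0")
            case False
            then have "y \<in> box y1 y2" using box_bump_nonzero by metis
            then have "(a, y) \<in> cbox c d" using cm box_subset_cbox by (auto simp: c d cbox_Pair_eq)
            then have "y \<in> {0<..<r}" using cd(1) by (auto simp: cyl_def)
            then show ?thesis using elim K box_bump_bounds(1)[of k y1 y2 y] by (simp add: abs_mult mult_left_mono)
          qed simp
        qed
      qed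
      also have "\<dots> = B * ((LINT z|lborel. ?\<eta> z) * (LINT y|lborel. ?\<zeta> y))" by simp
      also have "(LINT z|lborel. ?\<eta> z) * (LINT y|lborel. ?\<zeta> y) = (LINT X|M2. box_bump k c d X)"
      proof -
        have "(LINT X|M2. box_bump k c d X) = (LINT X|M2. (case X of (z, y) \<Rightarrow> ?\<eta> z * ?\<zeta> y))"
          by (intro Bochner_Integration.integral_cong refl) (auto simp: box_bump_Pair c d)
        also have "\<dots> = (LINT z|lborel. LINT y|lborel. ?\<eta> z * ?\<zeta> y)"
          by (rule lborel_pair.integral_fst[symmetric, OF integrable_product[OF box_bump_integrable box_bump_integrable]])
        finally show ?thesis by simp
      qed
      also have "B * (LINT X|M2. box_bump k c d X) \<le> B * measure lborel (cbox c d)"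
      proof (rule mult_left_mono)
        have "(LINT X|M2. box_bump k c d X) = (LINT X|lborel. box_bump k c d X)" by (simp only: M2)
        also have "\<dots> \<le> (LINT X|lborel. indicator (cbox c d) X)"
          using box_bump_bounds[of k c d] box_bump_nonzero[of k c d] box_subset_cbox[of c d]
          by (intro integral_mono box_bump_integrable integrable_indicator_bounded) (force simp: indicator_def)+
        finally show "(LINT X|M2. box_bump k c d X) \<le> measure lborel (cbox c d)" by simp
        \<comment> \<open>a kernel of nonzero mass forces the bound to be nonnegative\<close>
        obtain y where "\<bar>conv F \<kappa> (a, y)\<bar> \<le> B * (LINT w|lborel. \<bar>\<kappa> w\<bar>)"
        proof -
          have "\<exists>y\<in>{0<..<r}. \<bar>conv F \<kappa> (a, y)\<bar> \<le> B * (LINT w|lborel. \<bar>\<kappa> w\<bar>)"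
          proof (rule ccontr)
            assume "\<not> ?thesis"
            then have "AE y in lborel. y \<notin> {0<..<r}" using H[OF kk a] by (auto elim: AE_mp)
            then have "emeasure lborel {0<..<r} = 0"
              by (subst (asm) AE_iff_measurable[where N = "{0<..<r}"]) auto
            moreover have "0 < r" using a norm_ge_zero[of a] by linarith
            ultimately show False by (simp add: ennreal_eq_0_iff)
          qed
          then show thesis using that by blast
        qed
        then have nn: "0 \<le> B * (LINT w|lborel. \<bar>\<kappa> w\<bar>)" using abs_ge_zero order_trans by blast
        show "0 \<le> B"
        proof (rule ccontr)
          assume neg: "\<not> 0 \<le> B"
          then have "(LINT z|lborel. ?\<eta> z) \<le> 0" using nn K by (simp add: zero_le_mult_iff)
          then have "(LINT z|lborel. ?\<eta> z) = 0"
            using Bochner_Integration.integral_nonneg[of lborel ?\<eta>] box_bump_bounds(1)[of k a b] by fastforce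
          then have "AE z in lborel. ?\<eta> z = 0"
            using integral_nonneg_eq_0_iff_AE[OF box_bump_integrable, of k a b] box_bump_bounds(1)[of k a b] by simp
          then have "AE z in lborel. z \<notin> box a b"
            by (rule AE_mp) (use box_bump_nonzero[of k a b] in \<open>auto intro!: AE_I2\<close>)
          then have "emeasure lborel (box a b) = 0"
            by (subst (asm) AE_iff_measurable[where N = "box a b"]) auto
          then have "negligible (box a b)"
            unfolding negligible_iff_null_sets by (intro null_sets_completionI) (simp add: null_sets_def)
          moreover have "box a b \<noteq> {}"
          proof -
            obtain z1 z2 where z: "(z1, z2) \<in> box c d" using cd(2) by auto
            have "z1 \<in> box a b"
              unfolding mem_box
            proof
              fix u :: 'a assume "u \<in> Basis"
              then have "(u, 0) \<in> (Basis :: ('a \<times> real) set)" by (simp add: Basis_prod_def)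
              then show "a \<bullet> u < z1 \<bullet> u \<and> z1 \<bullet> u < b \<bullet> u" using z by (force simp: mem_box c d)
            qed
            then show ?thesis by auto
          qed
          ultimately show False
            using open_not_negligible[of "box a b"] open_box by blast
        qed
      qed
      finally show ?thesis .
    qed
    have "set_integrable lebesgue (cbox c d) F"
      using integrable_imp_locally_integrable_on[OF iF', of UNIV] by (simp add: locally_integrable_on_def)
    note lim = box_bump_integral_tendsto[OF this]
    have "(LINT X|lebesgue. F X * box_bump k c d X) = (LINT X|M2. F X * box_bump k c d X)" for k
    proof -
      have "(LINT X|lebesgue. F X * box_bump k c d X) = (LINT X|lborel. F X * box_bump k c d X)"
        using borel_measurable_integrable[OF iF'] smooth_borel_measurable[OF smooth_box_bump[of k c d]]
        by (intro integral_completion) simp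
      then show ?thesis by (simp only: M2)
    qed
    then have "\<bar>LINT X|lebesgue. F X * box_bump k c d X\<bar> \<le> B * measure lborel (cbox c d)" for k
      using bump by simp
    then show "\<bar>LINT X:cbox c d|lebesgue. F X\<bar> \<le> B * measure lborel (cbox c d)"
      using tendsto_upperbound[OF tendsto_rabs[OF lim], of "B * measure lborel (cbox c d)"] by simp
  qed
  then have "AE X in lborel. X \<in> cyl r \<longrightarrow> \<bar>F X\<bar> \<le> B" by (simp add: AE_completion_iff)
  then show ?thesis by (simp only: M2)
qed

lemma sup_const_nonneg: "0 \<le> D \<Longrightarrow> 0 \<le> sup_const D L"
  unfolding sup_const_def using K_pos by (intro sum_nonneg mult_nonneg_nonneg) auto

text \<open>
  The distance \<open>(1 - \<theta>) \<tau> = (n + 6) \<delta>\<close> is divided into layers of width \<open>\<delta>\<close>: two for the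
  mollification, \<open>n + 2\<close> for the supremum bound, one for an additional Caccioppoli step and one for the
  ball over which the Taylor expansion is averaged.

  The supremum bound for first derivatives gives the bound on \<open>P\<close>. For \<open>p0\<close> it is applied to second derivatives,
  which are of size \<open>B / \<delta>\<close>. The flux identity integrates them against the weight, and the
  hypothesis on the weight returns a factor \<open>\<tau> m y = L \<delta> m y\<close>: the powers of \<open>\<delta>\<close> and the weight cancel.
\<close>

lemma gradient_bound:
  fixes \<theta> \<delta> L D :: real
  assumes \<theta>: "0 < \<theta>" "\<theta> < 1" and L: "L = (DIM('a) + 6) / (1 - \<theta>)" and \<delta>: "\<delta> = \<tau> / L"
    and D: "D = 20 * DIM('a) ^ 4 * \<Lambda> ^ 4 * L\<^sup>2"
    and C: "C = sup_const D L * (1 + \<Lambda>\<^sup>2 * (real DIM('a))\<^sup>2 * sqrt D * L * C\<^sub>0)"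
    and B: "B = sqrt (total / (measure lborel (ball (0::'a) \<delta>) * mass (\<theta> * \<tau>)))"
  shows "e \<in> Basis \<Longrightarrow> AE X in M2. X \<in> cyl (\<theta> * \<tau>) \<longrightarrow> \<bar>P X \<bullet> e\<bar> \<le> C * B"
    and "AE X in M2. X \<in> cyl (\<theta> * \<tau>) \<longrightarrow> \<bar>p0 X\<bar> \<le> C * B"
proof -
  let ?n = "DIM('a)"
  define r where "r = \<theta> * \<tau>"
  have L7: "7 \<le> L"
  proof -
    have "7 \<le> real (?n + 6)" using DIM_positive[where 'a='a] by linarith
    also have "\<dots> \<le> L" using \<theta> unfolding L by (simp add: field_simps)
    finally show ?thesis .
  qed
  have \<tau>L: "\<tau> = L * \<delta>" using L7 by (simp add: \<delta>)
  have \<delta>0: "0 < \<delta>" using L7 \<tau> by (simp add: \<delta>)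
  have gap: "\<tau> - r = (?n + 6) * \<delta>"
    using \<theta> \<tau> by (simp add: r_def \<delta> L field_simps)
  have r0: "0 < r" "r \<le> \<tau>" using \<theta> \<tau> by (auto simp: r_def)
  have D0: "0 \<le> D" using D by simp
  define S where "S = sup_const D L"
  have S0: "0 \<le> S" unfolding S_def by (rule sup_const_nonneg[OF D0])
  define b where "b = measure lborel (ball (0::'a) \<delta>)"
  have b: "0 < b" unfolding b_def using \<delta>0 by (simp add: content_ball_pos)
  have mr: "0 < mass r" by (rule mass_pos[OF r0])
  have B': "B = sqrt (total / (b * mass r))" by (simp add: B b_def r_def)
  have B0: "0 \<le> B" unfolding B' using total_nonneg b mr by simp
  define R where "R = \<tau> - 2 * \<delta>"
  have R: "R + \<delta> < \<tau>" "R \<le> \<tau>" "\<delta> < R" "R \<le> L * \<delta>"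
  proof -
    show "R + \<delta> < \<tau>" "R \<le> \<tau>" "R \<le> L * \<delta>" using \<delta>0 \<tau>L by (auto simp: R_def)
    have "7 * \<delta> \<le> L * \<delta>" using L7 \<delta>0 by (intro mult_right_mono) auto
    then show "\<delta> < R" using \<delta>0 \<tau>L by (simp add: R_def)
  qed
  have \<rho>1: "R - (?n + 2) * \<delta> = r + 2 * \<delta>" "R - \<delta> - (?n + 2) * \<delta> = r + \<delta>"
    using gap by (simp_all add: R_def algebra_simps)
  have \<rho>\<tau>: "r + 2 * \<delta> \<le> \<tau>" using \<rho>1(1) R(2) \<delta>0 by (smt (verit) mult_nonneg_nonneg of_nat_0_le_iff)
  have sqrt_le: "sqrt (E / (b * mass \<rho>)) \<le> c * A * B"
    if "E \<le> c\<^sup>2 * (A\<^sup>2 * total)" "r \<le> \<rho>" "\<rho> \<le> \<tau>" "0 \<le> c" "0 \<le> A" for E c A \<rho>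
  proof -
    have "mass r \<le> mass \<rho>" by (rule mass_mono[OF that(2,3)])
    then have "E / (b * mass \<rho>) \<le> (c\<^sup>2 * (A\<^sup>2 * total)) / (b * mass r)"
      using that b mr total_nonneg by (intro frac_le mult_left_mono mult_pos_pos mult_nonneg_nonneg) auto
    also have "\<dots> = (c * A)\<^sup>2 * (total / (b * mass r))" by (simp add: power_mult_distrib)
    finally have "sqrt (E / (b * mass \<rho>)) \<le> sqrt ((c * A)\<^sup>2 * (total / (b * mass r)))" by simp
    also have "\<dots> = c * A * B" unfolding B' real_sqrt_mult using that by simp
    finally show ?thesis .
  qed
  have A0: "0 \<le> (LINT w|lborel. \<bar>\<kappa> w\<bar>)" for \<kappa> :: "'a \<Rightarrow> real" by simp
  have \<tau>\<delta>: "\<tau> \<le> L * \<delta>" using \<tau>L by simp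
  \<comment> \<open>first derivatives: no Caccioppoli step is lost, since their energy is part of \<open>total\<close>\<close>
  have first: "AE y in lborel. y \<in> {0<..<r} \<longrightarrow> (\<forall>x. norm x < r \<longrightarrow> \<bar>conv V (dirderiv e \<kappa>) (x, y)\<bar> \<le> S * ((LINT w|lborel. \<bar>\<kappa> w\<bar>) * B))"
    if k: "kernel \<delta> \<kappa>" and e: "e \<in> Basis" for \<kappa> e
  proof -
    have "energy R (conv V (dirderiv e \<kappa>)) \<le> 1\<^sup>2 * ((LINT w|lborel. \<bar>\<kappa> w\<bar>)\<^sup>2 * total)"
      using gradient_energy[OF k R(1) e] by simp
    from sqrt_le[OF this, of "r + 2 * \<delta>"] have *: "sqrt (energy R (conv V (dirderiv e \<kappa>)) / (b * mass (r + 2 * \<delta>))) \<le> (LINT w|lborel. \<bar>\<kappa> w\<bar>) * B"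
      using \<rho>\<tau> \<delta>0 A0 by simp
    have "AE y in lborel. y \<in> {0<..<r + 2 * \<delta>} \<longrightarrow> (\<forall>x. norm x + \<delta> \<le> r + 2 * \<delta> \<longrightarrow>
       \<bar>conv V (dirderiv e \<kappa>) (x, y)\<bar> \<le> S * sqrt (energy R (conv V (dirderiv e \<kappa>)) / (b * mass (r + 2 * \<delta>))))"
      unfolding S_def b_def by (rule sup_bound[OF kernel_dirderiv[OF k] \<delta>0 \<tau>\<delta> R(1,2) D \<rho>1(1)[symmetric]]) (use r0 \<delta>0 in simp)
    then show ?thesis
    proof (rule AE_mp, intro AE_I2 impI allI)
      fix y :: real and x :: 'a assume H: "y \<in> {0<..<r + 2 * \<delta>} \<longrightarrow> (\<forall>x. norm x + \<delta> \<le> r + 2 * \<delta> \<longrightarrow>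
         \<bar>conv V (dirderiv e \<kappa>) (x, y)\<bar> \<le> S * sqrt (energy R (conv V (dirderiv e \<kappa>)) / (b * mass (r + 2 * \<delta>))))"
        and y: "y \<in> {0<..<r}" and x: "norm x < r"
      have "\<bar>conv V (dirderiv e \<kappa>) (x, y)\<bar> \<le> S * sqrt (energy R (conv V (dirderiv e \<kappa>)) / (b * mass (r + 2 * \<delta>)))"
        using H y x \<delta>0 by auto
      also have "\<dots> \<le> S * ((LINT w|lborel. \<bar>\<kappa> w\<bar>) * B)" by (rule mult_left_mono[OF * S0])
      finally show "\<bar>conv V (dirderiv e \<kappa>) (x, y)\<bar> \<le> S * ((LINT w|lborel. \<bar>\<kappa> w\<bar>) * B)" .
    qed
  qed
  \<comment> \<open>second derivatives: one Caccioppoli step reduces them to first derivatives\<close>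
  have second: "AE y in lborel. y \<in> {0<..<r} \<longrightarrow> (\<forall>x. norm x < r \<longrightarrow> \<bar>conv V (dirderiv e (dirderiv e' \<kappa>)) (x, y)\<bar> \<le> S * (sqrt D / \<delta> * (LINT w|lborel. \<bar>\<kappa> w\<bar>) * B))"
    if k: "kernel \<delta> \<kappa>" and e: "e \<in> Basis" "e' \<in> Basis" for \<kappa> e e'
  proof -
    let ?\<kappa> = "dirderiv e (dirderiv e' \<kappa>)"
    have "energy (R - \<delta>) (conv V ?\<kappa>) \<le> D / \<delta>\<^sup>2 * energy R (conv V (dirderiv e' \<kappa>))"
      unfolding D by (rule caccioppoli_step(1)[OF kernel_dirderiv[OF k] \<delta>0 R(3,4,1,2) e(1)])
    also have "\<dots> \<le> D / \<delta>\<^sup>2 * ((LINT w|lborel. \<bar>\<kappa> w\<bar>)\<^sup>2 * total)"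
      using gradient_energy[OF k R(1) e(2)] D0 by (intro mult_left_mono) auto
    also have "D / \<delta>\<^sup>2 = (sqrt D / \<delta>)\<^sup>2" using D0 by (simp add: power_divide)
    finally have "energy (R - \<delta>) (conv V ?\<kappa>) \<le> (sqrt D / \<delta>)\<^sup>2 * ((LINT w|lborel. \<bar>\<kappa> w\<bar>)\<^sup>2 * total)" .
    from sqrt_le[OF this, of "r + \<delta>"] have *: "sqrt (energy (R - \<delta>) (conv V ?\<kappa>) / (b * mass (r + \<delta>))) \<le> sqrt D / \<delta> * (LINT w|lborel. \<bar>\<kappa> w\<bar>) * B"
      using \<rho>\<tau> \<delta>0 A0 D0 by simp
    have R': "R - \<delta> + \<delta> < \<tau>" "R - \<delta> \<le> \<tau>" using R \<delta>0 by auto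
    have "AE y in lborel. y \<in> {0<..<r + \<delta>} \<longrightarrow> (\<forall>x. norm x + \<delta> \<le> r + \<delta> \<longrightarrow>
       \<bar>conv V ?\<kappa> (x, y)\<bar> \<le> S * sqrt (energy (R - \<delta>) (conv V ?\<kappa>) / (b * mass (r + \<delta>))))"
      unfolding S_def b_def by (rule sup_bound[OF kernel_dirderiv[OF kernel_dirderiv[OF k]] \<delta>0 \<tau>\<delta> R' D \<rho>1(2)[symmetric]]) (use r0 \<delta>0 in simp)
    then show ?thesis
    proof (rule AE_mp, intro AE_I2 impI allI)
      fix y :: real and x :: 'a assume H: "y \<in> {0<..<r + \<delta>} \<longrightarrow> (\<forall>x. norm x + \<delta> \<le> r + \<delta> \<longrightarrow>
         \<bar>conv V ?\<kappa> (x, y)\<bar> \<le> S * sqrt (energy (R - \<delta>) (conv V ?\<kappa>) / (b * mass (r + \<delta>))))"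
        and y: "y \<in> {0<..<r}" and x: "norm x < r"
      have "\<bar>conv V ?\<kappa> (x, y)\<bar> \<le> S * sqrt (energy (R - \<delta>) (conv V ?\<kappa>) / (b * mass (r + \<delta>)))"
        using H y x \<delta>0 by auto
      also have "\<dots> \<le> S * (sqrt D / \<delta> * (LINT w|lborel. \<bar>\<kappa> w\<bar>) * B)" by (rule mult_left_mono[OF * S0])
      finally show "\<bar>conv V ?\<kappa> (x, y)\<bar> \<le> S * (sqrt D / \<delta> * (LINT w|lborel. \<bar>\<kappa> w\<bar>) * B)" .
    qed
  qed
  have Cge: "S \<le> C" "S * (\<Lambda>\<^sup>2 * (real ?n)\<^sup>2 * sqrt D * L * C\<^sub>0) \<le> C"
    using S0 D0 L7 C0_pos unfolding C S_def[symmetric] by (auto simp: algebra_simps)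
  show "AE X in M2. X \<in> cyl (\<theta> * \<tau>) \<longrightarrow> \<bar>P X \<bullet> e\<bar> \<le> C * B" if e: "e \<in> Basis" for e
    unfolding r_def[symmetric]
  proof (rule AE_bound_of_mollifications[OF slice_ok(2)[OF e] \<delta>0 r0(2)])
    fix \<kappa> :: "'a \<Rightarrow> real" and x :: 'a assume k: "kernel \<delta> \<kappa>" and x: "norm x < r"
    have "norm x + \<delta> < \<tau>" using x \<rho>\<tau> \<delta>0 by simp
    from conv_gradient[OF k this e] first[OF k e]
    show "AE y in lborel. y \<in> {0<..<r} \<longrightarrow> \<bar>conv (\<lambda>X. P X \<bullet> e) \<kappa> (x, y)\<bar> \<le> C * B * (LINT w|lborel. \<bar>\<kappa> w\<bar>)"
    proof eventually_elim
      case (elim y)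
      have "S * ((LINT w|lborel. \<bar>\<kappa> w\<bar>) * B) \<le> C * ((LINT w|lborel. \<bar>\<kappa> w\<bar>) * B)"
        using Cge(1) B0 A0 by (intro mult_right_mono) auto
      then show ?case using elim x by (auto simp: ac_simps)
    qed
  qed
  show "AE X in M2. X \<in> cyl (\<theta> * \<tau>) \<longrightarrow> \<bar>p0 X\<bar> \<le> C * B"
    unfolding r_def[symmetric]
  proof (rule AE_bound_of_mollifications[OF slice_ok(3) \<delta>0 r0(2)])
    fix \<kappa> :: "'a \<Rightarrow> real" and x :: 'a assume k: "kernel \<delta> \<kappa>" and x: "norm x < r"
    have x\<tau>: "norm x + \<delta> < \<tau>" using x \<rho>\<tau> \<delta>0 by simp
    define A where "A = (LINT w|lborel. \<bar>\<kappa> w\<bar>)"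
    define H2 where "H2 = S * (sqrt D / \<delta> * A * B)"
    have H20: "0 \<le> H2" unfolding H2_def A_def using S0 D0 \<delta>0 A0 B0 by simp
    have "AE s in lborel. \<forall>e\<in>Basis. \<forall>e'\<in>Basis. s \<in> {0<..<r} \<longrightarrow> \<bar>conv V (dirderiv e (dirderiv e' \<kappa>)) (x, s)\<bar> \<le> H2"
    proof (intro AE_finite_allI finite_Basis)
      fix e e' :: 'a assume "e \<in> Basis" "e' \<in> Basis"
      from second[OF k this] show "AE s in lborel. s \<in> {0<..<r} \<longrightarrow> \<bar>conv V (dirderiv e (dirderiv e' \<kappa>)) (x, s)\<bar> \<le> H2"
        by (rule AE_mp) (use x in \<open>auto simp: H2_def A_def intro!: AE_I2\<close>)
    qed
    then have hess: "AE s in lborel. s \<in> {0<..<r} \<longrightarrow> \<bar>hess \<kappa> (x, s)\<bar> \<le> (real ?n)\<^sup>2 * \<Lambda> * H2"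
    proof eventually_elim
      case (elim s)
      show ?case
      proof
        assume s: "s \<in> {0<..<r}"
        have "\<bar>hess \<kappa> (x, s)\<bar> \<le> (\<Sum>e\<in>(Basis::'a set). \<Sum>e'\<in>(Basis::'a set). \<Lambda> * H2)"
          unfolding hess_def
        proof (rule order_trans[OF sum_abs], rule sum_mono, rule order_trans[OF sum_abs], rule sum_mono)
          fix e e' :: 'a assume "e \<in> Basis" "e' \<in> Basis"
          then show "\<bar>aa e e' (snd (x, s)) * conv V (dirderiv e (dirderiv e' \<kappa>)) (x, s)\<bar> \<le> \<Lambda> * H2"
            unfolding abs_mult using elim s aa_bound \<Lambda> by (intro mult_mono) auto
        qed
        then show "\<bar>hess \<kappa> (x, s)\<bar> \<le> (real ?n)\<^sup>2 * \<Lambda> * H2" by (simp add: power2_eq_square ac_simps)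
      qed
    qed
    have im: "integrable lborel (\<lambda>s. m s * hess \<kappa> (x, s))" by (rule hess_line_integrable[OF k])
    have hz: "hess \<kappa> (x, s) = 0" if "s \<notin> {0<..<\<tau>}" for s
      using conv_zero_outside[OF slice_ok(1) kernel_dirderiv[OF kernel_dirderiv[OF k]] that] by (simp add: hess_def)
    have cumb: "\<bar>cum (\<lambda>s. m s * hess \<kappa> (x, s)) y\<bar> \<le> (real ?n)\<^sup>2 * \<Lambda> * H2 * cum (\<lambda>s. indicator {0<..<\<tau>} s * m s) y"
      if y: "y \<in> {0<..<r}" for y
    proof -
      have "\<bar>cum (\<lambda>s. m s * hess \<kappa> (x, s)) y\<bar> \<le> (LINT s|lborel. \<bar>indicator {..<y} s * (m s * hess \<kappa> (x, s))\<bar>)"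
        unfolding cum_def by (rule integral_abs_bound)
      also have "\<dots> \<le> (LINT s|lborel. (real ?n)\<^sup>2 * \<Lambda> * H2 * (indicator {..<y} s * (indicator {0<..<\<tau>} s * m s)))"
      proof (rule integral_mono_AE)
        show "integrable lborel (\<lambda>s. \<bar>indicator {..<y} s * (m s * hess \<kappa> (x, s))\<bar>)"
          by (intro integrable_abs integrable_indicator_mult im) simp
        show "integrable lborel (\<lambda>s. (real ?n)\<^sup>2 * \<Lambda> * H2 * (indicator {..<y} s * (indicator {0<..<\<tau>} s * m s)))"
          by (intro integrable_mult_right integrable_indicator_mult m_int) simp
        show "AE s in lborel. \<bar>indicator {..<y} s * (m s * hess \<kappa> (x, s))\<bar> \<le> (real ?n)\<^sup>2 * \<Lambda> * H2 * (indicator {..<y} s * (indicator {0<..<\<tau>} s * m s))"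
          using hess
        proof eventually_elim
          case (elim s)
          show ?case
          proof (cases "0 < s \<and> s < y")
            case True
            then have "\<bar>hess \<kappa> (x, s)\<bar> \<le> (real ?n)\<^sup>2 * \<Lambda> * H2" using elim y by auto
            from mult_left_mono[OF this, of "m s"] show ?thesis
              using True y r0 m_pos[of s] by (simp add: abs_mult ac_simps)
          next
            case False
            then show ?thesis using hz[of s] H20 \<Lambda> m_pos[of s] by (cases "s < y") (auto simp: indicator_def)
          qed
        qed
      qed
      finally show ?thesis by (simp add: cum_def)
    qed
    show "AE y in lborel. y \<in> {0<..<r} \<longrightarrow> \<bar>conv p0 \<kappa> (x, y)\<bar> \<le> C * B * (LINT w|lborel. \<bar>\<kappa> w\<bar>)"
      using conv_flux[OF k x\<tau>] flux_weight
    proof eventually_elim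
      case (elim y)
      show ?case
      proof
        assume y: "y \<in> {0<..<r}"
        then have y\<tau>: "y \<in> {0<..<\<tau>}" using r0 by auto
        have mp: "0 < m y" by (rule m_pos)
        have nn: "0 \<le> (real ?n)\<^sup>2 * \<Lambda> * H2" using \<Lambda> H20 by simp
        have bb0: "0 < bb y" using bb_bounds(1)[of y] \<Lambda> by (smt (verit) positive_imp_inverse_positive)
        have "m y * bb y * \<bar>conv p0 \<kappa> (x, y)\<bar> = \<bar>m y * bb y * conv p0 \<kappa> (x, y)\<bar>"
          using mp bb0 by (simp add: abs_mult)
        also have "\<dots> \<le> (real ?n)\<^sup>2 * \<Lambda> * H2 * cum (\<lambda>s. indicator {0<..<\<tau>} s * m s) y"
          using elim(1) y\<tau> cumb[OF y] by simp
        also have "\<dots> \<le> (real ?n)\<^sup>2 * \<Lambda> * H2 * (C\<^sub>0 * \<tau> * m y)"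
          using elim(2) y\<tau> nn by (intro mult_left_mono) auto
        finally have "m y * (bb y * \<bar>conv p0 \<kappa> (x, y)\<bar>) \<le> m y * ((real ?n)\<^sup>2 * \<Lambda> * H2 * (C\<^sub>0 * \<tau>))"
          by (simp add: ac_simps)
        then have 1: "bb y * \<bar>conv p0 \<kappa> (x, y)\<bar> \<le> (real ?n)\<^sup>2 * \<Lambda> * H2 * (C\<^sub>0 * \<tau>)" using mp by simp
        have "inverse \<Lambda> * \<bar>conv p0 \<kappa> (x, y)\<bar> \<le> bb y * \<bar>conv p0 \<kappa> (x, y)\<bar>"
          using bb_bounds(1)[of y] by (intro mult_right_mono) auto
        then have "\<Lambda> * (inverse \<Lambda> * \<bar>conv p0 \<kappa> (x, y)\<bar>) \<le> \<Lambda> * ((real ?n)\<^sup>2 * \<Lambda> * H2 * (C\<^sub>0 * \<tau>))"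
          using 1 \<Lambda> by (intro mult_left_mono) auto
        moreover have "\<Lambda> * (inverse \<Lambda> * \<bar>conv p0 \<kappa> (x, y)\<bar>) = \<bar>conv p0 \<kappa> (x, y)\<bar>" using \<Lambda> by simp
        ultimately have "\<bar>conv p0 \<kappa> (x, y)\<bar> \<le> \<Lambda> * ((real ?n)\<^sup>2 * \<Lambda> * H2 * (C\<^sub>0 * \<tau>))" by simp
        also have "\<dots> = S * (\<Lambda>\<^sup>2 * (real ?n)\<^sup>2 * sqrt D * L * C\<^sub>0) * (A * B)"
          using \<delta>0 by (simp add: H2_def \<tau>L power2_eq_square)
        also have "\<dots> \<le> C * (A * B)" using Cge(2) A0 B0 by (intro mult_right_mono) (auto simp: A_def)
        finally show "\<bar>conv p0 \<kappa> (x, y)\<bar> \<le> C * B * (LINT w|lborel. \<bar>\<kappa> w\<bar>)" by (simp add: A_def ac_simps)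
      qed
    qed
  qed
qed

end

section \<open>Borel representatives of the weight and of the coefficients\<close>

text \<open>
  Measurability and integrals with respect to Lebesgue measure can be read off from a Borel
  representative.
\<close>

lemma lebesgue_transfer:
  fixes f h :: "'a::euclidean_space \<Rightarrow> real"
  assumes h: "h \<in> borel_measurable borel" and eq: "AE x in lborel. f x = h x"
  shows "f \<in> borel_measurable lebesgue" "integrable lebesgue f \<longleftrightarrow> integrable lborel h"
    "(LINT x|lebesgue. f x) = (LINT x|lborel. h x)"
proof -
  have h': "h \<in> borel_measurable lborel" "h \<in> borel_measurable lebesgue"
    using h by (auto intro: measurable_completion)
  have ae: "AE x in lebesgue. h x = f x"
    using eq unfolding AE_completion_iff by eventually_elim simp
  show f: "f \<in> borel_measurable lebesgue" by (rule borel_measurable_AE[OF h'(2) ae])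
  show "integrable lebesgue f \<longleftrightarrow> integrable lborel h"
    using integrable_cong_AE[OF h'(2) f ae] integrable_completion[OF h'(1)] by simp
  show "(LINT x|lebesgue. f x) = (LINT x|lborel. h x)"
    using integral_cong_AE[OF h'(2) f ae] integral_completion[OF h'(1)] by simp
qed

lemma AE_snd:
  assumes "AE y in lborel. R y"
  shows "AE X in (M2 :: ('a::euclidean_space \<times> real) measure). R (snd X)"
proof -
  obtain N where N: "\<And>y. y \<in> space lborel - N \<Longrightarrow> R y" "N \<in> null_sets lborel" using AE_E3[OF assms] by blast
  have "emeasure M2 ((UNIV::'a set) \<times> N) = emeasure lborel (UNIV::'a set) * emeasure lborel N"
    using N(2) by (intro lborel.emeasure_pair_measure_Times) auto
  also have "\<dots> = 0" using N(2) by (simp add: null_sets_def)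
  finally have "(UNIV::'a set) \<times> N \<in> null_sets M2" using N(2) by (auto simp: null_sets_def intro!: pair_measureI)
  moreover have "y \<in> N" if "\<not> R y" for y using N(1)[of y] that by auto
  ultimately show ?thesis by (intro AE_I') auto
qed

lemma AE_open_closed_interval:
  fixes \<tau> :: real
  shows "AE y in lborel. (indicator {0..\<tau>} y :: real) = indicator {0<..<\<tau>} y"
proof -
  have "AE y in lborel. y \<noteq> 0" "AE y in lborel. y \<noteq> \<tau>" by (rule AE_lborel_singleton)+
  then show ?thesis by eventually_elim (auto simp: indicator_def)
qed

text \<open>
  The Muckenhoupt constant is used for the single interval \<open>(0, \<tau>)\<close>. Since the integral of the
  weight is positive there, finiteness of the product makes the reciprocal integrable. The null set
  where the weight is not positive is repaired by the value \<open>1\<close>.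
\<close>

lemma A2_weight_representative:
  assumes \<mu>: "A2_weight \<mu>" "A2_const \<mu> = ennreal K" and \<tau>: "0 < \<tau>"
  shows "\<exists>m\<in>borel_measurable borel. (\<forall>y. 0 < m y) \<and> (AE y in lborel. \<mu> y = m y) \<and>
    integrable lborel (\<lambda>y. indicator {0<..<\<tau>} y * m y) \<and>
    integrable lborel (\<lambda>y. indicator {0<..<\<tau>} y * inverse (m y)) \<and>
    (LINT y|lborel. indicator {0<..<\<tau>} y * m y) * (LINT y|lborel. indicator {0<..<\<tau>} y * inverse (m y)) \<le> K * \<tau>\<^sup>2"
proof -
  obtain m0 where m0: "m0 \<in> borel_measurable lborel" "AE y in lborel. \<mu> y = m0 y"
    using completion_ex_borel_measurable_real[of \<mu> lborel] \<mu>(1) by (auto simp: A2_weight_def)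
  define m where "m y = (if 0 < m0 y then m0 y else 1)" for y
  have mm [measurable]: "m \<in> borel_measurable borel" using m0(1) unfolding m_def by simp
  have mp: "0 < m y" for y by (simp add: m_def)
  have "AE y in lborel. 0 < \<mu> y" using \<mu>(1) by (simp add: A2_weight_def AE_completion_iff)
  with m0(2) have eq: "AE y in lborel. \<mu> y = m y" by eventually_elim (simp add: m_def)
  have i1: "integrable lborel (\<lambda>y. indicator {0<..<\<tau>} y * m y)"
  proof -
    have "AE y in lborel. indicator {0..\<tau>} y *\<^sub>R \<mu> y = indicator {0<..<\<tau>} y * m y"
      using eq AE_open_closed_interval[of \<tau>] by eventually_elim simp
    moreover have "integrable lebesgue (\<lambda>y. indicator {0..\<tau>} y *\<^sub>R \<mu> y)"
      using \<mu>(1) by (simp add: A2_weight_def set_integrable_def)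
    ultimately show ?thesis using lebesgue_transfer(2)[of "\<lambda>y. indicator {0<..<\<tau>} y * m y"] by simp
  qed
  let ?M = "LINT y|lborel. indicator {0<..<\<tau>} y * m y"
  have M: "0 < ?M" by (rule integral_pos_on_interval[OF i1 mp \<tau>])
  have a: "(\<integral>\<^sup>+ y\<in>{0..\<tau>}. ennreal (\<mu> y) \<partial>lebesgue) = ennreal ?M"
  proof -
    have "(\<integral>\<^sup>+ y\<in>{0..\<tau>}. ennreal (\<mu> y) \<partial>lebesgue) = (\<integral>\<^sup>+ y. ennreal (indicator {0<..<\<tau>} y * m y) \<partial>lebesgue)"
    proof (rule nn_integral_cong_AE)
      show "AE y in lebesgue. ennreal (\<mu> y) * indicator {0..\<tau>} y = ennreal (indicator {0<..<\<tau>} y * m y)"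
        using eq AE_open_closed_interval[of \<tau>] unfolding AE_completion_iff
        by eventually_elim (auto simp: indicator_def split: if_splits)
    qed
    also have "\<dots> = (\<integral>\<^sup>+ y. ennreal (indicator {0<..<\<tau>} y * m y) \<partial>lborel)" by (rule nn_integral_completion)
    also have "\<dots> = ennreal ?M" using less_imp_le[OF mp] by (intro nn_integral_eq_integral[OF i1] AE_I2) auto
    finally show ?thesis .
  qed
  have c: "(\<integral>\<^sup>+ y\<in>{0..\<tau>}. inverse (ennreal (\<mu> y)) \<partial>lebesgue) = (\<integral>\<^sup>+ y. ennreal (indicator {0<..<\<tau>} y * inverse (m y)) \<partial>lborel)"
    (is "_ = ?c")
  proof -
    have "(\<integral>\<^sup>+ y\<in>{0..\<tau>}. inverse (ennreal (\<mu> y)) \<partial>lebesgue) = (\<integral>\<^sup>+ y. ennreal (indicator {0<..<\<tau>} y * inverse (m y)) \<partial>lebesgue)"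
    proof (rule nn_integral_cong_AE)
      show "AE y in lebesgue. inverse (ennreal (\<mu> y)) * indicator {0..\<tau>} y = ennreal (indicator {0<..<\<tau>} y * inverse (m y))"
        using eq AE_open_closed_interval[of \<tau>] unfolding AE_completion_iff
        by eventually_elim (use mp in \<open>auto simp: indicator_def inverse_ennreal split: if_splits\<close>)
    qed
    also have "\<dots> = ?c" by (rule nn_integral_completion)
    finally show ?thesis .
  qed
  have "(\<lambda>(a, b). ((\<integral>\<^sup>+ y\<in>{a..b}. ennreal (\<mu> y) \<partial>lebesgue) / ennreal (b - a)) *
     ((\<integral>\<^sup>+ y\<in>{a..b}. inverse (ennreal (\<mu> y)) \<partial>lebesgue) / ennreal (b - a))) (0, \<tau>) \<le> A2_const \<mu>"
    unfolding A2_const_def by (rule SUP_upper) (use \<tau> in simp)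
  then have le: "(ennreal ?M / ennreal \<tau>) * (?c / ennreal \<tau>) \<le> ennreal K" by (simp add: a c \<mu>(2))
  have "?c \<noteq> \<infinity>"
  proof
    assume "?c = \<infinity>"
    then have "(ennreal ?M / ennreal \<tau>) * (?c / ennreal \<tau>) = \<infinity>"
      using M \<tau> by (simp add: divide_ennreal ennreal_top_divide ennreal_mult_top)
    then show False using le by (simp add: top_unique)
  qed
  then have i2: "integrable lborel (\<lambda>y. indicator {0<..<\<tau>} y * inverse (m y))"
    using less_imp_le[OF mp] by (intro integrableI_nonneg) (auto simp: less_top)
  let ?W = "LINT y|lborel. indicator {0<..<\<tau>} y * inverse (m y)"
  have W: "0 < ?W" by (rule integral_pos_on_interval[OF i2 _ \<tau>]) (use mp in simp)
  have "?c = ennreal ?W" using less_imp_le[OF mp] by (intro nn_integral_eq_integral[OF i2] AE_I2) auto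
  then have "ennreal ((?M / \<tau>) * (?W / \<tau>)) \<le> ennreal K"
    using le M W \<tau> by (simp add: divide_ennreal ennreal_mult[symmetric])
  moreover have "0 < (?M / \<tau>) * (?W / \<tau>)" using M W \<tau> by simp
  ultimately have "(?M / \<tau>) * (?W / \<tau>) \<le> K" by (auto simp: ennreal_le_iff2)
  then have "?M * ?W \<le> K * \<tau>\<^sup>2" using \<tau> by (simp add: field_simps power2_eq_square)
  then show ?thesis using mm mp eq i1 i2 by blast
qed

lemma matrix_entry_measurable:
  fixes B :: "real \<Rightarrow> real^'n^'n"
  assumes "B \<in> borel_measurable (lebesgue_on S)"
  shows "(\<lambda>y. (B y *v e) \<bullet> e') \<in> borel_measurable (lebesgue_on S)"
proof -
  have "continuous_on UNIV (\<lambda>A::real^'n^'n. (A *v e) \<bullet> e')"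
    unfolding matrix_vector_mult_def by (intro continuous_intros)
  then have "(\<lambda>A::real^'n^'n. (A *v e) \<bullet> e') \<in> borel_measurable borel" by (rule borel_measurable_continuous_onI)
  from measurable_compose[OF assms this] show ?thesis .
qed

lemma restricted_representative:
  fixes f :: "real \<Rightarrow> real"
  assumes "f \<in> borel_measurable (lebesgue_on {a<..<b})"
  shows "\<exists>f'\<in>borel_measurable borel. AE y in lborel. y \<in> {a<..<b} \<longrightarrow> f y = f' y"
proof -
  have "(\<lambda>y. indicator {a<..<b} y *\<^sub>R f y) \<in> borel_measurable lebesgue"
    using assms by (subst (asm) borel_measurable_restrict_space_iff) auto
  then have "(\<lambda>y. indicator {a<..<b} y * f y) \<in> borel_measurable lebesgue" by simp
  from borel_representative[OF this] show ?thesis by auto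
qed

lemma linear_bilinear_expansion:
  fixes f :: "'a::euclidean_space \<Rightarrow> 'a"
  assumes f: "linear f"
  shows "f x \<bullet> z = (\<Sum>e\<in>Basis. \<Sum>e'\<in>Basis. (f e \<bullet> e') * (x \<bullet> e) * (z \<bullet> e'))"
proof -
  have "f x = (\<Sum>e\<in>Basis. (x \<bullet> e) *\<^sub>R f e)"
    by (subst euclidean_representation[symmetric, of x]) (simp add: linear_sum[OF f] linear_cmul[OF f])
  then have "f x \<bullet> z = (\<Sum>e\<in>Basis. (x \<bullet> e) * (f e \<bullet> z))" by (simp add: inner_sum_left)
  also have "\<dots> = (\<Sum>e\<in>Basis. (x \<bullet> e) * (\<Sum>e'\<in>Basis. (f e \<bullet> e') * (z \<bullet> e')))"
    by (subst euclidean_inner) simp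
  finally show ?thesis by (simp add: sum_distrib_left ac_simps)
qed

text \<open>
  By polarisation the entry is a quarter of the difference of the form at \<open>e + e'\<close> and at \<open>e - e'\<close>,
  vectors of length at most \<open>2\<close>.
\<close>

lemma symmetric_form_entry_bound:
  fixes f :: "'a::euclidean_space \<Rightarrow> 'a"
  assumes f: "linear f" and sym: "\<And>x z. f x \<bullet> z = x \<bullet> f z"
    and q: "\<And>x. 0 \<le> f x \<bullet> x" "\<And>x. f x \<bullet> x \<le> \<Lambda> * (norm x)\<^sup>2" and e: "e \<in> Basis" "e' \<in> Basis" and \<Lambda>: "0 \<le> \<Lambda>"
  shows "\<bar>f e \<bullet> e'\<bar> \<le> \<Lambda>"
proof -
  have n: "norm (e + e') \<le> 2" "norm (e - e') \<le> 2"
    using norm_triangle_ineq[of e e'] norm_triangle_ineq4[of e e'] e by auto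
  have b: "f x \<bullet> x \<le> \<Lambda> * 4" if "norm x \<le> 2" for x
  proof -
    have "(norm x)\<^sup>2 \<le> 2\<^sup>2" using that by (intro power_mono) auto
    then have "\<Lambda> * (norm x)\<^sup>2 \<le> \<Lambda> * 4" using \<Lambda> by (intro mult_left_mono) auto
    then show ?thesis using q(2)[of x] by linarith
  qed
  have "f (e + e') \<bullet> (e + e') - f (e - e') \<bullet> (e - e') = 4 * (f e \<bullet> e')"
    using sym[of e e'] by (simp add: linear_add[OF f] linear_diff[OF f] inner_add_left inner_add_right inner_diff_left inner_diff_right inner_commute)
  then show ?thesis using b[OF n(1)] b[OF n(2)] q(1)[of "e + e'"] q(1)[of "e - e'"] by linarith
qed

text \<open>
  On the null set where ellipticity, symmetry or the choice of representatives fails, and outside the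
  interval, the coefficients are replaced by those of the identity matrix. That \<open>\<Lambda> \<ge> 1\<close> follows
  from ellipticity at one point.
\<close>

lemma coefficient_representative:
  fixes B :: "real \<Rightarrow> real^'n^'n"
  assumes el: "elliptic_coefficients \<Lambda> \<tau> \<mu> B b" and \<tau>: "0 < \<tau>" and \<Lambda>: "0 < \<Lambda>"
    and m: "AE y in lborel. \<mu> y = m y" "\<And>y. 0 < m y"
  shows "1 \<le> \<Lambda> \<and> (\<exists>bb aa. bb \<in> borel_measurable borel \<and> (\<forall>e e'. aa e e' \<in> borel_measurable borel) \<and>
    (\<forall>y. inverse \<Lambda> \<le> bb y \<and> bb y \<le> \<Lambda>) \<and> (\<forall>e e' y. \<bar>aa e e' y\<bar> \<le> \<Lambda>) \<and>
    (\<forall>\<xi> y. inverse \<Lambda> * (norm \<xi>)\<^sup>2 \<le> (\<Sum>e\<in>Basis. \<Sum>e'\<in>Basis. aa e e' y * (\<xi> \<bullet> e) * (\<xi> \<bullet> e'))) \<and>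
    (AE y in lborel. y \<in> {0<..<\<tau>} \<longrightarrow> (\<forall>x s z t. A0 \<mu> B b y (x, s) \<bullet> (z, t) =
      m y * ((\<Sum>e\<in>Basis. \<Sum>e'\<in>Basis. aa e e' y * (x \<bullet> e) * (z \<bullet> e')) + bb y * s * t))))"
proof -
  let ?S = "{0<..<\<tau>}"
  obtain b1 where b1: "b1 \<in> borel_measurable borel" "AE y in lborel. y \<in> ?S \<longrightarrow> b y = b1 y"
    using restricted_representative[of b 0 \<tau>] el by (auto simp: elliptic_coefficients_def)
  define a1 where "a1 e e' = (SOME a. a \<in> borel_measurable borel \<and> (AE y in lborel. y \<in> ?S \<longrightarrow> (B y *v e) \<bullet> e' = a y))" for e e'
  have "\<exists>a. a \<in> borel_measurable borel \<and> (AE y in lborel. y \<in> ?S \<longrightarrow> (B y *v e) \<bullet> e' = a y)" for e e'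
    using restricted_representative[OF matrix_entry_measurable, of B 0 \<tau> e e'] el by (auto simp: elliptic_coefficients_def)
  then have "a1 e e' \<in> borel_measurable borel \<and> (AE y in lborel. y \<in> ?S \<longrightarrow> (B y *v e) \<bullet> e' = a1 e e' y)" for e e'
    unfolding a1_def by (rule someI_ex)
  then have a1: "\<And>e e'. a1 e e' \<in> borel_measurable borel" "\<And>e e'. AE y in lborel. y \<in> ?S \<longrightarrow> (B y *v e) \<bullet> e' = a1 e e' y"
    by blast+
  define G where "G y \<longleftrightarrow> \<mu> y = m y \<and> b y = b1 y \<and> (\<forall>e\<in>Basis. \<forall>e'\<in>Basis. (B y *v e) \<bullet> e' = a1 e e' y) \<and> transpose (B y) = B y \<and>
     (\<forall>\<xi>. inverse \<Lambda> * \<mu> y * (norm \<xi>)\<^sup>2 \<le> A0 \<mu> B b y \<xi> \<bullet> \<xi> \<and> A0 \<mu> B b y \<xi> \<bullet> \<xi> \<le> \<Lambda> * \<mu> y * (norm \<xi>)\<^sup>2)" for y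
  have "AE y in lborel. y \<in> ?S \<longrightarrow> G y"
  proof -
    have 1: "AE y in lborel. y \<in> ?S \<longrightarrow> transpose (B y) = B y"
      using el by (simp add: elliptic_coefficients_def AE_restrict_space_iff AE_completion_iff)
    have 2: "AE y in lborel. y \<in> ?S \<longrightarrow> (\<forall>\<xi>. inverse \<Lambda> * \<mu> y * (norm \<xi>)\<^sup>2 \<le> A0 \<mu> B b y \<xi> \<bullet> \<xi> \<and>
        A0 \<mu> B b y \<xi> \<bullet> \<xi> \<le> \<Lambda> * \<mu> y * (norm \<xi>)\<^sup>2)"
      using el by (simp add: elliptic_coefficients_def AE_restrict_space_iff AE_completion_iff)
    have 3: "AE y in lborel. \<forall>e\<in>Basis. \<forall>e'\<in>Basis. y \<in> ?S \<longrightarrow> (B y *v e) \<bullet> e' = a1 e e' y"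
      by (rule AE_finite_allI[OF finite_Basis AE_finite_allI[OF finite_Basis a1(2)]])
    from 1 2 3 m(1) b1(2) show ?thesis by eventually_elim (simp add: G_def)
  qed
  then obtain N where N: "\<And>y. y \<notin> N \<Longrightarrow> y \<in> ?S \<Longrightarrow> G y" "N \<in> null_sets lborel" by (rule AE_E3) auto
  have Nb: "N \<in> sets borel" "AE y in lborel. y \<notin> N" using N(2) by (auto intro: AE_not_in)
  define T where "T = ?S - N"
  have Tb [measurable]: "T \<in> sets borel" using Nb by (auto simp: T_def)
  have G: "G y" if "y \<in> T" for y using N(1) that by (auto simp: T_def)
  have dec: "A0 \<mu> B b y (x, s) \<bullet> (z, t) = m y * ((\<Sum>e\<in>Basis. \<Sum>e'\<in>Basis. a1 e e' y * (x \<bullet> e) * (z \<bullet> e')) + b1 y * s * t)"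
    if y: "y \<in> T" for y x s z t
  proof -
    have "(B y *v x) \<bullet> z = (\<Sum>e\<in>Basis. \<Sum>e'\<in>Basis. a1 e e' y * (x \<bullet> e) * (z \<bullet> e'))"
      using G[OF y] by (subst linear_bilinear_expansion[OF matrix_vector_mul_linear]) (simp add: G_def)
    then show ?thesis using G[OF y] by (simp add: A0_def G_def distrib_left)
  qed
  \<comment> \<open>the weight is positive and can be divided out\<close>
  have el1: "inverse \<Lambda> * (norm (x, s))\<^sup>2 \<le> (B y *v x) \<bullet> x + b1 y * s * s" "(B y *v x) \<bullet> x + b1 y * s * s \<le> \<Lambda> * (norm (x, s))\<^sup>2"
    if y: "y \<in> T" for y s and x :: "real^'n"
  proof -
    have A: "A0 \<mu> B b y (x, s) \<bullet> (x, s) = m y * ((B y *v x) \<bullet> x + b1 y * s * s)"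
      using G[OF y] by (simp add: A0_def G_def distrib_left)
    have "inverse \<Lambda> * m y * (norm (x, s))\<^sup>2 \<le> A0 \<mu> B b y (x, s) \<bullet> (x, s)"
       "A0 \<mu> B b y (x, s) \<bullet> (x, s) \<le> \<Lambda> * m y * (norm (x, s))\<^sup>2"
      using G[OF y] unfolding G_def by auto
    then have "m y * (inverse \<Lambda> * (norm (x, s))\<^sup>2) \<le> m y * ((B y *v x) \<bullet> x + b1 y * s * s)"
       "m y * ((B y *v x) \<bullet> x + b1 y * s * s) \<le> m y * (\<Lambda> * (norm (x, s))\<^sup>2)"
      unfolding A by (simp_all only: ac_simps)
    then show "inverse \<Lambda> * (norm (x, s))\<^sup>2 \<le> (B y *v x) \<bullet> x + b1 y * s * s" "(B y *v x) \<bullet> x + b1 y * s * s \<le> \<Lambda> * (norm (x, s))\<^sup>2"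
      using m(2)[of y] by simp_all
  qed
  have bT: "inverse \<Lambda> \<le> b1 y" "b1 y \<le> \<Lambda>" if "y \<in> T" for y
    using el1[OF that, of 0 1] by (simp_all add: norm_Pair)
  have qT: "inverse \<Lambda> * (norm x)\<^sup>2 \<le> (B y *v x) \<bullet> x" "(B y *v x) \<bullet> x \<le> \<Lambda> * (norm x)\<^sup>2" if "y \<in> T" for y and x :: "real^'n"
    using el1[OF that, of x 0] by (simp_all add: norm_Pair)
  have "T \<noteq> {}"
  proof
    assume "T = {}"
    then have "?S \<subseteq> N" by (auto simp: T_def)
    then have "?S \<in> null_sets lborel" by (intro null_sets_subset[OF N(2)]) auto
    then have "emeasure lborel ?S = 0" by (rule null_setsD1)
    then show False using \<tau> by (simp add: ennreal_eq_0_iff)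
  qed
  then have "inverse \<Lambda> \<le> \<Lambda>" using bT by (meson all_not_in_conv order_trans)
  then have "1 \<le> \<Lambda> * \<Lambda>" using \<Lambda> by (simp add: field_simps)
  then have \<Lambda>1: "1 \<le> \<Lambda>" using \<Lambda> by (smt (verit) mult_le_one mult_less_cancel_left2)
  define bb where "bb y = (if y \<in> T then b1 y else 1)" for y
  define aa where "aa e e' y = (if e \<in> Basis \<and> e' \<in> Basis then if y \<in> T then a1 e e' y else e \<bullet> e' else 0)" for e e' y
  have 1: "bb \<in> borel_measurable borel" unfolding bb_def using b1(1) by measurable
  have 2: "aa e e' \<in> borel_measurable borel" for e e'
  proof (cases "e \<in> Basis \<and> e' \<in> Basis")
    case True
    have "(\<lambda>y. if y \<in> T then a1 e e' y else e \<bullet> e') \<in> borel_measurable borel" using a1(1)[of e e'] by measurable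
    then show ?thesis using True by (simp add: aa_def[abs_def])
  next
    case False
    then have "aa e e' = (\<lambda>_. 0)" by (auto simp: aa_def)
    then show ?thesis by simp
  qed
  have 3: "inverse \<Lambda> \<le> bb y \<and> bb y \<le> \<Lambda>" for y
    using bT[of y] \<Lambda>1 by (auto simp: bb_def inverse_le_1_iff)
  have 4: "\<bar>aa e e' y\<bar> \<le> \<Lambda>" for e e' y
  proof (cases "e \<in> Basis \<and> e' \<in> Basis \<and> y \<in> T")
    case True
    have "\<bar>(B y *v e) \<bullet> e'\<bar> \<le> \<Lambda>"
    proof (rule symmetric_form_entry_bound[OF matrix_vector_mul_linear])
      show "(B y *v x) \<bullet> z = x \<bullet> (B y *v z)" for x z
      proof -
        have "transpose (B y) = B y" using G[of y] True by (simp add: G_def)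
        then have "(B y *v x) \<bullet> z = (x v* B y) \<bullet> z" using transpose_matrix_vector[of "B y" x] by simp
        then show ?thesis by (simp add: dot_lmul_matrix)
      qed
      show "0 \<le> (B y *v x) \<bullet> x" for x
        using qT(1)[of y x] True \<Lambda>1 by (smt (verit) positive_imp_inverse_positive zero_le_mult_iff zero_le_power2)
    qed (use qT True \<Lambda> in auto)
    then show ?thesis using True G[of y] by (simp add: aa_def G_def)
  next
    case False
    then show ?thesis using \<Lambda>1 by (auto simp: aa_def inner_Basis)
  qed
  have 5: "inverse \<Lambda> * (norm \<xi>)\<^sup>2 \<le> (\<Sum>e\<in>Basis. \<Sum>e'\<in>Basis. aa e e' y * (\<xi> \<bullet> e) * (\<xi> \<bullet> e'))" for \<xi> y
  proof (cases "y \<in> T")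
    case True
    have "(B y *v \<xi>) \<bullet> \<xi> = (\<Sum>e\<in>Basis. \<Sum>e'\<in>Basis. a1 e e' y * (\<xi> \<bullet> e) * (\<xi> \<bullet> e'))"
      using G[OF True] by (subst linear_bilinear_expansion[OF matrix_vector_mul_linear]) (simp add: G_def)
    then show ?thesis using qT(1)[OF True, of \<xi>] True by (simp add: aa_def)
  next
    case False
    have "\<xi> \<bullet> \<xi> = (\<Sum>e\<in>Basis. \<Sum>e'\<in>Basis. aa e e' y * (\<xi> \<bullet> e) * (\<xi> \<bullet> e'))"
      using linear_bilinear_expansion[OF linear_id, of \<xi> \<xi>] False by (simp add: aa_def)
    moreover have "inverse \<Lambda> * (norm \<xi>)\<^sup>2 \<le> 1 * (norm \<xi>)\<^sup>2" using \<Lambda>1 by (intro mult_right_mono) (auto simp: inverse_le_1_iff)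
    ultimately show ?thesis by (simp add: power2_norm_eq_inner)
  qed
  have 6: "AE y in lborel. y \<in> ?S \<longrightarrow> (\<forall>x s z t. A0 \<mu> B b y (x, s) \<bullet> (z, t) =
      m y * ((\<Sum>e\<in>Basis. \<Sum>e'\<in>Basis. aa e e' y * (x \<bullet> e) * (z \<bullet> e')) + bb y * s * t))"
    using Nb(2)
  proof eventually_elim
    case (elim y)
    then show ?case using dec[of y] by (auto simp: T_def aa_def bb_def)
  qed
  show ?thesis using \<Lambda>1 1 2 3 4 5 6 by blast
qed

text \<open>
  The majorant is the \<open>L\<^sup>1\<close> norm of the slice, which the Cauchy-Schwarz inequality on the
  bounded ball estimates by the \<open>L\<^sup>2\<close> norm. It is finite except at a null set \<open>Y\<close> of heights.
\<close>

lemma slice_majorant: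
  fixes H :: "'a::euclidean_space \<times> real \<Rightarrow> real"
  assumes [measurable]: "H \<in> borel_measurable M2" "m \<in> borel_measurable borel" and m: "\<And>y. 0 < m y"
    and H: "\<And>X. 0 \<le> H X" "\<And>X. X \<notin> cyl \<tau> \<Longrightarrow> H X = 0" and sq: "integrable M2 (\<lambda>X. (H X)\<^sup>2 * m (snd X))"
  shows "\<exists>Y\<in>null_sets lborel. (\<forall>y. y \<notin> Y \<longrightarrow> integrable lborel (\<lambda>z. H (z, y))) \<and>
     integrable lborel (\<lambda>y. (indicator (- Y) y * (LINT z|lborel. H (z, y)))\<^sup>2 * m y)"
proof -
  have iy: "integrable lborel (\<lambda>y. LINT z|lborel. (H (z, y))\<^sup>2 * m y)" "AE y in lborel. integrable lborel (\<lambda>z. (H (z, y))\<^sup>2 * m y)"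
    using lborel_pair.integrable_snd[of "\<lambda>z y. (H (z, y))\<^sup>2 * m y"] lborel_pair.AE_integrable_snd[of "\<lambda>z y. (H (z, y))\<^sup>2 * m y"] sq
    by (simp_all add: case_prod_beta')
  from iy(2) obtain Y where Y: "\<And>y. y \<notin> Y \<Longrightarrow> integrable lborel (\<lambda>z. (H (z, y))\<^sup>2 * m y)" "Y \<in> null_sets lborel" by (rule AE_E3) auto
  define b where "b = measure lborel (ball (0::'a) \<tau>)"
  have CS: "integrable lborel (\<lambda>z. H (z, y))" "(LINT z|lborel. H (z, y))\<^sup>2 * m y \<le> b * (LINT z|lborel. (H (z, y))\<^sup>2 * m y)"
    if y: "y \<notin> Y" for y
  proof -
    have "integrable lborel (\<lambda>z. inverse (m y) * ((H (z, y))\<^sup>2 * m y))" using Y(1)[OF y] by simp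
    then have i2: "integrable lborel (\<lambda>z. (H (z, y))\<^sup>2)" using m[of y] by (simp add: field_simps)
    have sm: "(\<lambda>z. H (z, y)) \<in> borel_measurable lborel" using slice_measurable[of H y] by simp
    have ib: "integrable lborel (indicator (ball (0::'a) \<tau>) :: 'a \<Rightarrow> real)" by (rule integrable_indicator_bounded) auto
    have isq: "(indicator (ball (0::'a) \<tau>) z :: real)\<^sup>2 = indicator (ball 0 \<tau>) z" for z by (simp add: indicator_def)
    have eq: "indicator (ball 0 \<tau>) z * H (z, y) = H (z, y)" for z using H(2)[of "(z, y)"] by (auto simp: cyl_def indicator_def)
    have im: "(\<lambda>z. indicator (ball (0::'a) \<tau>) z :: real) \<in> borel_measurable lborel" by (rule borel_measurable_indicator) simp
    note C = Cauchy_Schwarz_integral[OF im sm, unfolded isq eq, OF ib i2]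
    show "integrable lborel (\<lambda>z. H (z, y))" by (rule C(1))
    have "(LINT z|lborel. H (z, y))\<^sup>2 \<le> b * (LINT z|lborel. (H (z, y))\<^sup>2)"
      using C(2) H(1) by (simp add: b_def)
    then have "(LINT z|lborel. H (z, y))\<^sup>2 * m y \<le> b * (LINT z|lborel. (H (z, y))\<^sup>2) * m y"
      using m[of y] by (intro mult_right_mono) auto
    then show "(LINT z|lborel. H (z, y))\<^sup>2 * m y \<le> b * (LINT z|lborel. (H (z, y))\<^sup>2 * m y)" by simp
  qed
  have b0: "0 \<le> b" by (simp add: b_def)
  have [measurable]: "(\<lambda>y. LINT z|lborel. H (z, y)) \<in> borel_measurable lborel" by measurable
  have [measurable]: "Y \<in> sets lborel" using Y(2) by auto
  have "integrable lborel (\<lambda>y. (indicator (- Y) y * (LINT z|lborel. H (z, y)))\<^sup>2 * m y)"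
  proof (rule Bochner_Integration.integrable_bound[OF integrable_mult_right[OF iy(1), of b]])
    have im: "(\<lambda>y. indicator (- Y) y :: real) \<in> borel_measurable lborel"
      using Y(2) by (intro borel_measurable_indicator) auto
    then show "(\<lambda>y. (indicator (- Y) y * (LINT z|lborel. H (z, y)))\<^sup>2 * m y) \<in> borel_measurable lborel" by measurable
    show "AE y in lborel. norm ((indicator (- Y) y * (LINT z|lborel. H (z, y)))\<^sup>2 * m y) \<le> norm (b * (LINT z|lborel. (H (z, y))\<^sup>2 * m y))"
    proof (intro AE_I2)
      fix y
      have n: "0 \<le> b * (LINT z|lborel. (H (z, y))\<^sup>2 * m y)"
        using b0 less_imp_le[OF m[of y]] by (intro mult_nonneg_nonneg Bochner_Integration.integral_nonneg) auto
      show "norm ((indicator (- Y) y * (LINT z|lborel. H (z, y)))\<^sup>2 * m y) \<le> norm (b * (LINT z|lborel. (H (z, y))\<^sup>2 * m y))"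
      proof (cases "y \<in> Y")
        case False
        then show ?thesis using CS(2)[OF False] n less_imp_le[OF m[of y]] by simp
      qed (use n in simp)
    qed
  qed
  then show ?thesis using Y(2) CS(1) by blast
qed

section \<open>Reduction of a weak solution to Borel data\<close>

lemma borel_measurable_M2:
  "f \<in> borel_measurable (M2 :: ('a::euclidean_space \<times> real) measure) \<longleftrightarrow> f \<in> borel_measurable borel"
  by (simp add: lborel_prod)

lemma M2_transfer:
  fixes f h :: "'a::euclidean_space \<times> real \<Rightarrow> real"
  assumes h: "h \<in> borel_measurable M2" and eq: "AE X in M2. f X = h X"
  shows "f \<in> borel_measurable lebesgue" "integrable lebesgue f \<longleftrightarrow> integrable M2 h"
    "(LINT X|lebesgue. f X) = (LINT X|M2. h X)"
  using lebesgue_transfer[of h f] h[unfolded borel_measurable_M2] eq by (simp_all only: lborel_prod)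

lemma AE_lborel_scale:
  fixes c :: real
  assumes R: "AE y in lborel. R y" and c: "c \<noteq> 0" shows "AE t in lborel. R (c * t)"
proof -
  obtain N where N: "\<And>y. y \<notin> N \<Longrightarrow> R y" "N \<in> null_sets lborel" using R by (rule AE_E3) auto
  have "AE y in lborel. y \<notin> N" using N(2) by (rule AE_not_in)
  then have "AE t in lborel. 0 + c * t \<notin> N"
    by (intro AE_borel_affine[OF c]) (use N(2) in auto)
  then show ?thesis by eventually_elim (use N(1) in auto)
qed

lemma dirderiv_0: "smooth f \<Longrightarrow> dirderiv 0 f x = 0"
  by (simp add: dirderiv_basis_sum[of f 0])

text \<open>
  Borel representatives of the solution and of its gradient are set to zero outside the cylinder and
  on the null set \<open>Y\<close> of heights whose slices are not integrable. Nothing changes almost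
  everywhere, so all integrals keep their values. The product tests of the equation belong to the test space
  because they are smooth and vanish on the lateral boundary and on the top; their gradient is
  computed by the product rule, and the block form of the matrix separates the two parts of the
  equation.
\<close>

lemma cylinder_solution_of_weak_solution:
  fixes v :: "(real^'n) \<times> real \<Rightarrow> real" and B :: "real \<Rightarrow> real^'n^'n" and b :: "real \<Rightarrow> real"
  assumes \<tau>: "0 < \<tau>" and \<Lambda>: "0 < \<Lambda>" and C0: "0 < C\<^sub>0"
    and \<mu>: "A2_weight \<mu>" "A2_const \<mu> = ennreal K" and el: "elliptic_coefficients \<Lambda> \<tau> \<mu> B b"
    and flux: "AE y in lebesgue_on {0<..<1}. (LINT s:{0..\<tau> * y}|lebesgue. \<mu> s) \<le> C\<^sub>0 * \<tau> * \<mu> (y * \<tau>)"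
    and sol: "weak_solution \<mu> B b \<tau> v"
  shows "\<exists>m bb aa V P p0 N. cylinder_solution \<tau> \<Lambda> K C\<^sub>0 m bb aa V P p0 N \<and>
     (AE X in M2. X \<in> cyl \<tau> \<longrightarrow> wgrad (Q \<tau>) v X = (P X, p0 X)) \<and>
     mu_hat \<mu> (Q \<tau> :: ((real^'n) \<times> real) set) =
        measure lborel (ball (0::real^'n) \<tau>) * (LINT s|lborel. indicator {0<..<\<tau>} s * m s) \<and>
     (LINT X|M2. (norm (P X))\<^sup>2 * m (snd X)) \<le> (LINT X:Q \<tau>|lebesgue. (norm (wgrad (Q \<tau>) v X))\<^sup>2 * \<mu> (snd X))"
proof -
  obtain m where m [measurable]: "m \<in> borel_measurable borel" and mp: "\<And>y. 0 < m y" and m\<mu>: "AE y in lborel. \<mu> y = m y"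
    and mi: "integrable lborel (\<lambda>y. indicator {0<..<\<tau>} y * m y)" "integrable lborel (\<lambda>y. indicator {0<..<\<tau>} y * inverse (m y))"
    and A2: "(LINT y|lborel. indicator {0<..<\<tau>} y * m y) * (LINT y|lborel. indicator {0<..<\<tau>} y * inverse (m y)) \<le> K * \<tau>\<^sup>2"
    using A2_weight_representative[OF \<mu> \<tau>] by blast
  obtain bb aa where \<Lambda>1: "1 \<le> \<Lambda>" and bbm: "bb \<in> borel_measurable borel" and aam: "\<And>e e'. aa e e' \<in> borel_measurable borel"
    and bbb: "\<And>y. inverse \<Lambda> \<le> bb y" "\<And>y. bb y \<le> \<Lambda>" and aab: "\<And>e e' y. \<bar>aa e e' y\<bar> \<le> \<Lambda>"
    and aae: "\<And>\<xi> y. inverse \<Lambda> * (norm \<xi>)\<^sup>2 \<le> (\<Sum>e\<in>Basis. \<Sum>e'\<in>Basis. aa e e' y * (\<xi> \<bullet> e) * (\<xi> \<bullet> e'))"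
    and co: "AE y in lborel. y \<in> {0<..<\<tau>} \<longrightarrow> (\<forall>x s z t. A0 \<mu> B b y (x, s) \<bullet> (z, t) =
      m y * ((\<Sum>e\<in>Basis. \<Sum>e'\<in>Basis. aa e e' y * (x \<bullet> e) * (z \<bullet> e')) + bb y * s * t))"
  proof -
    note cr = coefficient_representative[OF el \<tau> \<Lambda> m\<mu> mp]
    from conjunct2[OF cr] obtain bb aa where c: "bb \<in> borel_measurable borel \<and> (\<forall>e e'. aa e e' \<in> borel_measurable borel) \<and>
      (\<forall>y. inverse \<Lambda> \<le> bb y \<and> bb y \<le> \<Lambda>) \<and> (\<forall>e e' y. \<bar>aa e e' y\<bar> \<le> \<Lambda>) \<and>
      (\<forall>\<xi> y. inverse \<Lambda> * (norm \<xi>)\<^sup>2 \<le> (\<Sum>e\<in>Basis. \<Sum>e'\<in>Basis. aa e e' y * (\<xi> \<bullet> e) * (\<xi> \<bullet> e'))) \<and>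
      (AE y in lborel. y \<in> {0<..<\<tau>} \<longrightarrow> (\<forall>x s z t. A0 \<mu> B b y (x, s) \<bullet> (z, t) =
        m y * ((\<Sum>e\<in>Basis. \<Sum>e'\<in>Basis. aa e e' y * (x \<bullet> e) * (z \<bullet> e')) + bb y * s * t)))"
      by (elim exE)
    show thesis using conjunct1[OF cr] c by (intro that[of bb aa]) simp_all
  qed
  let ?E = "Q \<tau> :: ((real^'n) \<times> real) set"
  define g where "g = wgrad ?E v"
  have EQ: "?E = cyl \<tau>" by (simp add: Q_def cyl_def)
  have E: "open ?E" unfolding Q_def by (intro open_Times) auto
  have Eb: "?E \<in> sets borel" using E by simp
  have E2 [measurable]: "?E \<in> sets M2" unfolding EQ by measurable
  have ind: "indicator ?E X = (indicator (ball 0 \<tau>) (fst X) * indicator {0<..<\<tau>} (snd X) :: real)" for X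
    by (cases X) (auto simp: Q_def indicator_def)
  have W: "v \<in> W12 \<mu> ?E" using sol by (simp add: weak_solution_def)
  have hg: "has_weak_gradient ?E v g"
    using W wgrad_has_weak_gradient unfolding W12_def g_def by blast
  have v2: "integrable lebesgue (\<lambda>X. indicator ?E X *\<^sub>R ((v X)\<^sup>2 * \<mu> (snd X)))"
    and g2: "integrable lebesgue (\<lambda>X. indicator ?E X *\<^sub>R ((norm (g X))\<^sup>2 * \<mu> (snd X)))"
    using W unfolding W12_def g_def set_integrable_def by auto
  have lv: "locally_integrable_on v ?E" using hg by (simp add: has_weak_gradient_def)
  obtain V1 where V1b: "V1 \<in> borel_measurable borel" and V1z: "\<And>X. X \<notin> ?E \<Longrightarrow> V1 X = 0"
    and V1e: "AE X in lborel. X \<in> ?E \<longrightarrow> v X = V1 X"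
    using borel_representative[OF locally_integrable_measurable[OF E lv] Eb] by blast
  define G where "G e = (SOME f. f \<in> borel_measurable borel \<and> (\<forall>X. X \<notin> ?E \<longrightarrow> f X = 0) \<and> (AE X in lborel. X \<in> ?E \<longrightarrow> g X \<bullet> e = f X))" for e
  have "\<exists>f. f \<in> borel_measurable borel \<and> (\<forall>X. X \<notin> ?E \<longrightarrow> f X = 0) \<and> (AE X in lborel. X \<in> ?E \<longrightarrow> g X \<bullet> e = f X)" for e
    using borel_representative[OF locally_integrable_measurable[OF E has_weak_gradient_component[OF hg, of e]] Eb] by blast
  then have "G e \<in> borel_measurable borel \<and> (\<forall>X. X \<notin> ?E \<longrightarrow> G e X = 0) \<and> (AE X in lborel. X \<in> ?E \<longrightarrow> g X \<bullet> e = G e X)" for e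
    unfolding G_def by (rule someI_ex)
  then have Gb: "\<And>e. G e \<in> borel_measurable borel" and Gz: "\<And>e X. X \<notin> ?E \<Longrightarrow> G e X = 0"
    and Ge: "\<And>e. AE X in lborel. X \<in> ?E \<longrightarrow> g X \<bullet> e = G e X" by blast+
  define P1 where "P1 X = (\<Sum>e\<in>Basis. G (e, 0) X *\<^sub>R e)" for X
  define p1 where "p1 X = G (0, 1) X" for X
  have P1c: "P1 X \<bullet> e = G (e, 0) X" if "e \<in> Basis" for e X using that by (simp add: P1_def)
  have geq: "AE X in M2. X \<in> ?E \<longrightarrow> v X = V1 X \<and> g X = (P1 X, p1 X)"
  proof -
    have "AE X in lborel. \<forall>e\<in>(Basis :: ((real^'n) \<times> real) set). X \<in> ?E \<longrightarrow> g X \<bullet> e = G e X"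
      by (intro AE_finite_allI finite_Basis Ge)
    with V1e have "AE X in lborel. X \<in> ?E \<longrightarrow> v X = V1 X \<and> g X = (P1 X, p1 X)"
    proof eventually_elim
      case (elim X)
      show ?case
      proof
        assume X: "X \<in> ?E"
        have c: "g X \<bullet> e = G e X" if "e \<in> Basis" for e using elim(2) X that by blast
        have "fst (g X) = P1 X"
        proof (rule euclidean_eqI)
          fix e :: "real^'n" assume e: "e \<in> Basis"
          have "g X \<bullet> (e, 0) = G (e, 0) X" by (rule c) (use e in \<open>simp add: Basis_prod_def\<close>)
          then show "fst (g X) \<bullet> e = P1 X \<bullet> e" using e by (cases "g X") (simp add: P1c)
        qed
        moreover have "g X \<bullet> (0, 1) = G (0, 1) X" by (rule c) (simp add: Basis_prod_def)
        then have "snd (g X) = p1 X" by (cases "g X") (simp add: p1_def)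
        ultimately show "v X = V1 X \<and> g X = (P1 X, p1 X)" using elim(1) X by (cases "g X") auto
      qed
    qed
    then show ?thesis by (simp only: lborel_prod)
  qed
  have V1m [measurable]: "V1 \<in> borel_measurable M2" using V1b by (simp only: borel_measurable_M2)
  have Gm [measurable]: "G e \<in> borel_measurable M2" for e using Gb by (simp only: borel_measurable_M2)
  have P1m [measurable]: "P1 \<in> borel_measurable M2" unfolding P1_def[abs_def] by measurable
  have p1m [measurable]: "p1 \<in> borel_measurable M2" unfolding p1_def[abs_def] by measurable
  have z1: "V1 X = 0" "P1 X = 0" "p1 X = 0" if "X \<notin> ?E" for X
    using V1z[OF that] Gz[OF that] by (simp_all add: P1_def p1_def)
  have m\<mu>2: "AE X in (M2 :: ((real^'n) \<times> real) measure). \<mu> (snd X) = m (snd X)" by (rule AE_snd[OF m\<mu>])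
  have iV: "integrable M2 (\<lambda>X. (V1 X)\<^sup>2 * m (snd X))"
  proof -
    have "AE X in M2. indicator ?E X *\<^sub>R ((v X)\<^sup>2 * \<mu> (snd X)) = (V1 X)\<^sup>2 * m (snd X)"
      using geq m\<mu>2 by eventually_elim (use z1 in \<open>auto simp: indicator_def\<close>)
    from M2_transfer(2)[OF _ this] show ?thesis using v2 by simp
  qed
  define gg where "gg X = ((norm (P1 X))\<^sup>2 + (p1 X)\<^sup>2) * m (snd X)" for X
  have ggm: "gg \<in> borel_measurable M2" unfolding gg_def[abs_def] by measurable
  have gge: "AE X in M2. indicator ?E X *\<^sub>R ((norm (g X))\<^sup>2 * \<mu> (snd X)) = gg X"
    using geq m\<mu>2 by eventually_elim (use z1 in \<open>auto simp: indicator_def gg_def norm_Pair\<close>)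
  have igg: "integrable M2 gg" using M2_transfer(2)[OF ggm gge] g2 by simp
  have Igg: "(LINT X:?E|lebesgue. (norm (g X))\<^sup>2 * \<mu> (snd X)) = (LINT X|M2. gg X)"
    unfolding set_lebesgue_integral_def by (rule M2_transfer(3)[OF ggm gge])
  define H where "H X = \<bar>V1 X\<bar> + norm (P1 X) + \<bar>p1 X\<bar>" for X
  have Hm [measurable]: "H \<in> borel_measurable M2" unfolding H_def[abs_def] by measurable
  have H0: "0 \<le> H X" for X by (simp add: H_def)
  have Hz: "H X = 0" if "X \<notin> cyl \<tau>" for X using z1[of X] that by (simp add: H_def EQ)
  have iH: "integrable M2 (\<lambda>X. (H X)\<^sup>2 * m (snd X))"
  proof (rule Bochner_Integration.integrable_bound)
    show "integrable M2 (\<lambda>X. 3 * ((V1 X)\<^sup>2 * m (snd X)) + 3 * gg X)" using iV igg by simp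
    show "AE X in M2. norm ((H X)\<^sup>2 * m (snd X)) \<le> norm (3 * ((V1 X)\<^sup>2 * m (snd X)) + 3 * gg X)"
    proof (intro AE_I2)
      fix X
      have sq: "(x + y + z)\<^sup>2 \<le> 3 * (x\<^sup>2 + (y\<^sup>2 + z\<^sup>2))" for x y z :: real
        using sum_power2_ge_zero[of "x - y" "y - z"] zero_le_power2[of "x - z"] by (simp add: power2_eq_square algebra_simps)
      have "(H X)\<^sup>2 \<le> 3 * ((V1 X)\<^sup>2 + ((norm (P1 X))\<^sup>2 + (p1 X)\<^sup>2))"
        using sq[of "\<bar>V1 X\<bar>" "norm (P1 X)" "\<bar>p1 X\<bar>"] by (simp add: H_def)
      then have "(H X)\<^sup>2 * m (snd X) \<le> 3 * ((V1 X)\<^sup>2 + ((norm (P1 X))\<^sup>2 + (p1 X)\<^sup>2)) * m (snd X)"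
        using mp[of "snd X"] by (intro mult_right_mono) auto
      also have "\<dots> = 3 * ((V1 X)\<^sup>2 * m (snd X)) + 3 * gg X" by (simp add: gg_def algebra_simps)
      finally show "norm ((H X)\<^sup>2 * m (snd X)) \<le> norm (3 * ((V1 X)\<^sup>2 * m (snd X)) + 3 * gg X)"
        using less_imp_le[OF mp[of "snd X"]] by (simp add: abs_mult)
    qed
  qed measurable
  obtain Y where Yn: "Y \<in> null_sets lborel" and Yi: "\<And>y. y \<notin> Y \<Longrightarrow> integrable lborel (\<lambda>z. H (z, y))"
    and YN: "integrable lborel (\<lambda>y. (indicator (- Y) y * (LINT z|lborel. H (z, y)))\<^sup>2 * m y)"
    using slice_majorant[OF Hm m mp H0 Hz iH] by blast
  have Yb: "- Y \<in> sets borel" using Yn by auto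
  have iYm [measurable]: "(\<lambda>y. indicator (- Y) y :: real) \<in> borel_measurable borel" using Yb by (rule borel_measurable_indicator)
  \<comment> \<open>heights with a slice that is not integrable are cut out\<close>
  define V where "V X = indicator (- Y) (snd X) * V1 X" for X
  define P where "P X = indicator (- Y) (snd X) *\<^sub>R P1 X" for X
  define p0 where "p0 X = indicator (- Y) (snd X) * p1 X" for X
  define N where "N y = indicator (- Y) y * (LINT z|lborel. H (z, y))" for y
  have Vm [measurable]: "V \<in> borel_measurable M2" unfolding V_def[abs_def] by measurable
  have Pm [measurable]: "P \<in> borel_measurable M2" unfolding P_def[abs_def] by measurable
  have Pm' [measurable]: "(\<lambda>X. P X \<bullet> e) \<in> borel_measurable M2" for e by measurable
  have p0m [measurable]: "p0 \<in> borel_measurable M2" unfolding p0_def[abs_def] by measurable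
  have Nm [measurable]: "N \<in> borel_measurable borel"
  proof -
    have "(\<lambda>y. LINT z|lborel. H (z, y)) \<in> borel_measurable lborel" by measurable
    then show ?thesis unfolding N_def[abs_def] by simp
  qed
  have eqY: "AE X in M2. X \<in> ?E \<longrightarrow> v X = V X \<and> g X = (P X, p0 X)"
  proof -
    have "AE X in (M2 :: ((real^'n) \<times> real) measure). snd X \<notin> Y" by (rule AE_snd) (rule AE_not_in[OF Yn])
    with geq show ?thesis by eventually_elim (simp add: V_def P_def p0_def)
  qed
  have z: "V X = 0" "P X = 0" "p0 X = 0" if "X \<notin> ?E" for X using z1[OF that] by (simp_all add: V_def P_def p0_def)
  have bd: "\<bar>V X\<bar> \<le> indicator (- Y) (snd X) * H X" "\<bar>p0 X\<bar> \<le> indicator (- Y) (snd X) * H X" "norm (P X) \<le> indicator (- Y) (snd X) * H X" for X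
    by (auto simp: V_def P_def p0_def H_def indicator_def)
  have sl: "integrable lborel (\<lambda>z. F (z, y))" "(LINT z|lborel. \<bar>F (z, y)\<bar>) \<le> N y"
    if F: "F \<in> borel_measurable M2" "\<And>X. \<bar>F X\<bar> \<le> indicator (- Y) (snd X) * H X" for F y
  proof -
    have i: "integrable lborel (\<lambda>z. indicator (- Y) y * H (z, y))" using Yi[of y] by (cases "y \<in> Y") auto
    show iF: "integrable lborel (\<lambda>z. F (z, y))"
    proof (rule Bochner_Integration.integrable_bound[OF i])
      show "(\<lambda>z. F (z, y)) \<in> borel_measurable lborel" using slice_measurable[OF F(1)] by simp
      show "AE z in lborel. norm (F (z, y)) \<le> norm (indicator (- Y) y * H (z, y))"
      proof (intro AE_I2)
        show "norm (F (z, y)) \<le> norm (indicator (- Y) y * H (z, y))" for z using F(2)[of "(z, y)"] by simp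
      qed
    qed
    have "(LINT z|lborel. \<bar>F (z, y)\<bar>) \<le> (LINT z|lborel. indicator (- Y) y * H (z, y))"
    proof (intro integral_mono integrable_abs iF i)
      show "\<bar>F (z, y)\<bar> \<le> indicator (- Y) y * H (z, y)" for z using F(2)[of "(z, y)"] by simp
    qed
    then show "(LINT z|lborel. \<bar>F (z, y)\<bar>) \<le> N y" by (simp add: N_def)
  qed
  have Pb: "\<bar>P X \<bullet> e\<bar> \<le> indicator (- Y) (snd X) * H X" if "e \<in> Basis" for X e
    using Basis_le_norm[OF that, of "P X"] bd(3)[of X] by linarith
  have N0: "N y = 0" if "y \<notin> {0<..<\<tau>}" for y
  proof -
    have "H (z, y) = 0" for z using Hz[of "(z, y)"] that by (auto simp: cyl_def)
    then show ?thesis by (simp add: N_def)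
  qed
  have P1sq: "integrable M2 (\<lambda>X. (norm (P X))\<^sup>2 * m (snd X))" "(LINT X|M2. (norm (P X))\<^sup>2 * m (snd X)) \<le> (LINT X|M2. gg X)"
  proof -
    have le: "(norm (P X))\<^sup>2 * m (snd X) \<le> gg X" for X
      using mp[of "snd X"] by (auto simp: gg_def P_def indicator_def intro!: mult_right_mono)
    show i: "integrable M2 (\<lambda>X. (norm (P X))\<^sup>2 * m (snd X))"
    proof (rule Bochner_Integration.integrable_bound[OF igg])
      show "AE X in M2. norm ((norm (P X))\<^sup>2 * m (snd X)) \<le> norm (gg X)"
      proof (intro AE_I2)
        fix X
        have "0 \<le> (norm (P X))\<^sup>2 * m (snd X)" using less_imp_le[OF mp[of "snd X"]] by simp
        then show "norm ((norm (P X))\<^sup>2 * m (snd X)) \<le> norm (gg X)" using le[of X] by simp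
      qed
    qed measurable
    show "(LINT X|M2. (norm (P X))\<^sup>2 * m (snd X)) \<le> (LINT X|M2. gg X)" by (intro integral_mono i igg le)
  qed
  have flux': "AE t in lborel. t \<in> {0<..<\<tau>} \<longrightarrow> cum (\<lambda>s. indicator {0<..<\<tau>} s * m s) t \<le> C\<^sub>0 * \<tau> * m t"
  proof -
    have "AE y in lborel. y \<in> {0<..<1} \<longrightarrow> (LINT s:{0..\<tau> * y}|lebesgue. \<mu> s) \<le> C\<^sub>0 * \<tau> * \<mu> (y * \<tau>)"
      using flux by (simp add: AE_restrict_space_iff AE_completion_iff)
    then have "AE t in lborel. inverse \<tau> * t \<in> {0<..<1} \<longrightarrow> (LINT s:{0..\<tau> * (inverse \<tau> * t)}|lebesgue. \<mu> s) \<le> C\<^sub>0 * \<tau> * \<mu> (inverse \<tau> * t * \<tau>)"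
      by (rule AE_lborel_scale) (use \<tau> in simp)
    with m\<mu> show ?thesis
    proof eventually_elim
      case (elim t)
      show ?case
      proof
        assume t: "t \<in> {0<..<\<tau>}"
        then have "inverse \<tau> * t \<in> {0<..<1}" "\<tau> * (inverse \<tau> * t) = t" "inverse \<tau> * t * \<tau> = t"
          using \<tau> by (auto simp: field_simps)
        then have 1: "(LINT s:{0..t}|lebesgue. \<mu> s) \<le> C\<^sub>0 * \<tau> * m t" using elim by (simp only:)
        have "AE s in lborel. indicator {0..t} s *\<^sub>R \<mu> s = indicator {..<t} s * (indicator {0<..<\<tau>} s * m s)"
          using m\<mu> AE_open_closed_interval[of t] by eventually_elim (use t in \<open>auto simp: indicator_def split: if_splits\<close>)
        then have "(LINT s:{0..t}|lebesgue. \<mu> s) = cum (\<lambda>s. indicator {0<..<\<tau>} s * m s) t"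
          unfolding set_lebesgue_integral_def cum_def by (intro lebesgue_transfer(3)) (auto intro: borel_measurable_times borel_measurable_indicator)
        then show "cum (\<lambda>s. indicator {0<..<\<tau>} s * m s) t \<le> C\<^sub>0 * \<tau> * m t" using 1 by simp
      qed
    qed
  qed
  have mE: "integrable M2 (\<lambda>X. indicator ?E X * m (snd X))"
    "(LINT X|M2. indicator ?E X * m (snd X)) = measure lborel (ball (0::real^'n) \<tau>) * (LINT s|lborel. indicator {0<..<\<tau>} s * m s)"
  proof -
    have ib: "integrable lborel (indicator (ball (0::real^'n) \<tau>) :: _ \<Rightarrow> real)" by (rule integrable_indicator_bounded) auto
    note i = integrable_product[OF ib mi(1)]
    have eq: "(\<lambda>X. indicator ?E X * m (snd X)) = (\<lambda>(x, y). indicator (ball (0::real^'n) \<tau>) x * (indicator {0<..<\<tau>} y * m y))"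
      by (rule ext) (simp add: ind case_prod_beta')
    show "integrable M2 (\<lambda>X. indicator ?E X * m (snd X))" unfolding eq by (rule i)
    show "(LINT X|M2. indicator ?E X * m (snd X)) = measure lborel (ball (0::real^'n) \<tau>) * (LINT s|lborel. indicator {0<..<\<tau>} s * m s)"
      unfolding eq lborel_pair.integral_fst[OF i, symmetric] by simp
  qed
  have cE: "integrable M2 (\<lambda>X. indicator ?E X * m (snd X) * c X)" if c: "continuous_on UNIV c" for c :: "(real^'n) \<times> real \<Rightarrow> real"
  proof -
    have "bounded (c ` (cball 0 \<tau> \<times> {0..\<tau>}))"
      by (intro compact_imp_bounded compact_continuous_image continuous_on_subset[OF c] compact_Times) auto
    then obtain C where "\<forall>u\<in>c ` (cball 0 \<tau> \<times> {0..\<tau>}). norm u \<le> C" unfolding bounded_iff ..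
    then have C: "\<bar>c X\<bar> \<le> C" if "X \<in> ?E" for X using that by (auto simp: Q_def)
    show ?thesis
    proof (rule integrable_mult_bounded[OF mE(1), where C = C])
      show "c \<in> borel_measurable M2" using borel_measurable_continuous_onI[OF c] by (simp only: borel_measurable_M2)
      show "\<bar>c X\<bar> \<le> C" if "indicator ?E X * m (snd X) \<noteq> 0" for X using that C[of X] by (auto simp: indicator_def)
    qed
  qed
  have tf: "(LINT X:?E|lebesgue. F X) = (LINT X|M2. F' X)"
    if "F' \<in> borel_measurable M2" "AE X in M2. indicator ?E X *\<^sub>R F X = F' X" for F F' :: "(real^'n) \<times> real \<Rightarrow> real"
    unfolding set_lebesgue_integral_def by (rule M2_transfer(3)[OF that])
  have tensor: "smooth (\<lambda>X. \<eta> (fst X) * \<zeta> (snd X))"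
    "compact (closure {X. \<eta> (fst X) * \<zeta> (snd X) \<noteq> 0})" "closure {X. \<eta> (fst X) * \<zeta> (snd X) \<noteq> 0} \<subseteq> ?E"
    if \<eta>: "smooth \<eta>" "r < \<tau>" "\<And>z. \<eta> z \<noteq> 0 \<Longrightarrow> norm z \<le> r" and \<zeta>: "smooth \<zeta>" "0 < a" "b' < \<tau>" "\<And>y. \<zeta> y \<noteq> 0 \<Longrightarrow> a \<le> y \<and> y \<le> b'"
    for \<eta> :: "real^'n \<Rightarrow> real" and \<zeta> r a b'
  proof -
    show "smooth (\<lambda>X. \<eta> (fst X) * \<zeta> (snd X))" by (rule smooth_fst_mult_snd(1)[OF \<eta>(1) \<zeta>(1)])
    have K: "compact (cball (0::real^'n) r \<times> {a..b'})" by (intro compact_Times) auto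
    have "{X. \<eta> (fst X) * \<zeta> (snd X) \<noteq> 0} \<subseteq> cball 0 r \<times> {a..b'}"
      using \<eta>(3) \<zeta>(4) by (auto simp: mem_Times_iff)
    then have sub: "closure {X. \<eta> (fst X) * \<zeta> (snd X) \<noteq> 0} \<subseteq> cball 0 r \<times> {a..b'}"
      by (rule closure_minimal[OF _ compact_imp_closed[OF K]])
    then show "compact (closure {X. \<eta> (fst X) * \<zeta> (snd X) \<noteq> 0})"
      using closed_Int_compact[OF closed_closure K, of "{X. \<eta> (fst X) * \<zeta> (snd X) \<noteq> 0}"] by (simp add: Int_absorb2)
    show "closure {X. \<eta> (fst X) * \<zeta> (snd X) \<noteq> 0} \<subseteq> ?E" using sub \<eta>(2) \<zeta>(2,3) by (force simp: Q_def)
  qed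
  have weak: "(LINT X:?E|lebesgue. v X * dirderiv e \<phi> X) = - (LINT X:?E|lebesgue. (g X \<bullet> e) * \<phi> X)"
    if "smooth \<phi>" "compact (closure {X. \<phi> X \<noteq> 0})" "closure {X. \<phi> X \<noteq> 0} \<subseteq> ?E" "e \<in> Basis" for \<phi> e
    using hg that unfolding has_weak_gradient_def dirderiv_def by blast
  have "cylinder_solution \<tau> \<Lambda> K C\<^sub>0 m bb aa V P p0 N"
  proof
    show "0 < \<tau>" "1 \<le> \<Lambda>" "m \<in> borel_measurable borel" "\<And>y. 0 < m y" "bb \<in> borel_measurable borel"
      "\<And>y. inverse \<Lambda> \<le> bb y" "\<And>y. bb y \<le> \<Lambda>" "\<And>e e'. aa e e' \<in> borel_measurable borel" "\<And>e e' y. \<bar>aa e e' y\<bar> \<le> \<Lambda>"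
      "\<And>\<xi> y. inverse \<Lambda> * (norm \<xi>)\<^sup>2 \<le> (\<Sum>e\<in>Basis. \<Sum>e'\<in>Basis. aa e e' y * (\<xi> \<bullet> e) * (\<xi> \<bullet> e'))"
      by (fact \<tau> \<Lambda>1 m mp bbm bbb aam aab aae)+
    show "V \<in> borel_measurable M2" "\<And>e. (\<lambda>X. P X \<bullet> e) \<in> borel_measurable M2" "p0 \<in> borel_measurable M2"
      by (fact Vm Pm' p0m)+
    show "integrable lborel (\<lambda>z. V (z, y))" "(LINT z|lborel. \<bar>V (z, y)\<bar>) \<le> N y" for y by (rule sl[OF Vm bd(1)])+
    show "integrable lborel (\<lambda>z. p0 (z, y))" "(LINT z|lborel. \<bar>p0 (z, y)\<bar>) \<le> N y" for y by (rule sl[OF p0m bd(2)])+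
    show "integrable lborel (\<lambda>z. P (z, y) \<bullet> e)" "(LINT z|lborel. \<bar>P (z, y) \<bullet> e\<bar>) \<le> N y" if "e \<in> Basis" for y e
      by (rule sl[OF Pm' Pb[OF that]])+
    show "N \<in> borel_measurable borel" "\<And>y. y \<notin> {0<..<\<tau>} \<Longrightarrow> N y = 0" by (fact Nm N0)+
    show "integrable lborel (\<lambda>y. (N y)\<^sup>2 * m y)" using YN by (simp add: N_def)
    show "integrable lborel (\<lambda>y. indicator {0<..<\<tau>} y * m y)" "integrable lborel (\<lambda>y. indicator {0<..<\<tau>} y * inverse (m y))"
      "(LINT y|lborel. indicator {0<..<\<tau>} y * m y) * (LINT y|lborel. indicator {0<..<\<tau>} y * inverse (m y)) \<le> K * \<tau>\<^sup>2"
      by (fact mi A2)+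
    show "integrable M2 (\<lambda>X. (norm (P X))\<^sup>2 * m (snd X))" by (fact P1sq(1))
    show "0 \<le> C\<^sub>0" using C0 by simp
    show "AE y in lborel. y \<in> {0<..<\<tau>} \<longrightarrow> cum (\<lambda>s. indicator {0<..<\<tau>} s * m s) y \<le> C\<^sub>0 * \<tau> * m y" by (fact flux')
  next
    fix \<eta> :: "real^'n \<Rightarrow> real" and \<zeta> :: "real \<Rightarrow> real" and r a b' and e :: "real^'n"
    assume \<eta>: "smooth \<eta>" "r < \<tau>" "\<And>z. \<eta> z \<noteq> 0 \<Longrightarrow> norm z \<le> r"
      and \<zeta>: "smooth \<zeta>" "0 < a" "b' < \<tau>" "\<And>y. \<zeta> y \<noteq> 0 \<Longrightarrow> a \<le> y \<and> y \<le> b'" and e: "e \<in> Basis"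
    note T = tensor[OF \<eta> \<zeta>]
    note [measurable] = smooth_borel_measurable[OF \<eta>(1)] smooth_borel_measurable[OF \<zeta>(1)] smooth_borel_measurable[OF smooth_dirderiv[OF \<eta>(1), of e]]
    have eB: "(e, 0) \<in> (Basis :: ((real^'n) \<times> real) set)" using e by (simp add: Basis_prod_def)
    have "(LINT X:?E|lebesgue. v X * dirderiv (e, 0) (\<lambda>X. \<eta> (fst X) * \<zeta> (snd X)) X) = (LINT X|M2. V X * \<zeta> (snd X) * dirderiv e \<eta> (fst X))"
    proof (rule tf)
      show "AE X in M2. indicator ?E X *\<^sub>R (v X * dirderiv (e, 0) (\<lambda>X. \<eta> (fst X) * \<zeta> (snd X)) X) = V X * \<zeta> (snd X) * dirderiv e \<eta> (fst X)"
        using eqY by eventually_elim (use z(1) in \<open>auto simp: indicator_def smooth_fst_mult_snd(2)[OF \<eta>(1) \<zeta>(1)] dirderiv_0[OF \<zeta>(1)]\<close>)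
    qed measurable
    moreover have "(LINT X:?E|lebesgue. (g X \<bullet> (e, 0)) * (\<eta> (fst X) * \<zeta> (snd X))) = (LINT X|M2. (P X \<bullet> e) * \<zeta> (snd X) * \<eta> (fst X))"
    proof (rule tf)
      show "AE X in M2. indicator ?E X *\<^sub>R ((g X \<bullet> (e, 0)) * (\<eta> (fst X) * \<zeta> (snd X))) = (P X \<bullet> e) * \<zeta> (snd X) * \<eta> (fst X)"
        using eqY by eventually_elim (use z(2) in \<open>auto simp: indicator_def\<close>)
    qed measurable
    ultimately show "(LINT X|M2. V X * \<zeta> (snd X) * dirderiv e \<eta> (fst X)) = - (LINT X|M2. (P X \<bullet> e) * \<zeta> (snd X) * \<eta> (fst X))"
      using weak[OF T eB] by simp
  next
    fix \<eta> :: "real^'n \<Rightarrow> real" and \<zeta> :: "real \<Rightarrow> real" and r a b'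
    assume \<eta>: "smooth \<eta>" "r < \<tau>" "\<And>z. \<eta> z \<noteq> 0 \<Longrightarrow> norm z \<le> r"
      and \<zeta>: "smooth \<zeta>" "0 < a" "b' < \<tau>" "\<And>y. \<zeta> y \<noteq> 0 \<Longrightarrow> a \<le> y \<and> y \<le> b'"
    note T = tensor[OF \<eta> \<zeta>]
    note [measurable] = smooth_borel_measurable[OF \<eta>(1)] smooth_borel_measurable[OF \<zeta>(1)] smooth_borel_measurable[OF smooth_dirderiv[OF \<zeta>(1), of 1]]
    have eB: "(0, 1) \<in> (Basis :: ((real^'n) \<times> real) set)" by (simp add: Basis_prod_def)
    have "(LINT X:?E|lebesgue. v X * dirderiv (0, 1) (\<lambda>X. \<eta> (fst X) * \<zeta> (snd X)) X) = (LINT X|M2. V X * dirderiv 1 \<zeta> (snd X) * \<eta> (fst X))"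
    proof (rule tf)
      show "AE X in M2. indicator ?E X *\<^sub>R (v X * dirderiv (0, 1) (\<lambda>X. \<eta> (fst X) * \<zeta> (snd X)) X) = V X * dirderiv 1 \<zeta> (snd X) * \<eta> (fst X)"
        using eqY by eventually_elim (use z(1) in \<open>auto simp: indicator_def smooth_fst_mult_snd(2)[OF \<eta>(1) \<zeta>(1)] dirderiv_0[OF \<eta>(1)]\<close>)
    qed measurable
    moreover have "(LINT X:?E|lebesgue. (g X \<bullet> (0, 1)) * (\<eta> (fst X) * \<zeta> (snd X))) = (LINT X|M2. p0 X * \<zeta> (snd X) * \<eta> (fst X))"
    proof (rule tf)
      show "AE X in M2. indicator ?E X *\<^sub>R ((g X \<bullet> (0, 1)) * (\<eta> (fst X) * \<zeta> (snd X))) = p0 X * \<zeta> (snd X) * \<eta> (fst X)"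
        using eqY by eventually_elim (use z(3) in \<open>auto simp: indicator_def\<close>)
    qed measurable
    ultimately show "(LINT X|M2. V X * dirderiv 1 \<zeta> (snd X) * \<eta> (fst X)) = - (LINT X|M2. p0 X * \<zeta> (snd X) * \<eta> (fst X))"
      using weak[OF T eB] by simp
  next
    fix \<eta> :: "real^'n \<Rightarrow> real" and \<zeta> :: "real \<Rightarrow> real" and r b'
    assume \<eta>: "smooth \<eta>" "r < \<tau>" "\<And>z. \<eta> z \<noteq> 0 \<Longrightarrow> norm z \<le> r"
      and \<zeta>: "smooth \<zeta>" "b' < \<tau>" "\<And>y. b' \<le> y \<Longrightarrow> \<zeta> y = 0"
    note [measurable] = smooth_borel_measurable[OF \<eta>(1)] smooth_borel_measurable[OF \<zeta>(1)] smooth_borel_measurable[OF smooth_dirderiv[OF \<zeta>(1), of 1]]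
    have [measurable]: "dirderiv e \<eta> \<in> borel_measurable borel" for e by (rule smooth_borel_measurable[OF smooth_dirderiv[OF \<eta>(1)]])
    note [measurable] = aam bbm
    define \<psi> where "\<psi> X = \<eta> (fst X) * \<zeta> (snd X)" for X
    have s\<psi>: "smooth \<psi>" unfolding \<psi>_def[abs_def] by (rule smooth_fst_mult_snd(1)[OF \<eta>(1) \<zeta>(1)])
    have h\<psi>: "has_weak_gradient ?E \<psi> (grad \<psi>)" by (rule smooth_has_weak_gradient[OF s\<psi>])
    have wg: "AE X in M2. X \<in> ?E \<longrightarrow> wgrad ?E \<psi> X = grad \<psi> X"
      using weak_gradient_unique[OF E wgrad_has_weak_gradient[OF h\<psi>] h\<psi>] by (simp only: AE_completion_iff lborel_prod)
    have \<psi>W: "\<psi> \<in> W12 \<mu> ?E"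
    proof -
      have "integrable lebesgue (\<lambda>X. indicator ?E X *\<^sub>R ((\<psi> X)\<^sup>2 * \<mu> (snd X)))"
      proof -
        have c: "continuous_on UNIV (\<lambda>X. (\<psi> X)\<^sup>2)" by (intro continuous_intros smooth_continuous[OF s\<psi>])
        have "AE X in M2. indicator ?E X *\<^sub>R ((\<psi> X)\<^sup>2 * \<mu> (snd X)) = indicator ?E X * m (snd X) * (\<psi> X)\<^sup>2"
          using m\<mu>2 by eventually_elim simp
        from M2_transfer(2)[OF borel_measurable_integrable[OF cE[OF c]] this] show ?thesis using cE[OF c] by simp
      qed
      moreover have "integrable lebesgue (\<lambda>X. indicator ?E X *\<^sub>R ((norm (wgrad ?E \<psi> X))\<^sup>2 * \<mu> (snd X)))"
      proof -
        have c: "continuous_on UNIV (\<lambda>X. (norm (grad \<psi> X))\<^sup>2)" by (intro continuous_intros grad_continuous[OF s\<psi>])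
        have "AE X in M2. indicator ?E X *\<^sub>R ((norm (wgrad ?E \<psi> X))\<^sup>2 * \<mu> (snd X)) = indicator ?E X * m (snd X) * (norm (grad \<psi> X))\<^sup>2"
          using m\<mu>2 wg by eventually_elim (auto simp: indicator_def)
        from M2_transfer(2)[OF borel_measurable_integrable[OF cE[OF c]] this] show ?thesis using cE[OF c] by simp
      qed
      ultimately show ?thesis using h\<psi> unfolding W12_def set_integrable_def by blast
    qed
    \<comment> \<open>\<open>\<psi>\<close> is its own approximation in the closure that defines the test space\<close>
    have \<psi>T: "\<psi> \<in> test_functions \<tau>"
      using s\<psi> \<eta>(2,3) \<zeta>(2,3) by (fastforce simp: test_functions_def \<psi>_def)
    have "\<psi> \<in> test_space \<mu> \<tau>"
    proof -
      have h0: "has_weak_gradient ?E (\<lambda>X. 0) (grad (\<lambda>X. 0))" by (rule smooth_has_weak_gradient[OF smooth_const])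
      have "AE X in M2. X \<in> ?E \<longrightarrow> wgrad ?E (\<lambda>X. 0) X = grad (\<lambda>X. 0) X"
        using weak_gradient_unique[OF E wgrad_has_weak_gradient[OF h0] h0] by (simp only: AE_completion_iff lborel_prod)
      then have "AE X in M2. indicator ?E X *\<^sub>R ((norm (wgrad ?E (\<lambda>X. 0) X))\<^sup>2 * \<mu> (snd X)) = 0"
        by eventually_elim (auto simp: indicator_def grad_def dirderiv_const)
      then have "(LINT X:?E|lebesgue. (norm (wgrad ?E (\<lambda>X. 0) X))\<^sup>2 * \<mu> (snd X)) = (LINT X|(M2 :: ((real^'n) \<times> real) measure). 0)"
        by (intro tf) simp_all
      then have "W12_norm \<mu> ?E (\<lambda>X. \<psi> X - \<psi> X) = 0" by (simp add: W12_norm_def set_lebesgue_integral_def)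
      then show ?thesis using \<psi>W \<psi>T unfolding test_space_def by force
    qed
    then have "0 = (LINT X:?E|lebesgue. A0 \<mu> B b (snd X) (g X) \<bullet> wgrad ?E \<psi> X)"
      using sol by (simp add: weak_solution_def g_def)
    also have "\<dots> = (LINT X|M2. (\<Sum>e\<in>Basis. \<Sum>e'\<in>Basis. (P X \<bullet> e) * (m (snd X) * aa e e' (snd X) * \<zeta> (snd X)) * dirderiv e' \<eta> (fst X))
         + p0 X * (m (snd X) * bb (snd X) * dirderiv 1 \<zeta> (snd X)) * \<eta> (fst X))"
    proof (rule tf)
      have co2: "AE X in (M2 :: ((real^'n) \<times> real) measure). snd X \<in> {0<..<\<tau>} \<longrightarrow> (\<forall>x s z t. A0 \<mu> B b (snd X) (x, s) \<bullet> (z, t) =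
        m (snd X) * ((\<Sum>e\<in>Basis. \<Sum>e'\<in>Basis. aa e e' (snd X) * (x \<bullet> e) * (z \<bullet> e')) + bb (snd X) * s * t))"
        by (rule AE_snd[OF co])
      show "AE X in M2. indicator ?E X *\<^sub>R (A0 \<mu> B b (snd X) (g X) \<bullet> wgrad ?E \<psi> X) =
        (\<Sum>e\<in>Basis. \<Sum>e'\<in>Basis. (P X \<bullet> e) * (m (snd X) * aa e e' (snd X) * \<zeta> (snd X)) * dirderiv e' \<eta> (fst X))
         + p0 X * (m (snd X) * bb (snd X) * dirderiv 1 \<zeta> (snd X)) * \<eta> (fst X)"
        using co2 eqY wg
      proof eventually_elim
        case (elim X)
        show ?case
        proof (cases "X \<in> ?E")
          case True
          then have sX: "snd X \<in> {0<..<\<tau>}" by (auto simp: Q_def)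
          have gr: "grad \<psi> X = (fst (grad \<psi> X), snd (grad \<psi> X))" by simp
          have c1: "fst (grad \<psi> X) \<bullet> e' = dirderiv e' \<eta> (fst X) * \<zeta> (snd X)" if "e' \<in> Basis" for e'
          proof -
            have "fst (grad \<psi> X) \<bullet> e' = grad \<psi> X \<bullet> (e', 0)" by (cases "grad \<psi> X") simp
            also have "\<dots> = dirderiv (e', 0) \<psi> X" by (rule grad_inner) (use that in \<open>simp add: Basis_prod_def\<close>)
            also have "\<dots> = dirderiv e' \<eta> (fst X) * \<zeta> (snd X)"
              unfolding \<psi>_def[abs_def] by (simp add: smooth_fst_mult_snd(2)[OF \<eta>(1) \<zeta>(1)] dirderiv_0[OF \<zeta>(1)])
            finally show ?thesis .
          qed
          have c2: "snd (grad \<psi> X) = \<eta> (fst X) * dirderiv 1 \<zeta> (snd X)"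
          proof -
            have "snd (grad \<psi> X) = grad \<psi> X \<bullet> (0, 1)" by (cases "grad \<psi> X") simp
            also have "\<dots> = dirderiv (0, 1) \<psi> X" by (rule grad_inner) (simp add: Basis_prod_def)
            also have "\<dots> = \<eta> (fst X) * dirderiv 1 \<zeta> (snd X)"
              unfolding \<psi>_def[abs_def] by (simp add: smooth_fst_mult_snd(2)[OF \<eta>(1) \<zeta>(1)] dirderiv_0[OF \<eta>(1)])
            finally show ?thesis .
          qed
          have "A0 \<mu> B b (snd X) (g X) \<bullet> wgrad ?E \<psi> X = A0 \<mu> B b (snd X) (P X, p0 X) \<bullet> (fst (grad \<psi> X), snd (grad \<psi> X))"
            using elim True gr by simp
          also have "\<dots> = m (snd X) * ((\<Sum>e\<in>Basis. \<Sum>e'\<in>Basis. aa e e' (snd X) * (P X \<bullet> e) * (fst (grad \<psi> X) \<bullet> e')) + bb (snd X) * p0 X * snd (grad \<psi> X))"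
            using elim(1) sX by blast
          also have "\<dots> = (\<Sum>e\<in>Basis. \<Sum>e'\<in>Basis. (P X \<bullet> e) * (m (snd X) * aa e e' (snd X) * \<zeta> (snd X)) * dirderiv e' \<eta> (fst X))
             + p0 X * (m (snd X) * bb (snd X) * dirderiv 1 \<zeta> (snd X)) * \<eta> (fst X)"
            by (simp add: c1 c2 distrib_left sum_distrib_left ac_simps)
          finally show ?thesis using True by simp
        qed (simp add: z)
      qed
    qed measurable
    finally show "(LINT X|M2. (\<Sum>e\<in>Basis. \<Sum>e'\<in>Basis. (P X \<bullet> e) * (m (snd X) * aa e e' (snd X) * \<zeta> (snd X)) * dirderiv e' \<eta> (fst X))
         + p0 X * (m (snd X) * bb (snd X) * dirderiv 1 \<zeta> (snd X)) * \<eta> (fst X)) = 0" by simp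
  qed
  moreover have "AE X in M2. X \<in> cyl \<tau> \<longrightarrow> wgrad (Q \<tau>) v X = (P X, p0 X)"
    using eqY by eventually_elim (simp add: EQ g_def)
  moreover have "mu_hat \<mu> ?E = measure lborel (ball (0::real^'n) \<tau>) * (LINT s|lborel. indicator {0<..<\<tau>} s * m s)"
  proof -
    have "mu_hat \<mu> ?E = (LINT X|M2. indicator ?E X * m (snd X))"
      unfolding mu_hat_def by (rule tf[OF borel_measurable_integrable[OF mE(1)]]) (use m\<mu>2 in \<open>eventually_elim, simp\<close>)
    then show ?thesis by (simp only: mE(2))
  qed
  moreover have "(LINT X|M2. (norm (P X))\<^sup>2 * m (snd X)) \<le> (LINT X:?E|lebesgue. (norm (wgrad (Q \<tau>) v X))\<^sup>2 * \<mu> (snd X))"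
    using P1sq(2) Igg by (simp add: g_def)
  ultimately show ?thesis by blast
qed

section \<open>The supremum estimate for weak solutions\<close>

text \<open>
  The factor \<open>n + 1\<close> passes from components to the Euclidean norm, and the last square root compares
  the weighted measures of small and large cylinders. The absolute value keeps the bound
  valid without a discussion of signs.
\<close>

definition gradient_const :: "nat \<Rightarrow> real \<Rightarrow> real \<Rightarrow> real \<Rightarrow> real \<Rightarrow> real" where
  "gradient_const n \<Lambda> C\<^sub>0 K \<theta> =
    (let L = (n + 6) / (1 - \<theta>); D = 20 * n ^ 4 * \<Lambda> ^ 4 * L\<^sup>2 in
      (n + 1) * \<bar>(\<Sum>j<Suc (Suc n). real n ^ j * sqrt (2 * (1 + K * D * L\<^sup>2) * D ^ j)) *
        (1 + \<Lambda>\<^sup>2 * (real n)\<^sup>2 * sqrt D * L * C\<^sub>0)\<bar> * sqrt (L ^ n * K / \<theta>\<^sup>2))"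

context cylinder_solution
begin

text \<open>
  The normalisation of \<open>gradient_bound\<close> by a ball of radius \<open>\<tau> / L\<close> and by the mass of a shorter
  interval is replaced by that of the full cylinder, by scaling and by \<open>mass_doubling\<close>.
\<close>

lemma full_gradient_bound:
  assumes \<theta>: "0 < \<theta>" "\<theta> < 1"
  shows "AE X in M2. X \<in> cyl (\<theta> * \<tau>) \<longrightarrow> norm (P X, p0 X) \<le>
    gradient_const DIM('a) \<Lambda> C\<^sub>0 K \<theta> * sqrt (total / (measure lborel (ball (0::'a) \<tau>) * mass \<tau>))"
proof -
  let ?n = "DIM('a)"
  define L where "L = (?n + 6) / (1 - \<theta>)"
  define D where "D = 20 * ?n ^ 4 * \<Lambda> ^ 4 * L\<^sup>2"
  define C where "C = sup_const D L * (1 + \<Lambda>\<^sup>2 * (real ?n)\<^sup>2 * sqrt D * L * C\<^sub>0)"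
  define \<delta> where "\<delta> = \<tau> / L"
  define B where "B = sqrt (total / (measure lborel (ball (0::'a) \<delta>) * mass (\<theta> * \<tau>)))"
  define q where "q = L ^ ?n * K / \<theta>\<^sup>2"
  define S where "S = sqrt (total / (measure lborel (ball (0::'a) \<tau>) * mass \<tau>))"
  have L: "0 < L" using \<theta> by (simp add: L_def add_nonneg_pos)
  have \<delta>: "0 < \<delta>" "\<tau> = L * \<delta>" using L \<tau> by (simp_all add: \<delta>_def)
  have b: "measure lborel (ball (0::'a) \<tau>) = L ^ ?n * measure lborel (ball (0::'a) \<delta>)"
    using content_ball_conv_unit_ball[of \<tau> "0::'a"] content_ball_conv_unit_ball[of \<delta> "0::'a"] \<delta> \<tau>
    by (simp add: power_mult_distrib)
  have bp: "0 < measure lborel (ball (0::'a) \<delta>)" by (rule content_ball_pos[OF \<delta>(1)])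
  have mp: "0 < mass (\<theta> * \<tau>)" "0 < mass \<tau>" using \<theta> \<tau> by (auto intro!: mass_pos simp: mult_le_cancel_right1)
  have K: "0 < K" by (rule K_pos)
  have q: "0 \<le> q" using K L by (simp add: q_def)
  have B: "B \<le> sqrt q * S"
  proof -
    have "total / (measure lborel (ball (0::'a) \<delta>) * mass (\<theta> * \<tau>)) \<le> total / (measure lborel (ball (0::'a) \<delta>) * (\<theta>\<^sup>2 * mass \<tau> / K))"
    proof (intro divide_left_mono mult_left_mono total_nonneg mult_pos_pos)
      show "\<theta>\<^sup>2 * mass \<tau> / K \<le> mass (\<theta> * \<tau>)" using mass_doubling[of \<theta>] \<theta> K by (simp add: pos_divide_le_eq mult.commute)
      show "0 < \<theta>\<^sup>2 * mass \<tau> / K" using \<theta> mp K by simp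
    qed (use bp mp in auto)
    also have "\<dots> = q * (total / (measure lborel (ball (0::'a) \<tau>) * mass \<tau>))"
      using L K \<theta> mp bp by (simp add: q_def b field_simps)
    finally show ?thesis unfolding B_def S_def by (simp add: real_sqrt_mult[symmetric])
  qed
  have S0: "0 \<le> S" using mp by (simp add: S_def total_nonneg)
  have CB: "C * B \<le> \<bar>C\<bar> * (sqrt q * S)"
  proof -
    have "C * B \<le> \<bar>C\<bar> * B" using bp mp total_nonneg by (intro mult_right_mono) (simp_all add: B_def)
    also have "\<dots> \<le> \<bar>C\<bar> * (sqrt q * S)" using B by (intro mult_left_mono) auto
    finally show ?thesis .
  qed
  note gb = gradient_bound[OF \<theta> L_def \<delta>_def D_def C_def B_def]
  have "AE X in M2. \<forall>e\<in>Basis. X \<in> cyl (\<theta> * \<tau>) \<longrightarrow> \<bar>P X \<bullet> e\<bar> \<le> C * B"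
    by (rule AE_finite_allI[OF finite_Basis gb(1)])
  with gb(2)
  have "AE X in M2. X \<in> cyl (\<theta> * \<tau>) \<longrightarrow> norm (P X, p0 X) \<le> (real ?n + 1) * (\<bar>C\<bar> * (sqrt q * S))"
  proof eventually_elim
    case (elim X)
    show ?case
    proof
      assume X: "X \<in> cyl (\<theta> * \<tau>)"
      have "norm (P X, p0 X) \<le> norm (P X) + norm (p0 X)"
        using sqrt_sum_squares_le_sum_abs[of "norm (P X)" "p0 X"] by (simp add: norm_Pair)
      also have "norm (P X) \<le> (\<Sum>e\<in>Basis. \<bar>P X \<bullet> e\<bar>)" by (rule norm_le_l1)
      also have "\<dots> \<le> (\<Sum>e\<in>(Basis::'a set). C * B)" using elim X by (intro sum_mono) auto
      also have "\<dots> = real ?n * (C * B)" by simp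
      also have "norm (p0 X) \<le> C * B" using elim X by simp
      also have "real ?n * (C * B) + C * B = (real ?n + 1) * (C * B)" by (simp add: algebra_simps)
      also have "\<dots> \<le> (real ?n + 1) * (\<bar>C\<bar> * (sqrt q * S))" using CB by (intro mult_left_mono) auto
      finally show "norm (P X, p0 X) \<le> (real ?n + 1) * (\<bar>C\<bar> * (sqrt q * S))" by simp
    qed
  qed
  moreover have "(real ?n + 1) * (\<bar>C\<bar> * (sqrt q * S)) = gradient_const ?n \<Lambda> C\<^sub>0 K \<theta> * S"
    unfolding gradient_const_def Let_def C_def D_def L_def q_def sup_const_def
    by (simp add: add.commute mult.assoc del: sum.lessThan_Suc)
  ultimately show ?thesis unfolding S_def by (simp only:)
qed

end

theorem lemma8p1:
  fixes \<Lambda> C\<^sub>0 K \<theta> :: real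
  assumes "\<Lambda> > 0" and "C\<^sub>0 > 0" and "0 < \<theta>" and "\<theta> < 1"
  shows "\<exists>C>0. \<forall>(\<tau>::real) (\<mu>::real \<Rightarrow> real) (B::real \<Rightarrow> real^'n^'n) (b::real \<Rightarrow> real)
            (v::(real^'n) \<times> real \<Rightarrow> real).
    0 < \<tau> \<and> \<tau> < 1 \<and>
    A2_weight \<mu> \<and> A2_const \<mu> = ennreal K \<and>
    elliptic_coefficients \<Lambda> \<tau> \<mu> B b \<and>
    (AE y in lebesgue_on {0<..<1}. (LINT s:{0..\<tau> * y}|lebesgue. \<mu> s) \<le> C\<^sub>0 * \<tau> * \<mu> (y * \<tau>)) \<and>
    weak_solution \<mu> B b \<tau> v
    \<longrightarrow>
    esssup (lebesgue_on (Q (\<theta> * \<tau>))) (\<lambda>X. ereal (norm (wgrad (Q \<tau>) v X)))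
      \<le> ereal (C * sqrt (1 / mu_hat \<mu> (Q \<tau> :: ((real^'n) \<times> real) set) *
                         (LINT X:Q \<tau>|lebesgue. (norm (wgrad (Q \<tau>) v X))\<^sup>2 * \<mu> (snd X))))"
proof -
  let ?c = "gradient_const CARD('n) \<Lambda> C\<^sub>0 K \<theta>"
  show ?thesis
  proof (intro exI[of _ "1 + \<bar>?c\<bar>"] conjI allI impI)
    fix \<tau> :: real and \<mu> :: "real \<Rightarrow> real" and B :: "real \<Rightarrow> real^'n^'n" and b :: "real \<Rightarrow> real" and v :: "(real^'n) \<times> real \<Rightarrow> real"
    assume a: "0 < \<tau> \<and> \<tau> < 1 \<and> A2_weight \<mu> \<and> A2_const \<mu> = ennreal K \<and> elliptic_coefficients \<Lambda> \<tau> \<mu> B b \<and>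
      (AE y in lebesgue_on {0<..<1}. (LINT s:{0..\<tau> * y}|lebesgue. \<mu> s) \<le> C\<^sub>0 * \<tau> * \<mu> (y * \<tau>)) \<and> weak_solution \<mu> B b \<tau> v"
    let ?M = "mu_hat \<mu> (Q \<tau> :: ((real^'n) \<times> real) set)"
    let ?I = "LINT X:Q \<tau>|lebesgue. (norm (wgrad (Q \<tau>) v X))\<^sup>2 * \<mu> (snd X)"
    have "0 < \<tau>" using a by blast
    obtain m bb aa V P p0 N where cs: "cylinder_solution \<tau> \<Lambda> K C\<^sub>0 m bb aa V P p0 N"
      and gr: "AE X in M2. X \<in> cyl \<tau> \<longrightarrow> wgrad (Q \<tau>) v X = (P X, p0 X)"
      and M: "?M = measure lborel (ball (0::real^'n) \<tau>) * (LINT s|lborel. indicator {0<..<\<tau>} s * m s)"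
      and I: "(LINT X|M2. (norm (P X))\<^sup>2 * m (snd X)) \<le> ?I"
      using cylinder_solution_of_weak_solution[of \<tau> \<Lambda> C\<^sub>0 \<mu> K B b v] a assms(1,2) by blast
    interpret cylinder_solution \<tau> \<Lambda> K C\<^sub>0 m bb aa V P p0 N by (rule cs)
    have M': "?M = measure lborel (ball (0::real^'n) \<tau>) * mass \<tau>" by (simp add: M mass_def)
    have I': "total \<le> ?I" using I by (simp add: total_def)
    have Mp: "0 < ?M" unfolding M' by (intro mult_pos_pos content_ball_pos mass_pos \<open>0 < \<tau>\<close>) simp
    \<comment> \<open>the gradient itself is only known up to a null set; \<open>G\<close> makes its norm measurable\<close>
    define G where "G X = (indicator (cyl \<tau>) X * norm (P X, p0 X) :: real)" for X
    have [measurable]: "P \<in> borel_measurable M2"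
      using P_meas by (intro borel_measurable_euclidean_space[THEN iffD2]) auto
    have Gm: "G \<in> borel_measurable M2" unfolding G_def[abs_def] norm_Pair by measurable
    have sub: "cyl (\<theta> * \<tau>) \<subseteq> (cyl \<tau> :: ((real^'n) \<times> real) set)"
    proof -
      have "\<theta> * \<tau> \<le> \<tau>" using assms(4) \<open>0 < \<tau>\<close> by simp
      then show ?thesis by (auto simp: cyl_def)
    qed
    have Qc: "Q r = cyl r" for r by (simp add: Q_def cyl_def)
    have cb: "cyl (\<theta> * \<tau>) \<in> sets (lebesgue :: ((real^'n) \<times> real) measure)"
    proof -
      have "open (cyl (\<theta> * \<tau>) :: ((real^'n) \<times> real) set)" unfolding cyl_def by (intro open_Times) auto
      then show ?thesis by auto
    qed
    have Ge: "AE X in M2. indicator (cyl \<tau>) X * norm (wgrad (Q \<tau>) v X) = G X"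
      using gr by eventually_elim (auto simp: G_def indicator_def)
    show "esssup (lebesgue_on (Q (\<theta> * \<tau>))) (\<lambda>X. ereal (norm (wgrad (Q \<tau>) v X))) \<le> ereal ((1 + \<bar>?c\<bar>) * sqrt (1 / ?M * ?I))"
    proof (rule esssup_I)
      have "(\<lambda>X. indicator (cyl \<tau>) X * norm (wgrad (Q \<tau>) v X)) \<in> borel_measurable lebesgue"
        by (rule M2_transfer(1)[OF Gm Ge])
      then have "(\<lambda>X. indicator (cyl \<tau>) X * norm (wgrad (Q \<tau>) v X)) \<in> borel_measurable (lebesgue_on (cyl (\<theta> * \<tau>)))"
        by (rule measurable_restrict_space1)
      then have "(\<lambda>X. norm (wgrad (Q \<tau>) v X)) \<in> borel_measurable (lebesgue_on (cyl (\<theta> * \<tau>)))"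
        by (rule measurable_cong[THEN iffD1, rotated]) (use sub in \<open>auto simp: indicator_def\<close>)
      then show "(\<lambda>X. ereal (norm (wgrad (Q \<tau>) v X))) \<in> borel_measurable (lebesgue_on (Q (\<theta> * \<tau>)))"
        unfolding Qc by measurable
      have "AE X in M2. X \<in> cyl (\<theta> * \<tau>) \<longrightarrow> norm (wgrad (Q \<tau>) v X) \<le> (1 + \<bar>?c\<bar>) * sqrt (1 / ?M * ?I)"
        using full_gradient_bound[OF assms(3,4)] gr
      proof eventually_elim
        case (elim X)
        show ?case
        proof
          assume X: "X \<in> cyl (\<theta> * \<tau>)"
          then have "norm (wgrad (Q \<tau>) v X) \<le> ?c * sqrt (total / ?M)" using elim sub by (auto simp: M')
          also have "\<dots> \<le> (1 + \<bar>?c\<bar>) * sqrt (1 / ?M * ?I)"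
            using I' Mp total_nonneg by (intro mult_mono) (auto simp: divide_right_mono)
          finally show "norm (wgrad (Q \<tau>) v X) \<le> (1 + \<bar>?c\<bar>) * sqrt (1 / ?M * ?I)" .
        qed
      qed
      then have "AE X in lebesgue. X \<in> cyl (\<theta> * \<tau>) \<longrightarrow> norm (wgrad (Q \<tau>) v X) \<le> (1 + \<bar>?c\<bar>) * sqrt (1 / ?M * ?I)"
        by (simp only: AE_completion_iff lborel_prod)
      then show "AE X in lebesgue_on (Q (\<theta> * \<tau>)). ereal (norm (wgrad (Q \<tau>) v X)) \<le> ereal ((1 + \<bar>?c\<bar>) * sqrt (1 / ?M * ?I))"
        unfolding Qc using cb by (simp add: AE_restrict_space_iff)
    qed
  qed simp
qed

end
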